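(* A finitely complete and small-cocomplete (locally small, ordinary) category is small-exact if and only if it is an $\infty$-pretopos.
   Context: All categories are ordinary locally small categories ($\mathcal V=\mathbf{Set}$). $\mathcal P\mathcal C$ is the category of small presheaves on $\mathcal C$ (presheaves $\mathcal C^{op}\to\mathbf{Set}$ that are left Kan extensions of their restriction to some small full subcategory), and $Y:\mathcal C\to\mathcal P\mathcal C$ is the restricted Yoneda embedding; $\mathcal P\mathcal C$ is finitely complete when $\mathcal C$ is. A finitely complete and small-cocomplete category $\mathcal C$ is small-exact if $Y:\mathcal C\to\mathcal P\mathcal C$ admits a finite-limit-preserving left adjoint (equivalently, for every finite-limit-preserving $D:\mathcal K\to\mathcal C$ with $\mathcal K$ small and finitely complete, $\mathrm{Lan}_YD:[\mathcal K^{op},\mathbf{Set}]\to\mathcal C$ preserves finite limits). An $\infty$-pretopos is a finitely complete and small-cocomplete category in which colimits are stable under pullback, coproduct injections are disjoint, and every equivalence relation is effective (is the kernel-pair of some map). *)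

theory Defs
  imports Main "HOL-Library.FuncSet" "HOL-Library.Equipollence"
begin

section \<open>Size\<close>

text \<open>
  A type \<open>'u\<close> of strongly inaccessible cardinality plays the role of a Grothendieck universe.
  A set of any type is small if it has fewer elements than \<open>'u\<close>; so every small set is in
  bijection with a small subset of \<open>'u\<close>.
\<close>

definition small :: "'u itself \<Rightarrow> 'x set \<Rightarrow> bool" where
  "small U A \<longleftrightarrow> A \<prec> (UNIV :: 'u set)"

definition inaccessible :: "'u itself \<Rightarrow> bool" where
  "inaccessible U \<longleftrightarrow>
     small U (UNIV :: nat set) \<and>
     (\<forall>A :: 'u set. small U A \<longrightarrow> small U (Pow A)) \<and>
     (\<forall>\<A> :: 'u set set. small U \<A> \<and> (\<forall>A\<in>\<A>. small U A) \<longrightarrow> small U (\<Union>\<A>))"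


section \<open>Categories, functors, natural transformations\<close>

record ('o, 'a) cat =
  Obj :: "'o set"
  Arr :: "'a set"
  Dom :: "'a \<Rightarrow> 'o"
  Cod :: "'a \<Rightarrow> 'o"
  Ident :: "'o \<Rightarrow> 'a"
  Comp :: "'a \<Rightarrow> 'a \<Rightarrow> 'a"  (infixr \<open>\<cdot>\<index>\<close> 70)

definition Hom :: "('o, 'a) cat \<Rightarrow> 'o \<Rightarrow> 'o \<Rightarrow> 'a set" where
  "Hom C x y = {f \<in> Arr C. Dom C f = x \<and> Cod C f = y}"

locale category =
  fixes C :: "('o, 'a) cat" (structure)
  assumes dom_cod: "f \<in> Arr C \<Longrightarrow> Dom C f \<in> Obj C \<and> Cod C f \<in> Obj C"
    and ident: "x \<in> Obj C \<Longrightarrow> Ident C x \<in> Hom C x x"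
    and comp: "f \<in> Hom C x y \<Longrightarrow> g \<in> Hom C y z \<Longrightarrow> g \<cdot> f \<in> Hom C x z"
    and comp_ident: "f \<in> Hom C x y \<Longrightarrow> f \<cdot> Ident C x = f"
    and ident_comp: "f \<in> Hom C x y \<Longrightarrow> Ident C y \<cdot> f = f"
    and assoc: "f \<in> Hom C w x \<Longrightarrow> g \<in> Hom C x y \<Longrightarrow> h \<in> Hom C y z \<Longrightarrow>
      (h \<cdot> g) \<cdot> f = h \<cdot> (g \<cdot> f)"

definition locally_small :: "'u itself \<Rightarrow> ('o, 'a) cat \<Rightarrow> bool" where
  "locally_small U C \<longleftrightarrow> (\<forall>x\<in>Obj C. \<forall>y\<in>Obj C. small U (Hom C x y))"

definition op_cat :: "('o, 'a) cat \<Rightarrow> ('o, 'a) cat" where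
  "op_cat C = \<lparr>Obj = Obj C, Arr = Arr C, Dom = Cod C, Cod = Dom C, Ident = Ident C,
               Comp = (\<lambda>g f. f \<cdot>\<^bsub>C\<^esub> g)\<rparr>"

definition full_subcat :: "('o, 'a) cat \<Rightarrow> 'o set \<Rightarrow> ('o, 'a) cat" where
  "full_subcat C S =
     C\<lparr>Obj := Obj C \<inter> S, Arr := {f \<in> Arr C. Dom C f \<in> S \<and> Cod C f \<in> S}\<rparr>"

definition discrete_cat :: "'i set \<Rightarrow> ('i, 'i) cat" where
  "discrete_cat I = \<lparr>Obj = I, Arr = I, Dom = (\<lambda>i. i), Cod = (\<lambda>i. i), Ident = (\<lambda>i. i),
                     Comp = (\<lambda>i j. i)\<rparr>"

text \<open>
  The two maps of a functor and the components of a natural transformation are extensional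
  (in the sense of \<open>extensional\<close>), so that equality of functors and of transformations is
  HOL equality.
\<close>

record ('o1, 'a1, 'o2, 'a2) ftor =
  obj_map :: "'o1 \<Rightarrow> 'o2"
  arr_map :: "'a1 \<Rightarrow> 'a2"

definition is_functor ::
  "('o1, 'a1) cat \<Rightarrow> ('o2, 'a2) cat \<Rightarrow> ('o1, 'a1, 'o2, 'a2) ftor \<Rightarrow> bool" where
  "is_functor A B F \<longleftrightarrow>
     category A \<and> category B \<and>
     obj_map F \<in> Obj A \<rightarrow>\<^sub>E Obj B \<and>
     arr_map F \<in> (\<Pi>\<^sub>E f\<in>Arr A. Hom B (obj_map F (Dom A f)) (obj_map F (Cod A f))) \<and>
     (\<forall>x\<in>Obj A. arr_map F (Ident A x) = Ident B (obj_map F x)) \<and>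
     (\<forall>f\<in>Arr A. \<forall>g\<in>Arr A. Cod A f = Dom A g \<longrightarrow>
        arr_map F (g \<cdot>\<^bsub>A\<^esub> f) = arr_map F g \<cdot>\<^bsub>B\<^esub> arr_map F f)"

definition nat_trans ::
  "('o1, 'a1) cat \<Rightarrow> ('o2, 'a2) cat \<Rightarrow> ('o1, 'a1, 'o2, 'a2) ftor \<Rightarrow>
   ('o1, 'a1, 'o2, 'a2) ftor \<Rightarrow> ('o1 \<Rightarrow> 'a2) \<Rightarrow> bool" where
  "nat_trans A B F G t \<longleftrightarrow>
     is_functor A B F \<and> is_functor A B G \<and>
     t \<in> (\<Pi>\<^sub>E x\<in>Obj A. Hom B (obj_map F x) (obj_map G x)) \<and>
     (\<forall>f\<in>Arr A. t (Cod A f) \<cdot>\<^bsub>B\<^esub> arr_map F f = arr_map G f \<cdot>\<^bsub>B\<^esub> t (Dom A f))"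

text \<open>
  For a subcategory \<open>A\<close> of \<open>B\<close>, \<open>id_ftor A\<close> is also the inclusion functor from \<open>A\<close> to \<open>B\<close>.
\<close>

definition id_ftor :: "('o, 'a) cat \<Rightarrow> ('o, 'a, 'o, 'a) ftor" where
  "id_ftor A = \<lparr>obj_map = (\<lambda>x\<in>Obj A. x), arr_map = (\<lambda>f\<in>Arr A. f)\<rparr>"

definition comp_ftor ::
  "('o1, 'a1) cat \<Rightarrow> ('o2, 'a2, 'o3, 'a3) ftor \<Rightarrow> ('o1, 'a1, 'o2, 'a2) ftor \<Rightarrow>
   ('o1, 'a1, 'o3, 'a3) ftor" where
  "comp_ftor A G F = \<lparr>obj_map = (\<lambda>x\<in>Obj A. obj_map G (obj_map F x)),
                      arr_map = (\<lambda>f\<in>Arr A. arr_map G (arr_map F f))\<rparr>"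

definition functor_cat ::
  "('o1, 'a1) cat \<Rightarrow> ('o2, 'a2) cat \<Rightarrow>
   (('o1, 'a1, 'o2, 'a2) ftor,
    ('o1, 'a1, 'o2, 'a2) ftor \<times> ('o1, 'a1, 'o2, 'a2) ftor \<times> ('o1 \<Rightarrow> 'a2)) cat" where
  "functor_cat A B =
     \<lparr>Obj = {F. is_functor A B F},
      Arr = {(F, G, t). nat_trans A B F G t},
      Dom = (\<lambda>(F, G, t). F),
      Cod = (\<lambda>(F, G, t). G),
      Ident = (\<lambda>F. (F, F, \<lambda>x\<in>Obj A. Ident B (obj_map F x))),
      Comp = (\<lambda>(G', H, s) (F, G, t). (F, H, \<lambda>x\<in>Obj A. s x \<cdot>\<^bsub>B\<^esub> t x))\<rparr>"

definition adjunction ::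
  "('o1, 'a1) cat \<Rightarrow> ('o2, 'a2) cat \<Rightarrow> ('o1, 'a1, 'o2, 'a2) ftor \<Rightarrow>
   ('o2, 'a2, 'o1, 'a1) ftor \<Rightarrow> ('o1 \<Rightarrow> 'a1) \<Rightarrow> ('o2 \<Rightarrow> 'a2) \<Rightarrow> bool" where
  "adjunction A B L R \<eta> \<epsilon> \<longleftrightarrow>
     is_functor A B L \<and> is_functor B A R \<and>
     nat_trans A A (id_ftor A) (comp_ftor A R L) \<eta> \<and>
     nat_trans B B (comp_ftor B L R) (id_ftor B) \<epsilon> \<and>
     (\<forall>x\<in>Obj A. \<epsilon> (obj_map L x) \<cdot>\<^bsub>B\<^esub> arr_map L (\<eta> x) = Ident B (obj_map L x)) \<and>
     (\<forall>y\<in>Obj B. arr_map R (\<epsilon> y) \<cdot>\<^bsub>A\<^esub> \<eta> (obj_map R y) = Ident A (obj_map R y))"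

text \<open>\<open>L\<close>, with unit \<open>\<eta>\<close>, is a left Kan extension of \<open>F : A \<rightarrow> E\<close> along \<open>K : A \<rightarrow> B\<close>.\<close>

definition is_left_Kan_extension ::
  "('o1, 'a1) cat \<Rightarrow> ('o2, 'a2) cat \<Rightarrow> ('o3, 'a3) cat \<Rightarrow> ('o1, 'a1, 'o2, 'a2) ftor \<Rightarrow>
   ('o1, 'a1, 'o3, 'a3) ftor \<Rightarrow> ('o2, 'a2, 'o3, 'a3) ftor \<Rightarrow> ('o1 \<Rightarrow> 'a3) \<Rightarrow> bool" where
  "is_left_Kan_extension A B E K F L \<eta> \<longleftrightarrow>
     is_functor A B K \<and> is_functor B E L \<and> nat_trans A E F (comp_ftor A L K) \<eta> \<and>
     (\<forall>G \<alpha>. is_functor B E G \<and> nat_trans A E F (comp_ftor A G K) \<alpha> \<longrightarrow>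
        (\<exists>!\<beta>. nat_trans B E L G \<beta> \<and>
              (\<forall>x\<in>Obj A. \<beta> (obj_map K x) \<cdot>\<^bsub>E\<^esub> \<eta> x = \<alpha> x)))"


section \<open>Limits and colimits\<close>

definition is_cone ::
  "('j, 'k) cat \<Rightarrow> ('o, 'a) cat \<Rightarrow> ('j, 'k, 'o, 'a) ftor \<Rightarrow> 'o \<Rightarrow> ('j \<Rightarrow> 'a) \<Rightarrow> bool" where
  "is_cone J C D x p \<longleftrightarrow>
     is_functor J C D \<and> x \<in> Obj C \<and> (\<forall>j\<in>Obj J. p j \<in> Hom C x (obj_map D j)) \<and>
     (\<forall>u\<in>Arr J. arr_map D u \<cdot>\<^bsub>C\<^esub> p (Dom J u) = p (Cod J u))"

definition is_limit ::
  "('j, 'k) cat \<Rightarrow> ('o, 'a) cat \<Rightarrow> ('j, 'k, 'o, 'a) ftor \<Rightarrow> 'o \<Rightarrow> ('j \<Rightarrow> 'a) \<Rightarrow> bool" where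
  "is_limit J C D x p \<longleftrightarrow>
     is_cone J C D x p \<and>
     (\<forall>y q. is_cone J C D y q \<longrightarrow>
        (\<exists>!h. h \<in> Hom C y x \<and> (\<forall>j\<in>Obj J. p j \<cdot>\<^bsub>C\<^esub> h = q j)))"

definition is_cocone ::
  "('j, 'k) cat \<Rightarrow> ('o, 'a) cat \<Rightarrow> ('j, 'k, 'o, 'a) ftor \<Rightarrow> 'o \<Rightarrow> ('j \<Rightarrow> 'a) \<Rightarrow> bool" where
  "is_cocone J C D x i \<longleftrightarrow>
     is_functor J C D \<and> x \<in> Obj C \<and> (\<forall>j\<in>Obj J. i j \<in> Hom C (obj_map D j) x) \<and>
     (\<forall>u\<in>Arr J. i (Cod J u) \<cdot>\<^bsub>C\<^esub> arr_map D u = i (Dom J u))"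

definition is_colimit ::
  "('j, 'k) cat \<Rightarrow> ('o, 'a) cat \<Rightarrow> ('j, 'k, 'o, 'a) ftor \<Rightarrow> 'o \<Rightarrow> ('j \<Rightarrow> 'a) \<Rightarrow> bool" where
  "is_colimit J C D x i \<longleftrightarrow>
     is_cocone J C D x i \<and>
     (\<forall>y k. is_cocone J C D y k \<longrightarrow>
        (\<exists>!h. h \<in> Hom C x y \<and> (\<forall>j\<in>Obj J. h \<cdot>\<^bsub>C\<^esub> i j = k j)))"

text \<open>
  HOL cannot quantify over the type of the indexing category inside a formula.  Every finite
  category is isomorphic to one carried by \<open>nat\<close>, and every small one to one carried by \<open>'u\<close>.
\<close>

definition finite_cat :: "(nat, nat) cat \<Rightarrow> bool" where
  "finite_cat J \<longleftrightarrow> category J \<and> finite (Obj J) \<and> finite (Arr J)"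

definition small_cat :: "'u itself \<Rightarrow> ('u, 'u) cat \<Rightarrow> bool" where
  "small_cat U J \<longleftrightarrow> category J \<and> small U (Obj J) \<and> small U (Arr J)"

definition finitely_complete :: "('o, 'a) cat \<Rightarrow> bool" where
  "finitely_complete C \<longleftrightarrow>
     (\<forall>J D. finite_cat J \<and> is_functor J C D \<longrightarrow> (\<exists>x p. is_limit J C D x p))"

definition small_cocomplete :: "'u itself \<Rightarrow> ('o, 'a) cat \<Rightarrow> bool" where
  "small_cocomplete U C \<longleftrightarrow>
     (\<forall>J D. small_cat U J \<and> is_functor J C D \<longrightarrow> (\<exists>x i. is_colimit J C D x i))"

definition preserves_finite_limits ::
  "('o1, 'a1) cat \<Rightarrow> ('o2, 'a2) cat \<Rightarrow> ('o1, 'a1, 'o2, 'a2) ftor \<Rightarrow> bool" where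
  "preserves_finite_limits A B F \<longleftrightarrow>
     (\<forall>J D x p. finite_cat J \<and> is_limit J A D x p \<longrightarrow>
        is_limit J B (comp_ftor J F D) (obj_map F x) (\<lambda>j. arr_map F (p j)))"

definition initial_object :: "('o, 'a) cat \<Rightarrow> 'o \<Rightarrow> bool" where
  "initial_object C x \<longleftrightarrow> x \<in> Obj C \<and> (\<forall>y\<in>Obj C. \<exists>!f. f \<in> Hom C x y)"

definition monic :: "('o, 'a) cat \<Rightarrow> 'a \<Rightarrow> bool" where
  "monic C m \<longleftrightarrow> m \<in> Arr C \<and>
     (\<forall>x f g. f \<in> Hom C x (Dom C m) \<and> g \<in> Hom C x (Dom C m) \<and>
        m \<cdot>\<^bsub>C\<^esub> f = m \<cdot>\<^bsub>C\<^esub> g \<longrightarrow> f = g)"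

text \<open>
  \<open>is_pullback C f g p q\<close>: the square \<open>f \<cdot> p = g \<cdot> q\<close> is a pullback, so \<open>p\<close> lies over the
  domain of \<open>f\<close> and \<open>q\<close> over the domain of \<open>g\<close>.
\<close>

definition commuting_square :: "('o, 'a) cat \<Rightarrow> 'a \<Rightarrow> 'a \<Rightarrow> 'a \<Rightarrow> 'a \<Rightarrow> bool" where
  "commuting_square C f g p q \<longleftrightarrow>
     f \<in> Arr C \<and> g \<in> Arr C \<and> p \<in> Arr C \<and> q \<in> Arr C \<and> Cod C f = Cod C g \<and>
     Dom C p = Dom C q \<and> Cod C p = Dom C f \<and> Cod C q = Dom C g \<and> f \<cdot>\<^bsub>C\<^esub> p = g \<cdot>\<^bsub>C\<^esub> q"

definition is_pullback :: "('o, 'a) cat \<Rightarrow> 'a \<Rightarrow> 'a \<Rightarrow> 'a \<Rightarrow> 'a \<Rightarrow> bool" where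
  "is_pullback C f g p q \<longleftrightarrow>
     commuting_square C f g p q \<and>
     (\<forall>h k. commuting_square C f g h k \<longrightarrow>
        (\<exists>!u. u \<in> Hom C (Dom C h) (Dom C p) \<and> p \<cdot>\<^bsub>C\<^esub> u = h \<and> q \<cdot>\<^bsub>C\<^esub> u = k))"


section \<open>Small presheaves and the Yoneda embedding\<close>

definition set_cat :: "'u itself \<Rightarrow> ('u set, 'u set \<times> 'u set \<times> ('u \<Rightarrow> 'u)) cat" where
  "set_cat U =
     \<lparr>Obj = {A. small U A},
      Arr = {(A, B, f). small U A \<and> small U B \<and> f \<in> A \<rightarrow>\<^sub>E B},
      Dom = (\<lambda>(A, B, f). A),
      Cod = (\<lambda>(A, B, f). B),
      Ident = (\<lambda>A. (A, A, \<lambda>x\<in>A. x)),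
      Comp = (\<lambda>(B', E, g) (A, B, f). (A, E, compose A g f))\<rparr>"

type_synonym ('o, 'a, 'u) presheaf =
  "('o, 'a, 'u set, 'u set \<times> 'u set \<times> ('u \<Rightarrow> 'u)) ftor"

type_synonym ('o, 'a, 'u) presheaf_map =
  "('o, 'a, 'u) presheaf \<times> ('o, 'a, 'u) presheaf \<times> ('o \<Rightarrow> 'u set \<times> 'u set \<times> ('u \<Rightarrow> 'u))"

text \<open>
  The inclusion of a full subcategory is fully faithful, so the unit of the Kan extension may
  be taken to be the identity transformation of the restricted presheaf.
\<close>

definition small_presheaf :: "'u itself \<Rightarrow> ('o, 'a) cat \<Rightarrow> ('o, 'a, 'u) presheaf \<Rightarrow> bool" where
  "small_presheaf U C P \<longleftrightarrow>
     is_functor (op_cat C) (set_cat U) P \<and>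
     (\<exists>S \<subseteq> Obj C. small U S \<and>
        (let K = op_cat (full_subcat C S) in
         is_left_Kan_extension K (op_cat C) (set_cat U) (id_ftor K)
           (comp_ftor K P (id_ftor K)) P (\<lambda>x\<in>S. Ident (set_cat U) (obj_map P x))))"

definition presheaf_cat ::
  "'u itself \<Rightarrow> ('o, 'a) cat \<Rightarrow> (('o, 'a, 'u) presheaf, ('o, 'a, 'u) presheaf_map) cat" where
  "presheaf_cat U C =
     full_subcat (functor_cat (op_cat C) (set_cat U)) {P. small_presheaf U C P}"

text \<open>
  A hom-set of a locally small category is a small set of arrows, not a subset of \<open>'u\<close>.  For
  the values of the representable presheaves each hom-set is replaced by its image under a
  chosen injection \<open>hom_encode\<close> into \<open>'u\<close>.  Another choice of injections gives an isomorphic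
  embedding.
\<close>

definition hom_encode :: "'u itself \<Rightarrow> ('o, 'a) cat \<Rightarrow> 'o \<Rightarrow> 'o \<Rightarrow> 'a \<Rightarrow> 'u" where
  "hom_encode U C x y = (SOME e. inj_on e (Hom C x y))"

definition hom_decode :: "'u itself \<Rightarrow> ('o, 'a) cat \<Rightarrow> 'o \<Rightarrow> 'o \<Rightarrow> 'u \<Rightarrow> 'a" where
  "hom_decode U C x y = inv_into (Hom C x y) (hom_encode U C x y)"

definition Hom_set :: "'u itself \<Rightarrow> ('o, 'a) cat \<Rightarrow> 'o \<Rightarrow> 'o \<Rightarrow> 'u set" where
  "Hom_set U C x y = hom_encode U C x y ` Hom C x y"

definition representable :: "'u itself \<Rightarrow> ('o, 'a) cat \<Rightarrow> 'o \<Rightarrow> ('o, 'a, 'u) presheaf" where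
  "representable U C c =
     \<lparr>obj_map = (\<lambda>x\<in>Obj C. Hom_set U C x c),
      arr_map = (\<lambda>f\<in>Arr C.
        (Hom_set U C (Cod C f) c, Hom_set U C (Dom C f) c,
         \<lambda>s\<in>Hom_set U C (Cod C f) c.
           hom_encode U C (Dom C f) c (hom_decode U C (Cod C f) c s \<cdot>\<^bsub>C\<^esub> f)))\<rparr>"

definition Yoneda ::
  "'u itself \<Rightarrow> ('o, 'a) cat \<Rightarrow>
   ('o, 'a, ('o, 'a, 'u) presheaf, ('o, 'a, 'u) presheaf_map) ftor" where
  "Yoneda U C =
     \<lparr>obj_map = (\<lambda>c\<in>Obj C. representable U C c),
      arr_map = (\<lambda>g\<in>Arr C.
        (representable U C (Dom C g), representable U C (Cod C g),
         \<lambda>x\<in>Obj C.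
           (Hom_set U C x (Dom C g), Hom_set U C x (Cod C g),
            \<lambda>s\<in>Hom_set U C x (Dom C g).
              hom_encode U C x (Cod C g) (g \<cdot>\<^bsub>C\<^esub> hom_decode U C x (Dom C g) s))))\<rparr>"


section \<open>Small-exact categories and \<open>\<infinity>\<close>-pretoposes\<close>

definition small_exact :: "'u itself \<Rightarrow> ('o, 'a) cat \<Rightarrow> bool" where
  "small_exact U C \<longleftrightarrow>
     finitely_complete C \<and> small_cocomplete U C \<and>
     (\<exists>L \<eta> \<epsilon>. adjunction (presheaf_cat U C) C L (Yoneda U C) \<eta> \<epsilon> \<and>
              preserves_finite_limits (presheaf_cat U C) C L)"

text \<open>
  The legs \<open>i' j\<close> are the pullbacks along \<open>f\<close> of the legs \<open>i j\<close> of a colimit cocone on \<open>D\<close>, and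
  \<open>D'\<close> is the resulting diagram of pullbacks, whose action on arrows is forced by naturality
  of \<open>\<alpha>\<close> and the cocone condition on \<open>i'\<close>.
\<close>

definition pullback_stable_colimits :: "'u itself \<Rightarrow> ('o, 'a) cat \<Rightarrow> bool" where
  "pullback_stable_colimits U C \<longleftrightarrow>
     (\<forall>J D x i f y D' i' \<alpha>.
        small_cat U J \<and> is_colimit J C D x i \<and> f \<in> Hom C y x \<and>
        nat_trans J C D' D \<alpha> \<and> is_cocone J C D' y i' \<and>
        (\<forall>j\<in>Obj J. is_pullback C f (i j) (i' j) (\<alpha> j)) \<longrightarrow>
        is_colimit J C D' y i')"

definition disjoint_coproducts :: "'u itself \<Rightarrow> ('o, 'a) cat \<Rightarrow> bool" where
  "disjoint_coproducts U C \<longleftrightarrow>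
     (\<forall>(I :: 'u set) X x i.
        small U I \<and> is_colimit (discrete_cat I) C X x i \<longrightarrow>
        (\<forall>j\<in>I. monic C (i j)) \<and>
        (\<forall>j\<in>I. \<forall>k\<in>I. \<forall>p q. j \<noteq> k \<and> is_pullback C (i j) (i k) p q \<longrightarrow>
           initial_object C (Dom C p)))"

text \<open>
  \<open>r, s : R \<rightarrow> X\<close> is jointly monic, reflexive, symmetric, and transitive, where transitivity
  is a map to \<open>R\<close> from any pullback of \<open>s\<close> along \<open>r\<close>.
\<close>

definition equivalence_relation :: "('o, 'a) cat \<Rightarrow> 'a \<Rightarrow> 'a \<Rightarrow> bool" where
  "equivalence_relation C r s \<longleftrightarrow>
     (\<exists>R\<in>Obj C. \<exists>X\<in>Obj C. r \<in> Hom C R X \<and> s \<in> Hom C R X \<and>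
        (\<forall>w h k. h \<in> Hom C w R \<and> k \<in> Hom C w R \<and>
           r \<cdot>\<^bsub>C\<^esub> h = r \<cdot>\<^bsub>C\<^esub> k \<and> s \<cdot>\<^bsub>C\<^esub> h = s \<cdot>\<^bsub>C\<^esub> k \<longrightarrow> h = k) \<and>
        (\<exists>\<rho> \<in> Hom C X R. r \<cdot>\<^bsub>C\<^esub> \<rho> = Ident C X \<and> s \<cdot>\<^bsub>C\<^esub> \<rho> = Ident C X) \<and>
        (\<exists>\<sigma> \<in> Hom C R R. r \<cdot>\<^bsub>C\<^esub> \<sigma> = s \<and> s \<cdot>\<^bsub>C\<^esub> \<sigma> = r) \<and>
        (\<forall>p q. is_pullback C s r p q \<longrightarrow>
           (\<exists>\<tau> \<in> Hom C (Dom C p) R. r \<cdot>\<^bsub>C\<^esub> \<tau> = r \<cdot>\<^bsub>C\<^esub> p \<and> s \<cdot>\<^bsub>C\<^esub> \<tau> = s \<cdot>\<^bsub>C\<^esub> q)))"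

definition effective :: "('o, 'a) cat \<Rightarrow> 'a \<Rightarrow> 'a \<Rightarrow> bool" where
  "effective C r s \<longleftrightarrow> (\<exists>f. is_pullback C f f r s)"

definition infinity_pretopos :: "'u itself \<Rightarrow> ('o, 'a) cat \<Rightarrow> bool" where
  "infinity_pretopos U C \<longleftrightarrow>
     finitely_complete C \<and> small_cocomplete U C \<and>
     pullback_stable_colimits U C \<and> disjoint_coproducts U C \<and>
     (\<forall>r s. equivalence_relation C r s \<longrightarrow> effective C r s)"

end

theory Submission
  imports Defs
begin

text \<open>
  If \<open>C\<close> is an \<open>\<infinity>\<close>-pretopos, the reflection \<open>L P\<close> of a small presheaf is the colimit of its
  elements, and \<open>P \<rightarrow> Y (L P)\<close> is locally bijective for the canonical topology: locally surjective
  because colimit cocones are stable under pullback, locally injective because the closure of the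
  zigzag relation on the coproduct of the generators is an effective equivalence relation.
  As the representables are sheaves, a cone over a finite diagram of reflections lifts locally
  to the presheaves and is glued back, so \<open>L\<close> preserves finite limits.

  Conversely, each of the three exactness properties says that a certain square in \<open>C\<close> is a pullback.
  That square is the image under \<open>L\<close> of a pointwise pullback of presheaves in which the
  colimits of \<open>C\<close> have been replaced by the corresponding colimits of representables.
\<close>

section \<open>Small sets\<close>

text \<open>Smallness is what makes the large category of presheaves tractable: a presheaf is small
  exactly when it has a small presentation, as a quotient of a small coproduct of representables by
  a small set of relations. Equality of its elements is then connectedness by finite zigzags of
  relations, and both directions compute with zigzags. The site need not be small; the topology
  enters only through the predicate \<open>locally\<close>. The obstacle in an infinity-pretopos is
  local injectivity. Zigzags do not form a subobject of X x X; instead generic zigzags of each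
  finite length, cut out by chosen pullbacks, are collected into a small family, and its image in X
  x X is taken. Disjointness of the coproduct makes this image transitive, since two zigzags that
  meet in the same element may name it by different generators. In the converse, \<open>L\<close> is
  known only up to isomorphism, so its values are handled through universal cocones; stability of
  colimits then rests on the fact that a pullback of an identity is invertible.\<close>

lemma small_lepoll: "A \<lesssim> B \<Longrightarrow> small U B \<Longrightarrow> small U A"
  unfolding small_def by (rule lesspoll_trans1)

lemma small_subset: "small U B \<Longrightarrow> A \<subseteq> B \<Longrightarrow> small U A"
  by (meson small_lepoll subset_imp_lepoll)

lemma small_image: "small U A \<Longrightarrow> small U (f ` A)"
  by (meson small_lepoll image_lepoll)

lemma small_surj: "small U A \<Longrightarrow> B \<subseteq> f ` A \<Longrightarrow> small U B"
  by (meson small_image small_subset)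

lemma small_inj_ex: "small (U :: 'u itself) A \<Longrightarrow> \<exists>e :: _ \<Rightarrow> 'u. inj_on e A"
  unfolding small_def by (meson lesspoll_imp_lepoll lepoll_def)

lemma inaccessible_infinite:
  assumes "inaccessible (U :: 'u itself)"
  shows "infinite (UNIV :: 'u set)"
  using assms unfolding inaccessible_def small_def
  by (meson infinite_le_lepoll lesspoll_imp_lepoll)

lemma small_finite:
  assumes "inaccessible U" "finite A"
  shows "small U A"
  using assms finite_lesspoll_infinite inaccessible_infinite unfolding small_def by blast

text \<open>\<open>inaccessible\<close> speaks only of unions of sets of subsets of
  \<open>'u\<close>. The sum is therefore coded inside \<open>'u\<close>, by a pairing that exists
  because an infinite set is equipotent to its square, and the code lies in a small union of small
  sets.\<close>

lemma small_Sigma: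
  fixes U :: "'u itself"
  assumes inacc: "inaccessible U" and I: "small U I" and A: "\<And>i. i \<in> I \<Longrightarrow> small U (A i)"
  shows "small U (Sigma I A)"
proof -
  obtain f :: "_ \<Rightarrow> 'u" where f: "inj_on f I" using small_inj_ex[OF I] by blast
  have "\<forall>i\<in>I. \<exists>e :: _ \<Rightarrow> 'u. inj_on e (A i)" using A small_inj_ex by blast
  then obtain g :: "_ \<Rightarrow> _ \<Rightarrow> 'u" where g: "\<And>i. i \<in> I \<Longrightarrow> inj_on (g i) (A i)" by metis
  have "\<exists>h :: 'u \<times> 'u \<Rightarrow> 'u. bij_betw h (UNIV \<times> UNIV) UNIV"
    using card_of_Times_same_infinite[OF inaccessible_infinite[OF inacc]] card_of_ordIso by blast
  then obtain h :: "'u \<times> 'u \<Rightarrow> 'u" where h: "inj h"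
    by (auto simp: bij_betw_def)
  let ?A = "(\<lambda>i. (\<lambda>a. h (f i, g i a)) ` A i) ` I"
  have "small U (\<Union>?A)"
  proof -
    have "\<forall>\<A> :: 'u set set. small U \<A> \<and> (\<forall>A\<in>\<A>. small U A) \<longrightarrow> small U (\<Union>\<A>)"
      using inacc unfolding inaccessible_def by simp
    moreover have "small U ?A" using I by (rule small_image)
    moreover have "\<forall>B\<in>?A. small U B" using A small_image by auto
    ultimately show ?thesis by simp
  qed
  moreover have "inj_on (\<lambda>(i, a). h (f i, g i a)) (Sigma I A)"
  proof (rule inj_onI, clarify)
    fix i a j b assume *: "i \<in> I" "a \<in> A i" "j \<in> I" "b \<in> A j" "h (f i, g i a) = h (f j, g j b)"
    then have "(f i, g i a) = (f j, g j b)" by (simp add: inj_eq[OF h])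
    with * show "i = j \<and> a = b" using inj_onD[OF f] inj_onD[OF g] by (metis prod.inject)
  qed
  then have "Sigma I A \<lesssim> \<Union>?A" unfolding lepoll_def
    by (intro exI[of _ "\<lambda>(i, a). h (f i, g i a)"]) auto
  ultimately show ?thesis by (meson small_lepoll)
qed

lemma small_UN:
  assumes "inaccessible U" "small U I" "\<And>i. i \<in> I \<Longrightarrow> small U (A i)"
  shows "small U (\<Union>i\<in>I. A i)"
  by (rule small_surj[OF small_Sigma[of U I A, OF assms], where f = snd]) force+

lemma small_Times:
  "inaccessible U \<Longrightarrow> small U A \<Longrightarrow> small U B \<Longrightarrow> small U (A \<times> B)"
  by (rule small_Sigma)

lemma small_Un:
  assumes "inaccessible U" "small U A" "small U B"
  shows "small U (A \<union> B)"
proof -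
  have "small U (\<Union>b\<in>(UNIV :: bool set). if b then A else B)"
    by (rule small_UN) (use assms in \<open>auto intro: small_finite\<close>)
  then show ?thesis by (simp add: UNIV_bool Un_commute)
qed

text \<open>Rests on the clause that \<open>nat\<close> itself is small, so that \<open>'u\<close>
  is uncountable. It serves the union over all lengths of generic zigzags in
  \<open>zigzag_effective\<close>.\<close>

lemma small_UN_nat:
  assumes "inaccessible U" "\<And>n :: nat. small U (A n)"
  shows "small U (\<Union>n. A n)"
  using assms by (intro small_UN) (auto simp: inaccessible_def)


section \<open>Categories\<close>

lemma Hom_iff: "f \<in> Hom C x y \<longleftrightarrow> f \<in> Arr C \<and> Dom C f = x \<and> Cod C f = y"
  by (auto simp: Hom_def)

context category
begin

lemma dom_obj[simp]: "f \<in> Arr C \<Longrightarrow> Dom C f \<in> Obj C"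
  and cod_obj[simp]: "f \<in> Arr C \<Longrightarrow> Cod C f \<in> Obj C"
  using dom_cod by auto

lemma ident_arr[simp]: "x \<in> Obj C \<Longrightarrow> Ident C x \<in> Arr C"
  and ident_dom[simp]: "x \<in> Obj C \<Longrightarrow> Dom C (Ident C x) = x"
  and ident_cod[simp]: "x \<in> Obj C \<Longrightarrow> Cod C (Ident C x) = x"
  using ident by (auto simp: Hom_iff)

lemma comp_arr[simp]: "f \<in> Arr C \<Longrightarrow> g \<in> Arr C \<Longrightarrow> Cod C f = Dom C g \<Longrightarrow> g \<cdot> f \<in> Arr C"
  and comp_dom[simp]: "f \<in> Arr C \<Longrightarrow> g \<in> Arr C \<Longrightarrow> Cod C f = Dom C g \<Longrightarrow> Dom C (g \<cdot> f) = Dom C f"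
  and comp_cod[simp]: "f \<in> Arr C \<Longrightarrow> g \<in> Arr C \<Longrightarrow> Cod C f = Dom C g \<Longrightarrow> Cod C (g \<cdot> f) = Cod C g"
  using comp[of f "Dom C f" "Cod C f" g "Cod C g"] by (auto simp: Hom_iff)

lemma comp_ident'[simp]: "f \<in> Arr C \<Longrightarrow> Dom C f = x \<Longrightarrow> f \<cdot> Ident C x = f"
  and ident_comp'[simp]: "f \<in> Arr C \<Longrightarrow> Cod C f = y \<Longrightarrow> Ident C y \<cdot> f = f"
  using comp_ident[of f "Dom C f" "Cod C f"] ident_comp[of f "Dom C f" "Cod C f"]
  by (auto simp: Hom_iff)

lemma comp_assoc: "f \<in> Arr C \<Longrightarrow> g \<in> Arr C \<Longrightarrow> h \<in> Arr C \<Longrightarrow> Cod C f = Dom C g \<Longrightarrow>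
    Cod C g = Dom C h \<Longrightarrow> (h \<cdot> g) \<cdot> f = h \<cdot> (g \<cdot> f)"
  using assoc[of f "Dom C f" "Cod C f" g "Cod C g" h "Cod C h"] by (auto simp: Hom_iff)

lemma category_axiom: "category C" ..

end

lemma categoryI:
  assumes "\<And>f. f \<in> Arr C \<Longrightarrow> Dom C f \<in> Obj C" "\<And>f. f \<in> Arr C \<Longrightarrow> Cod C f \<in> Obj C"
    and "\<And>x. x \<in> Obj C \<Longrightarrow> Ident C x \<in> Arr C \<and> Dom C (Ident C x) = x \<and> Cod C (Ident C x) = x"
    and "\<And>f g. f \<in> Arr C \<Longrightarrow> g \<in> Arr C \<Longrightarrow> Cod C f = Dom C g \<Longrightarrow>
      g \<cdot>\<^bsub>C\<^esub> f \<in> Arr C \<and> Dom C (g \<cdot>\<^bsub>C\<^esub> f) = Dom C f \<and> Cod C (g \<cdot>\<^bsub>C\<^esub> f) = Cod C g"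
    and "\<And>f. f \<in> Arr C \<Longrightarrow> f \<cdot>\<^bsub>C\<^esub> Ident C (Dom C f) = f"
    and "\<And>f. f \<in> Arr C \<Longrightarrow> Ident C (Cod C f) \<cdot>\<^bsub>C\<^esub> f = f"
    and "\<And>f g h. f \<in> Arr C \<Longrightarrow> g \<in> Arr C \<Longrightarrow> h \<in> Arr C \<Longrightarrow> Cod C f = Dom C g \<Longrightarrow>
      Cod C g = Dom C h \<Longrightarrow> (h \<cdot>\<^bsub>C\<^esub> g) \<cdot>\<^bsub>C\<^esub> f = h \<cdot>\<^bsub>C\<^esub> (g \<cdot>\<^bsub>C\<^esub> f)"
  shows "category C"
  using assms by unfold_locales (auto simp: Hom_iff)

lemma op_cat_simps[simp]:
  "Obj (op_cat C) = Obj C" "Arr (op_cat C) = Arr C" "Dom (op_cat C) = Cod C"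
  "Cod (op_cat C) = Dom C" "Ident (op_cat C) = Ident C" "g \<cdot>\<^bsub>op_cat C\<^esub> f = f \<cdot>\<^bsub>C\<^esub> g"
  "Hom (op_cat C) x y = Hom C y x"
  by (auto simp: op_cat_def Hom_def)

lemma full_subcat_simps[simp]:
  "Obj (full_subcat C S) = Obj C \<inter> S"
  "Arr (full_subcat C S) = {f \<in> Arr C. Dom C f \<in> S \<and> Cod C f \<in> S}"
  "Dom (full_subcat C S) = Dom C" "Cod (full_subcat C S) = Cod C"
  "Ident (full_subcat C S) = Ident C" "g \<cdot>\<^bsub>full_subcat C S\<^esub> f = g \<cdot>\<^bsub>C\<^esub> f"
  by (auto simp: full_subcat_def)

lemma category_op: "category C \<Longrightarrow> category (op_cat C)"
  by (rule categoryI) (auto simp: category.dom_obj category.cod_obj category.ident_arr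
      category.ident_dom category.ident_cod category.comp_arr category.comp_dom category.comp_cod
      category.comp_ident' category.ident_comp' category.comp_assoc)

lemma category_full_subcat: "category C \<Longrightarrow> category (full_subcat C S)"
  by (rule categoryI) (auto simp: category.dom_obj category.cod_obj category.ident_arr
      category.ident_dom category.ident_cod category.comp_arr category.comp_dom category.comp_cod
      category.comp_ident' category.ident_comp' category.comp_assoc)

lemma category_set_cat: "category (set_cat U)"
  by (rule categoryI) (auto simp: set_cat_def compose_def fun_eq_iff PiE_def extensional_def)

lemma is_functorI:
  assumes "category A" "category B"
    and "obj_map F \<in> extensional (Obj A)" "arr_map F \<in> extensional (Arr A)"
    and "\<And>x. x \<in> Obj A \<Longrightarrow> obj_map F x \<in> Obj B"
    and "\<And>f. f \<in> Arr A \<Longrightarrow> arr_map F f \<in> Hom B (obj_map F (Dom A f)) (obj_map F (Cod A f))"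
    and "\<And>x. x \<in> Obj A \<Longrightarrow> arr_map F (Ident A x) = Ident B (obj_map F x)"
    and "\<And>f g. f \<in> Arr A \<Longrightarrow> g \<in> Arr A \<Longrightarrow> Cod A f = Dom A g \<Longrightarrow>
        arr_map F (g \<cdot>\<^bsub>A\<^esub> f) = arr_map F g \<cdot>\<^bsub>B\<^esub> arr_map F f"
  shows "is_functor A B F"
  using assms unfolding is_functor_def by (auto simp: PiE_def)

lemma is_functorD:
  assumes "is_functor A B F"
  shows functor_dom: "category A" and functor_cod: "category B"
    and functor_obj: "x \<in> Obj A \<Longrightarrow> obj_map F x \<in> Obj B"
    and functor_hom: "f \<in> Arr A \<Longrightarrow> arr_map F f \<in> Hom B (obj_map F (Dom A f)) (obj_map F (Cod A f))"
    and functor_ident: "x \<in> Obj A \<Longrightarrow> arr_map F (Ident A x) = Ident B (obj_map F x)"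
    and functor_comp: "f \<in> Arr A \<Longrightarrow> g \<in> Arr A \<Longrightarrow> Cod A f = Dom A g \<Longrightarrow>
        arr_map F (g \<cdot>\<^bsub>A\<^esub> f) = arr_map F g \<cdot>\<^bsub>B\<^esub> arr_map F f"
  using assms unfolding is_functor_def by (auto simp: PiE_def)

lemma functor_arr:
  assumes "is_functor A B F" "f \<in> Arr A"
  shows "arr_map F f \<in> Arr B" "Dom B (arr_map F f) = obj_map F (Dom A f)"
    "Cod B (arr_map F f) = obj_map F (Cod A f)"
  using functor_hom[OF assms] by (auto simp: Hom_iff)

lemma ftor_eqI: "obj_map F = obj_map G \<Longrightarrow> arr_map F = arr_map G \<Longrightarrow> F = (G :: ('a,'b,'c,'d) ftor)"
  by (cases F; cases G) simp

lemma nat_transD: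
  assumes "nat_trans A B F G t"
  shows nat_trans_dom: "is_functor A B F" and nat_trans_cod: "is_functor A B G"
    and nat_trans_ext: "t \<in> extensional (Obj A)"
    and nat_trans_hom: "x \<in> Obj A \<Longrightarrow> t x \<in> Hom B (obj_map F x) (obj_map G x)"
    and nat_trans_nat: "f \<in> Arr A \<Longrightarrow> t (Cod A f) \<cdot>\<^bsub>B\<^esub> arr_map F f = arr_map G f \<cdot>\<^bsub>B\<^esub> t (Dom A f)"
  using assms unfolding nat_trans_def by (auto simp: PiE_def)

lemma nat_transI:
  assumes "is_functor A B F" "is_functor A B G" "t \<in> extensional (Obj A)"
    and "\<And>x. x \<in> Obj A \<Longrightarrow> t x \<in> Hom B (obj_map F x) (obj_map G x)"
    and "\<And>f. f \<in> Arr A \<Longrightarrow> t (Cod A f) \<cdot>\<^bsub>B\<^esub> arr_map F f = arr_map G f \<cdot>\<^bsub>B\<^esub> t (Dom A f)"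
  shows "nat_trans A B F G t"
  using assms unfolding nat_trans_def by (auto simp: PiE_def)

lemma functor_id: "category A \<Longrightarrow> is_functor A A (id_ftor A)"
  by (rule is_functorI) (auto simp: id_ftor_def Hom_iff category.dom_obj category.cod_obj
      category.ident_arr category.comp_arr)

lemma functor_compose:
  assumes "is_functor A B F" "is_functor B D G"
  shows "is_functor A D (comp_ftor A G F)"
proof -
  interpret A: category A using assms functor_dom by blast
  interpret B: category B using assms functor_dom by blast
  show ?thesis
    by (rule is_functorI)
      (use assms in \<open>auto simp: comp_ftor_def functor_obj functor_arr functor_ident functor_comp
        Hom_iff A.category_axiom intro: functor_cod\<close>)
qed

lemma functor_cat_category:
  assumes "category A" "category B"
  shows "category (functor_cat A B)"
proof -
  interpret A: category A by fact
  interpret B: category B by fact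
  note nd = nat_trans_dom nat_trans_cod
  have c: "nat_trans A B F H (\<lambda>x\<in>Obj A. s x \<cdot>\<^bsub>B\<^esub> t x)"
    if t: "nat_trans A B F G t" and s: "nat_trans A B G H s" for F G H s t
  proof (rule nat_transI)
    have ta: "t x \<in> Arr B \<and> Dom B (t x) = obj_map F x \<and> Cod B (t x) = obj_map G x"
      and sa: "s x \<in> Arr B \<and> Dom B (s x) = obj_map G x \<and> Cod B (s x) = obj_map H x"
      if "x \<in> Obj A" for x
      using nat_trans_hom[OF t that] nat_trans_hom[OF s that] by (auto simp: Hom_iff)
    show "(\<lambda>x\<in>Obj A. s x \<cdot>\<^bsub>B\<^esub> t x) x \<in> Hom B (obj_map F x) (obj_map H x)" if "x \<in> Obj A" for x
      using ta[OF that] sa[OF that] that by (simp add: Hom_iff)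
    fix f assume f: "f \<in> Arr A"
    note F = functor_arr[OF nat_trans_dom[OF t] f] and G = functor_arr[OF nat_trans_dom[OF s] f]
      and H = functor_arr[OF nat_trans_cod[OF s] f]
    have "(s (Cod A f) \<cdot>\<^bsub>B\<^esub> t (Cod A f)) \<cdot>\<^bsub>B\<^esub> arr_map F f
        = s (Cod A f) \<cdot>\<^bsub>B\<^esub> (t (Cod A f) \<cdot>\<^bsub>B\<^esub> arr_map F f)"
      using ta[of "Cod A f"] sa[of "Cod A f"] F f by (simp add: B.comp_assoc)
    also have "\<dots> = (s (Cod A f) \<cdot>\<^bsub>B\<^esub> arr_map G f) \<cdot>\<^bsub>B\<^esub> t (Dom A f)"
      using ta[of "Dom A f"] sa[of "Cod A f"] G f by (simp add: B.comp_assoc nat_trans_nat[OF t])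
    also have "\<dots> = arr_map H f \<cdot>\<^bsub>B\<^esub> (s (Dom A f) \<cdot>\<^bsub>B\<^esub> t (Dom A f))"
      using ta[of "Dom A f"] sa[of "Dom A f"] H f by (simp add: B.comp_assoc nat_trans_nat[OF s])
    finally show "(\<lambda>x\<in>Obj A. s x \<cdot>\<^bsub>B\<^esub> t x) (Cod A f) \<cdot>\<^bsub>B\<^esub> arr_map F f
        = arr_map H f \<cdot>\<^bsub>B\<^esub> (\<lambda>x\<in>Obj A. s x \<cdot>\<^bsub>B\<^esub> t x) (Dom A f)"
      using f by simp
  qed (use t s nd in auto)
  have i: "nat_trans A B F F (\<lambda>x\<in>Obj A. Ident B (obj_map F x))" if "is_functor A B F" for F
    by (rule nat_transI) (use that in \<open>auto simp: functor_arr functor_obj Hom_iff\<close>)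
  have ext: "(\<lambda>x\<in>Obj A. k x) = t" if "t \<in> extensional (Obj A)" "\<And>x. x \<in> Obj A \<Longrightarrow> k x = t x"
    for k t :: "'a \<Rightarrow> 'd"
    using that by (auto simp: extensional_def fun_eq_iff)
  show ?thesis
  proof (rule categoryI, goal_cases)
    case (4 f g) then show ?case using c by (auto simp: functor_cat_def)
  next
    case (5 f)
    obtain F G t where f: "f = (F, G, t)" by (cases f)
    with 5 have t: "nat_trans A B F G t" by (auto simp: functor_cat_def)
    show ?case unfolding f using nat_trans_hom[OF t] nat_trans_ext[OF t]
      by (auto simp: functor_cat_def Hom_iff intro!: ext)
  next
    case (6 f)
    obtain F G t where f: "f = (F, G, t)" by (cases f)
    with 6 have t: "nat_trans A B F G t" by (auto simp: functor_cat_def)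
    show ?case unfolding f using nat_trans_hom[OF t] nat_trans_ext[OF t]
      by (auto simp: functor_cat_def Hom_iff intro!: ext)
  next
    case (7 f g h)
    obtain F G t where f: "f = (F, G, t)" by (cases f)
    obtain G' H s where g: "g = (G', H, s)" by (cases g)
    obtain H' K r where h: "h = (H', K, r)" by (cases h)
    have e: "G' = G" "H' = H" and
      t: "nat_trans A B F G t" and s: "nat_trans A B G H s" and r: "nat_trans A B H K r"
      using 7 f g h by (auto simp: functor_cat_def)
    show ?case unfolding f g h e using nat_trans_hom[OF t] nat_trans_hom[OF s] nat_trans_hom[OF r]
      by (auto simp: functor_cat_def Hom_iff B.comp_assoc intro!: ext)
  qed (use i nd in \<open>auto simp: functor_cat_def\<close>)
qed


section \<open>The canonical topology\<close>

context category
begin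

definition sieve :: "'o \<Rightarrow> 'a set \<Rightarrow> bool" where
  "sieve x R \<longleftrightarrow> x \<in> Obj C \<and> (\<forall>h\<in>R. h \<in> Arr C \<and> Cod C h = x) \<and>
     (\<forall>h\<in>R. \<forall>k\<in>Arr C. Cod C k = Dom C h \<longrightarrow> h \<cdot> k \<in> R)"

definition pull_sieve :: "'a \<Rightarrow> 'a set \<Rightarrow> 'a set" where
  "pull_sieve g R = {h \<in> Arr C. Cod C h = Dom C g \<and> g \<cdot> h \<in> R}"

definition matching :: "'a set \<Rightarrow> 'o \<Rightarrow> ('a \<Rightarrow> 'a) \<Rightarrow> bool" where
  "matching R z m \<longleftrightarrow> (\<forall>h\<in>R. m h \<in> Hom C (Dom C h) z) \<and>
     (\<forall>h\<in>R. \<forall>k\<in>Arr C. Cod C k = Dom C h \<longrightarrow> m (h \<cdot> k) = m h \<cdot> k)"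

text \<open>Every representable satisfies the sheaf condition for this one sieve; equivalently, x is
  the colimit of the arrows in R.\<close>

definition effective_epi :: "'o \<Rightarrow> 'a set \<Rightarrow> bool" where
  "effective_epi x R \<longleftrightarrow>
     (\<forall>z\<in>Obj C. \<forall>m. matching R z m \<longrightarrow> (\<exists>!n. n \<in> Hom C x z \<and> (\<forall>h\<in>R. n \<cdot> h = m h)))"

text \<open>These are the universally effective-epimorphic sieves, that is, the covers of the
  canonical topology. Requiring the condition after every pullback makes stability immediate in
  \<open>covering_pull\<close>; the content is then in \<open>covering_trans\<close>.\<close>

definition covering :: "'o \<Rightarrow> 'a set \<Rightarrow> bool" where
  "covering x R \<longleftrightarrow>
     sieve x R \<and> (\<forall>g\<in>Arr C. Cod C g = x \<longrightarrow> effective_epi (Dom C g) (pull_sieve g R))"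

lemma sieve_pull: "sieve x R \<Longrightarrow> g \<in> Arr C \<Longrightarrow> Cod C g = x \<Longrightarrow> sieve (Dom C g) (pull_sieve g R)"
  unfolding sieve_def pull_sieve_def by (auto simp: comp_assoc[symmetric])

lemma pull_sieve_comp:
  "g \<in> Arr C \<Longrightarrow> h \<in> Arr C \<Longrightarrow> Cod C h = Dom C g \<Longrightarrow>
    pull_sieve h (pull_sieve g R) = pull_sieve (g \<cdot> h) R"
  unfolding pull_sieve_def by (auto simp: comp_assoc)

lemma pull_sieve_ident: "sieve x R \<Longrightarrow> pull_sieve (Ident C x) R = R"
  unfolding pull_sieve_def sieve_def by auto

lemma pull_sieve_mem:
  "sieve x R \<Longrightarrow> g \<in> R \<Longrightarrow> pull_sieve g R = {h \<in> Arr C. Cod C h = Dom C g}"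
  unfolding pull_sieve_def sieve_def by auto

lemma covering_arr: "covering x R \<Longrightarrow> h \<in> R \<Longrightarrow> h \<in> Arr C \<and> Cod C h = x"
  by (auto simp: covering_def sieve_def)

lemma covering_obj: "covering x R \<Longrightarrow> x \<in> Obj C"
  by (auto simp: covering_def sieve_def)

lemma covering_closed: "covering x R \<Longrightarrow> h \<in> R \<Longrightarrow> k \<in> Arr C \<Longrightarrow> Cod C k = Dom C h \<Longrightarrow> h \<cdot> k \<in> R"
  by (auto simp: covering_def sieve_def)

lemma covering_pull:
  "covering x R \<Longrightarrow> g \<in> Arr C \<Longrightarrow> Cod C g = x \<Longrightarrow> covering (Dom C g) (pull_sieve g R)"
  unfolding covering_def using comp_arr comp_dom comp_cod by (metis pull_sieve_comp sieve_pull)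

lemma covering_effective: "covering x R \<Longrightarrow> effective_epi x R"
  using covering_obj[of x R] pull_sieve_ident[of x R] unfolding covering_def
  by (metis ident_arr ident_cod ident_dom)

text \<open>Both arrows glue the same matching family, the restrictions of \<open>n\<close>.\<close>

lemma covering_eqI:
  assumes R: "covering x R" and n: "n \<in> Hom C x z" "n' \<in> Hom C x z"
    and eq: "\<And>h. h \<in> R \<Longrightarrow> n \<cdot> h = n' \<cdot> h"
  shows "n = n'"
proof -
  have "matching R z (\<lambda>h. n \<cdot> h)"
    using n covering_arr[OF R] by (auto simp: matching_def Hom_iff comp_assoc)
  moreover have "z \<in> Obj C" using n by (auto simp: Hom_iff)
  ultimately have "\<exists>!k. k \<in> Hom C x z \<and> (\<forall>h\<in>R. k \<cdot> h = n \<cdot> h)"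
    using covering_effective[OF R] unfolding effective_epi_def by blast
  then show ?thesis using n eq by metis
qed

lemma covering_glue:
  assumes "covering x R" "z \<in> Obj C" "matching R z m"
  obtains n where "n \<in> Hom C x z" "\<And>h. h \<in> R \<Longrightarrow> n \<cdot> h = m h"
  using covering_effective[OF assms(1)] assms(2,3) unfolding effective_epi_def by blast

text \<open>Gluing in two stages: a family on T restricts to the sieve pulled back along each h in R
  and glues there to some \<open>n h\<close>; the \<open>n h\<close> are compatible and glue along
  R.\<close>

lemma covering_trans_effective:
  assumes R: "covering x R" and T: "sieve x T"
    and l: "\<And>h. h \<in> R \<Longrightarrow> covering (Dom C h) (pull_sieve h T)"
  shows "effective_epi x T"
  unfolding effective_epi_def
proof (intro ballI allI impI)
  fix z m assume z: "z \<in> Obj C" and m: "matching T z m"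
  note Ra = covering_arr[OF R]
  have mh: "h \<in> T \<Longrightarrow> m h \<in> Hom C (Dom C h) z" for h using m by (auto simp: matching_def)
  have mc: "h \<in> T \<Longrightarrow> k \<in> Arr C \<Longrightarrow> Cod C k = Dom C h \<Longrightarrow> m (h \<cdot> k) = m h \<cdot> k" for h k
    using m by (auto simp: matching_def)
  have "\<exists>n. n \<in> Hom C (Dom C h) z \<and> (\<forall>k\<in>pull_sieve h T. n \<cdot> k = m (h \<cdot> k))" if h: "h \<in> R" for h
  proof -
    have "matching (pull_sieve h T) z (\<lambda>k. m (h \<cdot> k))"
      unfolding matching_def using Ra[OF h]
      by (auto simp: pull_sieve_def Hom_iff comp_assoc[symmetric] mc dest!: mh)
    from covering_glue[OF l[OF h] z this] show ?thesis by metis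
  qed
  then obtain n where n: "\<And>h. h \<in> R \<Longrightarrow> n h \<in> Hom C (Dom C h) z"
    and nk: "\<And>h k. h \<in> R \<Longrightarrow> k \<in> pull_sieve h T \<Longrightarrow> n h \<cdot> k = m (h \<cdot> k)" by metis
  \<comment> \<open>Compatibility of the \<open>n h\<close> is itself local: both sides agree on the
    cover \<open>pull_sieve (h \<cdot> k) T\<close>.\<close>
  have "matching R z n" unfolding matching_def
  proof (intro conjI ballI impI)
    fix h k assume h: "h \<in> R" and k: "k \<in> Arr C" "Cod C k = Dom C h"
    have hk: "h \<cdot> k \<in> R" using covering_closed[OF R h k] .
    show "n (h \<cdot> k) = n h \<cdot> k"
    proof (rule covering_eqI[OF l[OF hk]])
      show "n (h \<cdot> k) \<in> Hom C (Dom C (h \<cdot> k)) z" using n[OF hk] .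
      show "n h \<cdot> k \<in> Hom C (Dom C (h \<cdot> k)) z" using n[OF h] k Ra[OF h] by (simp add: Hom_iff)
      fix q assume q: "q \<in> pull_sieve (h \<cdot> k) T"
      then have "k \<cdot> q \<in> pull_sieve h T" using k Ra[OF h] by (auto simp: pull_sieve_def comp_assoc)
      then show "n (h \<cdot> k) \<cdot> q = (n h \<cdot> k) \<cdot> q"
        using nk[OF hk q] nk[OF h, of "k \<cdot> q"] q k n[OF h] Ra[OF h]
        by (auto simp: pull_sieve_def comp_assoc Hom_iff)
    qed
  qed (use n in auto)
  then obtain N where N: "N \<in> Hom C x z" and Nh: "\<And>h. h \<in> R \<Longrightarrow> N \<cdot> h = n h"
    using covering_glue[OF R z] by metis
  \<comment> \<open>An arrow of T need not lie in R, so agreement with \<open>m\<close> is tested on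
    the pullback of R along \<open>t\<close>, where \<open>t \<cdot> k\<close> lies in both
    sieves.\<close>
  have Nt: "N \<cdot> t = m t" if t: "t \<in> T" for t
  proof -
    have ta: "t \<in> Arr C" "Cod C t = x" using T t by (auto simp: sieve_def)
    show ?thesis
    proof (rule covering_eqI[OF covering_pull[OF R ta]])
      show "N \<cdot> t \<in> Hom C (Dom C t) z" using N ta by (simp add: Hom_iff)
      show "m t \<in> Hom C (Dom C t) z" using mh[OF t] .
      fix k assume k: "k \<in> pull_sieve t R"
      then have ka: "k \<in> Arr C" "Cod C k = Dom C t" "t \<cdot> k \<in> R" by (auto simp: pull_sieve_def)
      have tk: "t \<cdot> k \<in> T" using T t ka by (auto simp: sieve_def)
      \<comment> \<open>Since \<open>t \<cdot> k\<close> is already in T, its pulled back sieve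
        contains the identity, and the value there determines
        \<open>n (t \<cdot> k)\<close>.\<close>
      then have "Ident C (Dom C k) \<in> pull_sieve (t \<cdot> k) T" using ka ta by (simp add: pull_sieve_def)
      from nk[OF ka(3) this] have "n (t \<cdot> k) = m (t \<cdot> k)"
        using n[OF ka(3)] ka ta by (simp add: Hom_iff)
      then show "(N \<cdot> t) \<cdot> k = m t \<cdot> k"
        using Nh[OF ka(3)] mc[OF t ka(1,2)] N ta ka by (simp add: comp_assoc Hom_iff)
    qed
  qed
  show "\<exists>!n. n \<in> Hom C x z \<and> (\<forall>h\<in>T. n \<cdot> h = m h)"
  proof (rule ex1I)
    show "N \<in> Hom C x z \<and> (\<forall>h\<in>T. N \<cdot> h = m h)" using N Nt by blast
    fix M assume M: "M \<in> Hom C x z \<and> (\<forall>h\<in>T. M \<cdot> h = m h)"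
    show "M = N"
    proof (rule covering_eqI[OF R _ N])
      show "M \<in> Hom C x z" using M by blast
      fix h assume h: "h \<in> R"
      show "M \<cdot> h = N \<cdot> h"
      proof (rule covering_eqI[OF l[OF h]])
        show "M \<cdot> h \<in> Hom C (Dom C h) z" "N \<cdot> h \<in> Hom C (Dom C h) z"
          using M N Ra[OF h] by (simp_all add: Hom_iff)
        fix k assume "k \<in> pull_sieve h T"
        then have k: "k \<in> Arr C" "Cod C k = Dom C h" "h \<cdot> k \<in> T" by (auto simp: pull_sieve_def)
        then show "(M \<cdot> h) \<cdot> k = (N \<cdot> h) \<cdot> k"
          using M N Nt[OF k(3)] Ra[OF h] by (simp add: Hom_iff comp_assoc)
      qed
    qed
  qed
qed

lemma covering_trans:
  assumes R: "covering x R" and T: "sieve x T"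
    and l: "\<And>h. h \<in> R \<Longrightarrow> covering (Dom C h) (pull_sieve h T)"
  shows "covering x T"
  unfolding covering_def
proof (intro conjI ballI impI)
  fix g assume g: "g \<in> Arr C" "Cod C g = x"
  show "effective_epi (Dom C g) (pull_sieve g T)"
  proof (rule covering_trans_effective[OF covering_pull[OF R g] sieve_pull[OF T g]])
    fix h assume "h \<in> pull_sieve g R"
    then have h: "h \<in> Arr C" "Cod C h = Dom C g" "g \<cdot> h \<in> R" by (auto simp: pull_sieve_def)
    show "covering (Dom C h) (pull_sieve h (pull_sieve g T))"
      using l[OF h(3)] g h by (simp add: pull_sieve_comp)
  qed
qed fact

text \<open>A family on the maximal sieve is determined by its value at the identity.\<close>

lemma covering_max:
  assumes "x \<in> Obj C"
  shows "covering x {h \<in> Arr C. Cod C h = x}"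
proof -
  have eff: "effective_epi y {h \<in> Arr C. Cod C h = y}" if y: "y \<in> Obj C" for y
    unfolding effective_epi_def
  proof (intro ballI allI impI)
    fix z m assume m: "matching {h \<in> Arr C. Cod C h = y} z m"
    have "m h = m (Ident C y) \<cdot> h" if "h \<in> Arr C" "Cod C h = y" for h
      using m y that unfolding matching_def
      by (metis (mono_tags, lifting) ident_arr ident_cod ident_comp' ident_dom mem_Collect_eq)
    moreover have "m (Ident C y) \<in> Hom C y z"
      using m y unfolding matching_def 
      by (metis (mono_tags, lifting) ident_arr ident_cod ident_dom mem_Collect_eq)
    ultimately show "\<exists>!n. n \<in> Hom C y z \<and> (\<forall>h\<in>{h \<in> Arr C. Cod C h = y}. n \<cdot> h = m h)"
    proof (intro ex1I[of _ "m (Ident C y)"])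
      fix n assume n: "n \<in> Hom C y z \<and> (\<forall>h\<in>{h \<in> Arr C. Cod C h = y}. n \<cdot> h = m h)"
      then have "n \<cdot> Ident C y = m (Ident C y)" using y by simp
      then show "n = m (Ident C y)" using n by (simp add: Hom_iff)
    qed auto
  qed
  have "pull_sieve g {h \<in> Arr C. Cod C h = x} = {h \<in> Arr C. Cod C h = Dom C g}"
    if "g \<in> Arr C" "Cod C g = x" for g using that by (auto simp: pull_sieve_def)
  then show ?thesis using assms eff by (auto simp: covering_def sieve_def)
qed

lemma covering_mono:
  assumes R: "covering x R" and T: "sieve x T" and RT: "R \<subseteq> T"
  shows "covering x T"
proof (rule covering_trans[OF R T])
  fix h assume h: "h \<in> R"
  with RT have "pull_sieve h T = {k \<in> Arr C. Cod C k = Dom C h}"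
    using pull_sieve_mem[OF T] by blast
  then show "covering (Dom C h) (pull_sieve h T)" using covering_max covering_arr[OF R h] by simp
qed

text \<open>Pulled back along an arrow of R, the intersection becomes the pullback of T, so
  transitivity applies.\<close>

lemma covering_Int:
  assumes R: "covering x R" and T: "covering x T"
  shows "covering x (R \<inter> T)"
proof (rule covering_trans[OF R])
  show "sieve x (R \<inter> T)" using R T by (auto simp: covering_def sieve_def)
  fix h assume h: "h \<in> R"
  have "pull_sieve h (R \<inter> T) = pull_sieve h T"
    using covering_closed[OF R h] by (auto simp: pull_sieve_def)
  then show "covering (Dom C h) (pull_sieve h (R \<inter> T))"
    using covering_pull[OF T] covering_arr[OF R h] by simp
qed

definition locally :: "'o \<Rightarrow> ('a \<Rightarrow> bool) \<Rightarrow> bool" where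
  "locally x Q \<longleftrightarrow> (\<exists>R. covering x R \<and> (\<forall>h\<in>R. Q h))"

lemma locallyI: "x \<in> Obj C \<Longrightarrow> (\<And>h. h \<in> Arr C \<Longrightarrow> Cod C h = x \<Longrightarrow> Q h) \<Longrightarrow> locally x Q"
  unfolding locally_def using covering_max by blast

lemma locally_mono:
  "locally x Q \<Longrightarrow> (\<And>h. h \<in> Arr C \<Longrightarrow> Cod C h = x \<Longrightarrow> Q h \<Longrightarrow> Q' h) \<Longrightarrow> locally x Q'"
  unfolding locally_def using covering_arr by blast

lemma locally_conj: "locally x Q \<Longrightarrow> locally x Q' \<Longrightarrow> locally x (\<lambda>h. Q h \<and> Q' h)"
  unfolding locally_def using covering_Int by blast

text \<open>A finite intersection of covers is a cover. This is where finiteness of the diagram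
  enters \<open>reflection_preserves_finite_limits\<close>.\<close>

lemma locally_ball:
  assumes "finite J" "x \<in> Obj C" "\<And>j. j \<in> J \<Longrightarrow> locally x (Q j)"
  shows "locally x (\<lambda>h. \<forall>j\<in>J. Q j h)"
  using assms
proof (induction J rule: finite_induct)
  case empty then show ?case by (simp add: locallyI)
next
  case (insert j J)
  then show ?case using locally_conj[of x "Q j" "\<lambda>h. \<forall>j\<in>J. Q j h"] by simp
qed

text \<open>Transitivity of the topology as a rule of inference: a local existence statement may be
  opened, and what then holds locally holds locally on x.\<close>

lemma locally_bind:
  assumes Q: "locally x Q"
    and l: "\<And>h. h \<in> Arr C \<Longrightarrow> Cod C h = x \<Longrightarrow> Q h \<Longrightarrow> locally (Dom C h) (\<lambda>k. Q' (h \<cdot> k))"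
  shows "locally x Q'"
proof -
  obtain R where R: "covering x R" "\<And>h. h \<in> R \<Longrightarrow> Q h" using Q by (auto simp: locally_def)
  \<comment> \<open>The largest sieve on which \<open>Q'\<close> holds; the quantification over
    \<open>k\<close> is needed because \<open>Q'\<close> alone need not define a sieve.\<close>
  let ?T = "{h \<in> Arr C. Cod C h = x \<and> (\<forall>k\<in>Arr C. Cod C k = Dom C h \<longrightarrow> Q' (h \<cdot> k))}"
  have "covering x ?T"
  proof (rule covering_trans[OF R(1)])
    show T: "sieve x ?T" using covering_obj[OF R(1)] by (auto simp: sieve_def comp_assoc)
    fix h assume h: "h \<in> R"
    have ha: "h \<in> Arr C" "Cod C h = x" using covering_arr[OF R(1) h] by auto
    obtain S where S: "covering (Dom C h) S" "\<And>k. k \<in> S \<Longrightarrow> Q' (h \<cdot> k)"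
      using l[OF ha R(2)[OF h]] by (auto simp: locally_def)
    show "covering (Dom C h) (pull_sieve h ?T)"
    proof (rule covering_mono[OF S(1) sieve_pull[OF T ha]])
      show "S \<subseteq> pull_sieve h ?T"
        using covering_arr[OF S(1)] covering_closed[OF S(1)] S(2) ha
        by (auto simp: pull_sieve_def comp_assoc)
    qed
  qed
  moreover have "Q' h" if "h \<in> ?T" for h using that by (auto dest!: bspec[of _ _ "Ident C (Dom C h)"])
  ultimately show ?thesis unfolding locally_def by blast
qed

lemma locally_eqD:
  "locally x (\<lambda>h. n \<cdot> h = n' \<cdot> h) \<Longrightarrow> n \<in> Hom C x z \<Longrightarrow> n' \<in> Hom C x z \<Longrightarrow> n = n'"
  unfolding locally_def using covering_eqI by metis

text \<open>Representables are sheaves for the canonical topology.  The matching family is given by a relation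
  \<open>\<Phi>\<close>, so that no local choices have to be made where the lemma is used.\<close>

lemma locally_glue:
  assumes z: "z \<in> Obj C" and l: "locally x (\<lambda>h. \<exists>m. m \<in> Hom C (Dom C h) z \<and> \<Phi> h m)"
    and uniq: "\<And>h m m'. h \<in> Arr C \<Longrightarrow> Cod C h = x \<Longrightarrow> m \<in> Hom C (Dom C h) z \<Longrightarrow>
      m' \<in> Hom C (Dom C h) z \<Longrightarrow> \<Phi> h m \<Longrightarrow> \<Phi> h m' \<Longrightarrow> m = m'"
    and stable: "\<And>h m k. h \<in> Arr C \<Longrightarrow> Cod C h = x \<Longrightarrow> m \<in> Hom C (Dom C h) z \<Longrightarrow> k \<in> Arr C \<Longrightarrow>
      Cod C k = Dom C h \<Longrightarrow> \<Phi> h m \<Longrightarrow> \<Phi> (h \<cdot> k) (m \<cdot> k)"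
  obtains n where "n \<in> Hom C x z" "locally x (\<lambda>h. \<Phi> h (n \<cdot> h))"
proof -
  obtain R where R: "covering x R" "\<And>h. h \<in> R \<Longrightarrow> \<exists>m. m \<in> Hom C (Dom C h) z \<and> \<Phi> h m"
    using l by (auto simp: locally_def)
  then obtain m where m: "\<And>h. h \<in> R \<Longrightarrow> m h \<in> Hom C (Dom C h) z" "\<And>h. h \<in> R \<Longrightarrow> \<Phi> h (m h)"
    by metis
  have "matching R z m" unfolding matching_def
  proof (intro conjI ballI impI)
    fix h k assume h: "h \<in> R" and k: "k \<in> Arr C" "Cod C k = Dom C h"
    note ha = covering_arr[OF R(1) h] and hk = covering_closed[OF R(1) h k]
    show "m (h \<cdot> k) = m h \<cdot> k"
    proof (rule uniq)
      show "\<Phi> (h \<cdot> k) (m h \<cdot> k)" using stable ha m[OF h] k by blast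
    qed (use ha k m[OF h] m[OF hk] in \<open>auto simp: Hom_iff\<close>)
  qed (use m in auto)
  then obtain n where "n \<in> Hom C x z" "\<And>h. h \<in> R \<Longrightarrow> n \<cdot> h = m h"
    using covering_glue[OF R(1) z] by metis
  with R(1) m that show thesis unfolding locally_def by metis
qed

end


section \<open>Pullbacks\<close>

lemma is_pullbackD:
  assumes "is_pullback C f g p q"
  shows "f \<in> Arr C" "g \<in> Arr C" "p \<in> Arr C" "q \<in> Arr C" "Cod C f = Cod C g" "Dom C p = Dom C q"
    "Cod C p = Dom C f" "Cod C q = Dom C g" "f \<cdot>\<^bsub>C\<^esub> p = g \<cdot>\<^bsub>C\<^esub> q"
  using assms by (auto simp: is_pullback_def commuting_square_def)

lemma is_pullback_lift:
  assumes "is_pullback C f g p q" "h \<in> Arr C" "k \<in> Arr C" "Dom C h = Dom C k"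
    "Cod C h = Dom C f" "Cod C k = Dom C g" "f \<cdot>\<^bsub>C\<^esub> h = g \<cdot>\<^bsub>C\<^esub> k"
  obtains u where "u \<in> Arr C" "Dom C u = Dom C h" "Cod C u = Dom C p" "p \<cdot>\<^bsub>C\<^esub> u = h" "q \<cdot>\<^bsub>C\<^esub> u = k"
  using assms unfolding is_pullback_def commuting_square_def Hom_iff by metis

lemma is_pullback_ex:
  assumes "is_pullback C f g p q" "h \<in> Arr C" "k \<in> Arr C" "Dom C h = Dom C k"
    "Cod C h = Dom C f" "Cod C k = Dom C g" "f \<cdot>\<^bsub>C\<^esub> h = g \<cdot>\<^bsub>C\<^esub> k"
  shows "\<exists>u\<in>Arr C. Dom C u = Dom C h \<and> Cod C u = Dom C p \<and> p \<cdot>\<^bsub>C\<^esub> u = h \<and> q \<cdot>\<^bsub>C\<^esub> u = k"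
  using is_pullback_lift[OF assms] by blast

lemma (in category) is_pullback_eqI:
  assumes P: "is_pullback C f g p q" and u: "u \<in> Arr C" "v \<in> Arr C" "Dom C u = Dom C v"
    "Cod C u = Dom C p" "Cod C v = Dom C p" "p \<cdot> u = p \<cdot> v" "q \<cdot> u = q \<cdot> v"
  shows "u = v"
proof -
  have "commuting_square C f g (p \<cdot> u) (q \<cdot> u)"
    using is_pullbackD[OF P] u by (simp add: commuting_square_def comp_assoc[symmetric])
  then have "\<exists>!w. w \<in> Hom C (Dom C (p \<cdot> u)) (Dom C p) \<and> p \<cdot> w = p \<cdot> u \<and> q \<cdot> w = q \<cdot> u"
    using P by (simp add: is_pullback_def)
  then show ?thesis using u is_pullbackD[OF P] by (auto simp: Hom_iff)
qed

lemma (in category) is_pullbackI: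
  assumes "f \<in> Arr C" "g \<in> Arr C" "p \<in> Arr C" "q \<in> Arr C" "Cod C f = Cod C g" "Dom C p = Dom C q"
    "Cod C p = Dom C f" "Cod C q = Dom C g" "f \<cdot> p = g \<cdot> q"
    and ex: "\<And>h k. h \<in> Arr C \<Longrightarrow> k \<in> Arr C \<Longrightarrow> Dom C h = Dom C k \<Longrightarrow> Cod C h = Dom C f \<Longrightarrow>
      Cod C k = Dom C g \<Longrightarrow> f \<cdot> h = g \<cdot> k \<Longrightarrow> \<exists>u\<in>Arr C. Dom C u = Dom C h \<and> Cod C u = Dom C p \<and>
        p \<cdot> u = h \<and> q \<cdot> u = k"
    and un: "\<And>u v. u \<in> Arr C \<Longrightarrow> v \<in> Arr C \<Longrightarrow> Dom C u = Dom C v \<Longrightarrow> Cod C u = Dom C p \<Longrightarrow>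
      Cod C v = Dom C p \<Longrightarrow> p \<cdot> u = p \<cdot> v \<Longrightarrow> q \<cdot> u = q \<cdot> v \<Longrightarrow> u = v"
  shows "is_pullback C f g p q"
  unfolding is_pullback_def
proof (intro conjI allI impI)
  fix h k assume "commuting_square C f g h k"
  then obtain u where "u\<in>Arr C" "Dom C u = Dom C h" "Cod C u = Dom C p" "p \<cdot> u = h" "q \<cdot> u = k"
    using ex[of h k] unfolding commuting_square_def by blast
  then show "\<exists>!u. u \<in> Hom C (Dom C h) (Dom C p) \<and> p \<cdot> u = h \<and> q \<cdot> u = k"
    by (intro ex1I[of _ u]) (auto simp: Hom_iff intro: un)
qed (use assms in \<open>simp add: commuting_square_def\<close>)

text \<open>The cospan category: arrows \<open>0, 1, 2\<close> are the identities, \<open>3 : 0 \<rightarrow> 2\<close> and \<open>4 : 1 \<rightarrow> 2\<close>.\<close>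

definition cospan_cat :: "(nat, nat) cat" where
  "cospan_cat = \<lparr>Obj = {0, 1, 2}, Arr = {0, 1, 2, 3, 4},
     Dom = (\<lambda>a. if a = 3 then 0 else if a = 4 then 1 else a),
     Cod = (\<lambda>a. if a = 3 \<or> a = 4 then 2 else a),
     Ident = (\<lambda>x. x), Comp = (\<lambda>b a. if b \<le> 2 then a else b)\<rparr>"

definition cospan_ftor :: "('o, 'a) cat \<Rightarrow> 'a \<Rightarrow> 'a \<Rightarrow> (nat, nat, 'o, 'a) ftor" where
  "cospan_ftor C f g = \<lparr>
     obj_map = (\<lambda>x\<in>{0, 1, 2}. if x = 0 then Dom C f else if x = 1 then Dom C g else Cod C f),
     arr_map = (\<lambda>a\<in>{0, 1, 2, 3, 4}. if a = 0 then Ident C (Dom C f)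
       else if a = 1 then Ident C (Dom C g) else if a = 2 then Ident C (Cod C f)
       else if a = 3 then f else g)\<rparr>"

lemma finite_cospan_cat: "finite_cat cospan_cat"
  unfolding finite_cat_def
proof (intro conjI)
  show "category cospan_cat"
    by (rule categoryI) (auto simp: cospan_cat_def split: if_splits)
qed (auto simp: cospan_cat_def)

lemma (in category) cospan_functor:
  assumes "f \<in> Arr C" "g \<in> Arr C" "Cod C f = Cod C g"
  shows "is_functor cospan_cat C (cospan_ftor C f g)"
proof (rule is_functorI)
  show "category cospan_cat" using finite_cospan_cat by (simp add: finite_cat_def)
qed (use assms category_axiom in \<open>auto simp: cospan_cat_def cospan_ftor_def Hom_iff split: if_splits\<close>)

text \<open>The leg at the vertex 2 is forced by the other two, so a cone on a cospan is a commuting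
  square. \<open>cospan_limit_iff\<close> then moves between pullbacks and the limits over
  categories on \<open>nat\<close> that occur in \<open>finitely_complete\<close> and
  \<open>preserves_finite_limits\<close>.\<close>

lemma (in category) cospan_cone_iff:
  assumes "f \<in> Arr C" "g \<in> Arr C" "Cod C f = Cod C g"
  shows "is_cone cospan_cat C (cospan_ftor C f g) x p \<longleftrightarrow>
     commuting_square C f g (p 0) (p 1) \<and> x = Dom C (p 0) \<and> p 2 = f \<cdot> p 0"
  using cospan_functor[OF assms] assms
  by (auto simp: is_cone_def cospan_cat_def cospan_ftor_def commuting_square_def Hom_iff)

lemma (in category) cospan_limit_iff:
  assumes fg: "f \<in> Arr C" "g \<in> Arr C" "Cod C f = Cod C g"
  shows "is_limit cospan_cat C (cospan_ftor C f g) x p \<longleftrightarrow>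
     is_pullback C f g (p 0) (p 1) \<and> x = Dom C (p 0) \<and> p 2 = f \<cdot> p 0" (is "?L \<longleftrightarrow> ?R")
proof
  have o: "Obj cospan_cat = {0, 1, 2}" by (simp add: cospan_cat_def)
  assume L: ?L
  then have c: "commuting_square C f g (p 0) (p 1)" "x = Dom C (p 0)" "p 2 = f \<cdot> p 0"
    unfolding is_limit_def cospan_cone_iff[OF fg] by auto
  have "\<exists>!u. u \<in> Hom C (Dom C h) (Dom C (p 0)) \<and> p 0 \<cdot> u = h \<and> p 1 \<cdot> u = k"
    if hk: "commuting_square C f g h k" for h k
  proof -
    define q where "q = (\<lambda>j :: nat. if j = 0 then h else if j = 1 then k else f \<cdot> h)"
    have "is_cone cospan_cat C (cospan_ftor C f g) (Dom C h) q"
      unfolding cospan_cone_iff[OF fg] using hk by (simp add: q_def)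
    then have u: "\<exists>!u. u \<in> Hom C (Dom C h) x \<and> (\<forall>j\<in>{0,1,2}. p j \<cdot> u = q j)"
      using L unfolding is_limit_def o by blast
    have "u \<in> Hom C (Dom C h) x \<and> (\<forall>j\<in>{0,1,2}. p j \<cdot> u = q j) \<longleftrightarrow>
        u \<in> Hom C (Dom C h) (Dom C (p 0)) \<and> p 0 \<cdot> u = h \<and> p 1 \<cdot> u = k" for u
    proof -
      have p: "p 0 \<in> Arr C" "Cod C (p 0) = Dom C f" using c(1) by (simp_all add: commuting_square_def)
      have q: "q 0 = h" "q 1 = k" "q 2 = f \<cdot> h" by (simp_all add: q_def)
      have "p 2 \<cdot> u = f \<cdot> h" if "u \<in> Hom C (Dom C h) (Dom C (p 0))" "p 0 \<cdot> u = h"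
        unfolding c(3) using that p fg by (simp add: comp_assoc Hom_iff)
      then show ?thesis unfolding c(2) ball_simps q by blast
    qed
    with u show ?thesis by simp
  qed
  with c show ?R unfolding is_pullback_def by blast
next
  have o: "Obj cospan_cat = {0, 1, 2}" by (simp add: cospan_cat_def)
  assume R: ?R
  show ?L unfolding is_limit_def
  proof (intro conjI allI impI)
    show "is_cone cospan_cat C (cospan_ftor C f g) x p"
      unfolding cospan_cone_iff[OF fg] using R by (simp add: is_pullback_def)
    fix y q assume "is_cone cospan_cat C (cospan_ftor C f g) y q"
    then have q: "commuting_square C f g (q 0) (q 1)" "y = Dom C (q 0)" "q 2 = f \<cdot> q 0"
      unfolding cospan_cone_iff[OF fg] by auto
    then have u: "\<exists>!u. u \<in> Hom C (Dom C (q 0)) (Dom C (p 0)) \<and> p 0 \<cdot> u = q 0 \<and> p 1 \<cdot> u = q 1"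
      using R unfolding is_pullback_def by blast
    have "u \<in> Hom C y x \<and> (\<forall>j\<in>{0,1,2}. p j \<cdot> u = q j) \<longleftrightarrow>
        u \<in> Hom C (Dom C (q 0)) (Dom C (p 0)) \<and> p 0 \<cdot> u = q 0 \<and> p 1 \<cdot> u = q 1" for u
    proof -
      have r: "x = Dom C (p 0)" "p 2 = f \<cdot> p 0" "p 0 \<in> Arr C" "Cod C (p 0) = Dom C f"
        using R by (auto dest: is_pullbackD)
      have "p 2 \<cdot> u = f \<cdot> q 0" if "u \<in> Hom C (Dom C (q 0)) (Dom C (p 0))" "p 0 \<cdot> u = q 0"
        unfolding r(2) using that r fg by (simp add: comp_assoc Hom_iff)
      then show ?thesis unfolding r(1) q(2,3) ball_simps by blast
    qed
    with u show "\<exists>!h. h \<in> Hom C y x \<and> (\<forall>j\<in>Obj cospan_cat. p j \<cdot> h = q j)"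
      unfolding o by simp
  qed
qed

lemma (in category) pullback_exists:
  assumes "finitely_complete C" and fg: "f \<in> Arr C" "g \<in> Arr C" "Cod C f = Cod C g"
  shows "\<exists>p q. is_pullback C f g p q"
  using assms finite_cospan_cat cospan_functor[OF fg] cospan_limit_iff[OF fg]
  unfolding finitely_complete_def by metis

lemma (in category) terminal_exists:
  assumes "finitely_complete C"
  shows "\<exists>t\<in>Obj C. \<forall>x\<in>Obj C. \<exists>!h. h \<in> Hom C x t"
proof -
  define J :: "(nat, nat) cat" where
    "J = \<lparr>Obj = {}, Arr = {}, Dom = id, Cod = id, Ident = id, Comp = (\<lambda>_. id)\<rparr>"
  define D :: "(nat, nat, 'o, 'a) ftor" where
    "D = \<lparr>obj_map = (\<lambda>_. undefined), arr_map = (\<lambda>_. undefined)\<rparr>"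
  have J: "category J" by (rule categoryI) (auto simp: J_def)
  have D: "is_functor J C D"
  proof (rule is_functorI)
    show "category J" by fact
  qed (auto simp: D_def J_def category_axiom)
  have "finite_cat J" using J by (simp add: finite_cat_def J_def)
  then obtain t p where t: "is_limit J C D t p"
    using assms D unfolding finitely_complete_def by blast
  \<comment> \<open>There are no objects in \<open>J\<close>, so any leg function will do and a cone
    is just an object.\<close>
  have "is_cone J C D x undefined" if "x \<in> Obj C" for x using D that by (simp add: is_cone_def J_def)
  with t show ?thesis unfolding is_limit_def by (force simp: J_def is_cone_def)
qed

definition (in category) is_product :: "'o \<Rightarrow> 'o \<Rightarrow> 'a \<Rightarrow> 'a \<Rightarrow> bool" where
  "is_product x y p q \<longleftrightarrow> p \<in> Arr C \<and> q \<in> Arr C \<and> Dom C p = Dom C q \<and> Cod C p = x \<and> Cod C q = y \<and>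
     (\<forall>h\<in>Arr C. \<forall>k\<in>Arr C. Dom C h = Dom C k \<and> Cod C h = x \<and> Cod C k = y \<longrightarrow>
        (\<exists>u\<in>Arr C. Dom C u = Dom C h \<and> Cod C u = Dom C p \<and> p \<cdot> u = h \<and> q \<cdot> u = k)) \<and>
     (\<forall>u\<in>Arr C. \<forall>v\<in>Arr C. Dom C u = Dom C v \<and> Cod C u = Dom C p \<and> Cod C v = Dom C p \<and>
        p \<cdot> u = p \<cdot> v \<and> q \<cdot> u = q \<cdot> v \<longrightarrow> u = v)"

text \<open>A pullback over the terminal object, where every square commutes.\<close>

lemma (in category) product_exists:
  assumes fc: "finitely_complete C" and xy: "x \<in> Obj C" "y \<in> Obj C"
  shows "\<exists>p q. is_product x y p q"
proof -
  obtain t where t: "t \<in> Obj C" "\<And>x. x \<in> Obj C \<Longrightarrow> \<exists>!h. h \<in> Hom C x t"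
    using terminal_exists[OF fc] by blast
  obtain f g where f: "f \<in> Hom C x t" "g \<in> Hom C y t" using t(2) xy by blast
  then obtain p q where P: "is_pullback C f g p q"
    using pullback_exists[OF fc, of f g] by (auto simp: Hom_iff)
  note d = is_pullbackD[OF P]
  have "is_product x y p q" unfolding is_product_def
  proof (intro conjI ballI impI; (elim conjE)?)
    fix h k assume hk: "h \<in> Arr C" "k \<in> Arr C" "Dom C h = Dom C k" "Cod C h = x" "Cod C k = y"
    have "f \<cdot> h \<in> Hom C (Dom C h) t" "g \<cdot> k \<in> Hom C (Dom C h) t"
      using hk f by (auto simp: Hom_iff)
    then have "f \<cdot> h = g \<cdot> k" using t(2)[of "Dom C h"] hk by auto
    then show "\<exists>u\<in>Arr C. Dom C u = Dom C h \<and> Cod C u = Dom C p \<and> p \<cdot> u = h \<and> q \<cdot> u = k"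
      using is_pullback_lift[OF P hk(1-3)] hk f by (auto simp: Hom_iff)
  next
    fix u v assume "u \<in> Arr C" "v \<in> Arr C" "Dom C u = Dom C v" "Cod C u = Dom C p"
      "Cod C v = Dom C p" "p \<cdot> u = p \<cdot> v" "q \<cdot> u = q \<cdot> v"
    then show "u = v" by (rule is_pullback_eqI[OF P])
  qed (use d f in \<open>auto simp: Hom_iff\<close>)
  then show ?thesis by blast
qed


section \<open>Presheaves given by generators and relations\<close>

context category
begin

text \<open>Elements may have any type here. Thus hom-sets and sets of equivalence classes are
  presheaves as they stand, and coding in \<open>'u\<close> is postponed to the objects of
  \<open>presheaf_cat\<close>.\<close>

definition psh :: "('o \<Rightarrow> 'x set) \<Rightarrow> ('a \<Rightarrow> 'x \<Rightarrow> 'x) \<Rightarrow> bool" where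
  "psh F a \<longleftrightarrow> (\<forall>f\<in>Arr C. \<forall>p\<in>F (Cod C f). a f p \<in> F (Dom C f)) \<and>
     (\<forall>x\<in>Obj C. \<forall>p\<in>F x. a (Ident C x) p = p) \<and>
     (\<forall>f\<in>Arr C. \<forall>g\<in>Arr C. Cod C f = Dom C g \<longrightarrow> (\<forall>p\<in>F (Cod C g). a (g \<cdot> f) p = a f (a g p)))"

definition natp :: "('o \<Rightarrow> 'x set) \<Rightarrow> ('a \<Rightarrow> 'x \<Rightarrow> 'x) \<Rightarrow> ('o \<Rightarrow> 'y set) \<Rightarrow> ('a \<Rightarrow> 'y \<Rightarrow> 'y) \<Rightarrow>
    ('o \<Rightarrow> 'x \<Rightarrow> 'y) \<Rightarrow> bool" where
  "natp F a G b \<phi> \<longleftrightarrow> (\<forall>x\<in>Obj C. \<forall>p\<in>F x. \<phi> x p \<in> G x) \<and>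
     (\<forall>f\<in>Arr C. \<forall>p\<in>F (Cod C f). \<phi> (Dom C f) (a f p) = b f (\<phi> (Cod C f) p))"

definition hom_act :: "'a \<Rightarrow> 'a \<Rightarrow> 'a" where
  "hom_act f h = h \<cdot> f"

text \<open>By the Yoneda lemma an element of \<open>F x\<close> is a map from the representable of
  x, so a natural map into the hom-sets \<open>Hom C x c\<close> is a cocone with vertex c on the
  category of elements of F.\<close>

abbreviation cocone_on :: "('o \<Rightarrow> 'x set) \<Rightarrow> ('a \<Rightarrow> 'x \<Rightarrow> 'x) \<Rightarrow> 'o \<Rightarrow> ('o \<Rightarrow> 'x \<Rightarrow> 'a) \<Rightarrow> bool" where
  "cocone_on F a c \<equiv> natp F a (\<lambda>x. Hom C x c) hom_act"

text \<open>The vertex c is a colimit of the category of elements of F, in other words the value at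
  F of a left adjoint of the Yoneda embedding. Working with this property instead of a chosen value
  allows any isomorphic vertex.\<close>

definition universal_on :: "('o \<Rightarrow> 'x set) \<Rightarrow> ('a \<Rightarrow> 'x \<Rightarrow> 'x) \<Rightarrow> 'o \<Rightarrow> ('o \<Rightarrow> 'x \<Rightarrow> 'a) \<Rightarrow> bool" where
  "universal_on F a c \<phi> \<longleftrightarrow> c \<in> Obj C \<and> cocone_on F a c \<phi> \<and>
     (\<forall>d\<in>Obj C. \<forall>\<psi>. cocone_on F a d \<psi> \<longrightarrow>
        (\<exists>!m. m \<in> Hom C c d \<and> (\<forall>x\<in>Obj C. \<forall>p\<in>F x. m \<cdot> \<phi> x p = \<psi> x p)))"

lemma psh_act: "psh F a \<Longrightarrow> f \<in> Arr C \<Longrightarrow> p \<in> F (Cod C f) \<Longrightarrow> a f p \<in> F (Dom C f)"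
  by (simp add: psh_def)

lemma psh_ident: "psh F a \<Longrightarrow> x \<in> Obj C \<Longrightarrow> p \<in> F x \<Longrightarrow> a (Ident C x) p = p"
  by (simp add: psh_def)

lemma psh_comp: "psh F a \<Longrightarrow> f \<in> Arr C \<Longrightarrow> g \<in> Arr C \<Longrightarrow> Cod C f = Dom C g \<Longrightarrow> p \<in> F (Cod C g) \<Longrightarrow>
    a (g \<cdot> f) p = a f (a g p)"
  by (simp add: psh_def)

lemma psh_hom: "psh (\<lambda>x. Hom C x d) hom_act"
  by (auto simp: psh_def hom_act_def Hom_iff comp_assoc)

lemma natp_in: "natp F a G b \<phi> \<Longrightarrow> x \<in> Obj C \<Longrightarrow> p \<in> F x \<Longrightarrow> \<phi> x p \<in> G x"
  by (simp add: natp_def)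

lemma natp_nat: "natp F a G b \<phi> \<Longrightarrow> f \<in> Arr C \<Longrightarrow> p \<in> F (Cod C f) \<Longrightarrow>
    \<phi> (Dom C f) (a f p) = b f (\<phi> (Cod C f) p)"
  by (simp add: natp_def)

lemma cocone_on_arr: "cocone_on F a c \<phi> \<Longrightarrow> x \<in> Obj C \<Longrightarrow> p \<in> F x \<Longrightarrow>
    \<phi> x p \<in> Arr C \<and> Dom C (\<phi> x p) = x \<and> Cod C (\<phi> x p) = c"
  by (auto simp: natp_def Hom_iff)

lemma cocone_on_nat: "cocone_on F a c \<phi> \<Longrightarrow> f \<in> Arr C \<Longrightarrow> p \<in> F (Cod C f) \<Longrightarrow>
    \<phi> (Dom C f) (a f p) = \<phi> (Cod C f) p \<cdot> f"
  by (simp add: natp_def hom_act_def)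

lemma cocone_on_compose:
  "cocone_on F a c \<phi> \<Longrightarrow> m \<in> Hom C c d \<Longrightarrow> cocone_on F a d (\<lambda>x p. m \<cdot> \<phi> x p)"
  unfolding natp_def hom_act_def by (auto simp: Hom_iff comp_assoc)

lemma natp_compose:
  "psh F a \<Longrightarrow> natp F a G b \<phi> \<Longrightarrow> natp G b H c \<psi> \<Longrightarrow> natp F a H c (\<lambda>x p. \<psi> x (\<phi> x p))"
  unfolding natp_def psh_def by auto

lemma universal_on_eqI:
  assumes "universal_on F a c \<phi>" "m \<in> Hom C c d" "m' \<in> Hom C c d"
    and "\<And>x p. x \<in> Obj C \<Longrightarrow> p \<in> F x \<Longrightarrow> m \<cdot> \<phi> x p = m' \<cdot> \<phi> x p"
  shows "m = m'"
proof -
  have "d \<in> Obj C" using assms(2) by (auto simp: Hom_iff)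
  moreover have "cocone_on F a d (\<lambda>x p. m \<cdot> \<phi> x p)"
    using assms(1,2) cocone_on_compose by (auto simp: universal_on_def)
  ultimately have "\<exists>!n. n \<in> Hom C c d \<and> (\<forall>x\<in>Obj C. \<forall>p\<in>F x. n \<cdot> \<phi> x p = m \<cdot> \<phi> x p)"
    using assms(1) by (simp add: universal_on_def)
  then show ?thesis using assms by metis
qed

lemma universal_on_ex:
  assumes "universal_on F a c \<phi>" "d \<in> Obj C" "cocone_on F a d \<psi>"
  shows "\<exists>m. m \<in> Hom C c d \<and> (\<forall>x\<in>Obj C. \<forall>p\<in>F x. m \<cdot> \<phi> x p = \<psi> x p)"
proof -
  have "\<exists>!m. m \<in> Hom C c d \<and> (\<forall>x\<in>Obj C. \<forall>p\<in>F x. m \<cdot> \<phi> x p = \<psi> x p)"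
    using assms by (simp add: universal_on_def)
  then show ?thesis by blast
qed

text \<open>The tuple \<open>(i, u, v, j)\<close> imposes that generator i restricted along u equals
  generator j restricted along v. Such tuples amount to a parallel pair between coproducts of
  representables, whose coequalizer is the presheaf to be presented.\<close>

definition pres_data :: "'i set \<Rightarrow> ('i \<Rightarrow> 'o) \<Rightarrow> ('i \<times> 'a \<times> 'a \<times> 'i) set \<Rightarrow> bool" where
  "pres_data I s Rel \<longleftrightarrow> (\<forall>i\<in>I. s i \<in> Obj C) \<and>
     (\<forall>i u v j. (i, u, v, j) \<in> Rel \<longrightarrow> i \<in> I \<and> j \<in> I \<and> u \<in> Arr C \<and> v \<in> Arr C \<and>
        Dom C u = Dom C v \<and> Cod C u = s i \<and> Cod C v = s j)"

lemma pres_dataD: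
  assumes "pres_data I s Rel" "(i, u, v, j) \<in> Rel"
  shows "i \<in> I" "j \<in> I" "u \<in> Arr C" "v \<in> Arr C" "Dom C u = Dom C v" "Cod C u = s i" "Cod C v = s j"
  using assms by (auto simp: pres_data_def)

lemma pres_data_obj: "pres_data I s Rel \<Longrightarrow> i \<in> I \<Longrightarrow> s i \<in> Obj C"
  by (simp add: pres_data_def)

text \<open>The pair \<open>(i, k)\<close> stands for the restriction of the \<open>i\<close>-th generator along \<open>k\<close>.\<close>

inductive zigzag :: "'i set \<Rightarrow> ('i \<Rightarrow> 'o) \<Rightarrow> ('i \<times> 'a \<times> 'a \<times> 'i) set \<Rightarrow> 'i \<Rightarrow> 'a \<Rightarrow> 'i \<Rightarrow> 'a \<Rightarrow> bool"
  for I s Rel where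
  refl: "i \<in> I \<Longrightarrow> k \<in> Arr C \<Longrightarrow> Cod C k = s i \<Longrightarrow> zigzag I s Rel i k i k"
| fwd: "zigzag I s Rel i k l (u \<cdot> h) \<Longrightarrow> (l, u, v, j) \<in> Rel \<Longrightarrow> h \<in> Arr C \<Longrightarrow> Cod C h = Dom C u \<Longrightarrow>
    zigzag I s Rel i k j (v \<cdot> h)"
| bwd: "zigzag I s Rel i k l (v \<cdot> h) \<Longrightarrow> (j, u, v, l) \<in> Rel \<Longrightarrow> h \<in> Arr C \<Longrightarrow> Cod C h = Dom C v \<Longrightarrow>
    zigzag I s Rel i k j (u \<cdot> h)"

lemma zigzag_arr:
  assumes "zigzag I s Rel i k j k'" and D: "pres_data I s Rel"
  shows "i \<in> I \<and> j \<in> I \<and> k \<in> Arr C \<and> k' \<in> Arr C \<and> Cod C k = s i \<and> Cod C k' = s j \<and> Dom C k = Dom C k'"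
  using assms(1) by induction (use pres_dataD[OF D] in auto)

lemma zigzag_trans:
  assumes "zigzag I s Rel j k' l k''" "zigzag I s Rel i k j k'"
  shows "zigzag I s Rel i k l k''"
  using assms by induction (auto intro: zigzag.intros)

lemma zigzag_rel:
  assumes "pres_data I s Rel" "(i, u, v, j) \<in> Rel" "h \<in> Arr C" "Cod C h = Dom C u"
  shows "zigzag I s Rel i (u \<cdot> h) j (v \<cdot> h)" "zigzag I s Rel j (v \<cdot> h) i (u \<cdot> h)"
proof -
  note d = pres_dataD[OF assms(1,2)]
  show "zigzag I s Rel i (u \<cdot> h) j (v \<cdot> h)"
    by (rule zigzag.fwd[OF zigzag.refl assms(2)]) (use d assms in auto)
  show "zigzag I s Rel j (v \<cdot> h) i (u \<cdot> h)"
    by (rule zigzag.bwd[OF zigzag.refl assms(2)]) (use d assms in auto)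
qed

lemma zigzag_sym:
  assumes "zigzag I s Rel i k j k'" and D: "pres_data I s Rel"
  shows "zigzag I s Rel j k' i k"
  using assms(1)
proof induction
  case (fwd i k l u h v j)
  show ?case by (rule zigzag_trans[OF fwd.IH zigzag_rel(2)[OF D fwd.hyps(2-4)]])
next
  case (bwd i k l v h j u)
  have "Cod C h = Dom C u" using bwd.hyps(4) pres_dataD(5)[OF D bwd.hyps(2)] by simp
  from zigzag_trans[OF bwd.IH zigzag_rel(1)[OF D bwd.hyps(2,3) this]] show ?case .
qed (rule zigzag.refl)

lemma zigzag_comp:
  assumes "zigzag I s Rel i k j k'" and D: "pres_data I s Rel" and "g \<in> Arr C" "Cod C g = Dom C k"
  shows "zigzag I s Rel i (k \<cdot> g) j (k' \<cdot> g)"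
  using assms(1,3,4)
proof induction
  case (fwd i k l u h v j)
  note d = pres_dataD[OF D fwd.hyps(2)]
  have "Dom C k = Dom C h" using zigzag_arr[OF fwd.hyps(1) D] d fwd.hyps by simp
  then show ?case
    using fwd d zigzag.fwd[OF _ fwd.hyps(2), of I s i "k \<cdot> g" "h \<cdot> g"] by (simp add: comp_assoc)
next
  case (bwd i k l v h j u)
  note d = pres_dataD[OF D bwd.hyps(2)]
  have "Dom C k = Dom C h" using zigzag_arr[OF bwd.hyps(1) D] d bwd.hyps by simp
  then show ?case
    using bwd d zigzag.bwd[OF _ bwd.hyps(2), of I s i "k \<cdot> g" "h \<cdot> g"] by (simp add: comp_assoc)
qed (auto intro: zigzag.refl)

text \<open>The equations imposed by \<open>Rel\<close> propagate along a zigzag because restriction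
  is functorial. This gives well-definedness in \<open>presents_natp\<close> and soundness of the
  relations in \<open>small_presents\<close>.\<close>

lemma zigzag_respects:
  assumes "zigzag I s Rel i k j k'" and D: "pres_data I s Rel"
    and G: "psh G b" and g: "\<And>i. i \<in> I \<Longrightarrow> g i \<in> G (s i)"
    and rel: "\<And>i u v j. (i, u, v, j) \<in> Rel \<Longrightarrow> b u (g i) = b v (g j)"
  shows "b k (g i) = b k' (g j)"
  using assms(1)
proof induction
  case (fwd i k l u h v j)
  note d = pres_dataD[OF D fwd.hyps(2)]
  have "b (u \<cdot> h) (g l) = b h (b u (g l))" using fwd d g by (intro psh_comp[OF G]) auto
  also have "\<dots> = b (v \<cdot> h) (g j)"
    unfolding rel[OF fwd.hyps(2)] using fwd d g by (intro psh_comp[OF G, symmetric]) auto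
  finally show ?case using fwd by simp
next
  case (bwd i k l v h j u)
  note d = pres_dataD[OF D bwd.hyps(2)]
  have "b (v \<cdot> h) (g l) = b h (b v (g l))" using bwd d g by (intro psh_comp[OF G]) auto
  also have "\<dots> = b (u \<cdot> h) (g j)"
    unfolding rel[OF bwd.hyps(2), symmetric] using bwd d g by (intro psh_comp[OF G, symmetric]) auto
  finally show ?case using bwd by simp
qed simp

text \<open>F is, up to isomorphism, the coequalizer described by the data. The description is by
  elements, generators suffice and two restrictions agree only when a zigzag forces it, so that
  pullbacks of presented presheaves can be checked by hand.\<close>

definition presents :: "('o \<Rightarrow> 'x set) \<Rightarrow> ('a \<Rightarrow> 'x \<Rightarrow> 'x) \<Rightarrow> 'i set \<Rightarrow> ('i \<Rightarrow> 'o) \<Rightarrow>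
    ('i \<times> 'a \<times> 'a \<times> 'i) set \<Rightarrow> ('i \<Rightarrow> 'x) \<Rightarrow> bool" where
  "presents F a I s Rel e \<longleftrightarrow> pres_data I s Rel \<and> psh F a \<and> (\<forall>i\<in>I. e i \<in> F (s i)) \<and>
     (\<forall>x\<in>Obj C. \<forall>p\<in>F x. \<exists>i\<in>I. \<exists>k\<in>Hom C x (s i). p = a k (e i)) \<and>
     (\<forall>i\<in>I. \<forall>j\<in>I. \<forall>x. \<forall>k\<in>Hom C x (s i). \<forall>k'\<in>Hom C x (s j).
        a k (e i) = a k' (e j) \<longleftrightarrow> zigzag I s Rel i k j k')"

lemma presentsD:
  assumes "presents F a I s Rel e"
  shows "pres_data I s Rel" "psh F a" "i \<in> I \<Longrightarrow> e i \<in> F (s i)" "i \<in> I \<Longrightarrow> s i \<in> Obj C"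
  using assms by (auto simp: presents_def pres_data_def)

lemma presents_gen:
  assumes "presents F a I s Rel e" "x \<in> Obj C" "p \<in> F x"
  obtains i k where "i \<in> I" "k \<in> Arr C" "Dom C k = x" "Cod C k = s i" "p = a k (e i)"
proof -
  have "\<exists>i\<in>I. \<exists>k\<in>Hom C x (s i). p = a k (e i)" using assms by (simp add: presents_def)
  then show thesis using that by (auto simp: Hom_iff)
qed

lemma presents_eq:
  assumes "presents F a I s Rel e" "i \<in> I" "j \<in> I" "k \<in> Hom C x (s i)" "k' \<in> Hom C x (s j)"
  shows "a k (e i) = a k' (e j) \<longleftrightarrow> zigzag I s Rel i k j k'"
  using assms unfolding presents_def by blast

lemma presents_rel:
  assumes P: "presents F a I s Rel e" and r: "(i, u, v, j) \<in> Rel"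
  shows "a u (e i) = a v (e j)"
proof -
  note d = pres_dataD[OF presentsD(1)[OF P] r]
  have "zigzag I s Rel i u j v"
    using zigzag_rel(1)[OF presentsD(1)[OF P] r, of "Ident C (Dom C u)"] d by simp
  then show ?thesis using presents_eq[OF P] d by (auto simp: Hom_iff)
qed

text \<open>The universal property of the coequalizer, recovered from the description by elements:
  each element is given a chosen representation as a restriction of a generator.\<close>

lemma presents_natp:
  assumes P: "presents F a I s Rel e" and G: "psh G b" and g: "\<And>i. i \<in> I \<Longrightarrow> g i \<in> G (s i)"
    and rel: "\<And>i u v j. (i, u, v, j) \<in> Rel \<Longrightarrow> b u (g i) = b v (g j)"
  obtains \<phi> where "natp F a G b \<phi>" "\<And>i. i \<in> I \<Longrightarrow> \<phi> (s i) (e i) = g i"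
    "\<And>i k. i \<in> I \<Longrightarrow> k \<in> Arr C \<Longrightarrow> Cod C k = s i \<Longrightarrow> \<phi> (Dom C k) (a k (e i)) = b k (g i)"
proof -
  note D = presentsD(1)[OF P] and F = presentsD(2)[OF P] and e = presentsD(3)[OF P]
  define R where "R x p ik \<longleftrightarrow> fst ik \<in> I \<and> snd ik \<in> Hom C x (s (fst ik)) \<and> p = a (snd ik) (e (fst ik))"
    for x p ik
  define \<phi> where "\<phi> x p = (let ik = SOME ik. R x p ik in b (snd ik) (g (fst ik)))" for x p
  \<comment> \<open>Independence of the chosen representation \<open>jl\<close>: two representations
    of one element are joined by a zigzag, along which the restrictions of the \<open>g i\<close>
    agree.\<close>
  have val: "\<phi> (Dom C k) (a k (e i)) = b k (g i)" if ik: "i \<in> I" "k \<in> Arr C" "Cod C k = s i" for i k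
  proof -
    let ?x = "Dom C k"
    define jl where "jl = (SOME jl. R ?x (a k (e i)) jl)"
    have "R ?x (a k (e i)) (i, k)" using ik by (simp add: R_def Hom_iff)
    then have jl: "R ?x (a k (e i)) jl" unfolding jl_def by (rule someI)
    obtain j l where [simp]: "jl = (j, l)" by (cases jl)
    have j: "j \<in> I" "l \<in> Hom C ?x (s j)" "a k (e i) = a l (e j)" using jl by (auto simp: R_def)
    then have "zigzag I s Rel i k j l" using presents_eq[OF P ik(1) j(1), of k ?x l] ik by (simp add: Hom_iff)
    then have "b k (g i) = b l (g j)" by (rule zigzag_respects[OF _ D G g rel])
    then show ?thesis unfolding \<phi>_def jl_def[symmetric] by (simp add: Let_def)
  qed
  have "natp F a G b \<phi>" unfolding natp_def
  proof (intro conjI ballI)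
    fix x p assume "x \<in> Obj C" "p \<in> F x"
    then obtain i k where ik: "i \<in> I" "k \<in> Arr C" "Dom C k = x" "Cod C k = s i" "p = a k (e i)"
      by (rule presents_gen[OF P])
    then show "\<phi> x p \<in> G x" using val[of i k] psh_act[OF G, of k "g i"] g by auto
  next
    fix f p assume f: "f \<in> Arr C" and "p \<in> F (Cod C f)"
    then obtain i k where ik: "i \<in> I" "k \<in> Arr C" "Dom C k = Cod C f" "Cod C k = s i" "p = a k (e i)"
      using presents_gen[OF P, of "Cod C f" p] by auto
    have "a f p = a (k \<cdot> f) (e i)" unfolding ik using ik f e by (intro psh_comp[OF F, symmetric]) auto
    moreover have "b f (b k (g i)) = b (k \<cdot> f) (g i)"
      using ik f g by (intro psh_comp[OF G, symmetric]) auto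
    ultimately show "\<phi> (Dom C f) (a f p) = b f (\<phi> (Cod C f) p)"
      using val[of i k] val[of i "k \<cdot> f"] ik f by simp
  qed
  moreover have "\<phi> (s i) (e i) = g i" if i: "i \<in> I" for i
    using val[OF i, of "Ident C (s i)"] presentsD(4)[OF P i] psh_ident[OF F _ e[OF i]]
      psh_ident[OF G _ g[OF i]] by simp
  ultimately show thesis using that val by blast
qed

lemma presents_unique:
  assumes P: "presents F a I s Rel e" and \<phi>: "natp F a G b \<phi>" and \<psi>: "natp F a G b \<psi>"
    and eq: "\<And>i. i \<in> I \<Longrightarrow> \<phi> (s i) (e i) = \<psi> (s i) (e i)" and p: "x \<in> Obj C" "p \<in> F x"
  shows "\<phi> x p = \<psi> x p"
proof -
  obtain i k where ik: "i \<in> I" "k \<in> Arr C" "Dom C k = x" "Cod C k = s i" "p = a k (e i)"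
    using p by (rule presents_gen[OF P])
  then show ?thesis
    using natp_nat[OF \<phi>, of k "e i"] natp_nat[OF \<psi>, of k "e i"] eq presentsD(3)[OF P] by simp
qed

text \<open>The elements are the zigzag classes of pairs \<open>(i, k)\<close>. The second
  conclusion bounds \<open>F x\<close> by an image of a sum of hom-sets, from which smallness is
  later derived.\<close>

lemma presented_exists:
  fixes I :: "'i set"
  assumes D: "pres_data I s Rel"
  obtains F :: "'o \<Rightarrow> ('i \<times> 'a) set set" and a e where "presents F a I s Rel e"
    "\<And>x. x \<in> Obj C \<Longrightarrow> F x \<subseteq> (\<lambda>(i, k). {(j, k'). zigzag I s Rel i k j k'}) ` (SIGMA i:I. Hom C x (s i))"
proof -
  define cl where "cl i k = {(j, k'). zigzag I s Rel i k j k'}" for i k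
  define F where "F x = (\<lambda>(i, k). cl i k) ` (SIGMA i:I. Hom C x (s i))" for x
  \<comment> \<open>Every representative yields the same class, so the union avoids choosing
    one.\<close>
  define a where "a f X = (\<Union>(i, k)\<in>X. cl i (k \<cdot> f))" for f X
  define e where "e i = cl i (Ident C (s i))" for i
  have cl_eq: "cl i k = cl j k' \<longleftrightarrow> zigzag I s Rel i k j k'" if "i \<in> I" "k \<in> Arr C" "Cod C k = s i"
    "j \<in> I" "k' \<in> Arr C" "Cod C k' = s j" for i k j k'
  proof
    assume "cl i k = cl j k'"
    moreover have "(j, k') \<in> cl j k'" using that by (simp add: cl_def zigzag.refl)
    ultimately show "zigzag I s Rel i k j k'" by (auto simp: cl_def)
  next
    assume z: "zigzag I s Rel i k j k'"
    then show "cl i k = cl j k'"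
      using zigzag_trans[OF _ z] zigzag_trans[OF _ zigzag_sym[OF z D]] by (auto simp: cl_def)
  qed
  have act: "a f (cl i k) = cl i (k \<cdot> f)"
    if ik: "i \<in> I" "k \<in> Arr C" "Cod C k = s i" and f: "f \<in> Arr C" "Cod C f = Dom C k" for i k f
  proof -
    have "cl j (k' \<cdot> f) = cl i (k \<cdot> f)" if z: "(j, k') \<in> cl i k" for j k'
    proof -
      have z: "zigzag I s Rel i k j k'" using z by (simp add: cl_def)
      have "zigzag I s Rel i (k \<cdot> f) j (k' \<cdot> f)" using zigzag_comp[OF z D f] .
      with z show ?thesis using cl_eq[of i "k \<cdot> f" j "k' \<cdot> f"] ik f zigzag_arr[OF z D] by auto
    qed
    moreover have "(i, k) \<in> cl i k" using ik by (simp add: cl_def zigzag.refl)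
    ultimately show ?thesis unfolding a_def by blast
  qed
  have F_iff: "X \<in> F x \<longleftrightarrow> (\<exists>i\<in>I. \<exists>k\<in>Arr C. Dom C k = x \<and> Cod C k = s i \<and> X = cl i k)" for X x
    unfolding F_def by (force simp: Hom_iff)
  have psh: "psh F a" unfolding psh_def
  proof (intro conjI ballI impI)
    fix f X assume f: "f \<in> Arr C" and "X \<in> F (Cod C f)"
    then obtain i k where "i \<in> I" "k \<in> Arr C" "Dom C k = Cod C f" "Cod C k = s i" "X = cl i k"
      unfolding F_iff by blast
    then show "a f X \<in> F (Dom C f)" using act[of i k f] f unfolding F_iff
      by (intro bexI[of _ i] bexI[of _ "k \<cdot> f"]) auto
  next
    fix x X assume "x \<in> Obj C" "X \<in> F x"
    then show "a (Ident C x) X = X" unfolding F_iff using act by auto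
  next
    fix f g X assume f: "f \<in> Arr C" "g \<in> Arr C" "Cod C f = Dom C g" and "X \<in> F (Cod C g)"
    then obtain i k where "i \<in> I" "k \<in> Arr C" "Dom C k = Cod C g" "Cod C k = s i" "X = cl i k"
      unfolding F_iff by blast
    then show "a (g \<cdot> f) X = a f (a g X)" using f act by (simp add: comp_assoc)
  qed
  have ek: "a k (e i) = cl i k" if "i \<in> I" "k \<in> Arr C" "Cod C k = s i" for i k
    using that act[of i "Ident C (s i)" k] pres_data_obj[OF D] by (simp add: e_def)
  have "presents F a I s Rel e" unfolding presents_def
  proof (intro conjI ballI allI)
    fix i assume "i \<in> I" then show "e i \<in> F (s i)"
      unfolding F_iff e_def using pres_data_obj[OF D, of i]
      by (intro bexI[of _ i] bexI[of _ "Ident C (s i)"]) auto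
  next
    fix x X assume "x \<in> Obj C" "X \<in> F x"
    then obtain i k where "i \<in> I" "k \<in> Arr C" "Dom C k = x" "Cod C k = s i" "X = cl i k"
      unfolding F_iff by blast
    then show "\<exists>i\<in>I. \<exists>k\<in>Hom C x (s i). X = a k (e i)"
      using ek by (intro bexI[of _ i] bexI[of _ k]) (auto simp: Hom_iff)
  next
    fix i j x k k' assume "i \<in> I" "j \<in> I" "k \<in> Hom C x (s i)" "k' \<in> Hom C x (s j)"
    then show "a k (e i) = a k' (e j) \<longleftrightarrow> zigzag I s Rel i k j k'"
      using ek cl_eq by (simp add: Hom_iff)
  qed (use D psh in auto)
  then show thesis by (rule that) (simp add: F_def cl_def)
qed

text \<open>Replaces elements by codes, since the objects of \<open>set_cat\<close> are subsets of
  \<open>'u\<close>.\<close>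

lemma presents_transport:
  fixes F :: "'o \<Rightarrow> 'x set" and \<epsilon> :: "'o \<Rightarrow> 'x \<Rightarrow> 'y"
  assumes P: "presents F a I s Rel e" and inj: "\<And>x. x \<in> Obj C \<Longrightarrow> inj_on (\<epsilon> x) (F x)"
  obtains b where "presents (\<lambda>x. \<epsilon> x ` F x) b I s Rel (\<lambda>i. \<epsilon> (s i) (e i))"
    "\<And>f p. f \<in> Arr C \<Longrightarrow> p \<in> F (Cod C f) \<Longrightarrow> b f (\<epsilon> (Cod C f) p) = \<epsilon> (Dom C f) (a f p)"
proof -
  note D = presentsD(1)[OF P] and F = presentsD(2)[OF P] and e = presentsD(3)[OF P]
  define b where "b f q = \<epsilon> (Dom C f) (a f (inv_into (F (Cod C f)) (\<epsilon> (Cod C f)) q))" for f q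
  have b: "b f (\<epsilon> x p) = \<epsilon> (Dom C f) (a f p)" if "f \<in> Arr C" "x = Cod C f" "p \<in> F x" for f p x
    using that inj by (simp add: b_def)
  have "psh (\<lambda>x. \<epsilon> x ` F x) b" unfolding psh_def
  proof (intro conjI ballI impI)
    fix f q assume "f \<in> Arr C" "q \<in> \<epsilon> (Cod C f) ` F (Cod C f)"
    then show "b f q \<in> \<epsilon> (Dom C f) ` F (Dom C f)" using b psh_act[OF F] by force
  next
    fix x q assume "x \<in> Obj C" "q \<in> \<epsilon> x ` F x"
    then show "b (Ident C x) q = q" using b[of "Ident C x" x] psh_ident[OF F] by auto
  next
    fix f g q assume f: "f \<in> Arr C" "g \<in> Arr C" "Cod C f = Dom C g" "q \<in> \<epsilon> (Cod C g) ` F (Cod C g)"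
    then obtain p where p: "p \<in> F (Cod C g)" "q = \<epsilon> (Cod C g) p" by blast
    have "a g p \<in> F (Dom C g)" using psh_act[OF F] f p by blast
    then show "b (g \<cdot> f) q = b f (b g q)"
      using f p b[of "g \<cdot> f" "Cod C g" p] b[of g "Cod C g" p] b[of f "Dom C g" "a g p"]
        psh_comp[OF F] by simp
  qed
  moreover have be: "b k (\<epsilon> (s i) (e i)) = \<epsilon> (Dom C k) (a k (e i))"
    if "i \<in> I" "k \<in> Arr C" "Cod C k = s i" for i k using that b[of k "s i" "e i"] e by simp
  moreover have inj': "\<epsilon> (Dom C k) (a k (e i)) = \<epsilon> (Dom C k) (a k' (e j)) \<longleftrightarrow> a k (e i) = a k' (e j)"
    if "i \<in> I" "k \<in> Arr C" "Cod C k = s i" "j \<in> I" "k' \<in> Arr C" "Cod C k' = s j" "Dom C k = Dom C k'"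
    for i k j k'
    using that inj_on_eq_iff[OF inj, of "Dom C k" "a k (e i)" "a k' (e j)"]
      psh_act[OF F, of k "e i"] psh_act[OF F, of k' "e j"] e by simp
  ultimately have "presents (\<lambda>x. \<epsilon> x ` F x) b I s Rel (\<lambda>i. \<epsilon> (s i) (e i))"
    unfolding presents_def
  proof (intro conjI ballI allI, goal_cases)
    case (4 x q)
    then obtain p where p: "p \<in> F x" "q = \<epsilon> x p" by blast
    obtain i k where "i \<in> I" "k \<in> Arr C" "Dom C k = x" "Cod C k = s i" "p = a k (e i)"
      using presents_gen[OF P _ p(1)] 4 by blast
    then show ?case using 4 p by (auto simp: Hom_iff intro!: bexI[of _ i] bexI[of _ k])
  next
    case (5 i j x k k')
    then have k: "k \<in> Arr C" "Dom C k = x" "Cod C k = s i" "k' \<in> Arr C" "Dom C k' = x"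
      "Cod C k' = s j" and ij: "i \<in> I" "j \<in> I"
      by (simp_all add: Hom_iff)
    have "b k (\<epsilon> (s i) (e i)) = b k' (\<epsilon> (s j) (e j)) \<longleftrightarrow> a k (e i) = a k' (e j)"
      using be[OF ij(1) k(1,3)] be[OF ij(2) k(4,6)] inj'[OF ij(1) k(1,3) ij(2) k(4,6)] k by simp
    then show ?case using presents_eq[OF P ij, of k x k'] k by (simp add: Hom_iff)
  qed (use D e in auto)
  then show thesis using that b by blast
qed

end


section \<open>Small presheaves\<close>

definition set_app :: "('x \<Rightarrow> 'u set \<times> 'u set \<times> ('u \<Rightarrow> 'u)) \<Rightarrow> 'x \<Rightarrow> 'u \<Rightarrow> 'u" where
  "set_app t x p = snd (snd (t x)) p"

lemma set_cat_simps:
  "Obj (set_cat U) = {A. small U A}"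
  "Dom (set_cat U) (A, B, f) = A" "Cod (set_cat U) (A, B, f) = B"
  "Ident (set_cat U) A = (A, A, \<lambda>x\<in>A. x)"
  "(B', E, g) \<cdot>\<^bsub>set_cat U\<^esub> (A, B, f) = (A, E, compose A g f)"
  by (auto simp: set_cat_def)

lemma set_cat_Hom:
  "m \<in> Hom (set_cat U) A B \<longleftrightarrow> small U A \<and> small U B \<and> (\<exists>f. m = (A, B, f) \<and> f \<in> A \<rightarrow>\<^sub>E B)"
  by (auto simp: Hom_def set_cat_def)

lemma set_functor_arr:
  assumes "is_functor A (set_cat U) F" "f \<in> Arr A"
  shows "arr_map F f = (obj_map F (Dom A f), obj_map F (Cod A f), set_app (arr_map F) f)"
    "set_app (arr_map F) f \<in> obj_map F (Dom A f) \<rightarrow>\<^sub>E obj_map F (Cod A f)"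
  using functor_hom[OF assms] unfolding set_cat_Hom by (auto simp: set_app_def[abs_def])

lemma set_nat_trans_app:
  assumes "nat_trans A (set_cat U) F G t" "x \<in> Obj A"
  shows "t x = (obj_map F x, obj_map G x, set_app t x)"
    "set_app t x \<in> obj_map F x \<rightarrow>\<^sub>E obj_map G x"
  using nat_trans_hom[OF assms] unfolding set_cat_Hom by (auto simp: set_app_def[abs_def])

lemma set_nat_trans_natural:
  assumes t: "nat_trans A (set_cat U) F G t" and f: "f \<in> Arr A" and p: "p \<in> obj_map F (Dom A f)"
  shows "set_app t (Cod A f) (set_app (arr_map F) f p) = set_app (arr_map G) f (set_app t (Dom A f) p)"
proof -
  interpret A: category A using functor_dom[OF nat_trans_dom[OF t]] .
  have "t (Cod A f) \<cdot>\<^bsub>set_cat U\<^esub> arr_map F f = arr_map G f \<cdot>\<^bsub>set_cat U\<^esub> t (Dom A f)"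
    using nat_trans_nat[OF t f] .
  then have "compose (obj_map F (Dom A f)) (set_app t (Cod A f)) (set_app (arr_map F) f) =
      compose (obj_map F (Dom A f)) (set_app (arr_map G) f) (set_app t (Dom A f))"
    unfolding set_functor_arr(1)[OF nat_trans_dom[OF t] f] set_functor_arr(1)[OF nat_trans_cod[OF t] f]
      set_nat_trans_app(1)[OF t A.dom_obj[OF f]] set_nat_trans_app(1)[OF t A.cod_obj[OF f]]
      set_cat_simps by simp
  from fun_cong[OF this, of p] show ?thesis using p by (simp add: compose_def)
qed

definition set_trans :: "'x set \<Rightarrow> ('x \<Rightarrow> 'u set) \<Rightarrow> ('x \<Rightarrow> 'u set) \<Rightarrow> ('x \<Rightarrow> 'u \<Rightarrow> 'u) \<Rightarrow>
    'x \<Rightarrow> 'u set \<times> 'u set \<times> ('u \<Rightarrow> 'u)" where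
  "set_trans X F G \<phi> = (\<lambda>x\<in>X. (F x, G x, \<lambda>p\<in>F x. \<phi> x p))"

lemma set_app_trans[simp]: "x \<in> X \<Longrightarrow> p \<in> F x \<Longrightarrow> set_app (set_trans X F G \<phi>) x p = \<phi> x p"
  by (simp add: set_app_def set_trans_def)

lemma set_nat_transI:
  assumes F: "is_functor A (set_cat U) F" and G: "is_functor A (set_cat U) G"
    and in_G: "\<And>x p. x \<in> Obj A \<Longrightarrow> p \<in> obj_map F x \<Longrightarrow> \<phi> x p \<in> obj_map G x"
    and nat: "\<And>f p. f \<in> Arr A \<Longrightarrow> p \<in> obj_map F (Dom A f) \<Longrightarrow>
      \<phi> (Cod A f) (set_app (arr_map F) f p) = set_app (arr_map G) f (\<phi> (Dom A f) p)"
  shows "nat_trans A (set_cat U) F G (set_trans (Obj A) (obj_map F) (obj_map G) \<phi>)"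
proof (rule nat_transI[OF F G])
  interpret A: category A using functor_dom[OF F] .
  have sm: "small U (obj_map F x)" "small U (obj_map G x)" if "x \<in> Obj A" for x
    using functor_obj[OF F that] functor_obj[OF G that] by (simp_all add: set_cat_simps)
  then show "set_trans (Obj A) (obj_map F) (obj_map G) \<phi> x \<in> Hom (set_cat U) (obj_map F x) (obj_map G x)"
    if "x \<in> Obj A" for x using that in_G by (auto simp: set_trans_def set_cat_Hom)
  fix f assume f: "f \<in> Arr A"
  have d: "Dom A f \<in> Obj A" "Cod A f \<in> Obj A" using f by auto
  show "set_trans (Obj A) (obj_map F) (obj_map G) \<phi> (Cod A f) \<cdot>\<^bsub>set_cat U\<^esub> arr_map F f =
      arr_map G f \<cdot>\<^bsub>set_cat U\<^esub> set_trans (Obj A) (obj_map F) (obj_map G) \<phi> (Dom A f)"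
    unfolding set_functor_arr(1)[OF F f] set_functor_arr(1)[OF G f]
    using d f nat[OF f] set_functor_arr(2)[OF F f] set_functor_arr(2)[OF G f] in_G[OF d(1)]
    by (auto simp: set_trans_def set_cat_simps compose_def fun_eq_iff)
qed (simp add: set_trans_def)

lemma set_nat_trans_eqI:
  assumes t: "nat_trans A (set_cat U) F G t" and t': "nat_trans A (set_cat U) F G t'"
    and eq: "\<And>x p. x \<in> Obj A \<Longrightarrow> p \<in> obj_map F x \<Longrightarrow> set_app t x p = set_app t' x p"
  shows "t = t'"
proof (rule extensionalityI[OF nat_trans_ext[OF t] nat_trans_ext[OF t']])
  fix x assume x: "x \<in> Obj A"
  have "set_app t x = set_app t' x"
    by (rule PiE_ext[OF set_nat_trans_app(2)[OF t x] set_nat_trans_app(2)[OF t' x]]) (rule eq[OF x])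
  then show "t x = t' x" using set_nat_trans_app(1)[OF t x] set_nat_trans_app(1)[OF t' x] by simp
qed

section \<open>Small presheaves and small presentations\<close>

locale universe_category = category C for C :: "('o, 'a) cat" (structure) +
  fixes U :: "'u itself"
  assumes inacc: "inaccessible U" and loc_small: "locally_small U C"
begin

abbreviation presheaf :: "('o, 'a, 'u) presheaf \<Rightarrow> bool" where
  "presheaf P \<equiv> is_functor (op_cat C) (set_cat U) P"

definition act :: "('o, 'a, 'u) presheaf \<Rightarrow> 'a \<Rightarrow> 'u \<Rightarrow> 'u" where
  "act P = set_app (arr_map P)"

abbreviation natpp :: "('o, 'a, 'u) presheaf \<Rightarrow> ('o, 'a, 'u) presheaf \<Rightarrow> ('o \<Rightarrow> 'u \<Rightarrow> 'u) \<Rightarrow> bool" where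
  "natpp P Q \<equiv> natp (obj_map P) (act P) (obj_map Q) (act Q)"

lemma presheaf_psh:
  assumes P: "presheaf P"
  shows "psh (obj_map P) (act P)"
  unfolding psh_def
proof (intro conjI ballI impI)
  fix f p assume "f \<in> Arr C" "p \<in> obj_map P (Cod C f)"
  then show "act P f p \<in> obj_map P (Dom C f)"
    using set_functor_arr(2)[OF P, of f] by (auto simp: act_def)
next
  fix x p assume "x \<in> Obj C" "p \<in> obj_map P x"
  then show "act P (Ident C x) p = p"
    using functor_ident[OF P, of x] by (simp add: act_def set_app_def set_cat_simps)
next
  fix f g p assume f: "f \<in> Arr C" "g \<in> Arr C" "Cod C f = Dom C g" and p: "p \<in> obj_map P (Cod C g)"
  have "arr_map P (g \<cdot> f) = arr_map P f \<cdot>\<^bsub>set_cat U\<^esub> arr_map P g"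
    using functor_comp[OF P, of g f] f by simp
  also have "\<dots> = (obj_map P (Cod C g), obj_map P (Dom C f),
      compose (obj_map P (Cod C g)) (act P f) (act P g))"
    using set_functor_arr(1)[OF P, of f] set_functor_arr(1)[OF P, of g] f
    by (simp add: set_cat_simps act_def)
  finally show "act P (g \<cdot> f) p = act P f (act P g p)"
    using p by (simp add: act_def set_app_def compose_def)
qed

lemma presheaf_small: "presheaf P \<Longrightarrow> x \<in> Obj C \<Longrightarrow> small U (obj_map P x)"
  using functor_obj by (fastforce simp: set_cat_simps)

definition mk_psh :: "('o \<Rightarrow> 'u set) \<Rightarrow> ('a \<Rightarrow> 'u \<Rightarrow> 'u) \<Rightarrow> ('o, 'a, 'u) presheaf" where
  "mk_psh F a = \<lparr>obj_map = (\<lambda>x\<in>Obj C. F x),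
     arr_map = (\<lambda>f\<in>Arr C. (F (Cod C f), F (Dom C f), \<lambda>p\<in>F (Cod C f). a f p))\<rparr>"

lemma mk_psh_obj[simp]: "x \<in> Obj C \<Longrightarrow> obj_map (mk_psh F a) x = F x"
  by (simp add: mk_psh_def)

lemma mk_psh_act[simp]: "f \<in> Arr C \<Longrightarrow> p \<in> F (Cod C f) \<Longrightarrow> act (mk_psh F a) f p = a f p"
  by (simp add: mk_psh_def act_def set_app_def)

lemma mk_psh_presheaf:
  assumes F: "psh F a" and sm: "\<And>x. x \<in> Obj C \<Longrightarrow> small U (F x)"
  shows "presheaf (mk_psh F a)"
proof (rule is_functorI)
  fix f assume f: "f \<in> Arr (op_cat C)"
  then show "arr_map (mk_psh F a) f \<in> Hom (set_cat U) (obj_map (mk_psh F a) (Dom (op_cat C) f))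
      (obj_map (mk_psh F a) (Cod (op_cat C) f))"
    using psh_act[OF F] sm by (auto simp: mk_psh_def set_cat_Hom)
next
  fix f g assume "f \<in> Arr (op_cat C)" "g \<in> Arr (op_cat C)" "Cod (op_cat C) f = Dom (op_cat C) g"
  then have f: "f \<in> Arr C" "g \<in> Arr C" "Cod C g = Dom C f" by auto
  then show "arr_map (mk_psh F a) (g \<cdot>\<^bsub>op_cat C\<^esub> f) =
      arr_map (mk_psh F a) g \<cdot>\<^bsub>set_cat U\<^esub> arr_map (mk_psh F a) f"
    using psh_act[OF F f(1)] psh_comp[OF F f(2,1,3)]
    by (auto simp: mk_psh_def set_cat_simps compose_def fun_eq_iff)
qed (use sm psh_ident[OF F] in \<open>auto simp: mk_psh_def category_op category_axiom category_set_cat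
      set_cat_simps fun_eq_iff\<close>)

lemma presents_mk_psh:
  assumes P: "presents F a I s Rel e"
  shows "presents (obj_map (mk_psh F a)) (act (mk_psh F a)) I s Rel e"
proof -
  note e = presentsD(3)[OF P] and s = presentsD(4)[OF P] and F = presentsD(2)[OF P]
  have ae: "act (mk_psh F a) k (e i) = a k (e i)" if "i \<in> I" "k \<in> Hom C x (s i)" for i k x
    using that e by (auto simp: Hom_iff)
  have "psh (obj_map (mk_psh F a)) (act (mk_psh F a))" unfolding psh_def
  proof (intro conjI ballI impI)
    fix f p assume "f \<in> Arr C" "p \<in> obj_map (mk_psh F a) (Cod C f)"
    then show "act (mk_psh F a) f p \<in> obj_map (mk_psh F a) (Dom C f)"
      using psh_act[OF F] by simp
  next
    fix f g p assume "f \<in> Arr C" "g \<in> Arr C" "Cod C f = Dom C g" "p \<in> obj_map (mk_psh F a) (Cod C g)"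
    then show "act (mk_psh F a) (g \<cdot> f) p = act (mk_psh F a) f (act (mk_psh F a) g p)"
      using psh_comp[OF F] psh_act[OF F, of g p] by simp
  qed (use psh_ident[OF F] in simp)
  then show ?thesis using P ae s unfolding presents_def by simp
qed

lemma natp_mk_psh:
  assumes "psh F a"
  shows "natp (obj_map (mk_psh F a)) (act (mk_psh F a)) G b \<phi> \<longleftrightarrow> natp F a G b \<phi>"
    "natp G b (obj_map (mk_psh F a)) (act (mk_psh F a)) \<psi> \<longleftrightarrow> natp G b F a \<psi>"
proof -
  show "natp (obj_map (mk_psh F a)) (act (mk_psh F a)) G b \<phi> \<longleftrightarrow> natp F a G b \<phi>"
    by (simp add: natp_def)
  show "natp G b (obj_map (mk_psh F a)) (act (mk_psh F a)) \<psi> \<longleftrightarrow> natp G b F a \<psi>"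
    by (auto simp: natp_def)
qed

lemma natpp_trans: "presheaf P \<Longrightarrow> presheaf Q \<Longrightarrow> natpp P Q \<phi> \<Longrightarrow>
    nat_trans (op_cat C) (set_cat U) P Q (set_trans (Obj C) (obj_map P) (obj_map Q) \<phi>)"
  using set_nat_transI[of "op_cat C" U P Q \<phi>] by (simp add: natp_def act_def)

lemma trans_natpp: "nat_trans (op_cat C) (set_cat U) P Q t \<Longrightarrow> natpp P Q (set_app t)"
  using set_nat_trans_app(2)[of "op_cat C" U P Q t] set_nat_trans_natural[of "op_cat C" U P Q t]
  by (force simp: natp_def act_def)

text \<open>The universal property that defines small presheaves, in terms of elements.\<close>

definition kan_on :: "'o set \<Rightarrow> ('o, 'a, 'u) presheaf \<Rightarrow> bool" where
  "kan_on S P \<longleftrightarrow>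
     (\<forall>G \<alpha>. presheaf G \<and> (\<forall>x\<in>S. \<forall>p\<in>obj_map P x. \<alpha> x p \<in> obj_map G x) \<and>
        (\<forall>f\<in>Arr C. Dom C f \<in> S \<longrightarrow> Cod C f \<in> S \<longrightarrow> (\<forall>p\<in>obj_map P (Cod C f).
           \<alpha> (Dom C f) (act P f p) = act G f (\<alpha> (Cod C f) p))) \<longrightarrow>
        (\<exists>\<phi>. natpp P G \<phi> \<and> (\<forall>x\<in>S. \<forall>p\<in>obj_map P x. \<phi> x p = \<alpha> x p))) \<and>
     (\<forall>G \<phi> \<psi>. presheaf G \<and> natpp P G \<phi> \<and> natpp P G \<psi> \<and>
        (\<forall>x\<in>S. \<forall>p\<in>obj_map P x. \<phi> x p = \<psi> x p) \<longrightarrow> (\<forall>x\<in>Obj C. \<forall>p\<in>obj_map P x. \<phi> x p = \<psi> x p))"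

text \<open>The unit is an identity, so the Kan triangle says that a transformation extends the
  given one from S. Unique existence then splits into the two clauses of \<open>kan_on\<close>; maps
  given on elements are made extensional by \<open>set_trans\<close>.\<close>

lemma kan_on_iff:
  assumes P: "presheaf P" and S: "S \<subseteq> Obj C"
  defines "K \<equiv> op_cat (full_subcat C S)"
  shows "is_left_Kan_extension K (op_cat C) (set_cat U) (id_ftor K) (comp_ftor K P (id_ftor K)) P
       (\<lambda>x\<in>S. Ident (set_cat U) (obj_map P x)) \<longleftrightarrow> kan_on S P" (is "?L \<longleftrightarrow> ?R")
proof -
  have catK: "category K" unfolding K_def by (intro category_op category_full_subcat category_axiom)
  have oK: "Obj K = S" using S by (auto simp: K_def)
  have aK: "f \<in> Arr K \<longleftrightarrow> f \<in> Arr C \<and> Dom C f \<in> S \<and> Cod C f \<in> S" for f by (simp add: K_def)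
  have dK: "Dom K = Cod C" "Cod K = Dom C" by (simp_all add: K_def)
  have inc: "is_functor K (op_cat C) (id_ftor K)"
    by (rule is_functorI) (use S in \<open>auto simp: catK category_op category_axiom id_ftor_def Hom_iff,
        auto simp: K_def category.comp_arr\<close>)
  have rf: "is_functor K (set_cat U) (comp_ftor K G (id_ftor K))" if "presheaf G" for G
    by (rule functor_compose[OF inc that])
  have ro: "obj_map (comp_ftor K G (id_ftor K)) x = obj_map G x" if "x \<in> S" for G :: "('o, 'a, 'u) presheaf" and x
    using that by (simp add: comp_ftor_def id_ftor_def oK)
  have ra: "set_app (arr_map (comp_ftor K G (id_ftor K))) f = act G f" if "f \<in> Arr K"
    for G :: "('o, 'a, 'u) presheaf" and f
    using that by (auto simp: comp_ftor_def id_ftor_def set_app_def act_def)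
  have fam: "nat_trans K (set_cat U) (comp_ftor K P (id_ftor K)) (comp_ftor K G (id_ftor K))
      (set_trans S (obj_map (comp_ftor K P (id_ftor K))) (obj_map (comp_ftor K G (id_ftor K))) \<alpha>)"
    if G: "presheaf G" and "\<forall>x\<in>S. \<forall>p\<in>obj_map P x. \<alpha> x p \<in> obj_map G x"
      "\<forall>f\<in>Arr C. Dom C f \<in> S \<longrightarrow> Cod C f \<in> S \<longrightarrow> (\<forall>p\<in>obj_map P (Cod C f).
           \<alpha> (Dom C f) (act P f p) = act G f (\<alpha> (Cod C f) p))" for G \<alpha>
    using set_nat_transI[OF rf[OF P] rf[OF G], of \<alpha>] that(2,3)
    by (simp add: oK aK ro ra dK)
  have idt: "nat_trans K (set_cat U) (comp_ftor K P (id_ftor K)) (comp_ftor K P (id_ftor K))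
      (\<lambda>x\<in>S. Ident (set_cat U) (obj_map P x))"
  proof -
    have "(\<lambda>x\<in>S. Ident (set_cat U) (obj_map P x)) =
      set_trans S (obj_map (comp_ftor K P (id_ftor K))) (obj_map (comp_ftor K P (id_ftor K))) (\<lambda>x p. p)"
      by (auto simp: set_trans_def set_cat_simps ro)
    then show ?thesis using fam[OF P, of "\<lambda>x p. p"] by simp
  qed
  have cid: "\<beta> x \<cdot>\<^bsub>set_cat U\<^esub> Ident (set_cat U) (obj_map P x) = \<beta> x"
    if "nat_trans (op_cat C) (set_cat U) P G \<beta>" "x \<in> S" for G \<beta> x
  proof -
    have "x \<in> Obj C" using that S by auto
    then show ?thesis using nat_trans_hom[OF that(1), of x]
      by (intro category.comp_ident[OF category_set_cat]) auto
  qed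
  have eqn: "(\<forall>x\<in>Obj K. \<beta> (obj_map (id_ftor K) x) \<cdot>\<^bsub>set_cat U\<^esub> (\<lambda>x\<in>S. Ident (set_cat U) (obj_map P x)) x = \<alpha> x)
     \<longleftrightarrow> (\<forall>x\<in>S. \<beta> x = \<alpha> x)" if \<beta>: "nat_trans (op_cat C) (set_cat U) P G \<beta>" for G \<beta> \<alpha>
    using cid[OF \<beta>] by (simp add: oK id_ftor_def)
  have L: "?L \<longleftrightarrow> (\<forall>G \<alpha>. presheaf G \<and>
      nat_trans K (set_cat U) (comp_ftor K P (id_ftor K)) (comp_ftor K G (id_ftor K)) \<alpha> \<longrightarrow>
      (\<exists>!\<beta>. nat_trans (op_cat C) (set_cat U) P G \<beta> \<and> (\<forall>x\<in>S. \<beta> x = \<alpha> x)))"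
    unfolding is_left_Kan_extension_def using inc P idt eqn by (simp cong: conj_cong)
  show ?thesis
  proof
    assume l: ?L
    show ?R unfolding kan_on_def
    proof (intro conjI allI impI; elim conjE)
      fix G \<alpha> assume G: "presheaf G"
        and a: "\<forall>x\<in>S. \<forall>p\<in>obj_map P x. \<alpha> x p \<in> obj_map G x"
          "\<forall>f\<in>Arr C. Dom C f \<in> S \<longrightarrow> Cod C f \<in> S \<longrightarrow> (\<forall>p\<in>obj_map P (Cod C f).
           \<alpha> (Dom C f) (act P f p) = act G f (\<alpha> (Cod C f) p))"
      let ?\<alpha> = "set_trans S (obj_map (comp_ftor K P (id_ftor K))) (obj_map (comp_ftor K G (id_ftor K))) \<alpha>"
      obtain \<beta> where \<beta>: "nat_trans (op_cat C) (set_cat U) P G \<beta>" "\<forall>x\<in>S. \<beta> x = ?\<alpha> x"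
        using l G fam[OF G a] unfolding L by blast
      have "set_app \<beta> x p = \<alpha> x p" if "x \<in> S" "p \<in> obj_map P x" for x p
      proof -
        have "set_app \<beta> x p = set_app ?\<alpha> x p" using \<beta>(2) that(1) by (simp add: set_app_def)
        also have "\<dots> = \<alpha> x p" using that ro by simp
        finally show ?thesis .
      qed
      then show "\<exists>\<phi>. natpp P G \<phi> \<and> (\<forall>x\<in>S. \<forall>p\<in>obj_map P x. \<phi> x p = \<alpha> x p)"
        using trans_natpp[OF \<beta>(1)] by blast
    next
      fix G \<phi> \<psi> assume G: "presheaf G" and f: "natpp P G \<phi>" "natpp P G \<psi>"
        and eq: "\<forall>x\<in>S. \<forall>p\<in>obj_map P x. \<phi> x p = \<psi> x p"
      let ?f = "set_trans (Obj C) (obj_map P) (obj_map G) \<phi>"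
        and ?g = "set_trans (Obj C) (obj_map P) (obj_map G) \<psi>"
        and ?a = "set_trans S (obj_map (comp_ftor K P (id_ftor K))) (obj_map (comp_ftor K G (id_ftor K))) \<phi>"
      have a: "nat_trans K (set_cat U) (comp_ftor K P (id_ftor K)) (comp_ftor K G (id_ftor K)) ?a"
        by (rule fam[OF G]) (use natp_in[OF f(1)] natp_nat[OF f(1)] S in auto)
      \<comment> \<open>Both coded transformations extend the restriction of \<open>\<phi>\<close>
        to S, so unique extension identifies them.\<close>
      have "?f x = ?a x" "?g x = ?a x" if "x \<in> S" for x
        using that S eq by (auto simp: set_trans_def ro restrict_def fun_eq_iff)
      moreover have "\<exists>!\<beta>. nat_trans (op_cat C) (set_cat U) P G \<beta> \<and> (\<forall>x\<in>S. \<beta> x = ?a x)"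
        using l a G unfolding L by blast
      ultimately have "?f = ?g" using natpp_trans[OF P G f(1)] natpp_trans[OF P G f(2)] by blast
      then show "\<forall>x\<in>Obj C. \<forall>p\<in>obj_map P x. \<phi> x p = \<psi> x p" by (metis set_app_trans)
    qed
  next
    assume r: ?R
    show ?L unfolding L
    proof (intro allI impI; elim conjE)
      fix G \<alpha> assume G: "presheaf G"
        and a: "nat_trans K (set_cat U) (comp_ftor K P (id_ftor K)) (comp_ftor K G (id_ftor K)) \<alpha>"
      have a_in: "\<forall>x\<in>S. \<forall>p\<in>obj_map P x. set_app \<alpha> x p \<in> obj_map G x"
        using set_nat_trans_app(2)[OF a] by (force simp: oK ro)
      moreover have "\<forall>f\<in>Arr C. Dom C f \<in> S \<longrightarrow> Cod C f \<in> S \<longrightarrow> (\<forall>p\<in>obj_map P (Cod C f).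
           set_app \<alpha> (Dom C f) (act P f p) = act G f (set_app \<alpha> (Cod C f) p))"
        using set_nat_trans_natural[OF a] by (simp add: dK aK ro ra)
      ultimately obtain \<phi> where f: "natpp P G \<phi>"
          "\<And>x p. x \<in> S \<Longrightarrow> p \<in> obj_map P x \<Longrightarrow> \<phi> x p = set_app \<alpha> x p"
        using r G unfolding kan_on_def by blast
      let ?f = "set_trans (Obj C) (obj_map P) (obj_map G) \<phi>"
      have f_nat: "nat_trans (op_cat C) (set_cat U) P G ?f" by (rule natpp_trans[OF P G f(1)])
      show "\<exists>!\<beta>. nat_trans (op_cat C) (set_cat U) P G \<beta> \<and> (\<forall>x\<in>S. \<beta> x = \<alpha> x)"
      proof (rule ex1I)
        have "?f x = \<alpha> x" if x: "x \<in> S" for x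
        proof -
          have "\<alpha> x = (obj_map P x, obj_map G x, set_app \<alpha> x)" "set_app \<alpha> x \<in> obj_map P x \<rightarrow>\<^sub>E obj_map G x"
            using set_nat_trans_app[OF a, of x] x by (simp_all add: oK ro)
          moreover have "x \<in> Obj C" using x S by auto
          moreover have "restrict (\<phi> x) (obj_map P x) = restrict (set_app \<alpha> x) (obj_map P x)"
            using f(2)[OF x] by (auto simp: restrict_def fun_eq_iff)
          ultimately show ?thesis by (simp add: set_trans_def PiE_restrict)
        qed
        then show "nat_trans (op_cat C) (set_cat U) P G ?f \<and> (\<forall>x\<in>S. ?f x = \<alpha> x)" using f_nat by blast
        fix \<beta> assume b: "nat_trans (op_cat C) (set_cat U) P G \<beta> \<and> (\<forall>x\<in>S. \<beta> x = \<alpha> x)"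
        then have "\<forall>x\<in>S. \<forall>p\<in>obj_map P x. set_app \<beta> x p = \<phi> x p" using f(2) by (simp add: set_app_def)
        then have "\<forall>x\<in>Obj C. \<forall>p\<in>obj_map P x. set_app \<beta> x p = \<phi> x p"
          using r G f(1) trans_natpp b unfolding kan_on_def by blast
        then show "\<beta> = ?f" using b f_nat by (intro set_nat_trans_eqI[of _ U P G]) auto
      qed
    qed
  qed
qed

lemma small_presheaf_iff:
  "small_presheaf U C P \<longleftrightarrow> presheaf P \<and> (\<exists>S\<subseteq>Obj C. small U S \<and> kan_on S P)"
  unfolding small_presheaf_def Let_def using kan_on_iff by blast

text \<open>A family on S extends through the presentation once it respects the relations. As it is
  natural only between objects of S, the sources of the relations have to belong to S together with
  the objects of the generators.\<close>

lemma presents_small: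
  assumes P: "presheaf P" and pr: "presents (obj_map P) (act P) I s Rel e"
    and sm: "small U I" "small U Rel"
  shows "small_presheaf U C P"
proof -
  define S where "S = s ` I \<union> (\<lambda>(i, u, v, j). Dom C u) ` Rel"
  note D = presentsD(1)[OF pr] and e = presentsD(3)[OF pr]
  have S: "S \<subseteq> Obj C" using presentsD(4)[OF pr] pres_dataD[OF D] by (auto simp: S_def)
  have "small U S" unfolding S_def by (intro small_Un small_image sm inacc)
  moreover have "kan_on S P" unfolding kan_on_def
  proof (intro conjI allI impI; elim conjE)
    fix G \<alpha> assume G: "presheaf G"
      and a_in: "\<forall>x\<in>S. \<forall>p\<in>obj_map P x. \<alpha> x p \<in> obj_map G x"
      and a_nat: "\<forall>f\<in>Arr C. Dom C f \<in> S \<longrightarrow> Cod C f \<in> S \<longrightarrow> (\<forall>p\<in>obj_map P (Cod C f).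
           \<alpha> (Dom C f) (act P f p) = act G f (\<alpha> (Cod C f) p))"
    have sS: "i \<in> I \<Longrightarrow> s i \<in> S" for i by (simp add: S_def)
    have nat: "\<alpha> (Dom C k) (act P k (e i)) = act G k (\<alpha> (s i) (e i))"
      if "i \<in> I" "k \<in> Arr C" "Dom C k \<in> S" "Cod C k = s i" for i k
      using a_nat that sS e by auto
    have rel: "act G u (\<alpha> (s i) (e i)) = act G v (\<alpha> (s j) (e j))" if r: "(i, u, v, j) \<in> Rel" for i u v j
    proof -
      have "Dom C u \<in> S" unfolding S_def using r by force
      then show ?thesis
        using nat[of i u] nat[of j v] pres_dataD[OF D r] presents_rel[OF pr r] by simp
    qed
    have ge: "\<alpha> (s i) (e i) \<in> obj_map G (s i)" if "i \<in> I" for i using a_in that sS e by blast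
    obtain \<phi> where f: "natpp P G \<phi>" "\<And>i. i \<in> I \<Longrightarrow> \<phi> (s i) (e i) = \<alpha> (s i) (e i)"
      "\<And>i k. i \<in> I \<Longrightarrow> k \<in> Arr C \<Longrightarrow> Cod C k = s i \<Longrightarrow>
         \<phi> (Dom C k) (act P k (e i)) = act G k (\<alpha> (s i) (e i))"
      using presents_natp[OF pr presheaf_psh[OF G] ge rel] by blast
    have "\<phi> x p = \<alpha> x p" if x: "x \<in> S" "p \<in> obj_map P x" for x p
    proof -
      have "x \<in> Obj C" using x S by auto
      then obtain i k where "i \<in> I" "k \<in> Arr C" "Dom C k = x" "Cod C k = s i" "p = act P k (e i)"
        using x(2) by (rule presents_gen[OF pr])
      then show ?thesis using f(3)[of i k] nat[of i k] x by simp
    qed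
    then show "\<exists>\<phi>. natpp P G \<phi> \<and> (\<forall>x\<in>S. \<forall>p\<in>obj_map P x. \<phi> x p = \<alpha> x p)" using f(1) by blast
  next
    fix G \<phi> \<psi> assume "presheaf G" and f: "natpp P G \<phi>" "natpp P G \<psi>"
      and eq: "\<forall>x\<in>S. \<forall>p\<in>obj_map P x. \<phi> x p = \<psi> x p"
    show "\<forall>x\<in>Obj C. \<forall>p\<in>obj_map P x. \<phi> x p = \<psi> x p"
    proof (intro ballI)
      fix x p assume "x \<in> Obj C" "p \<in> obj_map P x"
      moreover have "\<phi> (s i) (e i) = \<psi> (s i) (e i)" if "i \<in> I" for i
        using eq e[OF that] that by (simp add: S_def)
      ultimately show "\<phi> x p = \<psi> x p" using presents_unique[OF pr f] by blast
    qed
  qed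
  ultimately show ?thesis using P S unfolding small_presheaf_iff by blast
qed

lemma small_Hom: "x \<in> Obj C \<Longrightarrow> y \<in> Obj C \<Longrightarrow> small U (Hom C x y)"
  using loc_small by (simp add: locally_small_def)

lemma presented_presheaf_exists:
  fixes I :: "'i set"
  assumes D: "pres_data I s Rel" and I: "small U I"
  obtains P e where "presheaf P" "presents (obj_map P) (act P) I s Rel e"
proof -
  obtain F :: "'o \<Rightarrow> ('i \<times> 'a) set set" and a e where F: "presents F a I s Rel e"
    and sub: "\<And>x. x \<in> Obj C \<Longrightarrow> F x \<subseteq> (\<lambda>(i, k). {(j, k'). zigzag I s Rel i k j k'}) ` (SIGMA i:I. Hom C x (s i))"
    using presented_exists[OF D] by blast
  have sm: "small U (F x)" if x: "x \<in> Obj C" for x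
    by (rule small_subset[OF small_image[OF small_Sigma[OF inacc I]] sub[OF x]])
      (rule small_Hom[OF x pres_data_obj[OF D]])
  then have "\<forall>x\<in>Obj C. \<exists>\<epsilon> :: _ \<Rightarrow> 'u. inj_on \<epsilon> (F x)" using small_inj_ex by blast
  then obtain \<epsilon> :: "'o \<Rightarrow> ('i \<times> 'a) set \<Rightarrow> 'u" where inj: "\<And>x. x \<in> Obj C \<Longrightarrow> inj_on (\<epsilon> x) (F x)" by metis
  obtain b where b: "presents (\<lambda>x. \<epsilon> x ` F x) b I s Rel (\<lambda>i. \<epsilon> (s i) (e i))"
    using presents_transport[OF F inj] by blast
  have "presheaf (mk_psh (\<lambda>x. \<epsilon> x ` F x) b)"
    by (rule mk_psh_presheaf[OF presentsD(2)[OF b]]) (intro small_image sm)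
  with presents_mk_psh[OF b] that show thesis by blast
qed

text \<open>The generators are all elements over the objects of \<open>S\<close>, and the relations record the
  action of the arrows between these objects.\<close>

lemma small_presents:
  assumes "small_presheaf U C P"
  obtains I :: "('o \<times> 'u) set" and s Rel e where
    "presents (obj_map P) (act P) I s Rel e" "small U I" "small U Rel"
proof -
  obtain S where P: "presheaf P" and S: "S \<subseteq> Obj C" "small U S" and kan: "kan_on S P"
    using assms unfolding small_presheaf_iff by blast
  have kan_ex: "\<exists>\<phi>. natpp P G \<phi> \<and> (\<forall>x\<in>S. \<forall>p\<in>obj_map P x. \<phi> x p = \<alpha> x p)"
    if "presheaf G" "\<And>x p. x \<in> S \<Longrightarrow> p \<in> obj_map P x \<Longrightarrow> \<alpha> x p \<in> obj_map G x"
      "\<And>f p. f \<in> Arr C \<Longrightarrow> Dom C f \<in> S \<Longrightarrow> Cod C f \<in> S \<Longrightarrow> p \<in> obj_map P (Cod C f) \<Longrightarrow>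
         \<alpha> (Dom C f) (act P f p) = act G f (\<alpha> (Cod C f) p)" for G \<alpha>
    using kan that unfolding kan_on_def by blast
  note F = presheaf_psh[OF P]
  define I where "I = (SIGMA x:S. obj_map P x)"
  define R where "R = (SIGMA f:{f \<in> Arr C. Dom C f \<in> S \<and> Cod C f \<in> S}. obj_map P (Cod C f))"
  \<comment> \<open>The relation for f identifies the generator \<open>act P f p\<close>, restricted
    along an identity, with the generator p restricted along f.\<close>
  define r where "r = (\<lambda>(f, p). ((Dom C f, act P f p), Ident C (Dom C f), f, (Cod C f, p)))"
  let ?Rel = "r ` R"
  have sI: "small U I" unfolding I_def using S presheaf_small[OF P] by (intro small_Sigma inacc) auto
  have sA: "small U {f \<in> Arr C. Dom C f \<in> S \<and> Cod C f \<in> S}"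
  proof (rule small_subset)
    show "small U (\<Union>x\<in>S. \<Union>y\<in>S. Hom C x y)" using S small_Hom by (intro small_UN inacc) auto
  qed (auto simp: Hom_iff)
  have sR: "small U ?Rel" unfolding R_def
    by (intro small_image small_Sigma inacc sA) (auto intro: presheaf_small[OF P])
  have D: "pres_data I fst ?Rel"
    using S psh_act[OF F] by (auto simp: pres_data_def I_def R_def r_def)
  \<comment> \<open>Generation follows from the Kan property: the identity on S extends to a map
    from P into the subpresheaf \<open>F'\<close> of generated elements, and by uniqueness its
    composite with the inclusion is the identity of P.\<close>
  have gen: "p \<in> {p \<in> obj_map P x. \<exists>i\<in>I. \<exists>k\<in>Hom C x (fst i). p = act P k (snd i)}"
    if x: "x \<in> Obj C" and p: "p \<in> obj_map P x" for x p
  proof -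
    define F' where "F' x = {p \<in> obj_map P x. \<exists>i\<in>I. \<exists>k\<in>Hom C x (fst i). p = act P k (snd i)}" for x
    have F': "psh F' (act P)" unfolding psh_def
    proof (intro conjI ballI impI)
      fix f q assume f: "f \<in> Arr C" and q: "q \<in> F' (Cod C f)"
      then obtain i k where ik: "i \<in> I" "k \<in> Hom C (Cod C f) (fst i)" "q = act P k (snd i)"
        by (auto simp: F'_def)
      have "act P f q = act P (k \<cdot> f) (snd i)"
        unfolding ik(3) by (rule psh_comp[OF F, symmetric]) (use ik f in \<open>auto simp: Hom_iff I_def\<close>)
      moreover have "k \<cdot> f \<in> Hom C (Dom C f) (fst i)" using ik f by (auto simp: Hom_iff)
      ultimately show "act P f q \<in> F' (Dom C f)"
        using ik(1) q f psh_act[OF F] unfolding F'_def by blast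
    qed (use psh_ident[OF F] psh_comp[OF F] in \<open>auto simp: F'_def\<close>)
    have G: "presheaf (mk_psh F' (act P))"
      by (rule mk_psh_presheaf[OF F']) (rule small_subset[OF presheaf_small[OF P]], auto simp: F'_def)
    have F'S: "p \<in> F' x" if "x \<in> S" "p \<in> obj_map P x" for x p
    proof -
      have "(x, p) \<in> I" "Ident C x \<in> Hom C x (fst (x, p))" "p = act P (Ident C x) (snd (x, p))"
        using that S psh_ident[OF F, of x p] by (auto simp: I_def Hom_iff)
      then show ?thesis using that(2) unfolding F'_def by blast
    qed
    obtain \<phi> where f: "natpp P (mk_psh F' (act P)) \<phi>" "\<And>x p. x \<in> S \<Longrightarrow> p \<in> obj_map P x \<Longrightarrow> \<phi> x p = p"
      using kan_ex[OF G, of "\<lambda>x p. p"] S F'S by (auto simp: subset_iff)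
    have f': "natp (obj_map P) (act P) F' (act P) \<phi>" using f(1) natp_mk_psh(2)[OF F'] by blast
    have "natpp P P \<phi>" using f' by (auto simp: natp_def F'_def)
    moreover have "natpp P P (\<lambda>x p. p)" by (simp add: natp_def)
    ultimately have "\<forall>x\<in>Obj C. \<forall>p\<in>obj_map P x. \<phi> x p = p"
      using kan P f(2) unfolding kan_on_def by blast
    then have "p \<in> F' x" using natp_in[OF f' x p] x p by simp
    then show ?thesis by (simp add: F'_def)
  qed
  \<comment> \<open>Completeness of the relations: P maps to the presheaf Q that has exactly these
    relations, so an equality in P yields one in Q, and that is a zigzag.\<close>
  obtain Q q where Q: "presheaf Q" "presents (obj_map Q) (act Q) I fst ?Rel q"
    using presented_presheaf_exists[OF D sI] by blast
  note Qp = presheaf_psh[OF Q(1)]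
  have "act Q f (q (Cod C f, p)) = q (Dom C f, act P f p)"
    if "f \<in> Arr C" "Dom C f \<in> S" "Cod C f \<in> S" "p \<in> obj_map P (Cod C f)" for f p
  proof -
    have "(f, p) \<in> R" using that by (simp add: R_def)
    then have "((Dom C f, act P f p), Ident C (Dom C f), f, (Cod C f, p)) \<in> ?Rel"
      by (force simp: r_def)
    from presents_rel[OF Q(2) this]
    have "act Q (Ident C (Dom C f)) (q (Dom C f, act P f p)) = act Q f (q (Cod C f, p))" .
    moreover have "(Dom C f, act P f p) \<in> I" using that psh_act[OF F] by (simp add: I_def)
    ultimately show ?thesis using psh_ident[OF Qp] presentsD(3)[OF Q(2)] that by fastforce
  qed
  moreover have "q (x, p) \<in> obj_map Q x" if "x \<in> S" "p \<in> obj_map P x" for x p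
    using presentsD(3)[OF Q(2), of "(x, p)"] that by (simp add: I_def)
  ultimately obtain \<phi> where f: "natpp P Q \<phi>" "\<And>x p. x \<in> S \<Longrightarrow> p \<in> obj_map P x \<Longrightarrow> \<phi> x p = q (x, p)"
    using kan_ex[OF Q(1), of "\<lambda>x p. q (x, p)"] by auto
  have val: "\<phi> (Dom C k) (act P k (snd i)) = act Q k (q i)"
    if "i \<in> I" "k \<in> Arr C" "Cod C k = fst i" for i k
    using natp_nat[OF f(1), of k "snd i"] f(2)[of "fst i" "snd i"] that by (auto simp: I_def)
  have "presents (obj_map P) (act P) I fst ?Rel snd" unfolding presents_def
  proof (intro conjI ballI allI)
    fix i j x k k' assume ij: "i \<in> I" "j \<in> I" and k: "k \<in> Hom C x (fst i)" "k' \<in> Hom C x (fst j)"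
    show "act P k (snd i) = act P k' (snd j) \<longleftrightarrow> zigzag I fst ?Rel i k j k'"
    proof
      assume "act P k (snd i) = act P k' (snd j)"
      then have "act Q k (q i) = act Q k' (q j)"
        using val[OF ij(1), of k] val[OF ij(2), of k'] k by (simp add: Hom_iff)
      then show "zigzag I fst ?Rel i k j k'" using presents_eq[OF Q(2) ij k] by blast
    next
      assume "zigzag I fst ?Rel i k j k'"
      then show "act P k (snd i) = act P k' (snd j)"
        by (rule zigzag_respects[OF _ D F])
          (use psh_ident[OF F] psh_act[OF F] in \<open>auto simp: I_def R_def r_def\<close>)
    qed
  qed (use D F gen in \<open>auto simp: I_def\<close>)
  then show thesis using that sI sR by blast
qed

end


section \<open>The Yoneda embedding and its left adjoint\<close>

context universe_category
begin

abbreviation PC :: "(('o, 'a, 'u) presheaf, ('o, 'a, 'u) presheaf_map) cat" where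
  "PC \<equiv> presheaf_cat U C"

definition app :: "('o, 'a, 'u) presheaf_map \<Rightarrow> 'o \<Rightarrow> 'u \<Rightarrow> 'u" where
  "app \<tau> = set_app (snd (snd \<tau>))"

definition mk_map :: "('o, 'a, 'u) presheaf \<Rightarrow> ('o, 'a, 'u) presheaf \<Rightarrow> ('o \<Rightarrow> 'u \<Rightarrow> 'u) \<Rightarrow>
    ('o, 'a, 'u) presheaf_map" where
  "mk_map P Q \<phi> = (P, Q, set_trans (Obj C) (obj_map P) (obj_map Q) \<phi>)"

lemma PC_category: "category PC"
  unfolding presheaf_cat_def
  by (intro category_full_subcat functor_cat_category category_op category_set_cat category_axiom)

lemma PC_presheaf: "P \<in> Obj PC \<Longrightarrow> presheaf P"
  by (simp add: presheaf_cat_def functor_cat_def)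

lemma PC_obj: "P \<in> Obj PC \<longleftrightarrow> small_presheaf U C P"
  by (auto simp: presheaf_cat_def functor_cat_def small_presheaf_def)

lemma PC_psh: "P \<in> Obj PC \<Longrightarrow> psh (obj_map P) (act P)"
  by (intro presheaf_psh PC_presheaf)

lemma PC_Hom: "\<tau> \<in> Hom PC P Q \<longleftrightarrow> P \<in> Obj PC \<and> Q \<in> Obj PC \<and>
    (\<exists>t. \<tau> = (P, Q, t) \<and> nat_trans (op_cat C) (set_cat U) P Q t)"
  by (auto simp: Hom_def presheaf_cat_def functor_cat_def small_presheaf_def)

lemma PC_Ident: "Ident PC P = (P, P, \<lambda>x\<in>Obj C. Ident (set_cat U) (obj_map P x))"
  by (simp add: presheaf_cat_def functor_cat_def)

lemma PC_Comp: "(Q', R, s) \<cdot>\<^bsub>PC\<^esub> (P, Q, t) = (P, R, \<lambda>x\<in>Obj C. s x \<cdot>\<^bsub>set_cat U\<^esub> t x)"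
  by (simp add: presheaf_cat_def functor_cat_def)

lemma mk_map_Hom: "P \<in> Obj PC \<Longrightarrow> Q \<in> Obj PC \<Longrightarrow> natpp P Q \<phi> \<Longrightarrow> mk_map P Q \<phi> \<in> Hom PC P Q"
  unfolding PC_Hom mk_map_def using natpp_trans PC_presheaf by blast

lemma app_mk_map: "x \<in> Obj C \<Longrightarrow> p \<in> obj_map P x \<Longrightarrow> app (mk_map P Q \<phi>) x p = \<phi> x p"
  by (simp add: app_def mk_map_def)

lemma app_natpp: "\<tau> \<in> Hom PC P Q \<Longrightarrow> natpp P Q (app \<tau>)"
  unfolding PC_Hom app_def using trans_natpp by auto

lemma app_in: "\<tau> \<in> Hom PC P Q \<Longrightarrow> x \<in> Obj C \<Longrightarrow> p \<in> obj_map P x \<Longrightarrow> app \<tau> x p \<in> obj_map Q x"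
  by (rule natp_in[OF app_natpp])

lemma PC_eqI:
  assumes "\<tau> \<in> Hom PC P Q" "\<tau>' \<in> Hom PC P Q"
    and "\<And>x p. x \<in> Obj C \<Longrightarrow> p \<in> obj_map P x \<Longrightarrow> app \<tau> x p = app \<tau>' x p"
  shows "\<tau> = \<tau>'"
  using assms set_nat_trans_eqI[of "op_cat C" U P Q] unfolding PC_Hom app_def by fastforce

lemma app_comp:
  assumes "\<tau> \<in> Hom PC P Q" "\<sigma> \<in> Hom PC Q R" "x \<in> Obj C" "p \<in> obj_map P x"
  shows "app (\<sigma> \<cdot>\<^bsub>PC\<^esub> \<tau>) x p = app \<sigma> x (app \<tau> x p)"
proof -
  obtain t s where t: "\<tau> = (P, Q, t)" "nat_trans (op_cat C) (set_cat U) P Q t"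
    and s: "\<sigma> = (Q, R, s)" "nat_trans (op_cat C) (set_cat U) Q R s"
    using assms(1,2) unfolding PC_Hom by blast
  have "s x \<cdot>\<^bsub>set_cat U\<^esub> t x = (obj_map P x, obj_map R x, compose (obj_map P x) (set_app s x) (set_app t x))"
    using set_nat_trans_app(1)[OF t(2), of x] set_nat_trans_app(1)[OF s(2), of x] assms(3)
    by (simp add: set_cat_simps)
  then have "set_app (\<lambda>x\<in>Obj C. s x \<cdot>\<^bsub>set_cat U\<^esub> t x) x p =
      compose (obj_map P x) (set_app s x) (set_app t x) p"
    using assms(3) by (simp add: set_app_def)
  then show ?thesis unfolding t(1) s(1) PC_Comp app_def using assms(4) by (simp add: compose_def)
qed

lemma app_Ident: "x \<in> Obj C \<Longrightarrow> p \<in> obj_map P x \<Longrightarrow> app (Ident PC P) x p = p"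
  by (simp add: PC_Ident app_def set_app_def set_cat_simps)

abbreviation enc :: "'o \<Rightarrow> 'o \<Rightarrow> 'a \<Rightarrow> 'u" where "enc \<equiv> hom_encode U C"
abbreviation dec :: "'o \<Rightarrow> 'o \<Rightarrow> 'u \<Rightarrow> 'a" where "dec \<equiv> hom_decode U C"
abbreviation rep :: "'o \<Rightarrow> ('o, 'a, 'u) presheaf" where "rep \<equiv> representable U C"
abbreviation Y where "Y \<equiv> Yoneda U C"

lemma enc_inj: "x \<in> Obj C \<Longrightarrow> c \<in> Obj C \<Longrightarrow> inj_on (enc x c) (Hom C x c)"
  unfolding hom_encode_def by (rule someI_ex[OF small_inj_ex[OF small_Hom]])

lemma dec_enc: "h \<in> Hom C x c \<Longrightarrow> dec x c (enc x c h) = h"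
  unfolding hom_decode_def by (rule inv_into_f_f[OF enc_inj]) (auto simp: Hom_iff)

lemma enc_in: "h \<in> Hom C x c \<Longrightarrow> enc x c h \<in> Hom_set U C x c"
  by (simp add: Hom_set_def)

lemma dec_in: "s \<in> Hom_set U C x c \<Longrightarrow> dec x c s \<in> Hom C x c"
  using dec_enc by (auto simp: Hom_set_def)

lemma enc_dec: "s \<in> Hom_set U C x c \<Longrightarrow> enc x c (dec x c s) = s"
  using dec_enc by (auto simp: Hom_set_def)

lemma rep_obj: "x \<in> Obj C \<Longrightarrow> obj_map (rep c) x = Hom_set U C x c"
  by (simp add: representable_def)

lemma rep_eq: "rep c = mk_psh (\<lambda>x. Hom_set U C x c)
    (\<lambda>f s. enc (Dom C f) c (dec (Cod C f) c s \<cdot> f))"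
  by (simp add: representable_def mk_psh_def)

lemma rep_presheaf:
  assumes c: "c \<in> Obj C"
  shows "presheaf (rep c)"
  unfolding rep_eq
proof (rule mk_psh_presheaf)
  show "small U (Hom_set U C x c)" if "x \<in> Obj C" for x
    unfolding Hom_set_def by (intro small_image small_Hom that c)
  have d: "s \<in> Hom_set U C x c \<Longrightarrow> dec x c s \<in> Arr C \<and> Dom C (dec x c s) = x \<and> Cod C (dec x c s) = c"
    for s x using dec_in[of s x c] by (simp add: Hom_iff)
  have h: "s \<in> Hom_set U C (Cod C f) c \<Longrightarrow> f \<in> Arr C \<Longrightarrow> dec (Cod C f) c s \<cdot> f \<in> Hom C (Dom C f) c"
    for s f using d[of s "Cod C f"] by (simp add: Hom_iff)
  show "psh (\<lambda>x. Hom_set U C x c) (\<lambda>f s. enc (Dom C f) c (dec (Cod C f) c s \<cdot> f))"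
    unfolding psh_def
  proof (intro conjI ballI impI)
    fix f g p assume "f \<in> Arr C" "g \<in> Arr C" "Cod C f = Dom C g" "p \<in> Hom_set U C (Cod C g) c"
    then show "enc (Dom C (g \<cdot> f)) c (dec (Cod C (g \<cdot> f)) c p \<cdot> g \<cdot> f) =
       enc (Dom C f) c (dec (Cod C f) c (enc (Dom C g) c (dec (Cod C g) c p \<cdot> g)) \<cdot> f)"
      using h[of p g] d[of p "Cod C g"] by (simp add: dec_enc comp_assoc)
  qed (use h d enc_in enc_dec in auto)
qed

lemma rep_act: "f \<in> Arr C \<Longrightarrow> h \<in> Hom C (Cod C f) c \<Longrightarrow>
    act (rep c) f (enc (Cod C f) c h) = enc (Dom C f) c (h \<cdot> f)"
  unfolding rep_eq using enc_in[of h "Cod C f" c] by (simp add: dec_enc)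

text \<open>With one generator and no relations, zigzags are trivial. This plays the part of the
  Yoneda lemma: by \<open>presents_unique\<close>, a map out of a representable is determined by the
  image of the identity.\<close>

lemma rep_presents:
  assumes c: "c \<in> Obj C"
  shows "presents (obj_map (rep c)) (act (rep c)) {()} (\<lambda>_. c) {} (\<lambda>_. enc c c (Ident C c))"
proof -
  have D: "pres_data {()} (\<lambda>_. c) {}" using c by (simp add: pres_data_def)
  have zz: "zigzag {()} (\<lambda>_. c) {} i k j k' \<longleftrightarrow> k = k'" if "k \<in> Hom C x c" for i k j k' x
  proof
    assume "zigzag {()} (\<lambda>_. c) {} i k j k'" then show "k = k'" by induction auto
  qed (use that zigzag.refl[of "()" "{()}" k "\<lambda>_. c" "{}"] in \<open>auto simp: Hom_iff\<close>)
  have ai: "act (rep c) k (enc c c (Ident C c)) = enc x c k" if "k \<in> Hom C x c" for x k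
    using rep_act[of k "Ident C c" c] that c by (auto simp: Hom_iff)
  have eq: "enc x c k = enc x c k' \<longleftrightarrow> k = k'" if "k \<in> Hom C x c" "k' \<in> Hom C x c" for x k k'
    using dec_enc that by metis
  show ?thesis unfolding presents_def
  proof (intro conjI ballI allI)
    fix x p assume x: "x \<in> Obj C" and p: "p \<in> obj_map (rep c) x"
    then have "dec x c p \<in> Hom C x c" "enc x c (dec x c p) = p"
      by (simp_all add: rep_obj dec_in enc_dec)
    then show "\<exists>i\<in>{()}. \<exists>k\<in>Hom C x c. p = act (rep c) k (enc c c (Ident C c))"
      using ai by force
  next
    fix i j x k k' assume "k \<in> Hom C x c" "k' \<in> Hom C x c"
    then show "act (rep c) k (enc c c (Ident C c)) = act (rep c) k' (enc c c (Ident C c)) \<longleftrightarrow>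
        zigzag {()} (\<lambda>_. c) {} i k j k'"
      using ai eq zz by simp
  qed (use D c presheaf_psh[OF rep_presheaf[OF c]] rep_obj enc_in ident in auto)
qed

lemma rep_PC: "c \<in> Obj C \<Longrightarrow> rep c \<in> Obj PC"
  unfolding PC_obj by (rule presents_small[OF rep_presheaf rep_presents]) (auto intro: small_finite inacc)

lemma cocone_on_rep: "cocone_on (obj_map (rep c)) (act (rep c)) c (\<lambda>x s. dec x c s)"
  unfolding natp_def hom_act_def
proof (intro conjI ballI)
  fix x p assume "x \<in> Obj C" "p \<in> obj_map (rep c) x"
  then show "dec x c p \<in> Hom C x c" by (simp add: rep_obj dec_in)
next
  fix f p assume f: "f \<in> Arr C" and "p \<in> obj_map (rep c) (Cod C f)"
  then have p: "dec (Cod C f) c p \<in> Hom C (Cod C f) c" "enc (Cod C f) c (dec (Cod C f) c p) = p"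
    by (simp_all add: rep_obj dec_in enc_dec)
  then have "dec (Cod C f) c p \<cdot> f \<in> Hom C (Dom C f) c" using f by (simp add: Hom_iff)
  then show "dec (Dom C f) c (act (rep c) f p) = dec (Cod C f) c p \<cdot> f"
    using rep_act[OF f p(1)] p(2) by (simp add: dec_enc)
qed

text \<open>Together with \<open>of_map\<close> it removes the coding of hom-sets from the
  arguments: cocones have arrows of C as values, maps into \<open>rep c\<close> have codes as
  values.\<close>

definition to_map :: "('o, 'a, 'u) presheaf \<Rightarrow> 'o \<Rightarrow> ('o \<Rightarrow> 'u \<Rightarrow> 'a) \<Rightarrow> ('o, 'a, 'u) presheaf_map" where
  "to_map P c \<phi> = mk_map P (rep c) (\<lambda>x p. enc x c (\<phi> x p))"

definition of_map :: "'o \<Rightarrow> ('o, 'a, 'u) presheaf_map \<Rightarrow> 'o \<Rightarrow> 'u \<Rightarrow> 'a" where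
  "of_map c \<tau> x p = dec x c (app \<tau> x p)"

lemma to_map_Hom:
  assumes P: "P \<in> Obj PC" and c: "c \<in> Obj C" and \<phi>: "cocone_on (obj_map P) (act P) c \<phi>"
  shows "to_map P c \<phi> \<in> Hom PC P (rep c)"
  unfolding to_map_def
proof (rule mk_map_Hom[OF P rep_PC[OF c]])
  show "natpp P (rep c) (\<lambda>x p. enc x c (\<phi> x p))" unfolding natp_def
  proof (intro conjI ballI)
    fix f p assume f: "f \<in> Arr C" "p \<in> obj_map P (Cod C f)"
    then show "enc (Dom C f) c (\<phi> (Dom C f) (act P f p)) = act (rep c) f (enc (Cod C f) c (\<phi> (Cod C f) p))"
      using cocone_on_nat[OF \<phi> f] rep_act[OF f(1), of "\<phi> (Cod C f) p" c] natp_in[OF \<phi>] by simp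
  qed (use natp_in[OF \<phi>] in \<open>simp add: rep_obj enc_in\<close>)
qed

lemma of_map_cocone: "\<tau> \<in> Hom PC P (rep c) \<Longrightarrow> P \<in> Obj PC \<Longrightarrow>
    cocone_on (obj_map P) (act P) c (of_map c \<tau>)"
  unfolding of_map_def[abs_def] by (rule natp_compose[OF PC_psh app_natpp cocone_on_rep])

lemma of_to_map: "cocone_on (obj_map P) (act P) c \<phi> \<Longrightarrow> x \<in> Obj C \<Longrightarrow> p \<in> obj_map P x \<Longrightarrow>
    of_map c (to_map P c \<phi>) x p = \<phi> x p"
  using natp_in by (fastforce simp: of_map_def to_map_def app_mk_map dec_enc)

lemma of_map_eqI:
  assumes \<tau>: "\<tau> \<in> Hom PC P (rep c)" "\<tau>' \<in> Hom PC P (rep c)"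
    and eq: "\<And>x p. x \<in> Obj C \<Longrightarrow> p \<in> obj_map P x \<Longrightarrow> of_map c \<tau> x p = of_map c \<tau>' x p"
  shows "\<tau> = \<tau>'"
proof (rule PC_eqI[OF \<tau>])
  fix x p assume x: "x \<in> Obj C" and p: "p \<in> obj_map P x"
  then show "app \<tau> x p = app \<tau>' x p"
    using eq[OF x p] app_in[OF \<tau>(1) x p] app_in[OF \<tau>(2) x p] enc_dec
    unfolding of_map_def rep_obj[OF x] by metis
qed

lemma Yoneda_obj: "c \<in> Obj C \<Longrightarrow> obj_map Y c = rep c"
  by (simp add: Yoneda_def)

lemma Yoneda_arr:
  assumes g: "g \<in> Arr C"
  shows "arr_map Y g \<in> Hom PC (rep (Dom C g)) (rep (Cod C g))"
    "x \<in> Obj C \<Longrightarrow> p \<in> obj_map (rep (Dom C g)) x \<Longrightarrow>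
      of_map (Cod C g) (arr_map Y g) x p = g \<cdot> dec x (Dom C g) p"
proof -
  let ?\<phi> = "\<lambda>x s. g \<cdot> dec x (Dom C g) s"
  have eq: "arr_map Y g = to_map (rep (Dom C g)) (Cod C g) ?\<phi>"
    using g by (auto simp: Yoneda_def to_map_def mk_map_def set_trans_def rep_obj restrict_def fun_eq_iff)
  have c: "cocone_on (obj_map (rep (Dom C g))) (act (rep (Dom C g))) (Cod C g) ?\<phi>"
    by (rule cocone_on_compose[OF cocone_on_rep]) (use g in \<open>simp add: Hom_iff\<close>)
  show "arr_map Y g \<in> Hom PC (rep (Dom C g)) (rep (Cod C g))"
    unfolding eq using g by (intro to_map_Hom rep_PC c) auto
  show "x \<in> Obj C \<Longrightarrow> p \<in> obj_map (rep (Dom C g)) x \<Longrightarrow>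
      of_map (Cod C g) (arr_map Y g) x p = g \<cdot> dec x (Dom C g) p"
    unfolding eq by (rule of_to_map[OF c])
qed

lemma of_map_comp:
  "\<tau> \<in> Hom PC P Q \<Longrightarrow> \<sigma> \<in> Hom PC Q (rep c) \<Longrightarrow> x \<in> Obj C \<Longrightarrow> p \<in> obj_map P x \<Longrightarrow>
    of_map c (\<sigma> \<cdot>\<^bsub>PC\<^esub> \<tau>) x p = of_map c \<sigma> x (app \<tau> x p)"
  by (simp add: of_map_def app_comp)

lemma of_map_Yoneda:
  assumes \<tau>: "\<tau> \<in> Hom PC P (rep (Dom C g))" and g: "g \<in> Arr C" and x: "x \<in> Obj C" "p \<in> obj_map P x"
  shows "of_map (Cod C g) (arr_map Y g \<cdot>\<^bsub>PC\<^esub> \<tau>) x p = g \<cdot> of_map (Dom C g) \<tau> x p"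
  using of_map_comp[OF \<tau> Yoneda_arr(1)[OF g] x] Yoneda_arr(2)[OF g x(1) app_in[OF \<tau> x]]
  by (simp add: of_map_def)

lemma Yoneda_functor: "is_functor C PC Y"
proof (rule is_functorI)
  interpret PC: category PC by (rule PC_category)
  fix f assume f: "f \<in> Arr C"
  then show "arr_map Y f \<in> Hom PC (obj_map Y (Dom C f)) (obj_map Y (Cod C f))"
    using Yoneda_arr(1) by (simp add: Yoneda_obj)
next
  interpret PC: category PC by (rule PC_category)
  fix c assume c: "c \<in> Obj C"
  have "arr_map Y (Ident C c) = Ident PC (rep c)"
  proof (rule of_map_eqI[where P = "rep c" and c = c])
    show "arr_map Y (Ident C c) \<in> Hom PC (rep c) (rep c)"
      using Yoneda_arr(1)[of "Ident C c"] c by simp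
    show "Ident PC (rep c) \<in> Hom PC (rep c) (rep c)" using PC.ident rep_PC[OF c] by blast
    fix x p assume x: "x \<in> Obj C" "p \<in> obj_map (rep c) x"
    then have "dec x c p \<in> Hom C x c" by (simp add: rep_obj dec_in)
    then show "of_map c (arr_map Y (Ident C c)) x p = of_map c (Ident PC (rep c)) x p"
      using Yoneda_arr(2)[of "Ident C c" x p] x c by (simp add: of_map_def app_Ident Hom_iff)
  qed
  then show "arr_map Y (Ident C c) = Ident PC (obj_map Y c)" using c by (simp add: Yoneda_obj)
next
  interpret PC: category PC by (rule PC_category)
  fix f g assume fg: "f \<in> Arr C" "g \<in> Arr C" "Cod C f = Dom C g"
  note Yf = Yoneda_arr(1)[OF fg(1)] and Yg = Yoneda_arr(1)[OF fg(2)]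
  show "arr_map Y (g \<cdot> f) = arr_map Y g \<cdot>\<^bsub>PC\<^esub> arr_map Y f"
  proof (rule of_map_eqI)
    show "arr_map Y (g \<cdot> f) \<in> Hom PC (rep (Dom C f)) (rep (Cod C g))"
      using Yoneda_arr(1)[of "g \<cdot> f"] fg by simp
    show "arr_map Y g \<cdot>\<^bsub>PC\<^esub> arr_map Y f \<in> Hom PC (rep (Dom C f)) (rep (Cod C g))"
      using PC.comp[OF Yf] Yg fg by simp
    fix x p assume x: "x \<in> Obj C" "p \<in> obj_map (rep (Dom C f)) x"
    then have "dec x (Dom C f) p \<in> Hom C x (Dom C f)" by (simp add: rep_obj dec_in)
    then show "of_map (Cod C g) (arr_map Y (g \<cdot> f)) x p =
        of_map (Cod C g) (arr_map Y g \<cdot>\<^bsub>PC\<^esub> arr_map Y f) x p"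
      using Yoneda_arr(2)[of "g \<cdot> f" x p] Yoneda_arr(2)[OF fg(1) x] of_map_Yoneda[of "arr_map Y f" _ g x p]
        Yf fg x by (simp add: comp_assoc Hom_iff)
  qed
qed (auto simp: category_axiom PC_category rep_PC Yoneda_def)

text \<open>The map from a representable that corresponds to the element p under the Yoneda
  lemma.\<close>

definition element_map :: "('o, 'a, 'u) presheaf \<Rightarrow> 'o \<Rightarrow> 'u \<Rightarrow> ('o, 'a, 'u) presheaf_map" where
  "element_map P x p = mk_map (rep x) P (\<lambda>w s. act P (dec w x s) p)"

lemma element_map_Hom:
  assumes P: "P \<in> Obj PC" and x: "x \<in> Obj C" and p: "p \<in> obj_map P x"
  shows "element_map P x p \<in> Hom PC (rep x) P"
  unfolding element_map_def
proof (rule mk_map_Hom[OF rep_PC[OF x] P])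
  note F = PC_psh[OF P]
  have d: "dec w x s \<in> Arr C \<and> Dom C (dec w x s) = w \<and> Cod C (dec w x s) = x"
    if "w \<in> Obj C" "s \<in> obj_map (rep x) w" for w s
    using that dec_in[of s w x] by (simp add: rep_obj Hom_iff)
  show "natpp (rep x) P (\<lambda>w s. act P (dec w x s) p)" unfolding natp_def
  proof (intro conjI ballI)
    fix w s assume "w \<in> Obj C" "s \<in> obj_map (rep x) w"
    then show "act P (dec w x s) p \<in> obj_map P w" using d[of w s] psh_act[OF F, of "dec w x s" p] p by simp
  next
    fix f s assume f: "f \<in> Arr C" "s \<in> obj_map (rep x) (Cod C f)"
    then show "act P (dec (Dom C f) x (act (rep x) f s)) p = act P f (act P (dec (Cod C f) x s) p)"
      using cocone_on_nat[OF cocone_on_rep[of x] f] d[of "Cod C f" s]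
        psh_comp[OF F, of f "dec (Cod C f) x s" p] p by simp
  qed
qed

lemma element_map_app: "h \<in> Hom C w x \<Longrightarrow> app (element_map P x p) w (enc w x h) = act P h p"
  using enc_in[of h w x] by (auto simp: element_map_def app_mk_map rep_obj dec_enc Hom_iff)

lemma element_map_app_ident:
  "P \<in> Obj PC \<Longrightarrow> x \<in> Obj C \<Longrightarrow> p \<in> obj_map P x \<Longrightarrow> app (element_map P x p) x (enc x x (Ident C x)) = p"
  using element_map_app[of "Ident C x" x x P p] psh_ident[OF PC_psh] by (simp add: ident)

lemma rep_map_eqI:
  assumes c: "c \<in> Obj C" and t: "\<tau> \<in> Hom PC (rep c) Q" "\<tau>' \<in> Hom PC (rep c) Q"
    and eq: "app \<tau> c (enc c c (Ident C c)) = app \<tau>' c (enc c c (Ident C c))"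
  shows "\<tau> = \<tau>'"
  by (rule PC_eqI[OF t]) (rule presents_unique[OF rep_presents[OF c] app_natpp[OF t(1)] app_natpp[OF t(2)] eq])

text \<open>Evaluation at \<open>x\<close> is represented by the small presheaf \<open>rep x\<close>.\<close>

lemma limit_pointwise:
  assumes L: "is_limit J PC D P \<pi>" and x: "x \<in> Obj C"
    and in_D: "\<And>j. j \<in> Obj J \<Longrightarrow> p j \<in> obj_map (obj_map D j) x"
    and compat: "\<And>u. u \<in> Arr J \<Longrightarrow> app (arr_map D u) x (p (Dom J u)) = p (Cod J u)"
  shows "\<exists>!q. q \<in> obj_map P x \<and> (\<forall>j\<in>Obj J. app (\<pi> j) x q = p j)"
proof -
  interpret PC: category PC by (rule PC_category)
  have cone: "is_cone J PC D P \<pi>" and univ: "\<And>y q. is_cone J PC D y q \<Longrightarrow>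
      \<exists>!h. h \<in> Hom PC y P \<and> (\<forall>j\<in>Obj J. \<pi> j \<cdot>\<^bsub>PC\<^esub> h = q j)"
    using L unfolding is_limit_def by blast+
  have D: "is_functor J PC D" and P: "P \<in> Obj PC"
    and \<pi>: "\<And>j. j \<in> Obj J \<Longrightarrow> \<pi> j \<in> Hom PC P (obj_map D j)"
    using cone by (auto simp: is_cone_def)
  have Dj: "j \<in> Obj J \<Longrightarrow> obj_map D j \<in> Obj PC" for j using functor_obj[OF D] .
  interpret J: category J using functor_dom[OF D] .
  let ?q = "\<lambda>j. element_map (obj_map D j) x (p j)" and ?one = "enc x x (Ident C x)"
  have one: "?one \<in> obj_map (rep x) x" using x by (simp add: rep_obj enc_in ident)
  have q: "?q j \<in> Hom PC (rep x) (obj_map D j)" if "j \<in> Obj J" for j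
    using element_map_Hom[OF Dj[OF that] x in_D[OF that]] .
  \<comment> \<open>A compatible family of elements is a cone with vertex \<open>rep x\<close>; its
    equations need only be checked at the identity of x.\<close>
  have "is_cone J PC D (rep x) ?q" unfolding is_cone_def
  proof (intro conjI ballI)
    fix u assume u: "u \<in> Arr J"
    note Du = functor_hom[OF D u]
    show "arr_map D u \<cdot>\<^bsub>PC\<^esub> ?q (Dom J u) = ?q (Cod J u)"
    proof (rule rep_map_eqI[OF x])
      show "arr_map D u \<cdot>\<^bsub>PC\<^esub> ?q (Dom J u) \<in> Hom PC (rep x) (obj_map D (Cod J u))"
        using PC.comp[OF q Du] u by simp
      show "?q (Cod J u) \<in> Hom PC (rep x) (obj_map D (Cod J u))" using q u by simp
      show "app (arr_map D u \<cdot>\<^bsub>PC\<^esub> ?q (Dom J u)) x ?one = app (?q (Cod J u)) x ?one"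
        using app_comp[OF q Du x one] u compat[OF u]
        by (simp add: element_map_app_ident Dj x in_D)
    qed
  qed (use D rep_PC[OF x] q in auto)
  from univ[OF this] obtain h where h: "h \<in> Hom PC (rep x) P" "\<And>j. j \<in> Obj J \<Longrightarrow> \<pi> j \<cdot>\<^bsub>PC\<^esub> h = ?q j"
    and huniq: "\<And>h'. h' \<in> Hom PC (rep x) P \<Longrightarrow> (\<forall>j\<in>Obj J. \<pi> j \<cdot>\<^bsub>PC\<^esub> h' = ?q j) \<Longrightarrow> h' = h"
    by metis
  have "app (\<pi> j) x (app h x ?one) = p j" if j: "j \<in> Obj J" for j
    using app_comp[OF h(1) \<pi>[OF j] x one] h(2)[OF j] element_map_app_ident[OF Dj[OF j] x in_D[OF j]] by simp
  \<comment> \<open>A second element with these components would give a second factorization of the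
    same cone.\<close>
  moreover have "r = app h x ?one" if r: "r \<in> obj_map P x" "\<forall>j\<in>Obj J. app (\<pi> j) x r = p j" for r
  proof -
    note er = element_map_Hom[OF P x r(1)]
    have "\<pi> j \<cdot>\<^bsub>PC\<^esub> element_map P x r = ?q j" if j: "j \<in> Obj J" for j
    proof (rule rep_map_eqI[OF x PC.comp[OF er \<pi>[OF j]] q[OF j]])
      show "app (\<pi> j \<cdot>\<^bsub>PC\<^esub> element_map P x r) x ?one = app (?q j) x ?one"
        using app_comp[OF er \<pi>[OF j] x one] r j
        by (simp add: element_map_app_ident P Dj x in_D)
    qed
    then have "element_map P x r = h" using huniq[OF er] by blast
    then show ?thesis using element_map_app_ident[OF P x r(1)] by simp
  qed
  ultimately show ?thesis using app_in[OF h(1) x one] by blast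
qed

text \<open>A cocone on the elements of P with vertex d is a map from P to \<open>Y d\<close>, and
  the adjunction transposes it to an arrow from \<open>L P\<close> to d. The second conclusion is
  naturality of the unit.\<close>

lemma adjunction_universal:
  assumes adj: "adjunction PC C L Y \<eta> \<epsilon>" and P: "P \<in> Obj PC"
  shows "universal_on (obj_map P) (act P) (obj_map L P) (of_map (obj_map L P) (\<eta> P))" (is ?U)
    and "\<tau> \<in> Hom PC P Q \<Longrightarrow> x \<in> Obj C \<Longrightarrow> p \<in> obj_map P x \<Longrightarrow>
      arr_map L \<tau> \<cdot> of_map (obj_map L P) (\<eta> P) x p = of_map (obj_map L Q) (\<eta> Q) x (app \<tau> x p)"
proof -
  interpret PC: category PC by (rule PC_category)
  have L: "is_functor PC C L" and Yf: "is_functor C PC Y"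
    and \<eta>: "nat_trans PC PC (id_ftor PC) (comp_ftor PC Y L) \<eta>"
    and \<epsilon>: "nat_trans C C (comp_ftor C L Y) (id_ftor C) \<epsilon>"
    and tri1: "\<And>P. P \<in> Obj PC \<Longrightarrow> \<epsilon> (obj_map L P) \<cdot> arr_map L (\<eta> P) = Ident C (obj_map L P)"
    and tri2: "\<And>y. y \<in> Obj C \<Longrightarrow> arr_map Y (\<epsilon> y) \<cdot>\<^bsub>PC\<^esub> \<eta> (obj_map Y y) = Ident PC (obj_map Y y)"
    using adj unfolding adjunction_def by blast+
  have LO: "P \<in> Obj PC \<Longrightarrow> obj_map L P \<in> Obj C" for P using functor_obj[OF L] .
  have LA: "arr_map L \<tau> \<in> Hom C (obj_map L P) (obj_map L Q)" if "\<tau> \<in> Hom PC P Q" for \<tau> P Q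
    using functor_hom[OF L, of \<tau>] that by (auto simp: Hom_iff)
  have Lc: "arr_map L (\<sigma> \<cdot>\<^bsub>PC\<^esub> \<tau>) = arr_map L \<sigma> \<cdot> arr_map L \<tau>"
    if "\<tau> \<in> Hom PC P Q" "\<sigma> \<in> Hom PC Q R" for \<sigma> \<tau> P Q R
    using functor_comp[OF L, of \<tau> \<sigma>] that by (auto simp: Hom_iff)
  have eta: "\<eta> P \<in> Hom PC P (rep (obj_map L P))" if "P \<in> Obj PC" for P
    using nat_trans_hom[OF \<eta> that] that LO[OF that] by (simp add: id_ftor_def comp_ftor_def Yoneda_obj)
  have eps: "\<epsilon> d \<in> Hom C (obj_map L (rep d)) d" if "d \<in> Obj C" for d
    using nat_trans_hom[OF \<epsilon> that] that by (simp add: id_ftor_def comp_ftor_def Yoneda_obj)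
  have eta_nat: "\<eta> Q \<cdot>\<^bsub>PC\<^esub> \<tau> = arr_map Y (arr_map L \<tau>) \<cdot>\<^bsub>PC\<^esub> \<eta> P" if "\<tau> \<in> Hom PC P Q" for \<tau> P Q
    using nat_trans_nat[OF \<eta>, of \<tau>] that by (simp add: id_ftor_def comp_ftor_def Hom_iff)
  have eps_nat: "\<epsilon> d \<cdot> arr_map L (arr_map Y m) = m \<cdot> \<epsilon> c" if "m \<in> Hom C c d" for m c d
    using nat_trans_nat[OF \<epsilon>, of m] that by (simp add: id_ftor_def comp_ftor_def Hom_iff)
  have YA: "arr_map Y m \<in> Hom PC (rep c) (rep d)" if "m \<in> Hom C c d" for m c d
    using Yoneda_arr(1)[of m] that by (simp add: Hom_iff)
  have mY: "m \<cdot> of_map c \<tau> x p = of_map d (arr_map Y m \<cdot>\<^bsub>PC\<^esub> \<tau>) x p"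
    if "m \<in> Hom C c d" "\<tau> \<in> Hom PC P (rep c)" "x \<in> Obj C" "p \<in> obj_map P x" for m c d \<tau> P x p
    using of_map_Yoneda[of \<tau> P m x p] that by (simp add: Hom_iff)
  show ?U unfolding universal_on_def
  proof (intro conjI ballI allI impI LO[OF P] of_map_cocone[OF eta[OF P] P])
    fix d \<psi> assume d: "d \<in> Obj C" and \<psi>: "cocone_on (obj_map P) (act P) d \<psi>"
    let ?\<tau> = "to_map P d \<psi>"
    have t: "?\<tau> \<in> Hom PC P (rep d)" using to_map_Hom[OF P d \<psi>] .
    \<comment> \<open>The transpose of \<open>?\<tau>\<close>. One triangle identity shows that it
      is a factorization, the other that every factorization equals it.\<close>
    let ?m = "\<epsilon> d \<cdot> arr_map L ?\<tau>"
    have m: "?m \<in> Hom C (obj_map L P) d" using comp[OF LA[OF t] eps[OF d]] .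
    have iff: "(\<forall>x\<in>Obj C. \<forall>p\<in>obj_map P x. n \<cdot> of_map (obj_map L P) (\<eta> P) x p = \<psi> x p) \<longleftrightarrow>
        arr_map Y n \<cdot>\<^bsub>PC\<^esub> \<eta> P = ?\<tau>" if n: "n \<in> Hom C (obj_map L P) d" for n
    proof
      assume *: "\<forall>x\<in>Obj C. \<forall>p\<in>obj_map P x. n \<cdot> of_map (obj_map L P) (\<eta> P) x p = \<psi> x p"
      show "arr_map Y n \<cdot>\<^bsub>PC\<^esub> \<eta> P = ?\<tau>"
        by (rule of_map_eqI[OF PC.comp[OF eta[OF P] YA[OF n]] t])
          (use * mY[OF n eta[OF P]] of_to_map[OF \<psi>] in simp)
    next
      assume "arr_map Y n \<cdot>\<^bsub>PC\<^esub> \<eta> P = ?\<tau>"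
      then show "\<forall>x\<in>Obj C. \<forall>p\<in>obj_map P x. n \<cdot> of_map (obj_map L P) (\<eta> P) x p = \<psi> x p"
        using mY[OF n eta[OF P]] of_to_map[OF \<psi>] by simp
    qed
    have YL: "arr_map Y (arr_map L ?\<tau>) \<in> Hom PC (rep (obj_map L P)) (rep (obj_map L (rep d)))"
      using YA[OF LA[OF t]] .
    have "arr_map Y ?m \<cdot>\<^bsub>PC\<^esub> \<eta> P = (arr_map Y (\<epsilon> d) \<cdot>\<^bsub>PC\<^esub> arr_map Y (arr_map L ?\<tau>)) \<cdot>\<^bsub>PC\<^esub> \<eta> P"
      using functor_comp[OF Yf, of "arr_map L ?\<tau>" "\<epsilon> d"] LA[OF t] eps[OF d] by (simp add: Hom_iff)
    also have "\<dots> = arr_map Y (\<epsilon> d) \<cdot>\<^bsub>PC\<^esub> (arr_map Y (arr_map L ?\<tau>) \<cdot>\<^bsub>PC\<^esub> \<eta> P)"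
      by (rule PC.assoc[OF eta[OF P] YL YA[OF eps[OF d]]])
    also have "\<dots> = arr_map Y (\<epsilon> d) \<cdot>\<^bsub>PC\<^esub> (\<eta> (rep d) \<cdot>\<^bsub>PC\<^esub> ?\<tau>)" using eta_nat[OF t] by simp
    also have "\<dots> = (arr_map Y (\<epsilon> d) \<cdot>\<^bsub>PC\<^esub> \<eta> (rep d)) \<cdot>\<^bsub>PC\<^esub> ?\<tau>"
      by (rule PC.assoc[OF t eta[OF rep_PC[OF d]] YA[OF eps[OF d]], symmetric])
    also have "\<dots> = ?\<tau>" using tri2[OF d] PC.ident_comp[OF t] by (simp add: Yoneda_obj d)
    finally have sol: "arr_map Y ?m \<cdot>\<^bsub>PC\<^esub> \<eta> P = ?\<tau>" .
    show "\<exists>!m. m \<in> Hom C (obj_map L P) d \<and>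
        (\<forall>x\<in>Obj C. \<forall>p\<in>obj_map P x. m \<cdot> of_map (obj_map L P) (\<eta> P) x p = \<psi> x p)"
    proof (rule ex1I)
      show "?m \<in> Hom C (obj_map L P) d \<and>
        (\<forall>x\<in>Obj C. \<forall>p\<in>obj_map P x. ?m \<cdot> of_map (obj_map L P) (\<eta> P) x p = \<psi> x p)"
        using m iff[OF m] sol by blast
      fix n assume "n \<in> Hom C (obj_map L P) d \<and>
        (\<forall>x\<in>Obj C. \<forall>p\<in>obj_map P x. n \<cdot> of_map (obj_map L P) (\<eta> P) x p = \<psi> x p)"
      then have n: "n \<in> Hom C (obj_map L P) d" and t_eq: "?\<tau> = arr_map Y n \<cdot>\<^bsub>PC\<^esub> \<eta> P"
        using iff by auto
      have "?m = \<epsilon> d \<cdot> (arr_map L (arr_map Y n) \<cdot> arr_map L (\<eta> P))"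
        unfolding t_eq using Lc[OF eta[OF P] YA[OF n]] by simp
      also have "\<dots> = (\<epsilon> d \<cdot> arr_map L (arr_map Y n)) \<cdot> arr_map L (\<eta> P)"
        by (rule assoc[OF LA[OF eta[OF P]] LA[OF YA[OF n]] eps[OF d], symmetric])
      also have "\<dots> = (n \<cdot> \<epsilon> (obj_map L P)) \<cdot> arr_map L (\<eta> P)" using eps_nat[OF n] by simp
      also have "\<dots> = n \<cdot> (\<epsilon> (obj_map L P) \<cdot> arr_map L (\<eta> P))"
        by (rule assoc[OF LA[OF eta[OF P]] eps[OF LO[OF P]] n])
      also have "\<dots> = n" using tri1[OF P] comp_ident[OF n] by simp
      finally show "n = ?m" ..
    qed
  qed
  assume t: "\<tau> \<in> Hom PC P Q" and x: "x \<in> Obj C" "p \<in> obj_map P x"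
  then have Q: "Q \<in> Obj PC" by (simp add: PC_Hom)
  show "arr_map L \<tau> \<cdot> of_map (obj_map L P) (\<eta> P) x p = of_map (obj_map L Q) (\<eta> Q) x (app \<tau> x p)"
    using mY[OF LA[OF t] eta[OF P] x] eta_nat[OF t] of_map_comp[OF t eta[OF Q] x] by simp
qed

text \<open>A left adjoint is assembled from universal arrows given object by object: uniqueness of
  factorizations yields functoriality, naturality and the triangle identities. Besides the
  adjunction, the values on objects and the action on the cocones are exported for the proof of
  exactness.\<close>

lemma adjunction_exists:
  assumes univ: "\<And>P. P \<in> Obj PC \<Longrightarrow> universal_on (obj_map P) (act P) (c P) (\<phi> P)"
  obtains L \<eta> \<epsilon> where "adjunction PC C L Y \<eta> \<epsilon>"
    "\<And>P. P \<in> Obj PC \<Longrightarrow> obj_map L P = c P"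
    "\<And>P Q \<tau> x p. \<tau> \<in> Hom PC P Q \<Longrightarrow> x \<in> Obj C \<Longrightarrow> p \<in> obj_map P x \<Longrightarrow>
      arr_map L \<tau> \<cdot> \<phi> P x p = \<phi> Q x (app \<tau> x p)"
proof -
  interpret PC: category PC by (rule PC_category)
  have cO: "P \<in> Obj PC \<Longrightarrow> c P \<in> Obj C" and coc: "P \<in> Obj PC \<Longrightarrow> cocone_on (obj_map P) (act P) (c P) (\<phi> P)" for P
    using univ[of P] by (auto simp: universal_on_def)
  have "\<exists>m. m \<in> Hom C (c P) (c Q) \<and> (\<forall>x\<in>Obj C. \<forall>p\<in>obj_map P x. m \<cdot> \<phi> P x p = \<phi> Q x (app \<tau> x p))"
    if t: "\<tau> \<in> Hom PC P Q" for \<tau> P Q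
  proof -
    have P: "P \<in> Obj PC" and Q: "Q \<in> Obj PC" using t by (auto simp: PC_Hom)
    show ?thesis
      by (rule universal_on_ex[OF univ[OF P] cO[OF Q] natp_compose[OF PC_psh[OF P] app_natpp[OF t] coc[OF Q]]])
  qed
  then have "\<forall>\<tau>\<in>Arr PC. \<exists>m. m \<in> Hom C (c (Dom PC \<tau>)) (c (Cod PC \<tau>)) \<and>
      (\<forall>x\<in>Obj C. \<forall>p\<in>obj_map (Dom PC \<tau>) x. m \<cdot> \<phi> (Dom PC \<tau>) x p = \<phi> (Cod PC \<tau>) x (app \<tau> x p))"
    by (simp add: Hom_iff)
  then obtain l where l: "\<And>\<tau>. \<tau> \<in> Arr PC \<Longrightarrow> l \<tau> \<in> Hom C (c (Dom PC \<tau>)) (c (Cod PC \<tau>))"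
    "\<And>\<tau> x p. \<tau> \<in> Arr PC \<Longrightarrow> x \<in> Obj C \<Longrightarrow> p \<in> obj_map (Dom PC \<tau>) x \<Longrightarrow>
      l \<tau> \<cdot> \<phi> (Dom PC \<tau>) x p = \<phi> (Cod PC \<tau>) x (app \<tau> x p)"
    by metis
  have lH: "l \<tau> \<in> Hom C (c P) (c Q)" if "\<tau> \<in> Hom PC P Q" for \<tau> P Q using l(1)[of \<tau>] that by (simp add: Hom_iff)
  have lv: "l \<tau> \<cdot> \<phi> P x p = \<phi> Q x (app \<tau> x p)"
    if "\<tau> \<in> Hom PC P Q" "x \<in> Obj C" "p \<in> obj_map P x" for \<tau> P Q x p
    using l(2)[of \<tau>] that by (simp add: Hom_iff)
  have ph: "\<phi> P x p \<in> Hom C x (c P)" if "P \<in> Obj PC" "x \<in> Obj C" "p \<in> obj_map P x" for P x p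
    using natp_in[OF coc[OF that(1)] that(2,3)] .
  define L where "L = \<lparr>obj_map = (\<lambda>P\<in>Obj PC. c P), arr_map = (\<lambda>\<tau>\<in>Arr PC. l \<tau>)\<rparr>"
  have LO: "obj_map L P = c P" if "P \<in> Obj PC" for P using that by (simp add: L_def)
  have LA: "arr_map L \<tau> = l \<tau>" if "\<tau> \<in> Hom PC P Q" for \<tau> P Q using that by (simp add: L_def Hom_iff)
  have eqI: "m = n" if "P \<in> Obj PC" "m \<in> Hom C (c P) d" "n \<in> Hom C (c P) d"
    "\<And>x p. x \<in> Obj C \<Longrightarrow> p \<in> obj_map P x \<Longrightarrow> m \<cdot> \<phi> P x p = n \<cdot> \<phi> P x p" for P m n d
    using universal_on_eqI[OF univ[OF that(1)] that(2-4)] .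
  have L: "is_functor PC C L"
  proof (rule is_functorI)
    fix \<tau> assume "\<tau> \<in> Arr PC"
    then have "\<tau> \<in> Hom PC (Dom PC \<tau>) (Cod PC \<tau>)" by (simp add: Hom_iff)
    then show "arr_map L \<tau> \<in> Hom C (obj_map L (Dom PC \<tau>)) (obj_map L (Cod PC \<tau>))"
      using lH LA LO by (auto simp: PC_Hom)
  next
    fix P assume P: "P \<in> Obj PC"
    note i = PC.ident[OF P]
    show "arr_map L (Ident PC P) = Ident C (obj_map L P)"
      unfolding LA[OF i] LO[OF P]
    proof (rule eqI[OF P lH[OF i] ident[OF cO[OF P]]])
      fix x p assume x: "x \<in> Obj C" "p \<in> obj_map P x"
      show "l (Ident PC P) \<cdot> \<phi> P x p = Ident C (c P) \<cdot> \<phi> P x p"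
        using lv[OF i x] ident_comp[OF ph[OF P x]] by (simp add: app_Ident x)
    qed
  next
    fix \<tau> \<sigma> assume "\<tau> \<in> Arr PC" "\<sigma> \<in> Arr PC" "Cod PC \<tau> = Dom PC \<sigma>"
    then obtain P Q R where t: "\<tau> \<in> Hom PC P Q" and s: "\<sigma> \<in> Hom PC Q R" by (simp add: Hom_iff)
    then have P: "P \<in> Obj PC" by (simp add: PC_Hom)
    note c = PC.comp[OF t s]
    show "arr_map L (\<sigma> \<cdot>\<^bsub>PC\<^esub> \<tau>) = arr_map L \<sigma> \<cdot> arr_map L \<tau>"
      unfolding LA[OF c] LA[OF t] LA[OF s]
    proof (rule eqI[OF P lH[OF c] comp[OF lH[OF t] lH[OF s]]])
      fix x p assume x: "x \<in> Obj C" "p \<in> obj_map P x"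
      show "l (\<sigma> \<cdot>\<^bsub>PC\<^esub> \<tau>) \<cdot> \<phi> P x p = (l \<sigma> \<cdot> l \<tau>) \<cdot> \<phi> P x p"
        using lv[OF c x] lv[OF t x] lv[OF s x(1) app_in[OF t x]] app_comp[OF t s x]
          assoc[OF ph[OF P x] lH[OF t] lH[OF s]] by simp
    qed
  qed (auto simp: PC_category category_axiom L_def cO)
  define \<eta> where "\<eta> = (\<lambda>P\<in>Obj PC. to_map P (c P) (\<phi> P))"
  have eta: "\<eta> P \<in> Hom PC P (rep (c P))" if "P \<in> Obj PC" for P
    using to_map_Hom[OF that cO coc] that by (simp add: \<eta>_def)
  have of_eta: "of_map (c P) (\<eta> P) x p = \<phi> P x p" if "P \<in> Obj PC" "x \<in> Obj C" "p \<in> obj_map P x" for P x p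
    using of_to_map[OF coc] that by (simp add: \<eta>_def)
  have app_eta: "app (\<eta> P) x p = enc x (c P) (\<phi> P x p)" if "P \<in> Obj PC" "x \<in> Obj C" "p \<in> obj_map P x" for P x p
    using that by (simp add: \<eta>_def to_map_def app_mk_map)
  have "\<exists>m. m \<in> Hom C (c (rep d)) d \<and>
      (\<forall>x\<in>Obj C. \<forall>p\<in>obj_map (rep d) x. m \<cdot> \<phi> (rep d) x p = dec x d p)" if d: "d \<in> Obj C" for d
    by (rule universal_on_ex[OF univ[OF rep_PC[OF d]] d cocone_on_rep])
  then obtain e where e: "\<And>d. d \<in> Obj C \<Longrightarrow> e d \<in> Hom C (c (rep d)) d"
    "\<And>d x p. d \<in> Obj C \<Longrightarrow> x \<in> Obj C \<Longrightarrow> p \<in> obj_map (rep d) x \<Longrightarrow> e d \<cdot> \<phi> (rep d) x p = dec x d p"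
    by metis
  define \<epsilon> where "\<epsilon> = (\<lambda>d\<in>Obj C. e d)"
  have YA: "arr_map Y m \<in> Hom PC (rep c) (rep d)" if "m \<in> Hom C c d" for m c d
    using Yoneda_arr(1)[of m] that by (simp add: Hom_iff)
  have mY: "of_map d (arr_map Y m \<cdot>\<^bsub>PC\<^esub> \<tau>) x p = m \<cdot> of_map c \<tau> x p"
    if "m \<in> Hom C c d" "\<tau> \<in> Hom PC P (rep c)" "x \<in> Obj C" "p \<in> obj_map P x" for m c d \<tau> P x p
    using of_map_Yoneda[of \<tau> P m x p] that by (simp add: Hom_iff)
  have \<eta>_nat: "nat_trans PC PC (id_ftor PC) (comp_ftor PC Y L) \<eta>"
  proof (rule nat_transI)
    show "is_functor PC PC (id_ftor PC)" by (rule functor_id[OF PC_category])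
    show "is_functor PC PC (comp_ftor PC Y L)" by (rule functor_compose[OF L Yoneda_functor])
    show "\<eta> \<in> extensional (Obj PC)" by (simp add: \<eta>_def)
    show "\<eta> P \<in> Hom PC (obj_map (id_ftor PC) P) (obj_map (comp_ftor PC Y L) P)" if "P \<in> Obj PC" for P
      using eta that LO cO by (simp add: id_ftor_def comp_ftor_def Yoneda_obj)
    fix \<tau> assume t': "\<tau> \<in> Arr PC"
    then obtain P Q where t: "\<tau> \<in> Hom PC P Q" by (simp add: Hom_iff)
    then have P: "P \<in> Obj PC" and Q: "Q \<in> Obj PC" by (auto simp: PC_Hom)
    have "\<eta> Q \<cdot>\<^bsub>PC\<^esub> \<tau> = arr_map Y (l \<tau>) \<cdot>\<^bsub>PC\<^esub> \<eta> P"
    proof (rule of_map_eqI[OF PC.comp[OF t eta[OF Q]] PC.comp[OF eta[OF P] YA[OF lH[OF t]]]])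
      fix x p assume x: "x \<in> Obj C" "p \<in> obj_map P x"
      show "of_map (c Q) (\<eta> Q \<cdot>\<^bsub>PC\<^esub> \<tau>) x p = of_map (c Q) (arr_map Y (l \<tau>) \<cdot>\<^bsub>PC\<^esub> \<eta> P) x p"
        using of_map_comp[OF t eta[OF Q] x] mY[OF lH[OF t] eta[OF P] x] of_eta[OF P x]
          of_eta[OF Q x(1) app_in[OF t x]] lv[OF t x] by simp
    qed
    then show "\<eta> (Cod PC \<tau>) \<cdot>\<^bsub>PC\<^esub> arr_map (id_ftor PC) \<tau> =
        arr_map (comp_ftor PC Y L) \<tau> \<cdot>\<^bsub>PC\<^esub> \<eta> (Dom PC \<tau>)"
      using t t' LA[OF t] by (simp add: id_ftor_def comp_ftor_def Hom_iff)
  qed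
  have \<epsilon>_nat: "nat_trans C C (comp_ftor C L Y) (id_ftor C) \<epsilon>"
  proof (rule nat_transI)
    show "is_functor C C (comp_ftor C L Y)" by (rule functor_compose[OF Yoneda_functor L])
    show "is_functor C C (id_ftor C)" by (rule functor_id[OF category_axiom])
    show "\<epsilon> \<in> extensional (Obj C)" by (simp add: \<epsilon>_def)
    show "\<epsilon> d \<in> Hom C (obj_map (comp_ftor C L Y) d) (obj_map (id_ftor C) d)" if "d \<in> Obj C" for d
      using e(1) that LO rep_PC by (simp add: id_ftor_def comp_ftor_def Yoneda_obj \<epsilon>_def)
    fix m assume m: "m \<in> Arr C"
    let ?a = "Dom C m" and ?b = "Cod C m"
    have mH: "m \<in> Hom C ?a ?b" and ab: "?a \<in> Obj C" "?b \<in> Obj C" using m by (auto simp: Hom_iff)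
    note Pa = rep_PC[OF ab(1)] and t = YA[OF mH]
    have "e ?b \<cdot> l (arr_map Y m) = m \<cdot> e ?a"
    proof (rule eqI[OF Pa comp[OF lH[OF t] e(1)[OF ab(2)]] comp[OF e(1)[OF ab(1)] mH]])
      fix x p assume x: "x \<in> Obj C" "p \<in> obj_map (rep ?a) x"
      have "dec x ?b (app (arr_map Y m) x p) = m \<cdot> dec x ?a p"
        using Yoneda_arr(2)[OF m x] by (simp add: of_map_def)
      then show "(e ?b \<cdot> l (arr_map Y m)) \<cdot> \<phi> (rep ?a) x p = (m \<cdot> e ?a) \<cdot> \<phi> (rep ?a) x p"
        using assoc[OF ph[OF Pa x] lH[OF t] e(1)[OF ab(2)]] assoc[OF ph[OF Pa x] e(1)[OF ab(1)] mH]
          lv[OF t x] e(2)[OF ab(2) x(1) app_in[OF t x]] e(2)[OF ab(1) x] by simp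
    qed
    then show "\<epsilon> ?b \<cdot> arr_map (comp_ftor C L Y) m = arr_map (id_ftor C) m \<cdot> \<epsilon> ?a"
      using m LA[OF t] by (simp add: id_ftor_def comp_ftor_def \<epsilon>_def)
  qed
  have "adjunction PC C L Y \<eta> \<epsilon>" unfolding adjunction_def
  proof (intro conjI ballI L Yoneda_functor \<eta>_nat \<epsilon>_nat)
    fix P assume P: "P \<in> Obj PC"
    note R = rep_PC[OF cO[OF P]]
    have "e (c P) \<cdot> l (\<eta> P) = Ident C (c P)"
    proof (rule eqI[OF P comp[OF lH[OF eta[OF P]] e(1)[OF cO[OF P]]] ident[OF cO[OF P]]])
      fix x p assume x: "x \<in> Obj C" "p \<in> obj_map P x"
      show "(e (c P) \<cdot> l (\<eta> P)) \<cdot> \<phi> P x p = Ident C (c P) \<cdot> \<phi> P x p"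
        using assoc[OF ph[OF P x] lH[OF eta[OF P]] e(1)[OF cO[OF P]]] lv[OF eta[OF P] x]
          e(2)[OF cO[OF P] x(1) app_in[OF eta[OF P] x]] of_eta[OF P x] ident_comp[OF ph[OF P x]]
        by (simp add: of_map_def)
    qed
    then show "\<epsilon> (obj_map L P) \<cdot> arr_map L (\<eta> P) = Ident C (obj_map L P)"
      using LO[OF P] LA[OF eta[OF P]] cO[OF P] by (simp add: \<epsilon>_def)
  next
    fix d assume d: "d \<in> Obj C"
    note R = rep_PC[OF d]
    have "arr_map Y (e d) \<cdot>\<^bsub>PC\<^esub> \<eta> (rep d) = Ident PC (rep d)"
    proof (rule of_map_eqI[OF PC.comp[OF eta[OF R] YA[OF e(1)[OF d]]] PC.ident[OF R]])
      fix x p assume x: "x \<in> Obj C" "p \<in> obj_map (rep d) x"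
      show "of_map d (arr_map Y (e d) \<cdot>\<^bsub>PC\<^esub> \<eta> (rep d)) x p = of_map d (Ident PC (rep d)) x p"
        using mY[OF e(1)[OF d] eta[OF R] x] of_eta[OF R x] e(2)[OF d x] by (simp add: of_map_def app_Ident x)
    qed
    then show "arr_map Y (\<epsilon> d) \<cdot>\<^bsub>PC\<^esub> \<eta> (obj_map Y d) = Ident PC (obj_map Y d)"
      using d by (simp add: \<epsilon>_def Yoneda_obj)
  qed
  then show thesis using that LO LA lv by metis
qed

end


section \<open>Colimits in an \<infinity>-pretopos\<close>

context universe_category
begin

text \<open>The definitions quantify only over diagrams carried by \<open>'u\<close>, whereas sum
  types are natural indices for presentations. The copy and the original share their colimit: the
  copy is what \<open>colimit_covering\<close> accepts, the original is convenient for the universal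
  property.\<close>

lemma small_colimit_transport:
  fixes J :: "('j, 'k) cat"
  assumes cc: "small_cocomplete U C" and J: "small U (Obj J)" "small U (Arr J)"
    and D: "is_functor J C D"
  obtains J' :: "('u, 'u) cat" and D' x i e where "small_cat U J'" "is_colimit J' C D' x i"
    "Obj J' = e ` Obj J" "\<forall>j\<in>Obj J. obj_map D' (e j) = obj_map D j"
    "is_colimit J C D x (\<lambda>j. i (e j))"
proof -
  interpret J: category J using functor_dom[OF D] .
  obtain e :: "'j \<Rightarrow> 'u" where e: "inj_on e (Obj J)" using small_inj_ex[OF J(1)] by blast
  obtain g :: "'k \<Rightarrow> 'u" where g: "inj_on g (Arr J)" using small_inj_ex[OF J(2)] by blast
  define e' where "e' = inv_into (Obj J) e"
  define g' where "g' = inv_into (Arr J) g"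
  have ee[simp]: "e' (e j) = j" if "j \<in> Obj J" for j using that e by (simp add: e'_def)
  have gg[simp]: "g' (g u) = u" if "u \<in> Arr J" for u using that g by (simp add: g'_def)
  define J' where "J' = \<lparr>Obj = e ` Obj J, Arr = g ` Arr J, Dom = (\<lambda>a. e (Dom J (g' a))),
    Cod = (\<lambda>a. e (Cod J (g' a))), Ident = (\<lambda>x. g (Ident J (e' x))),
    Comp = (\<lambda>b a. g (g' b \<cdot>\<^bsub>J\<^esub> g' a))\<rparr>"
  define D' where "D' = \<lparr>obj_map = (\<lambda>x\<in>e ` Obj J. obj_map D (e' x)),
    arr_map = (\<lambda>a\<in>g ` Arr J. arr_map D (g' a))\<rparr>"
  have inj: "e (Cod J f) = e (Dom J f') \<longleftrightarrow> Cod J f = Dom J f'" if "f \<in> Arr J" "f' \<in> Arr J" for f f'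
    using inj_on_eq_iff[OF e, of "Cod J f" "Dom J f'"] that by simp
  have cJ': "category J'"
    by (rule categoryI) (auto simp: J'_def J.comp_assoc inj)
  then have sJ': "small_cat U J'" unfolding small_cat_def using J by (simp add: J'_def small_image)
  have J's: "Obj J' = e ` Obj J" "Arr J' = g ` Arr J"
    "\<And>u. u \<in> Arr J \<Longrightarrow> Dom J' (g u) = e (Dom J u)" "\<And>u. u \<in> Arr J \<Longrightarrow> Cod J' (g u) = e (Cod J u)"
    "\<And>j. j \<in> Obj J \<Longrightarrow> Ident J' (e j) = g (Ident J j)"
    "\<And>u v. u \<in> Arr J \<Longrightarrow> v \<in> Arr J \<Longrightarrow> v' = g v \<Longrightarrow> v' \<cdot>\<^bsub>J'\<^esub> g u = g (v \<cdot>\<^bsub>J\<^esub> u)" for v'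
    by (simp_all add: J'_def)
  have D's: "\<And>j. j \<in> Obj J \<Longrightarrow> obj_map D' (e j) = obj_map D j"
    "\<And>u. u \<in> Arr J \<Longrightarrow> arr_map D' (g u) = arr_map D u"
    by (simp_all add: D'_def)
  have D': "is_functor J' C D'"
  proof (rule is_functorI[OF cJ' category_axiom])
    fix a assume "a \<in> Arr J'"
    then obtain u where "u \<in> Arr J" "a = g u" unfolding J's by blast
    then show "arr_map D' a \<in> Hom C (obj_map D' (Dom J' a)) (obj_map D' (Cod J' a))"
      using functor_hom[OF D] by (simp add: J's D's)
  next
    fix a b assume ab: "a \<in> Arr J'" "b \<in> Arr J'" "Cod J' a = Dom J' b"
    then obtain u v where uv: "u \<in> Arr J" "a = g u" "v \<in> Arr J" "b = g v" unfolding J's by blast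
    then have "Cod J u = Dom J v" using ab(3) by (simp add: J's inj)
    then show "arr_map D' (b \<cdot>\<^bsub>J'\<^esub> a) = arr_map D' b \<cdot> arr_map D' a"
      using functor_comp[OF D] uv by (simp add: J's D's)
  next
    fix j' assume "j' \<in> Obj J'"
    then obtain j where "j \<in> Obj J" "j' = e j" unfolding J's by blast
    then show "obj_map D' j' \<in> Obj C" "arr_map D' (Ident J' j') = Ident C (obj_map D' j')"
      using functor_obj[OF D] functor_ident[OF D] by (simp_all add: J's D's)
  qed (simp_all add: D'_def J's)
  have coc: "is_cocone J' C D' x k \<longleftrightarrow> is_cocone J C D x (\<lambda>j. k (e j))" for x k
    unfolding is_cocone_def using D D' by (simp add: J's D's)
  obtain x i where xi: "is_colimit J' C D' x i"
    using cc sJ' D' unfolding small_cocomplete_def by blast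
  have "is_colimit J C D x (\<lambda>j. i (e j))" unfolding is_colimit_def
  proof (intro conjI allI impI)
    show "is_cocone J C D x (\<lambda>j. i (e j))" using xi coc by (auto simp: is_colimit_def)
    fix y k assume k: "is_cocone J C D y k"
    then have "is_cocone J C D y (\<lambda>j. k (e' (e j)))" unfolding is_cocone_def by simp
    then have "is_cocone J' C D' y (\<lambda>j. k (e' j))" by (simp add: coc)
    then have "\<exists>!h. h \<in> Hom C x y \<and> (\<forall>j\<in>Obj J'. h \<cdot> i j = k (e' j))"
      using xi unfolding is_colimit_def by blast
    then show "\<exists>!h. h \<in> Hom C x y \<and> (\<forall>j\<in>Obj J. h \<cdot> i (e j) = k j)"
      by (simp add: J'_def)
  qed
  then show thesis using that[OF sJ' xi, of e] by (simp add: J'_def D'_def)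
qed

text \<open>Pulling a colimit cocone back along \<open>g\<close> gives a colimit cocone, so maps out of the domain of
  \<open>g\<close> are matching families on the pulled back sieve.\<close>

lemma colimit_covering:
  assumes fc: "finitely_complete C" and stable: "pullback_stable_colimits U C"
    and J: "small_cat U J" and L: "is_colimit J C D x i"
  shows "covering x {h \<in> Arr C. \<exists>j\<in>Obj J. \<exists>k\<in>Arr C. Cod C k = obj_map D j \<and> h = i j \<cdot> k}"
    (is "covering x ?R")
  unfolding covering_def
proof (intro conjI ballI impI)
  have D: "is_functor J C D" and x: "x \<in> Obj C"
    and i: "\<And>j. j \<in> Obj J \<Longrightarrow> i j \<in> Arr C \<and> Dom C (i j) = obj_map D j \<and> Cod C (i j) = x"
    and iu: "\<And>u. u \<in> Arr J \<Longrightarrow> i (Cod J u) \<cdot> arr_map D u = i (Dom J u)"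
    using L by (auto simp: is_colimit_def is_cocone_def Hom_iff)
  interpret J: category J using functor_dom[OF D] .
  show "sieve x ?R" unfolding sieve_def
  proof (intro conjI ballI impI x)
    fix h k assume "h \<in> ?R" and k: "k \<in> Arr C" "Cod C k = Dom C h"
    then obtain j l where "h \<in> Arr C" "j \<in> Obj J" "l \<in> Arr C" "Cod C l = obj_map D j" "h = i j \<cdot> l" by blast
    then show "h \<cdot> k \<in> ?R" using i[of j] k
      by (auto simp: comp_assoc intro!: bexI[of _ j] bexI[of _ "l \<cdot> k"])
  qed (use i in auto)
  fix g assume g: "g \<in> Arr C" "Cod C g = x"
  let ?y = "Dom C g"
  have "\<exists>p q. is_pullback C g (i j) p q" if "j \<in> Obj J" for j
    by (rule pullback_exists[OF fc g(1)]) (use i[OF that] g in auto)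
  then obtain i' \<alpha> where pb: "\<And>j. j \<in> Obj J \<Longrightarrow> is_pullback C g (i j) (i' j) (\<alpha> j)" by metis
  note pbD = is_pullbackD[OF pb]
  let ?d = "\<lambda>j. Dom C (i' j)"
  have d: "j \<in> Obj J \<Longrightarrow> Dom C (\<alpha> j) = ?d j \<and> Cod C (\<alpha> j) = obj_map D j \<and> Cod C (i' j) = ?y \<and>
      i' j \<in> Arr C \<and> \<alpha> j \<in> Arr C \<and> g \<cdot> i' j = i j \<cdot> \<alpha> j \<and> ?d j \<in> Obj C" for j
    using pbD[of j] i[of j] by auto
  have eqI: "v = w" if "j \<in> Obj J" "v \<in> Arr C" "w \<in> Arr C" "Dom C v = Dom C w" "Cod C v = ?d j"
    "Cod C w = ?d j" "i' j \<cdot> v = i' j \<cdot> w" "\<alpha> j \<cdot> v = \<alpha> j \<cdot> w" for j v w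
    using is_pullback_eqI[OF pb[OF that(1)] that(2-8)] .
  \<comment> \<open>The pulled back vertices form a diagram: the arrow over u is induced by the
    pullback at \<open>Cod J u\<close>.\<close>
  have "\<exists>w. w \<in> Arr C \<and> Dom C w = ?d (Dom J u) \<and> Cod C w = ?d (Cod J u) \<and>
      i' (Cod J u) \<cdot> w = i' (Dom J u) \<and> \<alpha> (Cod J u) \<cdot> w = arr_map D u \<cdot> \<alpha> (Dom J u)"
    if u: "u \<in> Arr J" for u
  proof -
    have o: "Dom J u \<in> Obj J" "Cod J u \<in> Obj J" using u by auto
    note Du = functor_arr[OF D u]
    have "g \<cdot> i' (Dom J u) = i (Cod J u) \<cdot> (arr_map D u \<cdot> \<alpha> (Dom J u))"
      using d[OF o(1)] i[OF o(2)] iu[OF u] Du by (simp add: comp_assoc[symmetric])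
    then have "\<exists>w\<in>Arr C. Dom C w = Dom C (i' (Dom J u)) \<and> Cod C w = Dom C (i' (Cod J u)) \<and>
        i' (Cod J u) \<cdot> w = i' (Dom J u) \<and> \<alpha> (Cod J u) \<cdot> w = arr_map D u \<cdot> \<alpha> (Dom J u)"
      by (intro is_pullback_ex[OF pb[OF o(2)]]) (use d[OF o(1)] i[OF o(2)] Du g in auto)
    then show ?thesis by blast
  qed
  then obtain w where w: "\<And>u. u \<in> Arr J \<Longrightarrow> w u \<in> Arr C \<and> Dom C (w u) = ?d (Dom J u) \<and>
      Cod C (w u) = ?d (Cod J u) \<and>
      i' (Cod J u) \<cdot> w u = i' (Dom J u) \<and> \<alpha> (Cod J u) \<cdot> w u = arr_map D u \<cdot> \<alpha> (Dom J u)"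
    by metis
  define D' where "D' = \<lparr>obj_map = (\<lambda>j\<in>Obj J. ?d j), arr_map = (\<lambda>u\<in>Arr J. w u)\<rparr>"
  have D': "is_functor J C D'"
  proof (rule is_functorI)
    fix j assume j: "j \<in> Obj J"
    have "w (Ident J j) = Ident C (?d j)"
      by (rule eqI[OF j]) (use w[of "Ident J j"] j d[OF j] functor_ident[OF D j] in auto)
    then show "arr_map D' (Ident J j) = Ident C (obj_map D' j)" using j by (simp add: D'_def)
  next
    fix u v assume uv: "u \<in> Arr J" "v \<in> Arr J" "Cod J u = Dom J v"
    then have o: "Dom J u \<in> Obj J" "Cod J u \<in> Obj J" "Cod J v \<in> Obj J" "v \<cdot>\<^bsub>J\<^esub> u \<in> Arr J" by auto
    have o': "Dom J v \<in> Obj J" using uv by auto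
    note wu = w[OF uv(1)] and wv = w[OF uv(2)] and wvu = w[OF o(4)]
    note Du = functor_arr[OF D uv(1)] and Dv = functor_arr[OF D uv(2)]
    have "w (v \<cdot>\<^bsub>J\<^esub> u) = w v \<cdot> w u"
    proof (rule eqI[OF o(3)])
      show "i' (Cod J v) \<cdot> w (v \<cdot>\<^bsub>J\<^esub> u) = i' (Cod J v) \<cdot> w v \<cdot> w u"
        using wu wv wvu uv d[OF o(3)] by (simp add: comp_assoc[symmetric])
      have "\<alpha> (Cod J v) \<cdot> w v \<cdot> w u = (\<alpha> (Cod J v) \<cdot> w v) \<cdot> w u"
        by (subst comp_assoc) (use wu wv uv d[OF o(3)] in auto)
      also have "\<dots> = (arr_map D v \<cdot> \<alpha> (Dom J v)) \<cdot> w u" using wv by simp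
      also have "\<dots> = arr_map D v \<cdot> (\<alpha> (Dom J v) \<cdot> w u)"
        using wu uv d[OF o'] Dv by (simp add: comp_assoc)
      also have "\<dots> = arr_map D v \<cdot> (arr_map D u \<cdot> \<alpha> (Dom J u))" using wu uv by simp
      also have "\<dots> = (arr_map D v \<cdot> arr_map D u) \<cdot> \<alpha> (Dom J u)"
        using uv d[OF o(1)] Du Dv by (simp add: comp_assoc)
      finally show "\<alpha> (Cod J v) \<cdot> w (v \<cdot>\<^bsub>J\<^esub> u) = \<alpha> (Cod J v) \<cdot> w v \<cdot> w u"
        using wvu uv functor_comp[OF D uv] by simp
    qed (use wu wv wvu uv in auto)
    then show "arr_map D' (v \<cdot>\<^bsub>J\<^esub> u) = arr_map D' v \<cdot> arr_map D' u" using uv by (simp add: D'_def)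
  qed (use d w J.category_axiom category_axiom in \<open>auto simp: D'_def Hom_iff\<close>)
  have "nat_trans J C D' D (\<lambda>j\<in>Obj J. \<alpha> j)"
    by (rule nat_transI[OF D' D]) (use d w in \<open>auto simp: D'_def Hom_iff\<close>)
  moreover have "is_cocone J C D' ?y i'"
    unfolding is_cocone_def using D' d w g by (auto simp: D'_def Hom_iff)
  moreover have "\<forall>j\<in>Obj J. is_pullback C g (i j) (i' j) ((\<lambda>j\<in>Obj J. \<alpha> j) j)" using pb by simp
  moreover have "g \<in> Hom C ?y x" using g by (simp add: Hom_iff)
  ultimately have L': "is_colimit J C D' ?y i'"
    using stable J L unfolding pullback_stable_colimits_def by blast
  show "effective_epi ?y (pull_sieve g ?R)" unfolding effective_epi_def
  proof (intro ballI allI impI)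
    fix z m assume z: "z \<in> Obj C" and m: "matching (pull_sieve g ?R) z m"
    have mi: "i' j \<in> pull_sieve g ?R" if j: "j \<in> Obj J" for j
      using d[OF j] i[OF j] j g unfolding pull_sieve_def
      by (auto intro!: bexI[of _ j] bexI[of _ "\<alpha> j"])
    have mh: "m h \<in> Hom C (Dom C h) z" if "h \<in> pull_sieve g ?R" for h
      using m that by (simp add: matching_def)
    have mc: "m (i' j \<cdot> k) = m (i' j) \<cdot> k" if "j \<in> Obj J" "k \<in> Arr C" "Cod C k = ?d j" for j k
      using m mi that by (simp add: matching_def)
    show "\<exists>!n. n \<in> Hom C ?y z \<and> (\<forall>h\<in>pull_sieve g ?R. n \<cdot> h = m h)"
    proof -
      have "is_cocone J C D' z (\<lambda>j. m (i' j))" unfolding is_cocone_def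
        using D' z mh[OF mi] mc[symmetric] w by (auto simp: D'_def)
      then have ex: "\<exists>!n. n \<in> Hom C ?y z \<and> (\<forall>j\<in>Obj J. n \<cdot> i' j = m (i' j))"
        using L' unfolding is_colimit_def by blast
      \<comment> \<open>The pulled back legs generate the pulled back sieve, so agreement on the
        legs is agreement on the whole sieve.\<close>
      have "(\<forall>j\<in>Obj J. n \<cdot> i' j = m (i' j)) \<longleftrightarrow> (\<forall>h\<in>pull_sieve g ?R. n \<cdot> h = m h)"
        if n: "n \<in> Hom C ?y z" for n
      proof
        assume *: "\<forall>j\<in>Obj J. n \<cdot> i' j = m (i' j)"
        show "\<forall>h\<in>pull_sieve g ?R. n \<cdot> h = m h"
        proof
          fix h assume "h \<in> pull_sieve g ?R"
          then obtain j k where h: "h \<in> Arr C" "Cod C h = ?y" "j \<in> Obj J" "k \<in> Arr C"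
            "Cod C k = obj_map D j" "g \<cdot> h = i j \<cdot> k" unfolding pull_sieve_def by blast
          have "Dom C h = Dom C k"
          proof -
            have "Dom C (g \<cdot> h) = Dom C h" by (rule comp_dom) (use h g in simp_all)
            moreover have "Dom C (i j \<cdot> k) = Dom C k" by (rule comp_dom) (use h i[OF h(3)] in simp_all)
            ultimately show ?thesis using h(6) by simp
          qed
          then have "\<exists>v\<in>Arr C. Dom C v = Dom C h \<and> Cod C v = ?d j \<and> i' j \<cdot> v = h \<and> \<alpha> j \<cdot> v = k"
            by (intro is_pullback_ex[OF pb[OF h(3)]]) (use h i[OF h(3)] g in auto)
          then obtain v where v: "v \<in> Arr C" "Cod C v = ?d j" "i' j \<cdot> v = h" by blast
          have "n \<cdot> h = (n \<cdot> i' j) \<cdot> v"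
            using v n d[OF h(3)] by (simp add: comp_assoc Hom_iff flip: v(3))
          also have "\<dots> = m h" using * h(3) mc[OF h(3) v(1,2)] v(3) by simp
          finally show "n \<cdot> h = m h" .
        qed
      qed (use mi in blast)
      with ex show ?thesis by (metis (no_types, lifting))
    qed
  qed
qed

end


section \<open>Presented colimits, coproducts and relations in an infinity-pretopos\<close>

locale pretopos = universe_category C U
  for C :: "('o, 'a) cat" (structure) and U :: "'u itself" +
  assumes pretopos: "infinity_pretopos U C"
begin

lemma fin_complete: "finitely_complete C"
  and small_cocompl: "small_cocomplete U C"
  and stable_colimits: "pullback_stable_colimits U C"
  and disjoint_coprods: "disjoint_coproducts U C"
  and equiv_effective: "equivalence_relation C r s \<Longrightarrow> effective C r s"
  using pretopos by (auto simp: infinity_pretopos_def)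

lemmas pullback_ex = pullback_exists[OF fin_complete]

text \<open>The colimit of the bipartite diagram that has the generators and the relations as its
  objects.\<close>

lemma presented_colimit:
  fixes I :: "'i set" and Rel :: "('i \<times> 'a \<times> 'a \<times> 'i) set"
  assumes P: "pres_data I s Rel" and sm: "small U I" "small U Rel"
  obtains c \<kappa> where "c \<in> Obj C" "\<And>i. i \<in> I \<Longrightarrow> \<kappa> i \<in> Hom C (s i) c"
    "\<And>i u v j. (i, u, v, j) \<in> Rel \<Longrightarrow> \<kappa> i \<cdot> u = \<kappa> j \<cdot> v"
    "\<And>d \<mu>. d \<in> Obj C \<Longrightarrow> (\<And>i. i \<in> I \<Longrightarrow> \<mu> i \<in> Hom C (s i) d) \<Longrightarrow>
       (\<And>i u v j. (i, u, v, j) \<in> Rel \<Longrightarrow> \<mu> i \<cdot> u = \<mu> j \<cdot> v) \<Longrightarrow>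
       \<exists>!m. m \<in> Hom C c d \<and> (\<forall>i\<in>I. m \<cdot> \<kappa> i = \<mu> i)"
    "\<And>h. h \<in> Arr C \<Longrightarrow> Cod C h = c \<Longrightarrow> locally (Dom C h)
       (\<lambda>g. \<exists>i\<in>I. \<exists>k\<in>Arr C. Cod C k = s i \<and> Dom C k = Dom C g \<and> h \<cdot> g = \<kappa> i \<cdot> k)"
proof -
  note pD = pres_dataD[OF P] and pO = pres_data_obj[OF P]
  define N where "N = Inl ` I \<union> Inr ` Rel"
  \<comment> \<open>A relation is an object with two arrows to its generators, tagged
    \<open>False\<close> for u and \<open>True\<close> for v. All other arrows are identities, so a
    composable pair always contains an identity.\<close>
  define J where "J = \<lparr>Obj = N, Arr = Inl ` N \<union> Inr ` (Rel \<times> (UNIV :: bool set)),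
    Dom = case_sum (\<lambda>n. n) (\<lambda>(r, b). Inr r),
    Cod = case_sum (\<lambda>n. n) (\<lambda>((i, u, v, j), b). Inl (if b then j else i)),
    Ident = Inl, Comp = (\<lambda>b a. case b of Inl _ \<Rightarrow> a | Inr _ \<Rightarrow> b)\<rparr>"
  define D0 :: "'i + 'i \<times> 'a \<times> 'a \<times> 'i \<Rightarrow> 'o" where "D0 = case_sum s (\<lambda>(i, u, v, j). Dom C u)"
  define D where "D = \<lparr>obj_map = (\<lambda>n\<in>N. D0 n),
    arr_map = (\<lambda>a\<in>Arr J. case a of Inl n \<Rightarrow> Ident C (D0 n) | Inr ((i, u, v, j), b) \<Rightarrow> if b then v else u)\<rparr>"
  have D0: "n \<in> N \<Longrightarrow> D0 n \<in> Obj C" for n using pD pO by (auto simp: N_def D0_def)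
  have J: "category J"
    by (rule categoryI) (auto simp: J_def N_def intro!: imageI dest: pD(1,2))
  have arrJ: "a \<in> Arr J \<longleftrightarrow> (\<exists>n\<in>N. a = Inl n) \<or> (\<exists>i u v j b. (i, u, v, j) \<in> Rel \<and> a = Inr ((i, u, v, j), b))"
    for a by (auto simp: J_def)
  have Jsm: "small U (Obj J)" "small U (Arr J)"
  proof -
    have N: "small U N" unfolding N_def by (intro small_Un small_image inacc sm)
    then show "small U (Obj J)" by (simp add: J_def)
    have "small U (Inl ` N \<union> Inr ` (Rel \<times> (UNIV :: bool set)))"
      by (intro small_Un small_image small_Times inacc N sm small_finite) simp
    then show "small U (Arr J)" by (simp add: J_def)
  qed
  have Do: "obj_map D (Inl i) = s i" if "i \<in> I" for i using that by (simp add: D_def D0_def N_def)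
  have Dr: "obj_map D (Inr (i, u, v, j)) = Dom C u" if "(i, u, v, j) \<in> Rel" for i u v j
    using that by (simp add: D_def D0_def N_def)
  have Da: "arr_map D (Inl n) = Ident C (obj_map D n)" if "n \<in> N" for n
    using that by (simp add: D_def J_def)
  have Db: "arr_map D (Inr ((i, u, v, j), b)) = (if b then v else u)" if "(i, u, v, j) \<in> Rel" for i u v j b
    using that by (simp add: D_def J_def)
  have DN: "obj_map D n \<in> Obj C" if "n \<in> N" for n using D0[OF that] that by (simp add: D_def)
  have Dext: "obj_map D \<in> extensional (Obj J)" "arr_map D \<in> extensional (Arr J)"
    by (simp_all add: D_def J_def)
  have D: "is_functor J C D"
  proof (rule is_functorI[OF J category_axiom Dext])
    fix a assume "a \<in> Arr J"
    then consider n where "n \<in> N" "a = Inl n" | i u v j b where "(i, u, v, j) \<in> Rel" "a = Inr ((i, u, v, j), b)"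
      unfolding arrJ by blast
    then show "arr_map D a \<in> Hom C (obj_map D (Dom J a)) (obj_map D (Cod J a))"
    proof cases
      case 1 then show ?thesis using DN by (simp add: Da J_def Hom_iff)
    next
      case 2
      then show ?thesis using pD[OF 2(1)] by (simp add: Db Do Dr J_def Hom_iff)
    qed
  next
    fix a b assume ab: "a \<in> Arr J" "b \<in> Arr J" "Cod J a = Dom J b"
    show "arr_map D (b \<cdot>\<^bsub>J\<^esub> a) = arr_map D b \<cdot> arr_map D a"
    proof (cases b)
      case (Inl n)
      then have n: "n \<in> N" using ab(2) by (auto simp: J_def)
      from ab(1) consider m where "m \<in> N" "a = Inl m" | i u v j b where "(i, u, v, j) \<in> Rel" "a = Inr ((i, u, v, j), b)"
        unfolding arrJ by blast
      then show ?thesis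
      proof cases
        case 1
        then show ?thesis using Inl n ab(3) DN by (simp add: Da J_def)
      next
        case 2
        then show ?thesis using Inl n ab(3) pD[OF 2(1)] by (auto simp: Da Db Do J_def)
      qed
    next
      case (Inr rb)
      then obtain i u v j b' where b: "(i, u, v, j) \<in> Rel" "b = Inr ((i, u, v, j), b')"
        using ab(2) unfolding arrJ by blast
      then have "a = Inl (Inr (i, u, v, j))" using ab by (auto simp: J_def split: if_splits)
      moreover have "Inr (i, u, v, j) \<in> N" using b by (simp add: N_def)
      ultimately show ?thesis using b pD[OF b(1)] by (simp add: Da Db Dr J_def)
    qed
  qed (auto simp: J_def Da DN)
  obtain J' :: "('u, 'u) cat" and D' c \<iota> e where J': "small_cat U J'" "is_colimit J' C D' c \<iota>"
    "Obj J' = e ` Obj J" "\<forall>n\<in>Obj J. obj_map D' (e n) = obj_map D n"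
    and L: "is_colimit J C D c (\<lambda>n. \<iota> (e n))"
    using small_colimit_transport[OF small_cocompl Jsm D] .
  define \<kappa> where "\<kappa> i = \<iota> (e (Inl i))" for i
  \<comment> \<open>The leg at a relation is forced to be the common composite, so a cocone amounts
    to a family on the generators that respects the relations.\<close>
  have coc_iff: "is_cocone J C D d k \<longleftrightarrow> d \<in> Obj C \<and> (\<forall>i\<in>I. k (Inl i) \<in> Hom C (s i) d) \<and>
      (\<forall>i u v j. (i, u, v, j) \<in> Rel \<longrightarrow> k (Inl i) \<cdot> u = k (Inr (i, u, v, j)) \<and> k (Inl j) \<cdot> v = k (Inr (i, u, v, j)))"
    (is "?A \<longleftrightarrow> ?B") for d k
  proof
    assume k: ?A
    have "k (Inl i) \<in> Hom C (s i) d" if "i \<in> I" for i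
    proof -
      have "\<forall>n\<in>Obj J. k n \<in> Hom C (obj_map D n) d" using k by (simp add: is_cocone_def)
      moreover have "Inl i \<in> Obj J" using that by (simp add: J_def N_def)
      ultimately show ?thesis using Do[OF that] by fastforce
    qed
    moreover have "k (Inl i) \<cdot> u = k (Inr (i, u, v, j))" "k (Inl j) \<cdot> v = k (Inr (i, u, v, j))"
      if r: "(i, u, v, j) \<in> Rel" for i u v j
    proof -
      have a: "Inr ((i, u, v, j), b) \<in> Arr J" for b using r by (simp add: J_def)
      have "k (Cod J a) \<cdot> arr_map D a = k (Dom J a)" if "a \<in> Arr J" for a
        using k that by (simp add: is_cocone_def)
      from this[OF a[of False]] this[OF a[of True]]
      show "k (Inl i) \<cdot> u = k (Inr (i, u, v, j))" "k (Inl j) \<cdot> v = k (Inr (i, u, v, j))"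
        using Db[OF r] by (simp_all add: J_def)
    qed
    ultimately show ?B using k by (simp add: is_cocone_def)
  next
    assume k: ?B
    have N: "k n \<in> Hom C (obj_map D n) d" if n: "n \<in> N" for n
    proof (cases n)
      case (Inl i) then show ?thesis using k n Do by (auto simp: N_def)
    next
      case (Inr r)
      obtain i u v j where [simp]: "r = (i, u, v, j)" by (cases r)
      have r: "(i, u, v, j) \<in> Rel" using n Inr by (auto simp: N_def)
      have "k (Inr (i, u, v, j)) = k (Inl i) \<cdot> u" using k r by simp
      moreover have "k (Inl i) \<in> Hom C (s i) d" using k pD(1)[OF r] by blast
      ultimately show ?thesis using Inr Dr[OF r] pD[OF r] by (simp add: Hom_iff)
    qed
    show ?A unfolding is_cocone_def
    proof (intro conjI ballI D)
      fix a assume "a \<in> Arr J"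
      then consider n where "n \<in> N" "a = Inl n" | i u v j b where "(i, u, v, j) \<in> Rel" "a = Inr ((i, u, v, j), b)"
        unfolding arrJ by blast
      then show "k (Cod J a) \<cdot> arr_map D a = k (Dom J a)"
      proof cases
        case 1 then show ?thesis using N[OF 1(1)] by (simp add: Da J_def Hom_iff)
      next
        case 2 then show ?thesis using k by (simp add: Db J_def)
      qed
    qed (use k N in \<open>auto simp: J_def\<close>)
  qed
  have cc: "is_cocone J C D c (\<lambda>n. \<iota> (e n))" using L by (simp add: is_colimit_def)
  then have c: "c \<in> Obj C" and k: "\<And>i. i \<in> I \<Longrightarrow> \<kappa> i \<in> Hom C (s i) c"
    and kr: "\<And>i u v j. (i, u, v, j) \<in> Rel \<Longrightarrow> \<kappa> i \<cdot> u = \<iota> (e (Inr (i, u, v, j))) \<and>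
      \<kappa> j \<cdot> v = \<iota> (e (Inr (i, u, v, j)))"
    unfolding coc_iff by (auto simp: \<kappa>_def)
  show thesis
  proof (rule that[OF c k])
    show "\<kappa> i \<cdot> u = \<kappa> j \<cdot> v" if "(i, u, v, j) \<in> Rel" for i u v j using kr[OF that] by simp
  next
    fix d and \<mu> :: "'i \<Rightarrow> 'a" assume d: "d \<in> Obj C" and l: "\<And>i. i \<in> I \<Longrightarrow> \<mu> i \<in> Hom C (s i) d"
      and lr: "\<And>i u v j. (i, u, v, j) \<in> Rel \<Longrightarrow> \<mu> i \<cdot> u = \<mu> j \<cdot> v"
    define q :: "'i + 'i \<times> 'a \<times> 'a \<times> 'i \<Rightarrow> 'a" where "q = case_sum \<mu> (\<lambda>(i, u, v, j). \<mu> i \<cdot> u)"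
    have "is_cocone J C D d q" unfolding coc_iff q_def using d l lr by simp
    then have ex: "\<exists>!m. m \<in> Hom C c d \<and> (\<forall>n\<in>N. m \<cdot> \<iota> (e n) = q n)"
      using L unfolding is_colimit_def by (simp add: J_def)
    have "(\<forall>n\<in>N. m \<cdot> \<iota> (e n) = q n) \<longleftrightarrow> (\<forall>i\<in>I. m \<cdot> \<kappa> i = \<mu> i)" if m: "m \<in> Hom C c d" for m
    proof
      assume "\<forall>n\<in>N. m \<cdot> \<iota> (e n) = q n"
      then show "\<forall>i\<in>I. m \<cdot> \<kappa> i = \<mu> i" by (auto simp: N_def q_def \<kappa>_def)
    next
      assume *: "\<forall>i\<in>I. m \<cdot> \<kappa> i = \<mu> i"
      have "m \<cdot> \<iota> (e (Inr (i, u, v, j))) = \<mu> i \<cdot> u" if r: "(i, u, v, j) \<in> Rel" for i u v j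
      proof -
        have "m \<cdot> (\<kappa> i \<cdot> u) = (m \<cdot> \<kappa> i) \<cdot> u"
          by (rule comp_assoc[symmetric]) (use m k[OF pD(1)[OF r]] pD[OF r] in \<open>auto simp: Hom_iff\<close>)
        then show ?thesis using kr[OF r] * pD(1)[OF r] by simp
      qed
      with * show "\<forall>n\<in>N. m \<cdot> \<iota> (e n) = q n" by (auto simp: N_def q_def \<kappa>_def)
    qed
    with ex show "\<exists>!m. m \<in> Hom C c d \<and> (\<forall>i\<in>I. m \<cdot> \<kappa> i = \<mu> i)" by (metis (no_types, lifting))
  next
    fix h assume h: "h \<in> Arr C" "Cod C h = c"
    let ?R = "{h \<in> Arr C. \<exists>j\<in>Obj J'. \<exists>k\<in>Arr C. Cod C k = obj_map D' j \<and> h = \<iota> j \<cdot> k}"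
    have "covering c ?R" by (rule colimit_covering[OF fin_complete stable_colimits J'(1,2)])
    then have cov: "covering (Dom C h) (pull_sieve h ?R)" using covering_pull h by blast
    have "\<exists>i\<in>I. \<exists>k\<in>Arr C. Cod C k = s i \<and> Dom C k = Dom C g \<and> h \<cdot> g = \<kappa> i \<cdot> k"
      if g: "g \<in> pull_sieve h ?R" for g
    proof -
      from g obtain n k where g: "g \<in> Arr C" "Cod C g = Dom C h"
        and nk: "n \<in> N" "k \<in> Arr C" "Cod C k = obj_map D n" "h \<cdot> g = \<iota> (e n) \<cdot> k"
        using J'(3,4) by (auto simp: pull_sieve_def J_def)
      have hg: "Dom C (h \<cdot> g) = Dom C g" by (rule comp_dom) (use g h in auto)
      show ?thesis
      proof (cases n)
        case (Inl i)
        then have i: "i \<in> I" "Cod C k = s i" using nk Do by (auto simp: N_def)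
        have "Dom C (\<kappa> i \<cdot> k) = Dom C k" by (rule comp_dom) (use i nk k in \<open>auto simp: Hom_iff\<close>)
        then have "Dom C k = Dom C g" using hg nk(4) Inl by (simp add: \<kappa>_def)
        then show ?thesis using i nk Inl by (auto simp: \<kappa>_def)
      next
        \<comment> \<open>A leg at a relation factors through the generator i by way of u, so the
          legs at the generators already generate the cover.\<close>
        case (Inr r)
        obtain i u v j where ruv: "r = (i, u, v, j)" by (cases r)
        have r: "(i, u, v, j) \<in> Rel" using nk Inr ruv by (auto simp: N_def)
        have ku: "Cod C k = Dom C u" using nk Inr ruv Dr[OF r] by simp
        have "(\<kappa> i \<cdot> u) \<cdot> k = \<kappa> i \<cdot> (u \<cdot> k)"
          by (rule comp_assoc) (use k[OF pD(1)[OF r]] pD[OF r] nk ku in \<open>auto simp: Hom_iff\<close>)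
        then have eq: "h \<cdot> g = \<kappa> i \<cdot> (u \<cdot> k)" using nk(4) Inr ruv kr[OF r] by simp
        have "Dom C (\<kappa> i \<cdot> (u \<cdot> k)) = Dom C (u \<cdot> k)"
          by (rule comp_dom) (use k[OF pD(1)[OF r]] pD[OF r] nk ku in \<open>auto simp: Hom_iff\<close>)
        then have "Dom C (u \<cdot> k) = Dom C g" using hg eq by simp
        then show ?thesis using eq pD[OF r] nk ku
          by (intro bexI[of _ i] bexI[of _ "u \<cdot> k"]) auto
      qed
    qed
    with cov show "locally (Dom C h)
       (\<lambda>g. \<exists>i\<in>I. \<exists>k\<in>Arr C. Cod C k = s i \<and> Dom C k = Dom C g \<and> h \<cdot> g = \<kappa> i \<cdot> k)"
      unfolding locally_def by blast
  qed
qed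

text \<open>An initial object is the colimit of the empty diagram, so by stability of colimits the
  empty sieve covers it and everything that maps to it. Disjointness of coproducts is used in this
  form.\<close>

lemma initial_locally_False:
  assumes z: "initial_object C z" and h: "h \<in> Arr C" "Cod C h = z"
  shows "locally (Dom C h) (\<lambda>_. False)"
proof -
  define J :: "('u, 'u) cat" where
    "J = \<lparr>Obj = {}, Arr = {}, Dom = id, Cod = id, Ident = id, Comp = (\<lambda>_. id)\<rparr>"
  define D :: "('u, 'u, 'o, 'a) ftor" where
    "D = \<lparr>obj_map = (\<lambda>_. undefined), arr_map = (\<lambda>_. undefined)\<rparr>"
  have J: "category J" by (rule categoryI) (auto simp: J_def)
  have sJ: "small_cat U J" using J by (simp add: small_cat_def J_def small_finite[OF inacc])
  have D: "is_functor J C D"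
  proof (rule is_functorI)
    show "category J" by fact
  qed (auto simp: D_def J_def category_axiom)
  have "is_colimit J C D z undefined"
    using D z by (auto simp: is_colimit_def is_cocone_def initial_object_def J_def)
  from colimit_covering[OF fin_complete stable_colimits sJ this]
  have "covering z {}" by (simp add: J_def)
  from covering_pull[OF this h] show ?thesis unfolding locally_def pull_sieve_def by auto
qed

text \<open>Disjointness in local form: an element common to two different summands factors through
  their pullback, which is initial, and therefore lives over an object covered by the empty
  sieve.\<close>

lemma coproduct_exists:
  assumes I: "small U I" and s: "\<And>i. i \<in> I \<Longrightarrow> s i \<in> Obj C"
  obtains X \<iota> where "X \<in> Obj C" "\<And>i. i \<in> I \<Longrightarrow> \<iota> i \<in> Hom C (s i) X"
    "\<And>i k k'. i \<in> I \<Longrightarrow> k \<in> Arr C \<Longrightarrow> k' \<in> Arr C \<Longrightarrow> Dom C k = Dom C k' \<Longrightarrow> Cod C k = s i \<Longrightarrow>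
      Cod C k' = s i \<Longrightarrow> \<iota> i \<cdot> k = \<iota> i \<cdot> k' \<Longrightarrow> k = k'"
    "\<And>i j k k'. i \<in> I \<Longrightarrow> j \<in> I \<Longrightarrow> i \<noteq> j \<Longrightarrow> k \<in> Arr C \<Longrightarrow> k' \<in> Arr C \<Longrightarrow> Dom C k = Dom C k' \<Longrightarrow>
      Cod C k = s i \<Longrightarrow> Cod C k' = s j \<Longrightarrow> \<iota> i \<cdot> k = \<iota> j \<cdot> k' \<Longrightarrow> locally (Dom C k) (\<lambda>_. False)"
    "\<And>h. h \<in> Arr C \<Longrightarrow> Cod C h = X \<Longrightarrow> locally (Dom C h)
       (\<lambda>g. \<exists>i\<in>I. \<exists>k\<in>Arr C. Cod C k = s i \<and> Dom C k = Dom C g \<and> h \<cdot> g = \<iota> i \<cdot> k)"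
proof -
  obtain e :: "_ \<Rightarrow> 'u" where e: "inj_on e I" using small_inj_ex[OF I] by blast
  define e' where "e' = inv_into I e"
  have ee: "e' (e i) = i" if "i \<in> I" for i using that e by (simp add: e'_def)
  let ?K = "e ` I"
  have sK: "small U ?K" using I by (rule small_image)
  define D where "D = \<lparr>obj_map = (\<lambda>x\<in>?K. s (e' x)), arr_map = (\<lambda>x\<in>?K. Ident C (s (e' x)))\<rparr>"
  have dJ: "category (discrete_cat ?K)" by (rule categoryI) (auto simp: discrete_cat_def)
  have sJ: "small_cat U (discrete_cat ?K)" using dJ sK by (simp add: small_cat_def discrete_cat_def)
  have Do: "obj_map D (e i) = s i" "arr_map D (e i) = Ident C (s i)" if "i \<in> I" for i
    using that ee by (simp_all add: D_def)
  have D: "is_functor (discrete_cat ?K) C D"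
  proof (rule is_functorI[OF dJ category_axiom])
    fix f g assume "f \<in> Arr (discrete_cat ?K)" "g \<in> Arr (discrete_cat ?K)"
      "Cod (discrete_cat ?K) f = Dom (discrete_cat ?K) g"
    then obtain i where "i \<in> I" "f = e i" "g = e i" by (auto simp: discrete_cat_def)
    then show "arr_map D (g \<cdot>\<^bsub>discrete_cat ?K\<^esub> f) = arr_map D g \<cdot> arr_map D f"
      using s Do by (simp add: discrete_cat_def)
  qed (use s Do in \<open>auto simp: discrete_cat_def D_def Hom_iff\<close>)
  obtain X \<iota> where L: "is_colimit (discrete_cat ?K) C D X \<iota>"
    using small_cocompl sJ D unfolding small_cocomplete_def by blast
  have X: "X \<in> Obj C" and \<iota>: "\<And>i. i \<in> I \<Longrightarrow> \<iota> (e i) \<in> Hom C (s i) X"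
    using L Do by (auto simp: is_colimit_def is_cocone_def discrete_cat_def)
  have mono: "monic C (\<iota> (e i))" if "i \<in> I" for i
    using disjoint_coprods sK L that unfolding disjoint_coproducts_def by blast
  have disj: "initial_object C (Dom C p)"
    if "i \<in> I" "j \<in> I" "i \<noteq> j" "is_pullback C (\<iota> (e i)) (\<iota> (e j)) p q" for i j p q
  proof -
    have "e i \<noteq> e j" using that e by (auto dest: inj_onD)
    then show ?thesis using disjoint_coprods sK L that unfolding disjoint_coproducts_def by blast
  qed
  show thesis
  proof (rule that[OF X \<iota>])
    fix i k k' assume "i \<in> I" "k \<in> Arr C" "k' \<in> Arr C" "Dom C k = Dom C k'" "Cod C k = s i"
      "Cod C k' = s i" "\<iota> (e i) \<cdot> k = \<iota> (e i) \<cdot> k'"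
    then show "k = k'" using mono[of i] \<iota>[of i] unfolding monic_def Hom_iff by metis
  next
    fix i j k k' assume i: "i \<in> I" "j \<in> I" "i \<noteq> j" and k: "k \<in> Arr C" "k' \<in> Arr C" "Dom C k = Dom C k'"
      "Cod C k = s i" "Cod C k' = s j" "\<iota> (e i) \<cdot> k = \<iota> (e j) \<cdot> k'"
    have ij: "\<iota> (e i) \<in> Arr C" "\<iota> (e j) \<in> Arr C" "Cod C (\<iota> (e i)) = Cod C (\<iota> (e j))"
      "Dom C (\<iota> (e i)) = s i" "Dom C (\<iota> (e j)) = s j" using \<iota> i by (auto simp: Hom_iff)
    obtain p q where pq: "is_pullback C (\<iota> (e i)) (\<iota> (e j)) p q" using pullback_ex[OF ij(1-3)] by blast
    obtain u where "u \<in> Arr C" "Dom C u = Dom C k" "Cod C u = Dom C p"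
      using is_pullback_ex[OF pq k(1-3)] k ij by auto
    then show "locally (Dom C k) (\<lambda>_. False)" using initial_locally_False[OF disj[OF i pq]] by metis
  next
    fix h assume h: "h \<in> Arr C" "Cod C h = X"
    let ?R = "{h \<in> Arr C. \<exists>j\<in>Obj (discrete_cat ?K). \<exists>k\<in>Arr C. Cod C k = obj_map D j \<and> h = \<iota> j \<cdot> k}"
    have "covering X ?R" by (rule colimit_covering[OF fin_complete stable_colimits sJ L])
    then have cov: "covering (Dom C h) (pull_sieve h ?R)" using covering_pull h by blast
    have "\<exists>i\<in>I. \<exists>k\<in>Arr C. Cod C k = s i \<and> Dom C k = Dom C g \<and> h \<cdot> g = \<iota> (e i) \<cdot> k"
      if g: "g \<in> pull_sieve h ?R" for g
    proof -
      from g obtain i k where g: "g \<in> Arr C" "Cod C g = Dom C h"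
        and ik: "i \<in> I" "k \<in> Arr C" "Cod C k = s i" "h \<cdot> g = \<iota> (e i) \<cdot> k"
        using Do by (auto simp: pull_sieve_def discrete_cat_def)
      have "Dom C (h \<cdot> g) = Dom C g" by (rule comp_dom) (use g h in auto)
      moreover have "Dom C (\<iota> (e i) \<cdot> k) = Dom C k"
        by (rule comp_dom) (use ik \<iota>[OF ik(1)] in \<open>auto simp: Hom_iff\<close>)
      ultimately show ?thesis using ik by auto
    qed
    with cov show "locally (Dom C h)
       (\<lambda>g. \<exists>i\<in>I. \<exists>k\<in>Arr C. Cod C k = s i \<and> Dom C k = Dom C g \<and> h \<cdot> g = \<iota> (e i) \<cdot> k)"
      unfolding locally_def by blast
  qed
qed

text \<open>The object \<open>E\<close> is the image in \<open>X \<times> X\<close> of the coproduct of the given family of pairs, built as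
  the colimit of the diagram of the pairs and their pairwise pullbacks.\<close>

lemma relation_exists:
  assumes T: "small U T" and X: "X \<in> Obj C"
    and uv: "\<And>u v. (u, v) \<in> T \<Longrightarrow> u \<in> Arr C \<and> v \<in> Arr C \<and> Dom C u = Dom C v \<and> Cod C u = X \<and> Cod C v = X"
  obtains E r s where "E \<in> Obj C" "r \<in> Hom C E X" "s \<in> Hom C E X"
    "\<And>h k. h \<in> Arr C \<Longrightarrow> k \<in> Arr C \<Longrightarrow> Dom C h = Dom C k \<Longrightarrow> Cod C h = E \<Longrightarrow> Cod C k = E \<Longrightarrow>
      r \<cdot> h = r \<cdot> k \<Longrightarrow> s \<cdot> h = s \<cdot> k \<Longrightarrow> h = k"
    "\<And>k k'. k \<in> Arr C \<Longrightarrow> k' \<in> Arr C \<Longrightarrow> Dom C k = Dom C k' \<Longrightarrow> Cod C k = X \<Longrightarrow> Cod C k' = X \<Longrightarrow>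
      (\<exists>h\<in>Hom C (Dom C k) E. k = r \<cdot> h \<and> k' = s \<cdot> h) \<longleftrightarrow>
      locally (Dom C k) (\<lambda>g. \<exists>(u, v)\<in>T. \<exists>h\<in>Arr C. Cod C h = Dom C u \<and> k \<cdot> g = u \<cdot> h \<and> k' \<cdot> g = v \<cdot> h)"
proof -
  obtain p q where prod: "is_product X X p q" using product_exists[OF fin_complete X X] by blast
  have pq: "p \<in> Arr C" "q \<in> Arr C" "Dom C p = Dom C q" "Cod C p = X" "Cod C q = X"
    using prod by (simp_all add: is_product_def)
  have pair: "\<exists>u\<in>Arr C. Dom C u = Dom C h \<and> Cod C u = Dom C p \<and> p \<cdot> u = h \<and> q \<cdot> u = k"
    if "h \<in> Arr C" "k \<in> Arr C" "Dom C h = Dom C k" "Cod C h = X" "Cod C k = X" for h k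
    using prod that unfolding is_product_def by blast
  have pq_eqI: "u = v" if "u \<in> Arr C" "v \<in> Arr C" "Dom C u = Dom C v" "Cod C u = Dom C p"
    "Cod C v = Dom C p" "p \<cdot> u = p \<cdot> v" "q \<cdot> u = q \<cdot> v" for u v
    using prod that unfolding is_product_def by blast
  let ?Z = "Dom C p"
  \<comment> \<open>Each pair becomes a single arrow into the product \<open>?Z\<close> of X with
    itself.\<close>
  have "\<exists>w\<in>Arr C. Dom C w = Dom C (fst \<tau>) \<and> Cod C w = ?Z \<and> p \<cdot> w = fst \<tau> \<and> q \<cdot> w = snd \<tau>"
    if "\<tau> \<in> T" for \<tau>
    using that uv[of "fst \<tau>" "snd \<tau>"] by (intro pair) auto
  then obtain w where w: "\<And>\<tau>. \<tau> \<in> T \<Longrightarrow> w \<tau> \<in> Arr C \<and> Dom C (w \<tau>) = Dom C (fst \<tau>) \<and>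
      Cod C (w \<tau>) = ?Z \<and> p \<cdot> w \<tau> = fst \<tau> \<and> q \<cdot> w \<tau> = snd \<tau>" by metis
  have "\<exists>a b. is_pullback C (w \<tau>) (w \<tau>') a b" if "\<tau> \<in> T" "\<tau>' \<in> T" for \<tau> \<tau>'
    by (rule pullback_ex) (use w that in auto)
  then obtain a b where pb: "\<And>\<tau> \<tau>'. \<tau> \<in> T \<Longrightarrow> \<tau>' \<in> T \<Longrightarrow> is_pullback C (w \<tau>) (w \<tau>') (a \<tau> \<tau>') (b \<tau> \<tau>')"
    by metis
  define s where "s \<tau> = Dom C (fst \<tau> :: 'a)" for \<tau> :: "'a \<times> 'a"
  \<comment> \<open>Gluing the sources of the arrows \<open>w \<tau>\<close> along all their
    pairwise pullbacks identifies elements with the same image in the product, which makes the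
    comparison \<open>m\<close> monic.\<close>
  define Rel where "Rel = (\<lambda>(\<tau>, \<tau>'). (\<tau>, a \<tau> \<tau>', b \<tau> \<tau>', \<tau>')) ` (T \<times> T)"
  have Rel: "(\<tau>, f, g, \<tau>') \<in> Rel \<longleftrightarrow> \<tau> \<in> T \<and> \<tau>' \<in> T \<and> f = a \<tau> \<tau>' \<and> g = b \<tau> \<tau>'" for \<tau> \<tau>' f g
    by (auto simp: Rel_def)
  have sR: "small U Rel" unfolding Rel_def by (intro small_image small_Times inacc T)
  have "pres_data T s Rel" unfolding pres_data_def
  proof (intro conjI ballI allI impI)
    fix \<tau> assume "\<tau> \<in> T" then show "s \<tau> \<in> Obj C" using uv[of "fst \<tau>" "snd \<tau>"] by (simp add: s_def)
  next
    fix \<tau> f g \<tau>' assume "(\<tau>, f, g, \<tau>') \<in> Rel"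
    then have t: "\<tau> \<in> T" "\<tau>' \<in> T" "f = a \<tau> \<tau>'" "g = b \<tau> \<tau>'" unfolding Rel by auto
    note d = is_pullbackD[OF pb[OF t(1,2)]]
    show "\<tau> \<in> T" "\<tau>' \<in> T" "f \<in> Arr C" "g \<in> Arr C" "Dom C f = Dom C g" "Cod C f = s \<tau>" "Cod C g = s \<tau>'"
      using t d w[OF t(1)] w[OF t(2)] by (simp_all add: s_def)
  qed
  from presented_colimit[OF this T sR] obtain E \<kappa> where E: "E \<in> Obj C"
    and \<kappa>: "\<And>\<tau>. \<tau> \<in> T \<Longrightarrow> \<kappa> \<tau> \<in> Hom C (s \<tau>) E"
    and \<kappa>_rel: "\<And>\<tau> f g \<tau>'. (\<tau>, f, g, \<tau>') \<in> Rel \<Longrightarrow> \<kappa> \<tau> \<cdot> f = \<kappa> \<tau>' \<cdot> g"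
    and univ: "\<And>d \<mu>. d \<in> Obj C \<Longrightarrow> (\<And>i. i \<in> T \<Longrightarrow> \<mu> i \<in> Hom C (s i) d) \<Longrightarrow>
       (\<And>i u v j. (i, u, v, j) \<in> Rel \<Longrightarrow> \<mu> i \<cdot> u = \<mu> j \<cdot> v) \<Longrightarrow>
       \<exists>!m. m \<in> Hom C E d \<and> (\<forall>i\<in>T. m \<cdot> \<kappa> i = \<mu> i)"
    and loc: "\<And>h. h \<in> Arr C \<Longrightarrow> Cod C h = E \<Longrightarrow> locally (Dom C h)
       (\<lambda>g. \<exists>i\<in>T. \<exists>k\<in>Arr C. Cod C k = s i \<and> Dom C k = Dom C g \<and> h \<cdot> g = \<kappa> i \<cdot> k)"
    by blast
  have "\<exists>!m. m \<in> Hom C E ?Z \<and> (\<forall>i\<in>T. m \<cdot> \<kappa> i = w i)"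
  proof (rule univ)
    show "?Z \<in> Obj C" using pq by simp
    show "w i \<in> Hom C (s i) ?Z" if "i \<in> T" for i using w[OF that] by (simp add: Hom_iff s_def)
    show "w i \<cdot> u = w j \<cdot> v" if "(i, u, v, j) \<in> Rel" for i u v j
      using that is_pullbackD(9)[OF pb] unfolding Rel by auto
  qed
  then obtain m where m: "m \<in> Hom C E ?Z" and mk: "\<And>\<tau>. \<tau> \<in> T \<Longrightarrow> m \<cdot> \<kappa> \<tau> = w \<tau>" by blast
  have ma: "m \<in> Arr C" "Dom C m = E" "Cod C m = ?Z" using m by (auto simp: Hom_iff)
  have ka: "\<kappa> \<tau> \<in> Arr C" "Dom C (\<kappa> \<tau>) = s \<tau>" "Cod C (\<kappa> \<tau>) = E" if "\<tau> \<in> T" for \<tau>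
    using \<kappa>[OF that] by (auto simp: Hom_iff)
  have mkl: "m \<cdot> (\<kappa> \<tau> \<cdot> l) = w \<tau> \<cdot> l" if "\<tau> \<in> T" "l \<in> Arr C" "Cod C l = s \<tau>" for \<tau> l
    using comp_assoc[of l "\<kappa> \<tau>" m] that ka[OF that(1)] ma mk by simp
  \<comment> \<open>Monicity is local: two elements of E come locally from members of T, and
    equality of their images factors through a pullback that \<open>Rel\<close> has
    identified.\<close>
  have mono: "h = h'" if h: "h \<in> Arr C" "Cod C h = E" and h': "h' \<in> Arr C" "Cod C h' = E"
    and d: "Dom C h = Dom C h'" and eq: "m \<cdot> h = m \<cdot> h'" for h h'
  proof (rule locally_eqD)
    show "h \<in> Hom C (Dom C h) E" "h' \<in> Hom C (Dom C h) E" using h h' d by (auto simp: Hom_iff)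
    show "locally (Dom C h) (\<lambda>g. h \<cdot> g = h' \<cdot> g)"
    proof (rule locally_mono[OF locally_conj[OF loc[OF h] loc[OF h', folded d]]])
      fix g assume g: "g \<in> Arr C" "Cod C g = Dom C h" and
        *: "(\<exists>i\<in>T. \<exists>k\<in>Arr C. Cod C k = s i \<and> Dom C k = Dom C g \<and> h \<cdot> g = \<kappa> i \<cdot> k) \<and>
          (\<exists>i\<in>T. \<exists>k\<in>Arr C. Cod C k = s i \<and> Dom C k = Dom C g \<and> h' \<cdot> g = \<kappa> i \<cdot> k)"
      then obtain i k i' k' where i: "i \<in> T" "k \<in> Arr C" "Cod C k = s i" "Dom C k = Dom C g" "h \<cdot> g = \<kappa> i \<cdot> k"
        and i': "i' \<in> T" "k' \<in> Arr C" "Cod C k' = s i'" "Dom C k' = Dom C g" "h' \<cdot> g = \<kappa> i' \<cdot> k'"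
        by blast
      have "w i \<cdot> k = m \<cdot> (h \<cdot> g)" using mkl[OF i(1-3)] i(5) by simp
      also have "\<dots> = (m \<cdot> h) \<cdot> g" by (rule comp_assoc[symmetric]) (use g h ma in auto)
      also have "\<dots> = (m \<cdot> h') \<cdot> g" using eq by simp
      also have "\<dots> = m \<cdot> (h' \<cdot> g)" by (rule comp_assoc) (use g h' d ma in auto)
      also have "\<dots> = w i' \<cdot> k'" using mkl[OF i'(1-3)] i'(5) by simp
      finally have eqw: "w i \<cdot> k = w i' \<cdot> k'" .
      obtain z where z: "z \<in> Arr C" "Cod C z = Dom C (a i i')" "a i i' \<cdot> z = k" "b i i' \<cdot> z = k'"
        using is_pullback_ex[OF pb[OF i(1) i'(1)] i(2) i'(2) _ _ _ eqw] i i' w by (auto simp: s_def)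
      note d = is_pullbackD[OF pb[OF i(1) i'(1)]]
      have "\<kappa> i \<cdot> k = (\<kappa> i \<cdot> a i i') \<cdot> z" unfolding z(3)[symmetric]
        by (rule comp_assoc[symmetric]) (use z d ka[OF i(1)] w[OF i(1)] in \<open>auto simp: s_def\<close>)
      also have "\<dots> = (\<kappa> i' \<cdot> b i i') \<cdot> z" using \<kappa>_rel[of i _ _ i'] i(1) i'(1) unfolding Rel by simp
      also have "\<dots> = \<kappa> i' \<cdot> k'" unfolding z(4)[symmetric]
        by (rule comp_assoc) (use z d ka[OF i'(1)] w[OF i'(1)] in \<open>auto simp: s_def\<close>)
      finally show "h \<cdot> g = h' \<cdot> g" using i(5) i'(5) by simp
    qed
  qed
  let ?r = "p \<cdot> m" and ?s = "q \<cdot> m"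
  have rs: "?r \<in> Hom C E X" "?s \<in> Hom C E X" using pq ma by (simp_all add: Hom_iff)
  show thesis
  proof (rule that[OF E rs])
    fix h k assume h: "h \<in> Arr C" "k \<in> Arr C" "Dom C h = Dom C k" "Cod C h = E" "Cod C k = E"
      "?r \<cdot> h = ?r \<cdot> k" "?s \<cdot> h = ?s \<cdot> k"
    have "p \<cdot> (m \<cdot> h) = p \<cdot> (m \<cdot> k)" "q \<cdot> (m \<cdot> h) = q \<cdot> (m \<cdot> k)"
      using h(6,7) comp_assoc[OF _ ma(1) pq(1)] comp_assoc[OF _ ma(1) pq(2)] h(1-5) ma pq(3) by simp_all
    then have "m \<cdot> h = m \<cdot> k" by (rule pq_eqI[rotated 5]) (use h(1-5) ma in simp_all)
    then show "h = k" by (rule mono[OF h(1,4,2,5,3)])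
  next
    fix k k' assume k: "k \<in> Arr C" "k' \<in> Arr C" "Dom C k = Dom C k'" "Cod C k = X" "Cod C k' = X"
    let ?Q = "\<lambda>g. \<exists>(u, v)\<in>T. \<exists>h\<in>Arr C. Cod C h = Dom C u \<and> k \<cdot> g = u \<cdot> h \<and> k' \<cdot> g = v \<cdot> h"
    have pw: "p \<cdot> (w \<tau> \<cdot> l) = fst \<tau> \<cdot> l" "q \<cdot> (w \<tau> \<cdot> l) = snd \<tau> \<cdot> l"
      if "\<tau> \<in> T" "l \<in> Arr C" "Cod C l = s \<tau>" for \<tau> l
      using comp_assoc[of l "w \<tau>" p] comp_assoc[of l "w \<tau>" q] w[OF that(1)] that pq by (simp_all add: s_def)
    show "(\<exists>h\<in>Hom C (Dom C k) E. k = ?r \<cdot> h \<and> k' = ?s \<cdot> h) \<longleftrightarrow> locally (Dom C k) ?Q"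
    proof
      assume "\<exists>h\<in>Hom C (Dom C k) E. k = ?r \<cdot> h \<and> k' = ?s \<cdot> h"
      then obtain h where h: "h \<in> Arr C" "Dom C h = Dom C k" "Cod C h = E" "k = ?r \<cdot> h" "k' = ?s \<cdot> h"
        by (auto simp: Hom_iff)
      show "locally (Dom C k) ?Q"
      proof (rule locally_mono[OF loc[OF h(1,3), unfolded h(2)]])
        fix g assume g: "g \<in> Arr C" "Cod C g = Dom C k"
          and "\<exists>i\<in>T. \<exists>k\<in>Arr C. Cod C k = s i \<and> Dom C k = Dom C g \<and> h \<cdot> g = \<kappa> i \<cdot> k"
        then obtain \<tau> l where l: "\<tau> \<in> T" "l \<in> Arr C" "Cod C l = s \<tau>" "h \<cdot> g = \<kappa> \<tau> \<cdot> l" by blast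
        have "k \<cdot> g = p \<cdot> (m \<cdot> (h \<cdot> g))" "k' \<cdot> g = q \<cdot> (m \<cdot> (h \<cdot> g))"
          unfolding h(4,5) using g h(1-3) ma pq by (simp_all add: comp_assoc)
        then have "k \<cdot> g = fst \<tau> \<cdot> l" "k' \<cdot> g = snd \<tau> \<cdot> l"
          unfolding l(4) mkl[OF l(1-3)] pw[OF l(1-3)] by auto
        then show "?Q g" using l by (intro bexI[of _ \<tau>]) (auto simp: s_def split_beta)
      qed
    next
      assume Q: "locally (Dom C k) ?Q"
      obtain z where z: "z \<in> Arr C" "Dom C z = Dom C k" "Cod C z = ?Z" "p \<cdot> z = k" "q \<cdot> z = k'"
        using pair[OF k] by blast
      \<comment> \<open>The pair \<open>z\<close> factors through \<open>m\<close> locally; as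
        \<open>m\<close> is monic, these factorizations are compatible and glue.\<close>
      have "locally (Dom C k) (\<lambda>g. \<exists>y. y \<in> Hom C (Dom C g) E \<and> m \<cdot> y = z \<cdot> g)"
      proof (rule locally_mono[OF Q])
        fix g assume g: "g \<in> Arr C" "Cod C g = Dom C k" and "?Q g"
        then obtain u v l where l: "(u, v) \<in> T" "l \<in> Arr C" "Cod C l = Dom C u" "k \<cdot> g = u \<cdot> l" "k' \<cdot> g = v \<cdot> l"
          by auto
        let ?\<tau> = "(u, v)"
        have ls: "Cod C l = s ?\<tau>" using l by (simp add: s_def)
        have zg: "z \<cdot> g \<in> Arr C" "Dom C (z \<cdot> g) = Dom C g" "Cod C (z \<cdot> g) = ?Z" using z g by simp_all
        have "Dom C (k \<cdot> g) = Dom C g" by (rule comp_dom) (use k g in auto)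
        moreover have "Dom C (u \<cdot> l) = Dom C l" by (rule comp_dom) (use uv l in auto)
        ultimately have dl: "Dom C l = Dom C g" using l(4) by simp
        have "w ?\<tau> \<cdot> l = z \<cdot> g"
        proof (rule pq_eqI)
          have "p \<cdot> (z \<cdot> g) = k \<cdot> g" "q \<cdot> (z \<cdot> g) = k' \<cdot> g"
            using comp_assoc[of g z p] comp_assoc[of g z q] z g pq by simp_all
          then show "p \<cdot> (w ?\<tau> \<cdot> l) = p \<cdot> (z \<cdot> g)" "q \<cdot> (w ?\<tau> \<cdot> l) = q \<cdot> (z \<cdot> g)"
            using pw[OF l(1,2) ls] l(4,5) by simp_all
        qed (use w[OF l(1)] l zg dl in auto)
        then have "m \<cdot> (\<kappa> ?\<tau> \<cdot> l) = z \<cdot> g" using mkl[OF l(1,2) ls] by simp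
        moreover have "\<kappa> ?\<tau> \<cdot> l \<in> Hom C (Dom C g) E" using ka[OF l(1)] l(2) ls dl by (simp add: Hom_iff)
        ultimately show "\<exists>y. y \<in> Hom C (Dom C g) E \<and> m \<cdot> y = z \<cdot> g" by blast
      qed
      then obtain n where n: "n \<in> Hom C (Dom C k) E" "locally (Dom C k) (\<lambda>g. m \<cdot> (n \<cdot> g) = z \<cdot> g)"
      proof (rule locally_glue[OF E, where \<Phi> = "\<lambda>g y. m \<cdot> y = z \<cdot> g"])
        fix h y y' assume yy: "y \<in> Hom C (Dom C h) E" "y' \<in> Hom C (Dom C h) E" "m \<cdot> y = z \<cdot> h" "m \<cdot> y' = z \<cdot> h"
        show "y = y'" by (rule mono) (use yy in \<open>simp_all add: Hom_iff\<close>)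
      next
        fix h y g assume "h \<in> Arr C" "Cod C h = Dom C k" "y \<in> Hom C (Dom C h) E" "g \<in> Arr C"
          "Cod C g = Dom C h" "m \<cdot> y = z \<cdot> h"
        then show "m \<cdot> (y \<cdot> g) = z \<cdot> (h \<cdot> g)"
          using comp_assoc[of g y m] comp_assoc[of g h z] z ma by (simp add: Hom_iff)
      qed
      have na: "n \<in> Arr C" "Dom C n = Dom C k" "Cod C n = E" using n(1) by (auto simp: Hom_iff)
      have "m \<cdot> n = z"
      proof (rule locally_eqD)
        show "locally (Dom C k) (\<lambda>g. (m \<cdot> n) \<cdot> g = z \<cdot> g)"
          by (rule locally_mono[OF n(2)]) (use na ma in \<open>simp add: comp_assoc\<close>)
        show "m \<cdot> n \<in> Hom C (Dom C k) ?Z" "z \<in> Hom C (Dom C k) ?Z"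
          using na ma z by (simp_all add: Hom_iff)
      qed
      then have "k = ?r \<cdot> n" "k' = ?s \<cdot> n" using z(4,5) na ma pq by (simp_all add: comp_assoc)
      then show "\<exists>h\<in>Hom C (Dom C k) E. k = ?r \<cdot> h \<and> k' = ?s \<cdot> h" using n(1) by blast
    qed
  qed
qed

end


section \<open>The reflection of a small presheaf\<close>

context pretopos
begin

text \<open>One fixed pullback for each cospan keeps the set of generic zigzags small.\<close>

definition some_pullback :: "'a \<Rightarrow> 'a \<Rightarrow> 'a \<times> 'a" where
  "some_pullback f g = (SOME pq. is_pullback C f g (fst pq) (snd pq))"

lemma some_pullback:
  assumes "f \<in> Arr C" "g \<in> Arr C" "Cod C f = Cod C g"
  shows "is_pullback C f g (fst (some_pullback f g)) (snd (some_pullback f g))"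
proof -
  have "\<exists>pq. is_pullback C f g (fst pq) (snd pq)" using pullback_ex[OF assms] by simp
  then show ?thesis unfolding some_pullback_def by (rule someI_ex)
qed

text \<open>A zigzag may use a relation in either direction; symmetrizing leaves a single kind of
  step for the recursion in \<open>spans\<close>.\<close>

definition sym_rel :: "('i \<times> 'a \<times> 'a \<times> 'i) set \<Rightarrow> ('i \<times> 'a \<times> 'a \<times> 'i) set" where
  "sym_rel Rel = Rel \<union> (\<lambda>(i, u, v, j). (j, v, u, i)) ` Rel"

text \<open>Generic zigzags of length \<open>n\<close>: every zigzag of that length is a restriction of one of them.\<close>

primrec spans :: "'i set \<Rightarrow> ('i \<Rightarrow> 'o) \<Rightarrow> ('i \<times> 'a \<times> 'a \<times> 'i) set \<Rightarrow> nat \<Rightarrow> ('i \<times> 'a \<times> 'a \<times> 'i) set" where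
  "spans I s Rel 0 = (\<lambda>i. (i, Ident C (s i), Ident C (s i), i)) ` I"
| "spans I s Rel (Suc n) = (\<lambda>((i, u, v, l), (l', u', v', j)).
      (i, u \<cdot> fst (some_pullback v u'), v' \<cdot> snd (some_pullback v u'), j)) `
    {(\<sigma>, \<rho>). \<sigma> \<in> spans I s Rel n \<and> \<rho> \<in> sym_rel Rel \<and> snd (snd (snd \<sigma>)) = fst \<rho>}"

lemma sym_rel_zigzag:
  assumes D: "pres_data I s Rel" and r: "(i, u, v, j) \<in> sym_rel Rel"
  shows "i \<in> I" "j \<in> I" "u \<in> Arr C" "v \<in> Arr C" "Dom C u = Dom C v" "Cod C u = s i" "Cod C v = s j"
    "h \<in> Arr C \<Longrightarrow> Cod C h = Dom C u \<Longrightarrow> zigzag I s Rel i (u \<cdot> h) j (v \<cdot> h)"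
proof -
  have c: "(i, u, v, j) \<in> Rel \<or> (j, v, u, i) \<in> Rel" using r by (auto simp: sym_rel_def)
  show "i \<in> I" "j \<in> I" "u \<in> Arr C" "v \<in> Arr C" "Dom C u = Dom C v" "Cod C u = s i" "Cod C v = s j"
    using c pres_dataD[OF D] by metis+
  then show "h \<in> Arr C \<Longrightarrow> Cod C h = Dom C u \<Longrightarrow> zigzag I s Rel i (u \<cdot> h) j (v \<cdot> h)"
    using c zigzag_rel[OF D] by metis
qed

lemma spans_small:
  assumes "small U I" "small U Rel"
  shows "small U (spans I s Rel n)"
proof (induction n)
  case 0 then show ?case using assms by (simp add: small_image)
next
  case (Suc n)
  have "small U (sym_rel Rel)" unfolding sym_rel_def by (intro small_Un small_image inacc assms)
  then have "small U {(\<sigma>, \<rho>). \<sigma> \<in> spans I s Rel n \<and> \<rho> \<in> sym_rel Rel \<and> snd (snd (snd \<sigma>)) = fst \<rho>}"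
    by (intro small_subset[OF small_Times[OF inacc Suc.IH]]) auto
  then show ?case unfolding spans.simps by (rule small_image)
qed

lemma spans_sound:
  assumes D: "pres_data I s Rel"
  shows "(i, u, v, j) \<in> spans I s Rel n \<Longrightarrow> zigzag I s Rel i u j v"
proof (induction n arbitrary: i u v j)
  case 0
  then show ?case using pres_data_obj[OF D] by (auto intro!: zigzag.refl)
next
  case (Suc n)
  then obtain u0 v0 l u' v' where \<sigma>: "(i, u0, v0, l) \<in> spans I s Rel n" and \<rho>: "(l, u', v', j) \<in> sym_rel Rel"
    and uv: "u = u0 \<cdot> fst (some_pullback v0 u')" "v = v' \<cdot> snd (some_pullback v0 u')"
    by auto
  let ?p = "fst (some_pullback v0 u')" and ?q = "snd (some_pullback v0 u')"
  note z = Suc.IH[OF \<sigma>] and r = sym_rel_zigzag[OF D \<rho>]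
  note t = zigzag_arr[OF z D]
  have pq: "is_pullback C v0 u' ?p ?q" using t r by (intro some_pullback) auto
  note d = is_pullbackD[OF pq]
  have "zigzag I s Rel i (u0 \<cdot> ?p) l (v0 \<cdot> ?p)" using zigzag_comp[OF z D, of ?p] d t by simp
  moreover have "zigzag I s Rel l (u' \<cdot> ?q) j (v' \<cdot> ?q)" using r(8)[of ?q] d by simp
  ultimately show ?case unfolding uv using d(9) zigzag_trans by metis
qed

text \<open>When a zigzag is prolonged, the end of the generic zigzag so far and the new relation
  agree after restriction, so the two parameters factor together through the chosen pullback; the
  factorization is the parameter of the longer generic zigzag.\<close>

lemma spans_complete:
  assumes "zigzag I s Rel i k j k'" and D: "pres_data I s Rel"
  shows "\<exists>n u v. (i, u, v, j) \<in> spans I s Rel n \<and> (\<exists>h\<in>Arr C. Cod C h = Dom C u \<and> k = u \<cdot> h \<and> k' = v \<cdot> h)"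
proof -
  have step: "\<exists>n u v. (i, u, v, j) \<in> spans I s Rel n \<and> (\<exists>h\<in>Arr C. Cod C h = Dom C u \<and> k = u \<cdot> h \<and> v1 \<cdot> h1 = v \<cdot> h)"
    if ih: "\<exists>n u v. (i, u, v, l) \<in> spans I s Rel n \<and> (\<exists>h\<in>Arr C. Cod C h = Dom C u \<and> k = u \<cdot> h \<and> u1 \<cdot> h1 = v \<cdot> h)"
      and \<rho>: "(l, u1, v1, j) \<in> sym_rel Rel" and h1: "h1 \<in> Arr C" "Cod C h1 = Dom C u1" for i k l j u1 v1 h1
  proof -
    obtain n u v h where \<sigma>: "(i, u, v, l) \<in> spans I s Rel n" and h: "h \<in> Arr C" "Cod C h = Dom C u"
      "k = u \<cdot> h" "u1 \<cdot> h1 = v \<cdot> h" using ih by blast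
    note t = zigzag_arr[OF spans_sound[OF D \<sigma>] D] and r = sym_rel_zigzag[OF D \<rho>]
    let ?p = "fst (some_pullback v u1)" and ?q = "snd (some_pullback v u1)"
    have pq: "is_pullback C v u1 ?p ?q" using t r by (intro some_pullback) auto
    note d = is_pullbackD[OF pq]
    have "Dom C (u1 \<cdot> h1) = Dom C h1" by (rule comp_dom) (use h1 r in auto)
    moreover have "Dom C (v \<cdot> h) = Dom C h" by (rule comp_dom) (use h t in auto)
    ultimately have dd: "Dom C h = Dom C h1" using h(4) by simp
    obtain w where w: "w \<in> Arr C" "Cod C w = Dom C ?p" "?p \<cdot> w = h" "?q \<cdot> w = h1"
      using is_pullback_ex[OF pq h(1) h1(1) dd] h h1 t by auto
    have "(i, u \<cdot> ?p, v1 \<cdot> ?q, j) \<in> spans I s Rel (Suc n)"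
      using \<sigma> \<rho> by (auto intro!: image_eqI[of _ _ "((i, u, v, l), (l, u1, v1, j))"])
    moreover have "u \<cdot> h = (u \<cdot> ?p) \<cdot> w" unfolding w(3)[symmetric]
      by (rule comp_assoc[symmetric]) (use w(1,2) d t in auto)
    moreover have "v1 \<cdot> h1 = (v1 \<cdot> ?q) \<cdot> w" unfolding w(4)[symmetric]
      by (rule comp_assoc[symmetric]) (use w(1,2) d r in auto)
    moreover have "Cod C w = Dom C (u \<cdot> ?p)" using w(2) d t by simp
    ultimately show ?thesis using w(1) h(3) by blast
  qed
  from assms(1) show ?thesis
  proof induction
    case (refl i k)
    have "(i, Ident C (s i), Ident C (s i), i) \<in> spans I s Rel 0" using refl by simp
    then show ?case using refl pres_data_obj[OF D refl(1)]
      by (intro exI[of _ 0] exI[of _ "Ident C (s i)"] conjI bexI[of _ k]) auto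
  next
    case (fwd i k l u h v j)
    show ?case by (rule step[OF fwd.IH _ fwd.hyps(3,4)]) (use fwd.hyps(2) in \<open>simp add: sym_rel_def\<close>)
  next
    case (bwd i k l v h j u)
    show ?case by (rule step[OF bwd.IH _ bwd.hyps(3,4)]) (use bwd.hyps(2) in \<open>force simp: sym_rel_def\<close>)
  qed
qed

text \<open>As representables are sheaves for the canonical topology, the two clauses say that
  \<open>\<phi>\<close> exhibits the representable of c as the associated sheaf of F. Stating it
  this way avoids constructing a sheafification.\<close>

definition locally_bijective :: "('o \<Rightarrow> 'x set) \<Rightarrow> ('a \<Rightarrow> 'x \<Rightarrow> 'x) \<Rightarrow> 'o \<Rightarrow> ('o \<Rightarrow> 'x \<Rightarrow> 'a) \<Rightarrow> bool" where
  "locally_bijective F a c \<phi> \<longleftrightarrow>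
     (\<forall>h\<in>Arr C. Cod C h = c \<longrightarrow> locally (Dom C h) (\<lambda>g. \<exists>p\<in>F (Dom C g). \<phi> (Dom C g) p = h \<cdot> g)) \<and>
     (\<forall>x\<in>Obj C. \<forall>p\<in>F x. \<forall>p'\<in>F x. \<phi> x p = \<phi> x p' \<longrightarrow> locally x (\<lambda>g. a g p = a g p'))"

text \<open>The maps \<open>\<mu> i\<close> are the components of a map \<open>f\<close> on the coproduct \<open>X\<close> of the generators whose
  kernel pair is the closure of the zigzag relation.\<close>

lemma zigzag_effective:
  assumes D: "pres_data I s Rel" and sm: "small U I" "small U Rel"
  obtains d \<mu> where "d \<in> Obj C" "\<forall>i\<in>I. \<mu> i \<in> Hom C (s i) d"
    "\<forall>i u v j. (i, u, v, j) \<in> Rel \<longrightarrow> \<mu> i \<cdot> u = \<mu> j \<cdot> v"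
    "\<forall>i\<in>I. \<forall>j\<in>I. \<forall>k\<in>Arr C. \<forall>k'\<in>Arr C. Cod C k = s i \<and> Cod C k' = s j \<and> Dom C k = Dom C k' \<and>
      \<mu> i \<cdot> k = \<mu> j \<cdot> k' \<longrightarrow> locally (Dom C k) (\<lambda>g. zigzag I s Rel i (k \<cdot> g) j (k' \<cdot> g))"
proof -
  note sO = pres_data_obj[OF D]
  obtain X \<iota> where X: "X \<in> Obj C" and \<iota>: "\<And>i. i \<in> I \<Longrightarrow> \<iota> i \<in> Hom C (s i) X"
    and mono: "\<And>i k k'. i \<in> I \<Longrightarrow> k \<in> Arr C \<Longrightarrow> k' \<in> Arr C \<Longrightarrow> Dom C k = Dom C k' \<Longrightarrow> Cod C k = s i \<Longrightarrow>
      Cod C k' = s i \<Longrightarrow> \<iota> i \<cdot> k = \<iota> i \<cdot> k' \<Longrightarrow> k = k'"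
    and disj: "\<And>i j k k'. i \<in> I \<Longrightarrow> j \<in> I \<Longrightarrow> i \<noteq> j \<Longrightarrow> k \<in> Arr C \<Longrightarrow> k' \<in> Arr C \<Longrightarrow> Dom C k = Dom C k' \<Longrightarrow>
      Cod C k = s i \<Longrightarrow> Cod C k' = s j \<Longrightarrow> \<iota> i \<cdot> k = \<iota> j \<cdot> k' \<Longrightarrow> locally (Dom C k) (\<lambda>_. False)"
    and cover: "\<And>h. h \<in> Arr C \<Longrightarrow> Cod C h = X \<Longrightarrow> locally (Dom C h)
       (\<lambda>g. \<exists>i\<in>I. \<exists>k\<in>Arr C. Cod C k = s i \<and> Dom C k = Dom C g \<and> h \<cdot> g = \<iota> i \<cdot> k)"
    using coproduct_exists[where s = s, OF sm(1) sO] by blast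
  have \<iota>a: "\<iota> i \<in> Arr C" "Dom C (\<iota> i) = s i" "Cod C (\<iota> i) = X" if "i \<in> I" for i
    using \<iota>[OF that] by (auto simp: Hom_iff)
  \<comment> \<open>The ends of the generic zigzags, pushed into the coproduct: a small family whose
    restrictions are exactly the pairs related by \<open>Q\<close>.\<close>
  define T where "T = (\<lambda>(i, u, v, j). (\<iota> i \<cdot> u, \<iota> j \<cdot> v)) ` (\<Union>n. spans I s Rel n)"
  have T_small: "small U T" unfolding T_def by (intro small_image small_UN_nat inacc spans_small sm)
  define Q where "Q k k' \<longleftrightarrow> (\<exists>i j l l'. zigzag I s Rel i l j l' \<and> k = \<iota> i \<cdot> l \<and> k' = \<iota> j \<cdot> l')" for k k'
  have Q_iff: "(\<exists>(u, v)\<in>T. \<exists>h\<in>Arr C. Cod C h = Dom C u \<and> k = u \<cdot> h \<and> k' = v \<cdot> h) \<longleftrightarrow> Q k k'" for k k'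
  proof
    assume "\<exists>(u, v)\<in>T. \<exists>h\<in>Arr C. Cod C h = Dom C u \<and> k = u \<cdot> h \<and> k' = v \<cdot> h"
    then obtain i u v j n h where \<sigma>: "(i, u, v, j) \<in> spans I s Rel n" and h: "h \<in> Arr C"
      "Cod C h = Dom C (\<iota> i \<cdot> u)" "k = (\<iota> i \<cdot> u) \<cdot> h" "k' = (\<iota> j \<cdot> v) \<cdot> h"
      unfolding T_def by auto
    note z = spans_sound[OF D \<sigma>]
    note t = zigzag_arr[OF z D]
    have "Cod C h = Dom C u" using h(2) t \<iota>a[of i] by simp
    then have "zigzag I s Rel i (u \<cdot> h) j (v \<cdot> h)" "k = \<iota> i \<cdot> (u \<cdot> h)" "k' = \<iota> j \<cdot> (v \<cdot> h)"
      using zigzag_comp[OF z D h(1)] h t \<iota>a[of i] \<iota>a[of j] by (simp_all add: comp_assoc)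
    then show "Q k k'" unfolding Q_def by blast
  next
    assume "Q k k'"
    then obtain i j l l' where z: "zigzag I s Rel i l j l'" and k: "k = \<iota> i \<cdot> l" "k' = \<iota> j \<cdot> l'"
      unfolding Q_def by blast
    obtain n u v h where \<sigma>: "(i, u, v, j) \<in> spans I s Rel n" and h: "h \<in> Arr C" "Cod C h = Dom C u"
      "l = u \<cdot> h" "l' = v \<cdot> h" using spans_complete[OF z D] by blast
    note t = zigzag_arr[OF spans_sound[OF D \<sigma>] D]
    have "(\<iota> i \<cdot> u, \<iota> j \<cdot> v) \<in> T" unfolding T_def using \<sigma> by (force intro!: image_eqI[of _ _ "(i, u, v, j)"])
    moreover have "k = (\<iota> i \<cdot> u) \<cdot> h" "k' = (\<iota> j \<cdot> v) \<cdot> h" "Cod C h = Dom C (\<iota> i \<cdot> u)"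
      using k h t \<iota>a[of i] \<iota>a[of j] by (simp_all add: comp_assoc)
    ultimately show "\<exists>(u, v)\<in>T. \<exists>h\<in>Arr C. Cod C h = Dom C u \<and> k = u \<cdot> h \<and> k' = v \<cdot> h"
      using h(1) by blast
  qed
  have T_arr: "u \<in> Arr C \<and> v \<in> Arr C \<and> Dom C u = Dom C v \<and> Cod C u = X \<and> Cod C v = X" if t: "(u, v) \<in> T" for u v
  proof -
    obtain \<sigma> n where "\<sigma> \<in> spans I s Rel n" "(u, v) = (\<lambda>(i, u, v, j). (\<iota> i \<cdot> u, \<iota> j \<cdot> v)) \<sigma>"
      using t unfolding T_def by blast
    moreover obtain i u0 v0 j where "\<sigma> = (i, u0, v0, j)" by (cases \<sigma>)
    ultimately have \<sigma>: "(i, u0, v0, j) \<in> spans I s Rel n" and uv: "u = \<iota> i \<cdot> u0" "v = \<iota> j \<cdot> v0"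
      by auto
    show ?thesis unfolding uv using zigzag_arr[OF spans_sound[OF D \<sigma>] D] \<iota>a[of i] \<iota>a[of j] by simp
  qed
  obtain E r s' where E: "E \<in> Obj C" and r: "r \<in> Hom C E X" and s': "s' \<in> Hom C E X"
    and jm: "\<And>h k. h \<in> Arr C \<Longrightarrow> k \<in> Arr C \<Longrightarrow> Dom C h = Dom C k \<Longrightarrow> Cod C h = E \<Longrightarrow> Cod C k = E \<Longrightarrow>
      r \<cdot> h = r \<cdot> k \<Longrightarrow> s' \<cdot> h = s' \<cdot> k \<Longrightarrow> h = k"
    and rel0: "\<And>k k'. k \<in> Arr C \<Longrightarrow> k' \<in> Arr C \<Longrightarrow> Dom C k = Dom C k' \<Longrightarrow> Cod C k = X \<Longrightarrow> Cod C k' = X \<Longrightarrow>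
      (\<exists>h\<in>Hom C (Dom C k) E. k = r \<cdot> h \<and> k' = s' \<cdot> h) \<longleftrightarrow>
      locally (Dom C k) (\<lambda>g. \<exists>(u, v)\<in>T. \<exists>h\<in>Arr C. Cod C h = Dom C u \<and> k \<cdot> g = u \<cdot> h \<and> k' \<cdot> g = v \<cdot> h)"
    by (rule relation_exists[OF T_small X T_arr]) blast+
  have rel: "(\<exists>h\<in>Hom C (Dom C k) E. k = r \<cdot> h \<and> k' = s' \<cdot> h) \<longleftrightarrow> locally (Dom C k) (\<lambda>g. Q (k \<cdot> g) (k' \<cdot> g))"
    if "k \<in> Arr C" "k' \<in> Arr C" "Dom C k = Dom C k'" "Cod C k = X" "Cod C k' = X" for k k'
    using rel0[OF that] unfolding Q_iff .
  have ra: "r \<in> Arr C" "Dom C r = E" "Cod C r = X" "s' \<in> Arr C" "Dom C s' = E" "Cod C s' = X"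
    using r s' by (auto simp: Hom_iff)
  have Q_stable: "Q (k \<cdot> g) (k' \<cdot> g)"
    if "Q k k'" and g: "g \<in> Arr C" "Cod C g = Dom C k" for k k' g
  proof -
    obtain i j l l' where z: "zigzag I s Rel i l j l'" and k: "k = \<iota> i \<cdot> l" "k' = \<iota> j \<cdot> l'"
      using \<open>Q k k'\<close> unfolding Q_def by blast
    note t = zigzag_arr[OF z D]
    have gl: "Cod C g = Dom C l" using g k t \<iota>a[of i] by simp
    have "zigzag I s Rel i (l \<cdot> g) j (l' \<cdot> g)" by (rule zigzag_comp[OF z D g(1) gl])
    moreover have "k \<cdot> g = \<iota> i \<cdot> (l \<cdot> g)" "k' \<cdot> g = \<iota> j \<cdot> (l' \<cdot> g)"
      unfolding k using g gl t \<iota>a[of i] \<iota>a[of j] by (simp_all add: comp_assoc)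
    ultimately show ?thesis unfolding Q_def by blast
  qed
  have relI: "\<exists>h\<in>Hom C (Dom C k) E. k = r \<cdot> h \<and> k' = s' \<cdot> h"
    if "k \<in> Arr C" "k' \<in> Arr C" "Dom C k = Dom C k'" "Cod C k = X" "Cod C k' = X" "Q k k'" for k k'
    unfolding rel[OF that(1-5)] by (rule locallyI) (use that Q_stable in auto)
  \<comment> \<open>An element of the coproduct may be written through different injections, but any
    two ways of writing it agree locally: each injection is monic, and distinct summands meet only
    over objects covered by the empty sieve.\<close>
  have cov_eq: "locally (Dom C k) (\<lambda>g. i = j \<and> k \<cdot> g = k' \<cdot> g)"
    if "i \<in> I" "j \<in> I" "k \<in> Arr C" "k' \<in> Arr C" "Dom C k = Dom C k'" "Cod C k = s i" "Cod C k' = s j"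
      "\<iota> i \<cdot> k = \<iota> j \<cdot> k'" for i j k k'
  proof (cases "i = j")
    case True
    then have "k = k'" using mono[of i k k'] that by simp
    then show ?thesis using True that by (intro locallyI) auto
  next
    case False
    then show ?thesis using disj[of i j k k'] that locally_mono by blast
  qed
  have relD: "locally (Dom C h) (\<lambda>g. Q ((r \<cdot> h) \<cdot> g) ((s' \<cdot> h) \<cdot> g))"
    if "h \<in> Arr C" "Cod C h = E" for h
  proof -
    have "\<exists>h'\<in>Hom C (Dom C (r \<cdot> h)) E. r \<cdot> h = r \<cdot> h' \<and> s' \<cdot> h = s' \<cdot> h'"
      by (rule bexI[of _ h]) (use that ra in \<open>auto simp: Hom_iff\<close>)
    then show ?thesis using rel[of "r \<cdot> h" "s' \<cdot> h"] that ra by simp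
  qed
  have "equivalence_relation C r s'" unfolding equivalence_relation_def
  proof (rule bexI[OF _ E], rule bexI[OF _ X], intro conjI r s' allI impI)
    fix w h k assume "h \<in> Hom C w E \<and> k \<in> Hom C w E \<and> r \<cdot> h = r \<cdot> k \<and> s' \<cdot> h = s' \<cdot> k"
    then show "h = k" using jm[of h k] by (simp add: Hom_iff)
  next
    \<comment> \<open>Reflexivity holds for \<open>Q\<close> only locally, since an element of X
      comes from a generator only on a cover.\<close>
    have "locally (Dom C (Ident C X)) (\<lambda>g. Q (Ident C X \<cdot> g) (Ident C X \<cdot> g))"
    proof (rule locally_mono[OF cover[of "Ident C X"]])
      fix g assume "\<exists>i\<in>I. \<exists>k\<in>Arr C. Cod C k = s i \<and> Dom C k = Dom C g \<and> Ident C X \<cdot> g = \<iota> i \<cdot> k"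
      then show "Q (Ident C X \<cdot> g) (Ident C X \<cdot> g)" unfolding Q_def using zigzag.refl by metis
    qed (use X in auto)
    then have "\<exists>h\<in>Hom C X E. Ident C X = r \<cdot> h \<and> Ident C X = s' \<cdot> h"
      using rel[of "Ident C X" "Ident C X"] X by simp
    then show "\<exists>\<rho>\<in>Hom C X E. r \<cdot> \<rho> = Ident C X \<and> s' \<cdot> \<rho> = Ident C X" by metis
  next
    have "locally E (\<lambda>g. Q (r \<cdot> g) (s' \<cdot> g))" using relD[of "Ident C E"] E ra by simp
    then have "locally E (\<lambda>g. Q (s' \<cdot> g) (r \<cdot> g))"
      by (rule locally_mono) (use zigzag_sym[OF _ D] in \<open>unfold Q_def, blast\<close>)
    then have "\<exists>h\<in>Hom C E E. s' = r \<cdot> h \<and> r = s' \<cdot> h" using rel[of s' r] ra by simp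
    then show "\<exists>\<sigma>\<in>Hom C E E. r \<cdot> \<sigma> = s' \<and> s' \<cdot> \<sigma> = r" by metis
  next
    fix p q assume pq: "is_pullback C s' r p q"
    note d = is_pullbackD[OF pq]
    let ?x = "Dom C p"
    have p: "p \<in> Arr C" "Cod C p = E" and q: "q \<in> Arr C" "Cod C q = E" "Dom C q = ?x"
      using d ra by auto
    have "locally ?x (\<lambda>g. Q ((r \<cdot> p) \<cdot> g) ((s' \<cdot> p) \<cdot> g) \<and> Q ((r \<cdot> q) \<cdot> g) ((s' \<cdot> q) \<cdot> g))"
      by (rule locally_conj[OF relD[OF p] relD[OF q(1,2), unfolded q(3)]])
    then have "locally ?x (\<lambda>g. Q ((r \<cdot> p) \<cdot> g) ((s' \<cdot> q) \<cdot> g))"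
    proof (rule locally_bind)
      fix g assume g: "g \<in> Arr C" "Cod C g = ?x"
        and "Q ((r \<cdot> p) \<cdot> g) ((s' \<cdot> p) \<cdot> g) \<and> Q ((r \<cdot> q) \<cdot> g) ((s' \<cdot> q) \<cdot> g)"
      then obtain i j l l' j' n m m' where z: "zigzag I s Rel i l j l'" "zigzag I s Rel j' m n m'"
        and e: "(r \<cdot> p) \<cdot> g = \<iota> i \<cdot> l" "(s' \<cdot> p) \<cdot> g = \<iota> j \<cdot> l'" "(r \<cdot> q) \<cdot> g = \<iota> j' \<cdot> m" "(s' \<cdot> q) \<cdot> g = \<iota> n \<cdot> m'"
        unfolding Q_def by blast
      note t1 = zigzag_arr[OF z(1) D] and t2 = zigzag_arr[OF z(2) D]
      have jj: "\<iota> j \<cdot> l' = \<iota> j' \<cdot> m" using e(2,3) d(9) by simp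
      have "Dom C (\<iota> j \<cdot> l') = Dom C l'" by (rule comp_dom) (use t1 \<iota>a[of j] in auto)
      moreover have "Dom C (\<iota> j' \<cdot> m) = Dom C m" by (rule comp_dom) (use t2 \<iota>a[of j'] in auto)
      moreover have "Dom C ((s' \<cdot> p) \<cdot> g) = Dom C g" using g p ra by simp
      ultimately have dm: "Dom C l' = Dom C m" "Dom C l' = Dom C g" using jj e(2) by simp_all
      \<comment> \<open>The two zigzags meet in one element of the coproduct, possibly through
        different generators. On a cover their middle ends coincide, and there they can be
        concatenated.\<close>
      have "locally (Dom C l') (\<lambda>k. j = j' \<and> l' \<cdot> k = m \<cdot> k)"
        by (rule cov_eq) (use t1 t2 dm jj in auto)
      then show "locally (Dom C g) (\<lambda>k. Q ((r \<cdot> p) \<cdot> g \<cdot> k) ((s' \<cdot> q) \<cdot> g \<cdot> k))"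
        unfolding dm(2)
      proof (rule locally_mono)
        fix k assume k: "k \<in> Arr C" "Cod C k = Dom C g" and eq: "j = j' \<and> l' \<cdot> k = m \<cdot> k"
        have "zigzag I s Rel i (l \<cdot> k) j (l' \<cdot> k)" using zigzag_comp[OF z(1) D k(1)] k dm t1 by simp
        moreover have "zigzag I s Rel j' (m \<cdot> k) n (m' \<cdot> k)" using zigzag_comp[OF z(2) D k(1)] k dm by simp
        ultimately have "zigzag I s Rel i (l \<cdot> k) n (m' \<cdot> k)" using eq zigzag_trans by metis
        moreover have "(r \<cdot> p) \<cdot> g \<cdot> k = ((r \<cdot> p) \<cdot> g) \<cdot> k" "(s' \<cdot> q) \<cdot> g \<cdot> k = ((s' \<cdot> q) \<cdot> g) \<cdot> k"
          using k g p q ra by (simp_all add: comp_assoc)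
        moreover have "(\<iota> i \<cdot> l) \<cdot> k = \<iota> i \<cdot> l \<cdot> k" "(\<iota> n \<cdot> m') \<cdot> k = \<iota> n \<cdot> m' \<cdot> k"
          using k t1 t2 dm \<iota>a[of i] \<iota>a[of n] by (simp_all add: comp_assoc)
        ultimately show "Q ((r \<cdot> p) \<cdot> g \<cdot> k) ((s' \<cdot> q) \<cdot> g \<cdot> k)"
          unfolding Q_def e by metis
      qed
    qed
    then have "\<exists>h\<in>Hom C ?x E. r \<cdot> p = r \<cdot> h \<and> s' \<cdot> q = s' \<cdot> h"
      using rel[of "r \<cdot> p" "s' \<cdot> q"] p q ra by simp
    then show "\<exists>\<tau>\<in>Hom C ?x E. r \<cdot> \<tau> = r \<cdot> p \<and> s' \<cdot> \<tau> = s' \<cdot> q" by metis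
  qed
  from equiv_effective[OF this] obtain f where f: "is_pullback C f f r s'" unfolding effective_def by blast
  note d = is_pullbackD[OF f]
  have fa: "f \<in> Arr C" "Dom C f = X" using d ra by auto
  define \<mu> where "\<mu> i = f \<cdot> \<iota> i" for i
  show thesis
  proof (rule that[of "Cod C f" \<mu>])
    show "Cod C f \<in> Obj C" using fa by simp
    show "\<forall>i\<in>I. \<mu> i \<in> Hom C (s i) (Cod C f)" using fa \<iota>a by (simp add: \<mu>_def Hom_iff)
    show "\<forall>i u v j. (i, u, v, j) \<in> Rel \<longrightarrow> \<mu> i \<cdot> u = \<mu> j \<cdot> v"
    proof (intro allI impI)
      fix i u v j assume R: "(i, u, v, j) \<in> Rel"
      note p = pres_dataD[OF D R]
      note i = \<iota>a[OF p(1)] and j = \<iota>a[OF p(2)]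
      have "zigzag I s Rel i u j v" using zigzag_rel(1)[OF D R, of "Ident C (Dom C u)"] p by simp
      then have "Q (\<iota> i \<cdot> u) (\<iota> j \<cdot> v)" unfolding Q_def by blast
      then have "\<exists>h\<in>Hom C (Dom C (\<iota> i \<cdot> u)) E. \<iota> i \<cdot> u = r \<cdot> h \<and> \<iota> j \<cdot> v = s' \<cdot> h"
        by (intro relI) (use p i j in auto)
      then obtain h where h: "h \<in> Arr C" "Cod C h = E" "\<iota> i \<cdot> u = r \<cdot> h" "\<iota> j \<cdot> v = s' \<cdot> h"
        by (auto simp: Hom_iff)
      have "\<mu> i \<cdot> u = f \<cdot> (r \<cdot> h)" unfolding \<mu>_def h(3)[symmetric]
        by (rule comp_assoc) (use p i fa in auto)
      also have "\<dots> = (f \<cdot> r) \<cdot> h" by (rule comp_assoc[symmetric]) (use h fa ra in auto)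
      also have "\<dots> = (f \<cdot> s') \<cdot> h" using d(9) by simp
      also have "\<dots> = f \<cdot> (s' \<cdot> h)" by (rule comp_assoc) (use h fa ra in auto)
      also have "\<dots> = \<mu> j \<cdot> v" unfolding \<mu>_def h(4)[symmetric]
        by (rule comp_assoc[symmetric]) (use p j fa in auto)
      finally show "\<mu> i \<cdot> u = \<mu> j \<cdot> v" .
    qed
    show "\<forall>i\<in>I. \<forall>j\<in>I. \<forall>k\<in>Arr C. \<forall>k'\<in>Arr C. Cod C k = s i \<and> Cod C k' = s j \<and> Dom C k = Dom C k' \<and>
      \<mu> i \<cdot> k = \<mu> j \<cdot> k' \<longrightarrow> locally (Dom C k) (\<lambda>g. zigzag I s Rel i (k \<cdot> g) j (k' \<cdot> g))"
    proof (intro ballI impI; elim conjE)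
      fix i j k k' assume ij: "i \<in> I" "j \<in> I" and k: "k \<in> Arr C" "Cod C k = s i"
        and k': "k' \<in> Arr C" "Cod C k' = s j" and dk: "Dom C k = Dom C k'" and eq: "\<mu> i \<cdot> k = \<mu> j \<cdot> k'"
      note i = \<iota>a[OF ij(1)] and j = \<iota>a[OF ij(2)]
      have ik: "\<iota> i \<cdot> k \<in> Arr C" "Dom C (\<iota> i \<cdot> k) = Dom C k" "Cod C (\<iota> i \<cdot> k) = X"
        and jk: "\<iota> j \<cdot> k' \<in> Arr C" "Dom C (\<iota> j \<cdot> k') = Dom C k" "Cod C (\<iota> j \<cdot> k') = X"
        using i j k k' dk by auto
      have "f \<cdot> (\<iota> i \<cdot> k) = \<mu> i \<cdot> k" unfolding \<mu>_def by (rule comp_assoc[symmetric]) (use i k fa in auto)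
      also have "\<dots> = f \<cdot> (\<iota> j \<cdot> k')" unfolding eq unfolding \<mu>_def by (rule comp_assoc) (use j k' fa in auto)
      finally have "\<exists>h\<in>Arr C. Dom C h = Dom C (\<iota> i \<cdot> k) \<and> Cod C h = Dom C r \<and> r \<cdot> h = \<iota> i \<cdot> k \<and> s' \<cdot> h = \<iota> j \<cdot> k'"
        by (intro is_pullback_ex[OF f]) (use ik jk fa in auto)
      then obtain h where h: "h \<in> Arr C" "Dom C h = Dom C k" "Cod C h = E" "r \<cdot> h = \<iota> i \<cdot> k" "s' \<cdot> h = \<iota> j \<cdot> k'"
        using ik ra by auto
      show "locally (Dom C k) (\<lambda>g. zigzag I s Rel i (k \<cdot> g) j (k' \<cdot> g))"
      proof (rule locally_bind[OF relD[OF h(1,3), unfolded h(2,4,5)]])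
        fix g assume g: "g \<in> Arr C" "Cod C g = Dom C k" and "Q ((\<iota> i \<cdot> k) \<cdot> g) ((\<iota> j \<cdot> k') \<cdot> g)"
        then obtain i' j' l l' where z: "zigzag I s Rel i' l j' l'" and
          e: "(\<iota> i \<cdot> k) \<cdot> g = \<iota> i' \<cdot> l" "(\<iota> j \<cdot> k') \<cdot> g = \<iota> j' \<cdot> l'" unfolding Q_def by blast
        note t = zigzag_arr[OF z D]
        have e': "\<iota> i \<cdot> (k \<cdot> g) = \<iota> i' \<cdot> l" "\<iota> j \<cdot> (k' \<cdot> g) = \<iota> j' \<cdot> l'"
          using e comp_assoc[of g k "\<iota> i"] comp_assoc[of g k' "\<iota> j"] g i j k k' dk by simp_all
        have "Dom C (\<iota> i \<cdot> (k \<cdot> g)) = Dom C g" using g i k by simp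
        moreover have "Dom C (\<iota> i' \<cdot> l) = Dom C l" using t \<iota>a[of i'] by simp
        ultimately have dl: "Dom C l = Dom C g" using e'(1) by simp
        have dg: "Dom C (k \<cdot> g) = Dom C g" "Dom C (k' \<cdot> g) = Dom C g" using g k k' dk by simp_all
        \<comment> \<open>The zigzag obtained from \<open>Q\<close> may run between other generators
          than i and j; \<open>cov_eq\<close> at both ends brings it back to them on a
          cover.\<close>
        have ci: "locally (Dom C (k \<cdot> g)) (\<lambda>w. i = i' \<and> (k \<cdot> g) \<cdot> w = l \<cdot> w)"
          by (rule cov_eq) (use ij t g k dl e' in auto)
        have cj: "locally (Dom C (k' \<cdot> g)) (\<lambda>w. j = j' \<and> (k' \<cdot> g) \<cdot> w = l' \<cdot> w)"
          by (rule cov_eq) (use ij t g k' dk dl e' in auto)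
        have "locally (Dom C g) (\<lambda>w. (i = i' \<and> (k \<cdot> g) \<cdot> w = l \<cdot> w) \<and> (j = j' \<and> (k' \<cdot> g) \<cdot> w = l' \<cdot> w))"
          by (rule locally_conj[OF ci[unfolded dg] cj[unfolded dg]])
        then show "locally (Dom C g) (\<lambda>w. zigzag I s Rel i (k \<cdot> g \<cdot> w) j (k' \<cdot> g \<cdot> w))"
        proof (rule locally_mono)
          fix w assume w: "w \<in> Arr C" "Cod C w = Dom C g"
            and eqs: "(i = i' \<and> (k \<cdot> g) \<cdot> w = l \<cdot> w) \<and> (j = j' \<and> (k' \<cdot> g) \<cdot> w = l' \<cdot> w)"
          have "(k \<cdot> g) \<cdot> w = k \<cdot> g \<cdot> w" "(k' \<cdot> g) \<cdot> w = k' \<cdot> g \<cdot> w"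
            using w g k k' dk by (simp_all add: comp_assoc)
          then show "zigzag I s Rel i (k \<cdot> g \<cdot> w) j (k' \<cdot> g \<cdot> w)"
            using zigzag_comp[OF z D w(1)] w(2) dl eqs by simp
        qed
      qed
    qed
  qed
qed

text \<open>The legs at the generators cover the colimit, which gives local surjectivity. For local
  injectivity, the family \<open>\<mu>\<close> of \<open>zigzag_effective\<close> factors through
  the colimit, so elements identified in the colimit are identified by \<open>\<mu>\<close> and
  hence joined by a zigzag locally.\<close>

lemma presented_reflection:
  assumes P: "presents F a I s Rel e" and sm: "small U I" "small U Rel"
  obtains c \<phi> where "universal_on F a c \<phi>" "locally_bijective F a c \<phi>"
proof -
  note D = presentsD(1)[OF P] and F = presentsD(2)[OF P] and e = presentsD(3)[OF P] and sO = presentsD(4)[OF P]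
  from presented_colimit[OF D sm] obtain c \<kappa> where c: "c \<in> Obj C"
    and \<kappa>: "\<And>i. i \<in> I \<Longrightarrow> \<kappa> i \<in> Hom C (s i) c"
    and \<kappa>_rel: "\<And>i u v j. (i, u, v, j) \<in> Rel \<Longrightarrow> \<kappa> i \<cdot> u = \<kappa> j \<cdot> v"
    and univ: "\<And>d \<mu>. d \<in> Obj C \<Longrightarrow> (\<And>i. i \<in> I \<Longrightarrow> \<mu> i \<in> Hom C (s i) d) \<Longrightarrow>
       (\<And>i u v j. (i, u, v, j) \<in> Rel \<Longrightarrow> \<mu> i \<cdot> u = \<mu> j \<cdot> v) \<Longrightarrow>
       \<exists>!m. m \<in> Hom C c d \<and> (\<forall>i\<in>I. m \<cdot> \<kappa> i = \<mu> i)"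
    and loc: "\<And>h. h \<in> Arr C \<Longrightarrow> Cod C h = c \<Longrightarrow> locally (Dom C h)
       (\<lambda>g. \<exists>i\<in>I. \<exists>k\<in>Arr C. Cod C k = s i \<and> Dom C k = Dom C g \<and> h \<cdot> g = \<kappa> i \<cdot> k)"
    by blast
  have \<kappa>a: "\<kappa> i \<in> Arr C" "Dom C (\<kappa> i) = s i" "Cod C (\<kappa> i) = c" if "i \<in> I" for i
    using \<kappa>[OF that] by (auto simp: Hom_iff)
  have kr: "hom_act u (\<kappa> i) = hom_act v (\<kappa> j)" if "(i, u, v, j) \<in> Rel" for i u v j
    using \<kappa>_rel[OF that] by (simp add: hom_act_def)
  obtain \<phi> where \<phi>: "cocone_on F a c \<phi>" and \<phi>e: "\<And>i. i \<in> I \<Longrightarrow> \<phi> (s i) (e i) = \<kappa> i"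
    and \<phi>k: "\<And>i k. i \<in> I \<Longrightarrow> k \<in> Arr C \<Longrightarrow> Cod C k = s i \<Longrightarrow> \<phi> (Dom C k) (a k (e i)) = hom_act k (\<kappa> i)"
    using presents_natp[OF P psh_hom \<kappa> kr] by blast
  have "universal_on F a c \<phi>" unfolding universal_on_def
  proof (intro conjI ballI allI impI c \<phi>)
    fix d \<psi> assume d: "d \<in> Obj C" and \<psi>: "cocone_on F a d \<psi>"
    have "\<exists>!m. m \<in> Hom C c d \<and> (\<forall>i\<in>I. m \<cdot> \<kappa> i = \<psi> (s i) (e i))"
    proof (rule univ[OF d])
      show "\<psi> (s i) (e i) \<in> Hom C (s i) d" if "i \<in> I" for i using natp_in[OF \<psi> sO[OF that] e[OF that]] .
      show "\<psi> (s i) (e i) \<cdot> u = \<psi> (s j) (e j) \<cdot> v" if r: "(i, u, v, j) \<in> Rel" for i u v j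
        using cocone_on_nat[OF \<psi>, of u "e i"] cocone_on_nat[OF \<psi>, of v "e j"] presents_rel[OF P r]
          pres_dataD[OF D r] e by simp
    qed
    moreover have "(\<forall>i\<in>I. m \<cdot> \<kappa> i = \<psi> (s i) (e i)) \<longleftrightarrow> (\<forall>x\<in>Obj C. \<forall>p\<in>F x. m \<cdot> \<phi> x p = \<psi> x p)"
      if m: "m \<in> Hom C c d" for m
    proof
      assume *: "\<forall>i\<in>I. m \<cdot> \<kappa> i = \<psi> (s i) (e i)"
      show "\<forall>x\<in>Obj C. \<forall>p\<in>F x. m \<cdot> \<phi> x p = \<psi> x p"
      proof (intro ballI)
        fix x p assume xp: "x \<in> Obj C" "p \<in> F x"
        show "m \<cdot> \<phi> x p = \<psi> x p"
          by (rule presents_unique[OF P cocone_on_compose[OF \<phi> m] \<psi> _ xp]) (use * \<phi>e in simp)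
      qed
    next
      assume "\<forall>x\<in>Obj C. \<forall>p\<in>F x. m \<cdot> \<phi> x p = \<psi> x p"
      then show "\<forall>i\<in>I. m \<cdot> \<kappa> i = \<psi> (s i) (e i)" using \<phi>e sO e by metis
    qed
    ultimately show "\<exists>!m. m \<in> Hom C c d \<and> (\<forall>x\<in>Obj C. \<forall>p\<in>F x. m \<cdot> \<phi> x p = \<psi> x p)"
      by (metis (no_types, lifting))
  qed
  moreover have "locally_bijective F a c \<phi>" unfolding locally_bijective_def
  proof (intro conjI ballI impI)
    fix h assume h: "h \<in> Arr C" "Cod C h = c"
    show "locally (Dom C h) (\<lambda>g. \<exists>p\<in>F (Dom C g). \<phi> (Dom C g) p = h \<cdot> g)"
    proof (rule locally_mono[OF loc[OF h]])
      fix g assume "\<exists>i\<in>I. \<exists>k\<in>Arr C. Cod C k = s i \<and> Dom C k = Dom C g \<and> h \<cdot> g = \<kappa> i \<cdot> k"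
      then obtain i k where ik: "i \<in> I" "k \<in> Arr C" "Cod C k = s i" "Dom C k = Dom C g" "h \<cdot> g = \<kappa> i \<cdot> k"
        by blast
      show "\<exists>p\<in>F (Dom C g). \<phi> (Dom C g) p = h \<cdot> g"
        using \<phi>k[OF ik(1-3)] ik psh_act[OF F ik(2), of "e i"] e[OF ik(1)]
        by (intro bexI[of _ "a k (e i)"]) (simp_all add: hom_act_def)
    qed
  next
    fix x p p' assume x: "x \<in> Obj C" and p: "p \<in> F x" and p': "p' \<in> F x" and eq: "\<phi> x p = \<phi> x p'"
    obtain i k where i: "i \<in> I" "k \<in> Arr C" "Dom C k = x" "Cod C k = s i" "p = a k (e i)"
      using presents_gen[OF P x p] .
    obtain j k' where j: "j \<in> I" "k' \<in> Arr C" "Dom C k' = x" "Cod C k' = s j" "p' = a k' (e j)"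
      using presents_gen[OF P x p'] .
    have eq': "\<kappa> i \<cdot> k = \<kappa> j \<cdot> k'"
      using eq \<phi>k[OF i(1,2,4)] \<phi>k[OF j(1,2,4)] i j by (simp add: hom_act_def)
    obtain d \<mu> where d: "d \<in> Obj C" and \<mu>: "\<forall>i\<in>I. \<mu> i \<in> Hom C (s i) d"
      "\<forall>i u v j. (i, u, v, j) \<in> Rel \<longrightarrow> \<mu> i \<cdot> u = \<mu> j \<cdot> v"
      and eff: "\<forall>i\<in>I. \<forall>j\<in>I. \<forall>k\<in>Arr C. \<forall>k'\<in>Arr C. Cod C k = s i \<and> Cod C k' = s j \<and> Dom C k = Dom C k' \<and>
      \<mu> i \<cdot> k = \<mu> j \<cdot> k' \<longrightarrow> locally (Dom C k) (\<lambda>g. zigzag I s Rel i (k \<cdot> g) j (k' \<cdot> g))"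
      using zigzag_effective[OF D sm] .
    have "\<exists>!m. m \<in> Hom C c d \<and> (\<forall>i\<in>I. m \<cdot> \<kappa> i = \<mu> i)" by (rule univ[OF d]) (use \<mu> in auto)
    then obtain m where m: "m \<in> Arr C" "Dom C m = c" "Cod C m = d" "\<And>i. i \<in> I \<Longrightarrow> m \<cdot> \<kappa> i = \<mu> i"
      by (auto simp: Hom_iff)
    have "\<mu> i \<cdot> k = m \<cdot> (\<kappa> i \<cdot> k)" unfolding m(4)[OF i(1), symmetric]
      by (rule comp_assoc) (use m i \<kappa>a in auto)
    also have "\<dots> = \<mu> j \<cdot> k'" unfolding m(4)[OF j(1), symmetric] eq'
      by (rule comp_assoc[symmetric]) (use m j \<kappa>a in auto)
    finally have "locally (Dom C k) (\<lambda>g. zigzag I s Rel i (k \<cdot> g) j (k' \<cdot> g))"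
      using eff[rule_format, OF i(1) j(1) i(2) j(2)] i(3,4) j(3,4) by simp
    then show "locally x (\<lambda>g. a g p = a g p')" unfolding i(3)
    proof (rule locally_mono)
      fix g assume g: "g \<in> Arr C" "Cod C g = x" and z: "zigzag I s Rel i (k \<cdot> g) j (k' \<cdot> g)"
      have "a g p = a (k \<cdot> g) (e i)" unfolding i(5)
        by (rule psh_comp[OF F, symmetric]) (use g i e in auto)
      also have "\<dots> = a (k' \<cdot> g) (e j)"
        using presents_eq[OF P i(1) j(1), of "k \<cdot> g" "Dom C g" "k' \<cdot> g"] z g i j by (simp add: Hom_iff)
      also have "\<dots> = a g p'" unfolding j(5) by (rule psh_comp[OF F]) (use g j e in auto)
      finally show "a g p = a g p'" .
    qed
  qed
  ultimately show thesis by (rule that)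
qed

text \<open>A cone on the images lifts locally to compatible families of elements, since finitely many
  conditions can be arranged by one common refinement.\<close>

lemma reflection_preserves_finite_limits:
  assumes L: "is_functor PC C L"
    and univ: "\<And>P. P \<in> Obj PC \<Longrightarrow> universal_on (obj_map P) (act P) (obj_map L P) (\<phi> P)"
    and bij: "\<And>P. P \<in> Obj PC \<Longrightarrow> locally_bijective (obj_map P) (act P) (obj_map L P) (\<phi> P)"
    and nat: "\<And>P Q \<tau> x p. \<tau> \<in> Hom PC P Q \<Longrightarrow> x \<in> Obj C \<Longrightarrow> p \<in> obj_map P x \<Longrightarrow>
      arr_map L \<tau> \<cdot> \<phi> P x p = \<phi> Q x (app \<tau> x p)"
  shows "preserves_finite_limits PC C L"
  unfolding preserves_finite_limits_def
proof (intro allI impI; elim conjE)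
  fix J :: "(nat, nat) cat" and D P \<pi> assume J: "finite_cat J" and lim: "is_limit J PC D P \<pi>"
  have cone: "is_cone J PC D P \<pi>" using lim by (simp add: is_limit_def)
  have D: "is_functor J PC D" and P: "P \<in> Obj PC"
    and \<pi>: "\<And>j. j \<in> Obj J \<Longrightarrow> \<pi> j \<in> Hom PC P (obj_map D j)"
    and D\<pi>: "\<And>u. u \<in> Arr J \<Longrightarrow> arr_map D u \<cdot>\<^bsub>PC\<^esub> \<pi> (Dom J u) = \<pi> (Cod J u)"
    using cone by (auto simp: is_cone_def)
  have fin: "finite (Obj J)" "finite (Arr J)" using J by (auto simp: finite_cat_def)
  interpret J: category J using functor_dom[OF D] .
  interpret PC: category PC by (rule PC_category)
  have LD: "is_functor J C (comp_ftor J L D)" by (rule functor_compose[OF D L])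
  have LDo: "obj_map (comp_ftor J L D) j = obj_map L (obj_map D j)" if "j \<in> Obj J" for j
    using that by (simp add: comp_ftor_def)
  have LDa: "arr_map (comp_ftor J L D) u = arr_map L (arr_map D u)" if "u \<in> Arr J" for u
    using that by (simp add: comp_ftor_def)
  have Dj: "j \<in> Obj J \<Longrightarrow> obj_map D j \<in> Obj PC" for j using functor_obj[OF D] .
  have LH: "arr_map L \<tau> \<in> Hom C (obj_map L A) (obj_map L B)" if "\<tau> \<in> Hom PC A B" for \<tau> A B
    using functor_hom[OF L, of \<tau>] that by (auto simp: Hom_iff)
  have coc: "cocone_on (obj_map A) (act A) (obj_map L A) (\<phi> A)" if "A \<in> Obj PC" for A
    using univ[OF that] by (simp add: universal_on_def)
  note ca = cocone_on_arr[OF coc]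
  have surj: "locally (Dom C h) (\<lambda>g. \<exists>p\<in>obj_map A (Dom C g). \<phi> A (Dom C g) p = h \<cdot> g)"
    if "A \<in> Obj PC" "h \<in> Arr C" "Cod C h = obj_map L A" for A h
    using bij[OF that(1)] that(2,3) by (simp add: locally_bijective_def)
  have inj: "locally x (\<lambda>g. act A g p = act A g p')"
    if "A \<in> Obj PC" "x \<in> Obj C" "p \<in> obj_map A x" "p' \<in> obj_map A x" "\<phi> A x p = \<phi> A x p'" for A x p p'
    using bij[OF that(1)] that(2-5) by (simp add: locally_bijective_def)
  let ?L\<pi> = "\<lambda>j. arr_map L (\<pi> j)"
  have L\<pi>: "?L\<pi> j \<in> Arr C" "Dom C (?L\<pi> j) = obj_map L P" "Cod C (?L\<pi> j) = obj_map L (obj_map D j)"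
    if "j \<in> Obj J" for j using LH[OF \<pi>[OF that]] by (auto simp: Hom_iff)
  have cone_L: "is_cone J C (comp_ftor J L D) (obj_map L P) ?L\<pi>" unfolding is_cone_def
  proof (intro conjI ballI LD)
    show "obj_map L P \<in> Obj C" using functor_obj[OF L P] .
    show "?L\<pi> j \<in> Hom C (obj_map L P) (obj_map (comp_ftor J L D) j)" if "j \<in> Obj J" for j
      using LH[OF \<pi>[OF that]] LDo[OF that] by simp
    fix u assume u: "u \<in> Arr J"
    have "arr_map L (arr_map D u \<cdot>\<^bsub>PC\<^esub> \<pi> (Dom J u)) = arr_map L (arr_map D u) \<cdot> ?L\<pi> (Dom J u)"
      using functor_comp[OF L, of "\<pi> (Dom J u)" "arr_map D u"] \<pi>[of "Dom J u"] functor_arr[OF D u] u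
      by (simp add: Hom_iff)
    then show "arr_map (comp_ftor J L D) u \<cdot> ?L\<pi> (Dom J u) = ?L\<pi> (Cod J u)"
      using D\<pi>[OF u] LDa[OF u] by simp
  qed
  \<comment> \<open>Uniqueness comes first because gluing in the existence part relies on it. Lifts
    of \<open>h\<close> and \<open>h'\<close> to P have components that agree locally, and as limits
    of presheaves are pointwise, the lifts then agree.\<close>
  have separated: "h = h'" if h: "h \<in> Hom C y (obj_map L P)" "h' \<in> Hom C y (obj_map L P)"
    and eq: "\<And>j. j \<in> Obj J \<Longrightarrow> ?L\<pi> j \<cdot> h = ?L\<pi> j \<cdot> h'" for y h h'
  proof (rule locally_eqD[OF _ h])
    have ha: "h \<in> Arr C" "Dom C h = y" "Cod C h = obj_map L P" "h' \<in> Arr C" "Dom C h' = y" "Cod C h' = obj_map L P"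
      using h by (auto simp: Hom_iff)
    have "locally y (\<lambda>g. (\<exists>p\<in>obj_map P (Dom C g). \<phi> P (Dom C g) p = h \<cdot> g) \<and>
        (\<exists>p\<in>obj_map P (Dom C g). \<phi> P (Dom C g) p = h' \<cdot> g))"
      using locally_conj[OF surj[OF P ha(1,3), unfolded ha(2)] surj[OF P ha(4,6), unfolded ha(5)]] .
    then show "locally y (\<lambda>g. h \<cdot> g = h' \<cdot> g)"
    proof (rule locally_bind)
      fix g assume g: "g \<in> Arr C" "Cod C g = y" and "(\<exists>p\<in>obj_map P (Dom C g). \<phi> P (Dom C g) p = h \<cdot> g) \<and>
        (\<exists>p\<in>obj_map P (Dom C g). \<phi> P (Dom C g) p = h' \<cdot> g)"
      then obtain p p' where p: "p \<in> obj_map P (Dom C g)" "\<phi> P (Dom C g) p = h \<cdot> g"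
        and p': "p' \<in> obj_map P (Dom C g)" "\<phi> P (Dom C g) p' = h' \<cdot> g" by blast
      let ?x = "Dom C g"
      have x: "?x \<in> Obj C" using g by simp
      have "locally ?x (\<lambda>k. \<forall>j\<in>Obj J. act (obj_map D j) k (app (\<pi> j) ?x p) = act (obj_map D j) k (app (\<pi> j) ?x p'))"
      proof (rule locally_ball[OF fin(1) x])
        fix j assume j: "j \<in> Obj J"
        have "\<phi> (obj_map D j) ?x (app (\<pi> j) ?x p) = ?L\<pi> j \<cdot> (h \<cdot> g)"
          using nat[OF \<pi>[OF j] x p(1)] p(2) by simp
        also have "\<dots> = (?L\<pi> j \<cdot> h) \<cdot> g" by (rule comp_assoc[symmetric]) (use g ha L\<pi>[OF j] in auto)
        also have "\<dots> = (?L\<pi> j \<cdot> h') \<cdot> g" using eq[OF j] by simp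
        also have "\<dots> = ?L\<pi> j \<cdot> (h' \<cdot> g)" by (rule comp_assoc) (use g ha L\<pi>[OF j] in auto)
        also have "\<dots> = \<phi> (obj_map D j) ?x (app (\<pi> j) ?x p')"
          using nat[OF \<pi>[OF j] x p'(1)] p'(2) by simp
        finally show "locally ?x (\<lambda>k. act (obj_map D j) k (app (\<pi> j) ?x p) = act (obj_map D j) k (app (\<pi> j) ?x p'))"
          by (rule inj[OF Dj[OF j] x app_in[OF \<pi>[OF j] x p(1)] app_in[OF \<pi>[OF j] x p'(1)]])
      qed
      then show "locally ?x (\<lambda>k. h \<cdot> g \<cdot> k = h' \<cdot> g \<cdot> k)"
      proof (rule locally_mono)
        fix k assume k: "k \<in> Arr C" "Cod C k = ?x"
          and *: "\<forall>j\<in>Obj J. act (obj_map D j) k (app (\<pi> j) ?x p) = act (obj_map D j) k (app (\<pi> j) ?x p')"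
        let ?w = "Dom C k"
        have w: "?w \<in> Obj C" using k by simp
        have ak: "act P k q \<in> obj_map P ?w" if "q \<in> obj_map P ?x" for q
          using psh_act[OF PC_psh[OF P] k(1)] that k by simp
        have nk: "app (\<pi> j) ?w (act P k q) = act (obj_map D j) k (app (\<pi> j) ?x q)"
          if "j \<in> Obj J" "q \<in> obj_map P ?x" for j q
          using natp_nat[OF app_natpp[OF \<pi>[OF that(1)]] k(1)] that(2) k by simp
        have "\<exists>!q. q \<in> obj_map P ?w \<and> (\<forall>j\<in>Obj J. app (\<pi> j) ?w q = app (\<pi> j) ?w (act P k p))"
        proof (rule limit_pointwise[OF lim w])
          show "app (\<pi> j) ?w (act P k p) \<in> obj_map (obj_map D j) ?w" if "j \<in> Obj J" for j
            using app_in[OF \<pi>[OF that] w ak[OF p(1)]] .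
          fix u assume u: "u \<in> Arr J"
          have Du: "arr_map D u \<in> Hom PC (obj_map D (Dom J u)) (obj_map D (Cod J u))" using functor_hom[OF D u] .
          show "app (arr_map D u) ?w (app (\<pi> (Dom J u)) ?w (act P k p)) = app (\<pi> (Cod J u)) ?w (act P k p)"
            using app_comp[OF \<pi> Du w ak[OF p(1)]] D\<pi>[OF u] u by simp
        qed
        moreover have "\<forall>j\<in>Obj J. app (\<pi> j) ?w (act P k p') = app (\<pi> j) ?w (act P k p)"
          using nk p(1) p'(1) * by simp
        ultimately have "act P k p = act P k p'" using ak p(1) p'(1) by blast
        then have "\<phi> P ?x p \<cdot> k = \<phi> P ?x p' \<cdot> k"
          using cocone_on_nat[OF coc[OF P] k(1)] p(1) p'(1) k(2) by metis
        then show "h \<cdot> g \<cdot> k = h' \<cdot> g \<cdot> k" unfolding p(2) p'(2) using k g ha by (simp add: comp_assoc)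
      qed
    qed
  qed
  show "is_limit J C (comp_ftor J L D) (obj_map L P) ?L\<pi>" unfolding is_limit_def
  proof (intro conjI allI impI cone_L)
    fix y q assume q: "is_cone J C (comp_ftor J L D) y q"
    have y: "y \<in> Obj C" and qa: "\<And>j. j \<in> Obj J \<Longrightarrow> q j \<in> Arr C \<and> Dom C (q j) = y \<and> Cod C (q j) = obj_map L (obj_map D j)"
      and qu: "\<And>u. u \<in> Arr J \<Longrightarrow> arr_map L (arr_map D u) \<cdot> q (Dom J u) = q (Cod J u)"
      using q LDo LDa by (auto simp: is_cone_def Hom_iff)
    have "locally y (\<lambda>g. \<forall>j\<in>Obj J. \<exists>p\<in>obj_map (obj_map D j) (Dom C g). \<phi> (obj_map D j) (Dom C g) p = q j \<cdot> g)"
      by (rule locally_ball[OF fin(1) y]) (use surj[OF Dj] qa in fastforce)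
    then have "locally y (\<lambda>g. \<exists>m. m \<in> Hom C (Dom C g) (obj_map L P) \<and> (\<forall>j\<in>Obj J. ?L\<pi> j \<cdot> m = q j \<cdot> g))"
    proof (rule locally_bind)
      fix g assume g: "g \<in> Arr C" "Cod C g = y"
        and "\<forall>j\<in>Obj J. \<exists>p\<in>obj_map (obj_map D j) (Dom C g). \<phi> (obj_map D j) (Dom C g) p = q j \<cdot> g"
      then obtain p where p: "\<And>j. j \<in> Obj J \<Longrightarrow> p j \<in> obj_map (obj_map D j) (Dom C g)"
        "\<And>j. j \<in> Obj J \<Longrightarrow> \<phi> (obj_map D j) (Dom C g) (p j) = q j \<cdot> g" by metis
      let ?x = "Dom C g"
      have x: "?x \<in> Obj C" using g by simp
      \<comment> \<open>The lifts \<open>p j\<close> need not be compatible, only their images are.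
        By local injectivity they become compatible after a refinement common to the finitely many
        arrows of \<open>J\<close>.\<close>
      have "locally ?x (\<lambda>k. \<forall>u\<in>Arr J. act (obj_map D (Cod J u)) k (app (arr_map D u) ?x (p (Dom J u))) =
          act (obj_map D (Cod J u)) k (p (Cod J u)))"
      proof (rule locally_ball[OF fin(2) x])
        fix u assume u: "u \<in> Arr J"
        have o: "Dom J u \<in> Obj J" "Cod J u \<in> Obj J" using u by auto
        note Du = functor_hom[OF D u]
        have LDu: "arr_map L (arr_map D u) \<in> Arr C" "Dom C (arr_map L (arr_map D u)) = obj_map L (obj_map D (Dom J u))"
          using LH[OF Du] by (auto simp: Hom_iff)
        have "\<phi> (obj_map D (Cod J u)) ?x (app (arr_map D u) ?x (p (Dom J u))) =
            arr_map L (arr_map D u) \<cdot> (q (Dom J u) \<cdot> g)"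
          using nat[OF Du x p(1)[OF o(1)]] p(2)[OF o(1)] by simp
        also have "\<dots> = (arr_map L (arr_map D u) \<cdot> q (Dom J u)) \<cdot> g"
          by (rule comp_assoc[symmetric]) (use g qa[OF o(1)] LDu in auto)
        also have "\<dots> = \<phi> (obj_map D (Cod J u)) ?x (p (Cod J u))" using qu[OF u] p(2)[OF o(2)] by simp
        finally show "locally ?x (\<lambda>k. act (obj_map D (Cod J u)) k (app (arr_map D u) ?x (p (Dom J u))) =
            act (obj_map D (Cod J u)) k (p (Cod J u)))"
          by (rule inj[OF Dj[OF o(2)] x app_in[OF Du x p(1)[OF o(1)]] p(1)[OF o(2)]])
      qed
      then show "locally ?x (\<lambda>k. \<exists>m. m \<in> Hom C (Dom C (g \<cdot> k)) (obj_map L P) \<and> (\<forall>j\<in>Obj J. ?L\<pi> j \<cdot> m = q j \<cdot> g \<cdot> k))"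
      proof (rule locally_mono)
        fix k assume k: "k \<in> Arr C" "Cod C k = ?x"
          and *: "\<forall>u\<in>Arr J. act (obj_map D (Cod J u)) k (app (arr_map D u) ?x (p (Dom J u))) =
            act (obj_map D (Cod J u)) k (p (Cod J u))"
        let ?w = "Dom C k"
        let ?p = "\<lambda>j. act (obj_map D j) k (p j)"
        have w: "?w \<in> Obj C" using k by simp
        have pw: "?p j \<in> obj_map (obj_map D j) ?w" if "j \<in> Obj J" for j
          using psh_act[OF PC_psh[OF Dj[OF that]] k(1)] p(1)[OF that] k by simp
        have "\<exists>!r. r \<in> obj_map P ?w \<and> (\<forall>j\<in>Obj J. app (\<pi> j) ?w r = ?p j)"
        proof (rule limit_pointwise[OF lim w pw])
          fix u assume u: "u \<in> Arr J"
          have o: "Dom J u \<in> Obj J" "Cod J u \<in> Obj J" using u by auto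
          have "app (arr_map D u) ?w (?p (Dom J u)) = act (obj_map D (Cod J u)) k (app (arr_map D u) ?x (p (Dom J u)))"
            using natp_nat[OF app_natpp[OF functor_hom[OF D u]] k(1)] p(1)[OF o(1)] k by simp
          then show "app (arr_map D u) ?w (?p (Dom J u)) = ?p (Cod J u)" using * u by simp
        qed
        then obtain r where r: "r \<in> obj_map P ?w" "\<And>j. j \<in> Obj J \<Longrightarrow> app (\<pi> j) ?w r = ?p j" by blast
        have "?L\<pi> j \<cdot> \<phi> P ?w r = q j \<cdot> g \<cdot> k" if j: "j \<in> Obj J" for j
        proof -
          have "?L\<pi> j \<cdot> \<phi> P ?w r = \<phi> (obj_map D j) ?w (?p j)" using nat[OF \<pi>[OF j] w r(1)] r(2)[OF j] by simp
          also have "\<dots> = \<phi> (obj_map D j) ?x (p j) \<cdot> k"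
            using cocone_on_nat[OF coc[OF Dj[OF j]] k(1)] p(1)[OF j] k by simp
          also have "\<dots> = q j \<cdot> g \<cdot> k" unfolding p(2)[OF j] using k g qa[OF j] by (simp add: comp_assoc)
          finally show ?thesis .
        qed
        moreover have "\<phi> P ?w r \<in> Hom C (Dom C (g \<cdot> k)) (obj_map L P)" using natp_in[OF coc[OF P] w r(1)] k g by simp
        ultimately show "\<exists>m. m \<in> Hom C (Dom C (g \<cdot> k)) (obj_map L P) \<and> (\<forall>j\<in>Obj J. ?L\<pi> j \<cdot> m = q j \<cdot> g \<cdot> k)"
          by blast
      qed
    qed
    \<comment> \<open>The local factorizations are determined by their components, by
      \<open>separated\<close>, and so they match and glue.\<close>
    then obtain n where n: "n \<in> Hom C y (obj_map L P)" "locally y (\<lambda>g. \<forall>j\<in>Obj J. ?L\<pi> j \<cdot> (n \<cdot> g) = q j \<cdot> g)"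
    proof (rule locally_glue[OF functor_obj[OF L P], where \<Phi> = "\<lambda>g m. \<forall>j\<in>Obj J. ?L\<pi> j \<cdot> m = q j \<cdot> g"])
      fix h m m' assume mm: "m \<in> Hom C (Dom C h) (obj_map L P)" "m' \<in> Hom C (Dom C h) (obj_map L P)"
        "\<forall>j\<in>Obj J. ?L\<pi> j \<cdot> m = q j \<cdot> h" "\<forall>j\<in>Obj J. ?L\<pi> j \<cdot> m' = q j \<cdot> h"
      show "m = m'" by (rule separated[OF mm(1,2)]) (use mm(3,4) in simp)
    next
      fix h m k assume hk: "h \<in> Arr C" "Cod C h = y" "m \<in> Hom C (Dom C h) (obj_map L P)" "k \<in> Arr C"
        "Cod C k = Dom C h" "\<forall>j\<in>Obj J. ?L\<pi> j \<cdot> m = q j \<cdot> h"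
      have "?L\<pi> j \<cdot> m \<cdot> k = q j \<cdot> h \<cdot> k" if j: "j \<in> Obj J" for j
      proof -
        have "?L\<pi> j \<cdot> m \<cdot> k = (?L\<pi> j \<cdot> m) \<cdot> k"
          by (rule comp_assoc[symmetric]) (use hk L\<pi>[OF j] in \<open>auto simp: Hom_iff\<close>)
        also have "\<dots> = (q j \<cdot> h) \<cdot> k" using hk(6) j by simp
        also have "\<dots> = q j \<cdot> h \<cdot> k" by (rule comp_assoc) (use hk qa[OF j] in auto)
        finally show ?thesis .
      qed
      then show "\<forall>j\<in>Obj J. ?L\<pi> j \<cdot> m \<cdot> k = q j \<cdot> h \<cdot> k" by blast
    qed
    have na: "n \<in> Arr C" "Dom C n = y" "Cod C n = obj_map L P" using n(1) by (auto simp: Hom_iff)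
    have nq: "?L\<pi> j \<cdot> n = q j" if j: "j \<in> Obj J" for j
    proof (rule locally_eqD)
      show "locally y (\<lambda>g. (?L\<pi> j \<cdot> n) \<cdot> g = q j \<cdot> g)"
        by (rule locally_mono[OF n(2)]) (use na L\<pi>[OF j] j in \<open>simp add: comp_assoc\<close>)
      show "?L\<pi> j \<cdot> n \<in> Hom C y (obj_map L (obj_map D j))" "q j \<in> Hom C y (obj_map L (obj_map D j))"
        using na L\<pi>[OF j] qa[OF j] by (simp_all add: Hom_iff)
    qed
    show "\<exists>!h. h \<in> Hom C y (obj_map L P) \<and> (\<forall>j\<in>Obj J. ?L\<pi> j \<cdot> h = q j)"
    proof (rule ex1I)
      show "n \<in> Hom C y (obj_map L P) \<and> (\<forall>j\<in>Obj J. ?L\<pi> j \<cdot> n = q j)" using n(1) nq by blast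
      fix h assume h: "h \<in> Hom C y (obj_map L P) \<and> (\<forall>j\<in>Obj J. ?L\<pi> j \<cdot> h = q j)"
      show "h = n" by (rule separated[OF _ n(1)]) (use h nq in auto)
    qed
  qed
qed

theorem small_exact: "small_exact U C"
proof -
  have "\<exists>c \<phi>. universal_on (obj_map P) (act P) c \<phi> \<and> locally_bijective (obj_map P) (act P) c \<phi>"
    if P: "P \<in> Obj PC" for P
  proof -
    obtain I :: "('o \<times> 'u) set" and s Rel e where "presents (obj_map P) (act P) I s Rel e" "small U I" "small U Rel"
      using small_presents[OF P[unfolded PC_obj]] by blast
    then show ?thesis using presented_reflection by metis
  qed
  then obtain c \<phi> where univ: "\<And>P. P \<in> Obj PC \<Longrightarrow> universal_on (obj_map P) (act P) (c P) (\<phi> P)"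
    and bij: "\<And>P. P \<in> Obj PC \<Longrightarrow> locally_bijective (obj_map P) (act P) (c P) (\<phi> P)" by metis
  obtain L \<eta> \<epsilon> where adj: "adjunction PC C L Y \<eta> \<epsilon>" and LO: "\<And>P. P \<in> Obj PC \<Longrightarrow> obj_map L P = c P"
    and nat: "\<And>P Q \<tau> x p. \<tau> \<in> Hom PC P Q \<Longrightarrow> x \<in> Obj C \<Longrightarrow> p \<in> obj_map P x \<Longrightarrow>
      arr_map L \<tau> \<cdot> \<phi> P x p = \<phi> Q x (app \<tau> x p)"
    using adjunction_exists[where c = c and \<phi> = \<phi>, OF univ] by blast
  have "is_functor PC C L" using adj by (simp add: adjunction_def)
  then have "preserves_finite_limits PC C L"
    by (rule reflection_preserves_finite_limits[where \<phi> = \<phi>]) (use univ bij nat LO in auto)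
  with adj show ?thesis unfolding small_exact_def using fin_complete small_cocompl by blast
qed

end


section \<open>Pullbacks and the reflection\<close>

context category
begin

text \<open>Lets an object isomorphic to a colimit of elements take its place. In
  \<open>small_exact_stable\<close> this passes from \<open>L Q\<close> to y.\<close>

lemma universal_on_iso:
  assumes F: "universal_on F a c \<phi>" and m: "m \<in> Hom C c d" and n: "n \<in> Hom C d c"
    and nm: "n \<cdot> m = Ident C c" and mn: "m \<cdot> n = Ident C d"
    and \<psi>: "cocone_on F a d \<psi>" and eq: "\<And>x p. x \<in> Obj C \<Longrightarrow> p \<in> F x \<Longrightarrow> \<psi> x p = m \<cdot> \<phi> x p"
  shows "universal_on F a d \<psi>"
  unfolding universal_on_def
proof (intro conjI ballI allI impI \<psi>)
  have \<phi>: "cocone_on F a c \<phi>" using F by (simp add: universal_on_def)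
  show "d \<in> Obj C" using m by (auto simp: Hom_iff)
  fix y \<chi> assume y: "y \<in> Obj C" and \<chi>: "cocone_on F a y \<chi>"
  obtain t where t: "t \<in> Hom C c y" "\<forall>x\<in>Obj C. \<forall>p\<in>F x. t \<cdot> \<phi> x p = \<chi> x p"
    using universal_on_ex[OF F y \<chi>] by blast
  have ph: "\<phi> x p \<in> Hom C x c" if "x \<in> Obj C" "p \<in> F x" for x p using natp_in[OF \<phi> that] .
  show "\<exists>!t. t \<in> Hom C d y \<and> (\<forall>x\<in>Obj C. \<forall>p\<in>F x. t \<cdot> \<psi> x p = \<chi> x p)"
  proof (rule ex1I)
    have "(t \<cdot> n) \<cdot> \<psi> x p = \<chi> x p" if xp: "x \<in> Obj C" "p \<in> F x" for x p
    proof -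
      have "(t \<cdot> n) \<cdot> (m \<cdot> \<phi> x p) = t \<cdot> ((n \<cdot> m) \<cdot> \<phi> x p)"
        using ph[OF xp] m n t(1) by (simp add: comp_assoc Hom_iff)
      also have "\<dots> = \<chi> x p" using nm ph[OF xp] t(2) xp by (simp add: Hom_iff)
      finally show ?thesis using eq[OF xp] by simp
    qed
    then show "t \<cdot> n \<in> Hom C d y \<and> (\<forall>x\<in>Obj C. \<forall>p\<in>F x. (t \<cdot> n) \<cdot> \<psi> x p = \<chi> x p)"
      using comp[OF n t(1)] by blast
    fix t' assume t': "t' \<in> Hom C d y \<and> (\<forall>x\<in>Obj C. \<forall>p\<in>F x. t' \<cdot> \<psi> x p = \<chi> x p)"
    have "t' \<cdot> m = t"
    proof (rule universal_on_eqI[OF F comp[OF m] t(1)])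
      show "t' \<in> Hom C d y" using t' by blast
      fix x p assume xp: "x \<in> Obj C" "p \<in> F x"
      have "(t' \<cdot> m) \<cdot> \<phi> x p = t' \<cdot> \<psi> x p" unfolding eq[OF xp]
        by (rule assoc[OF ph[OF xp] m]) (use t' in blast)
      then show "(t' \<cdot> m) \<cdot> \<phi> x p = t \<cdot> \<phi> x p" using t' t(2) xp by simp
    qed
    then have "t \<cdot> n = (t' \<cdot> m) \<cdot> n" by simp
    also have "\<dots> = t' \<cdot> (m \<cdot> n)" by (rule assoc[OF n m]) (use t' in blast)
    also have "\<dots> = t'" using mn t' by (simp add: Hom_iff)
    finally show "t' = t \<cdot> n" ..
  qed
qed

lemma universal_on_compare:
  assumes F: "universal_on F a c \<phi>" and G: "universal_on F a d \<psi>"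
  obtains m n where "m \<in> Hom C c d" "n \<in> Hom C d c" "n \<cdot> m = Ident C c" "m \<cdot> n = Ident C d"
    "\<forall>x\<in>Obj C. \<forall>p\<in>F x. m \<cdot> \<phi> x p = \<psi> x p"
proof -
  have c: "c \<in> Obj C" "cocone_on F a c \<phi>" and d: "d \<in> Obj C" "cocone_on F a d \<psi>"
    using F G by (auto simp: universal_on_def)
  obtain m where m: "m \<in> Hom C c d" "\<forall>x\<in>Obj C. \<forall>p\<in>F x. m \<cdot> \<phi> x p = \<psi> x p"
    using universal_on_ex[OF F d] by blast
  obtain n where n: "n \<in> Hom C d c" "\<forall>x\<in>Obj C. \<forall>p\<in>F x. n \<cdot> \<psi> x p = \<phi> x p"
    using universal_on_ex[OF G c] by blast
  have "n \<cdot> m = Ident C c"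
  proof (rule universal_on_eqI[OF F comp[OF m(1) n(1)] ident[OF c(1)]])
    fix x p assume xp: "x \<in> Obj C" "p \<in> F x"
    note h = natp_in[OF c(2) xp]
    show "(n \<cdot> m) \<cdot> \<phi> x p = Ident C c \<cdot> \<phi> x p"
      using assoc[OF h m(1) n(1)] m(2) n(2) ident_comp[OF h] xp by simp
  qed
  moreover have "m \<cdot> n = Ident C d"
  proof (rule universal_on_eqI[OF G comp[OF n(1) m(1)] ident[OF d(1)]])
    fix x p assume xp: "x \<in> Obj C" "p \<in> F x"
    note h = natp_in[OF d(2) xp]
    show "(m \<cdot> n) \<cdot> \<psi> x p = Ident C d \<cdot> \<psi> x p"
      using assoc[OF h n(1) m(1)] m(2) n(2) ident_comp[OF h] xp by simp
  qed
  ultimately show thesis using that m n by blast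
qed

text \<open>A square isomorphic to a pullback square is a pullback. It is needed because
  \<open>L (rep c)\<close> is only isomorphic to c.\<close>

lemma is_pullback_transport:
  assumes P: "is_pullback C f g p q"
    and \<omega>: "\<omega> \<in> Hom C (Dom C p) w" "\<omega>' \<in> Hom C w (Dom C p)" "\<omega>' \<cdot> \<omega> = Ident C (Dom C p)" "\<omega> \<cdot> \<omega>' = Ident C w"
    and \<alpha>: "\<alpha> \<in> Hom C (Dom C f) x" "\<alpha>' \<in> Hom C x (Dom C f)" "\<alpha>' \<cdot> \<alpha> = Ident C (Dom C f)" "\<alpha> \<cdot> \<alpha>' = Ident C x"
    and \<beta>: "\<beta> \<in> Hom C (Dom C g) y" "\<beta>' \<in> Hom C y (Dom C g)" "\<beta>' \<cdot> \<beta> = Ident C (Dom C g)" "\<beta> \<cdot> \<beta>' = Ident C y"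
    and \<gamma>: "\<gamma> \<in> Hom C (Cod C f) z" "\<gamma>' \<in> Hom C z (Cod C f)" "\<gamma>' \<cdot> \<gamma> = Ident C (Cod C f)" "\<gamma> \<cdot> \<gamma>' = Ident C z"
    and f': "f' \<in> Hom C x z" "f' \<cdot> \<alpha> = \<gamma> \<cdot> f" and g': "g' \<in> Hom C y z" "g' \<cdot> \<beta> = \<gamma> \<cdot> g"
    and p': "p' \<in> Hom C w x" "p' \<cdot> \<omega> = \<alpha> \<cdot> p" and q': "q' \<in> Hom C w y" "q' \<cdot> \<omega> = \<beta> \<cdot> q"
  shows "is_pullback C f' g' p' q'"
proof -
  note d = is_pullbackD[OF P]
  have fH: "f \<in> Hom C (Dom C f) (Cod C f)" and gH: "g \<in> Hom C (Dom C g) (Cod C f)"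
    and pH: "p \<in> Hom C (Dom C p) (Dom C f)" and qH: "q \<in> Hom C (Dom C p) (Dom C g)"
    using d by (auto simp: Hom_iff)
  have p_eq: "p' = \<alpha> \<cdot> p \<cdot> \<omega>'"
  proof -
    have "p' = p' \<cdot> (\<omega> \<cdot> \<omega>')" using p'(1) \<omega> comp_ident by simp
    also have "\<dots> = \<alpha> \<cdot> p \<cdot> \<omega>'"
      using assoc[OF \<omega>(2,1) p'(1)] p'(2) assoc[OF \<omega>(2) pH \<alpha>(1)] by simp
    finally show ?thesis .
  qed
  have q_eq: "q' = \<beta> \<cdot> q \<cdot> \<omega>'"
  proof -
    have "q' = q' \<cdot> (\<omega> \<cdot> \<omega>')" using q'(1) \<omega> comp_ident by simp
    also have "\<dots> = \<beta> \<cdot> q \<cdot> \<omega>'"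
      using assoc[OF \<omega>(2,1) q'(1)] q'(2) assoc[OF \<omega>(2) qH \<beta>(1)] by simp
    finally show ?thesis .
  qed
  have f_eq: "f' \<cdot> (\<alpha> \<cdot> h) = \<gamma> \<cdot> (f \<cdot> h)" if "h \<in> Hom C v (Dom C f)" for h v
    using assoc[OF that \<alpha>(1) f'(1)] f'(2) assoc[OF that fH \<gamma>(1)] by simp
  have g_eq: "g' \<cdot> (\<beta> \<cdot> h) = \<gamma> \<cdot> (g \<cdot> h)" if "h \<in> Hom C v (Dom C g)" for h v
    using assoc[OF that \<beta>(1) g'(1)] g'(2) assoc[OF that gH \<gamma>(1)] by simp
  have \<alpha>_inv: "\<alpha>' \<cdot> (\<alpha> \<cdot> h) = h" if "h \<in> Hom C v (Dom C f)" for h v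
    using assoc[OF that \<alpha>(1,2)] \<alpha>(3) ident_comp[OF that] by simp
  have \<alpha>_inv': "\<alpha> \<cdot> (\<alpha>' \<cdot> h) = h" if "h \<in> Hom C v x" for h v
    using assoc[OF that \<alpha>(2,1)] \<alpha>(4) ident_comp[OF that] by simp
  have \<beta>_inv: "\<beta>' \<cdot> (\<beta> \<cdot> h) = h" if "h \<in> Hom C v (Dom C g)" for h v
    using assoc[OF that \<beta>(1,2)] \<beta>(3) ident_comp[OF that] by simp
  have \<beta>_inv': "\<beta> \<cdot> (\<beta>' \<cdot> h) = h" if "h \<in> Hom C v y" for h v
    using assoc[OF that \<beta>(2,1)] \<beta>(4) ident_comp[OF that] by simp
  have \<gamma>_inv: "\<gamma>' \<cdot> (\<gamma> \<cdot> h) = h" if "h \<in> Hom C v (Cod C f)" for h v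
    using assoc[OF that \<gamma>(1,2)] \<gamma>(3) ident_comp[OF that] by simp
  have \<omega>_inv: "\<omega>' \<cdot> (\<omega> \<cdot> h) = h" if "h \<in> Hom C v (Dom C p)" for h v
    using assoc[OF that \<omega>(1,2)] \<omega>(3) ident_comp[OF that] by simp
  have \<omega>_inv': "\<omega> \<cdot> (\<omega>' \<cdot> h) = h" if "h \<in> Hom C v w" for h v
    using assoc[OF that \<omega>(2,1)] \<omega>(4) ident_comp[OF that] by simp
  have p_u: "p' \<cdot> u = \<alpha> \<cdot> (p \<cdot> (\<omega>' \<cdot> u))" and q_u: "q' \<cdot> u = \<beta> \<cdot> (q \<cdot> (\<omega>' \<cdot> u))" if u: "u \<in> Hom C v w" for u v
    unfolding p_eq q_eq
    using assoc[OF u comp[OF \<omega>(2) pH] \<alpha>(1)] assoc[OF u \<omega>(2) pH] assoc[OF u comp[OF \<omega>(2) qH] \<beta>(1)] assoc[OF u \<omega>(2) qH]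
    by simp_all
  have a: "f' \<in> Arr C" "Dom C f' = x" "Cod C f' = z" "g' \<in> Arr C" "Dom C g' = y" "Cod C g' = z"
    "p' \<in> Arr C" "Dom C p' = w" "Cod C p' = x" "q' \<in> Arr C" "Dom C q' = w" "Cod C q' = y"
    using f' g' p' q' by (auto simp: Hom_iff)
  show ?thesis
  proof (rule is_pullbackI)
    have "f' \<cdot> p' = \<gamma> \<cdot> (f \<cdot> (p \<cdot> \<omega>'))" unfolding p_eq by (rule f_eq[OF comp[OF \<omega>(2) pH]])
    also have "\<dots> = \<gamma> \<cdot> (g \<cdot> (q \<cdot> \<omega>'))"
      using assoc[OF \<omega>(2) pH fH] assoc[OF \<omega>(2) qH gH] d(9) by simp
    also have "\<dots> = g' \<cdot> q'" unfolding q_eq by (rule g_eq[OF comp[OF \<omega>(2) qH], symmetric])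
    finally show "f' \<cdot> p' = g' \<cdot> q'" .
  next
    fix h k assume hk: "h \<in> Arr C" "k \<in> Arr C" "Dom C h = Dom C k" "Cod C h = Dom C f'"
      "Cod C k = Dom C g'" "f' \<cdot> h = g' \<cdot> k"
    let ?v = "Dom C h"
    have h: "h \<in> Hom C ?v x" and k: "k \<in> Hom C ?v y" using hk a by (auto simp: Hom_iff)
    have h': "\<alpha>' \<cdot> h \<in> Hom C ?v (Dom C f)" and k': "\<beta>' \<cdot> k \<in> Hom C ?v (Dom C g)"
      using comp[OF h \<alpha>(2)] comp[OF k \<beta>(2)] .
    have "\<gamma> \<cdot> (f \<cdot> (\<alpha>' \<cdot> h)) = \<gamma> \<cdot> (g \<cdot> (\<beta>' \<cdot> k))"
      using f_eq[OF h'] g_eq[OF k'] \<alpha>_inv'[OF h] \<beta>_inv'[OF k] hk(6) by simp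
    then have "f \<cdot> (\<alpha>' \<cdot> h) = g \<cdot> (\<beta>' \<cdot> k)"
      using \<gamma>_inv[OF comp[OF h' fH]] \<gamma>_inv[OF comp[OF k' gH]] by metis
    then have "\<exists>u\<in>Arr C. Dom C u = Dom C (\<alpha>' \<cdot> h) \<and> Cod C u = Dom C p \<and> p \<cdot> u = \<alpha>' \<cdot> h \<and> q \<cdot> u = \<beta>' \<cdot> k"
      by (intro is_pullback_ex[OF P]) (use h' k' in \<open>auto simp: Hom_iff\<close>)
    then obtain u where u: "u \<in> Hom C ?v (Dom C p)" "p \<cdot> u = \<alpha>' \<cdot> h" "q \<cdot> u = \<beta>' \<cdot> k"
      using h' by (auto simp: Hom_iff)
    have wu: "\<omega> \<cdot> u \<in> Hom C ?v w" using comp[OF u(1) \<omega>(1)] .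
    have "p' \<cdot> (\<omega> \<cdot> u) = h" "q' \<cdot> (\<omega> \<cdot> u) = k"
      using p_u[OF wu] q_u[OF wu] \<omega>_inv[OF u(1)] u(2,3) \<alpha>_inv'[OF h] \<beta>_inv'[OF k] by simp_all
    then show "\<exists>u\<in>Arr C. Dom C u = ?v \<and> Cod C u = Dom C p' \<and> p' \<cdot> u = h \<and> q' \<cdot> u = k"
      using wu a by (intro bexI[of _ "\<omega> \<cdot> u"]) (auto simp: Hom_iff)
  next
    fix u v assume uv: "u \<in> Arr C" "v \<in> Arr C" "Dom C u = Dom C v" "Cod C u = Dom C p'"
      "Cod C v = Dom C p'" "p' \<cdot> u = p' \<cdot> v" "q' \<cdot> u = q' \<cdot> v"
    let ?x = "Dom C u"
    have u: "u \<in> Hom C ?x w" and v: "v \<in> Hom C ?x w" using uv a by (auto simp: Hom_iff)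
    note u' = comp[OF u \<omega>(2)] and v' = comp[OF v \<omega>(2)]
    have "p \<cdot> (\<omega>' \<cdot> u) = p \<cdot> (\<omega>' \<cdot> v)"
      using \<alpha>_inv[OF comp[OF u' pH]] \<alpha>_inv[OF comp[OF v' pH]] p_u[OF u] p_u[OF v] uv(6) by metis
    moreover have "q \<cdot> (\<omega>' \<cdot> u) = q \<cdot> (\<omega>' \<cdot> v)"
      using \<beta>_inv[OF comp[OF u' qH]] \<beta>_inv[OF comp[OF v' qH]] q_u[OF u] q_u[OF v] uv(7) by metis
    ultimately have "\<omega>' \<cdot> u = \<omega>' \<cdot> v"
      using u' v' by (intro is_pullback_eqI[OF P, of "\<omega>' \<cdot> u" "\<omega>' \<cdot> v"]) (auto simp: Hom_iff)
    then show "u = v" using \<omega>_inv'[OF u] \<omega>_inv'[OF v] by metis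
  qed (use a in auto)
qed

end

section \<open>Pullbacks of presheaves and their images under the left adjoint\<close>

context universe_category
begin

text \<open>The category of elements of a representable has a terminal object, the identity of c, so
  its colimit is c.\<close>

lemma universal_on_rep:
  assumes c: "c \<in> Obj C"
  shows "universal_on (obj_map (rep c)) (act (rep c)) c (\<lambda>x s. dec x c s)"
  unfolding universal_on_def
proof (intro conjI ballI allI impI c cocone_on_rep)
  fix d \<psi> assume d: "d \<in> Obj C" and \<psi>: "cocone_on (obj_map (rep c)) (act (rep c)) d \<psi>"
  let ?e = "enc c c (Ident C c)"
  have e: "?e \<in> obj_map (rep c) c" using c by (simp add: rep_obj enc_in ident)
  have de: "dec c c ?e = Ident C c" using dec_enc[OF ident[OF c]] .
  let ?m = "\<psi> c ?e"
  have m: "?m \<in> Hom C c d" using natp_in[OF \<psi> c e] .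
  show "\<exists>!m. m \<in> Hom C c d \<and> (\<forall>x\<in>Obj C. \<forall>p\<in>obj_map (rep c) x. m \<cdot> dec x c p = \<psi> x p)"
  proof (rule ex1I)
    have "?m \<cdot> dec x c p = \<psi> x p" if xp: "x \<in> Obj C" "p \<in> obj_map (rep c) x" for x p
      by (rule presents_unique[OF rep_presents[OF c] cocone_on_compose[OF cocone_on_rep m] \<psi> _ xp])
        (simp add: de comp_ident[OF m])
    then show "?m \<in> Hom C c d \<and> (\<forall>x\<in>Obj C. \<forall>p\<in>obj_map (rep c) x. ?m \<cdot> dec x c p = \<psi> x p)"
      using m by blast
    fix n assume n: "n \<in> Hom C c d \<and> (\<forall>x\<in>Obj C. \<forall>p\<in>obj_map (rep c) x. n \<cdot> dec x c p = \<psi> x p)"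
    then have "n \<cdot> dec c c ?e = ?m" using c e by blast
    then show "n = ?m" using de n by (simp add: Hom_iff)
  qed
qed

text \<open>Pullbacks of presheaves are tested on elements. Lifts are chosen for each element
  separately; naturality is automatic because a pair of elements has only one lift.\<close>

lemma PC_pullback:
  assumes f: "f \<in> Hom PC A P" and g: "g \<in> Hom PC B P" and a: "a \<in> Hom PC W A" and b: "b \<in> Hom PC W B"
    and comm: "\<And>x w. x \<in> Obj C \<Longrightarrow> w \<in> obj_map W x \<Longrightarrow> app f x (app a x w) = app g x (app b x w)"
    and ex: "\<And>x p q. x \<in> Obj C \<Longrightarrow> p \<in> obj_map A x \<Longrightarrow> q \<in> obj_map B x \<Longrightarrow> app f x p = app g x q \<Longrightarrow>
      \<exists>w\<in>obj_map W x. app a x w = p \<and> app b x w = q"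
    and un: "\<And>x w w'. x \<in> Obj C \<Longrightarrow> w \<in> obj_map W x \<Longrightarrow> w' \<in> obj_map W x \<Longrightarrow> app a x w = app a x w' \<Longrightarrow>
      app b x w = app b x w' \<Longrightarrow> w = w'"
  shows "is_pullback PC f g a b"
proof -
  interpret PC: category PC by (rule PC_category)
  have obj: "A \<in> Obj PC" "B \<in> Obj PC" "P \<in> Obj PC" "W \<in> Obj PC" using f g a by (auto simp: PC_Hom)
  have arr: "f \<in> Arr PC" "Dom PC f = A" "Cod PC f = P" "g \<in> Arr PC" "Dom PC g = B" "Cod PC g = P"
    "a \<in> Arr PC" "Dom PC a = W" "Cod PC a = A" "b \<in> Arr PC" "Dom PC b = W" "Cod PC b = B"
    using f g a b by (auto simp: Hom_iff)
  show ?thesis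
  proof (rule PC.is_pullbackI)
    show "f \<cdot>\<^bsub>PC\<^esub> a = g \<cdot>\<^bsub>PC\<^esub> b"
      by (rule PC_eqI[OF PC.comp[OF a f] PC.comp[OF b g]])
        (use app_comp[OF a f] app_comp[OF b g] comm in simp)
  next
    fix h k assume hk: "h \<in> Arr PC" "k \<in> Arr PC" "Dom PC h = Dom PC k" "Cod PC h = Dom PC f"
      "Cod PC k = Dom PC g" "f \<cdot>\<^bsub>PC\<^esub> h = g \<cdot>\<^bsub>PC\<^esub> k"
    let ?V = "Dom PC h"
    have h: "h \<in> Hom PC ?V A" and k: "k \<in> Hom PC ?V B" using hk arr by (auto simp: Hom_iff)
    have V: "?V \<in> Obj PC" using hk by simp
    have eq: "app f x (app h x v) = app g x (app k x v)" if "x \<in> Obj C" "v \<in> obj_map ?V x" for x v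
      using app_comp[OF h f that] app_comp[OF k g that] hk(6) by simp
    have "\<forall>x\<in>Obj C. \<forall>v\<in>obj_map ?V x. \<exists>w. w \<in> obj_map W x \<and> app a x w = app h x v \<and> app b x w = app k x v"
      using ex[OF _ app_in[OF h] app_in[OF k] eq] by blast
    then obtain \<phi> where \<phi>: "\<And>x v. x \<in> Obj C \<Longrightarrow> v \<in> obj_map ?V x \<Longrightarrow>
        \<phi> x v \<in> obj_map W x \<and> app a x (\<phi> x v) = app h x v \<and> app b x (\<phi> x v) = app k x v" by metis
    have n: "natpp ?V W \<phi>" unfolding natp_def
    proof (intro conjI ballI)
      fix t v assume t: "t \<in> Arr C" and v: "v \<in> obj_map ?V (Cod C t)"
      have o: "Dom C t \<in> Obj C" "Cod C t \<in> Obj C" using t by auto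
      have v': "act ?V t v \<in> obj_map ?V (Dom C t)" using psh_act[OF PC_psh[OF V] t v] .
      note p1 = \<phi>[OF o(1) v'] and p2 = \<phi>[OF o(2) v]
      show "\<phi> (Dom C t) (act ?V t v) = act W t (\<phi> (Cod C t) v)"
      proof (rule un[OF o(1)])
        show "act W t (\<phi> (Cod C t) v) \<in> obj_map W (Dom C t)" using psh_act[OF PC_psh[OF obj(4)] t] p2 by blast
        show "app a (Dom C t) (\<phi> (Dom C t) (act ?V t v)) = app a (Dom C t) (act W t (\<phi> (Cod C t) v))"
          using p1 p2 natp_nat[OF app_natpp[OF a] t] natp_nat[OF app_natpp[OF h] t v] by simp
        show "app b (Dom C t) (\<phi> (Dom C t) (act ?V t v)) = app b (Dom C t) (act W t (\<phi> (Cod C t) v))"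
          using p1 p2 natp_nat[OF app_natpp[OF b] t] natp_nat[OF app_natpp[OF k] t v] by simp
      qed (use p1 in blast)
    qed (use \<phi> in blast)
    let ?u = "mk_map ?V W \<phi>"
    have u: "?u \<in> Hom PC ?V W" by (rule mk_map_Hom[OF V obj(4) n])
    have "a \<cdot>\<^bsub>PC\<^esub> ?u = h"
      by (rule PC_eqI[OF PC.comp[OF u a] h]) (use app_comp[OF u a] \<phi> in \<open>simp add: app_mk_map\<close>)
    moreover have "b \<cdot>\<^bsub>PC\<^esub> ?u = k"
      by (rule PC_eqI[OF PC.comp[OF u b] k]) (use app_comp[OF u b] \<phi> in \<open>simp add: app_mk_map\<close>)
    ultimately show "\<exists>u\<in>Arr PC. Dom PC u = ?V \<and> Cod PC u = Dom PC a \<and> a \<cdot>\<^bsub>PC\<^esub> u = h \<and> b \<cdot>\<^bsub>PC\<^esub> u = k"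
      using u arr by (intro bexI[of _ ?u]) (auto simp: Hom_iff)
  next
    fix u v assume uv: "u \<in> Arr PC" "v \<in> Arr PC" "Dom PC u = Dom PC v" "Cod PC u = Dom PC a"
      "Cod PC v = Dom PC a" "a \<cdot>\<^bsub>PC\<^esub> u = a \<cdot>\<^bsub>PC\<^esub> v" "b \<cdot>\<^bsub>PC\<^esub> u = b \<cdot>\<^bsub>PC\<^esub> v"
    let ?V = "Dom PC u"
    have u: "u \<in> Hom PC ?V W" and v: "v \<in> Hom PC ?V W" using uv arr by (auto simp: Hom_iff)
    show "u = v"
    proof (rule PC_eqI[OF u v])
      fix x p assume xp: "x \<in> Obj C" "p \<in> obj_map ?V x"
      show "app u x p = app v x p"
      proof (rule un[OF xp(1) app_in[OF u xp] app_in[OF v xp]])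
        show "app a x (app u x p) = app a x (app v x p)"
          using app_comp[OF u a xp] app_comp[OF v a xp] uv(6) by simp
        show "app b x (app u x p) = app b x (app v x p)"
          using app_comp[OF u b xp] app_comp[OF v b xp] uv(7) by simp
      qed
    qed
  qed (use arr in auto)
qed

text \<open>The working form of exactness of \<open>L\<close>, from which all three properties of an
  infinity-pretopos are derived: each corner may be replaced by any colimit of elements and each
  side by the arrow induced on these colimits.\<close>

lemma lex_pullback:
  assumes adj: "adjunction PC C L Y \<eta> \<epsilon>" and lex: "preserves_finite_limits PC C L"
    and f: "f \<in> Hom PC A P" and g: "g \<in> Hom PC B P" and a: "a \<in> Hom PC W A" and b: "b \<in> Hom PC W B"
    and pb: "is_pullback PC f g a b"
    and uW: "universal_on (obj_map W) (act W) w \<theta>W" and uA: "universal_on (obj_map A) (act A) x \<theta>A"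
    and uB: "universal_on (obj_map B) (act B) y \<theta>B" and uP: "universal_on (obj_map P) (act P) z \<theta>P"
    and f': "f' \<in> Hom C x z" "\<And>v p. v \<in> Obj C \<Longrightarrow> p \<in> obj_map A v \<Longrightarrow> f' \<cdot> \<theta>A v p = \<theta>P v (app f v p)"
    and g': "g' \<in> Hom C y z" "\<And>v p. v \<in> Obj C \<Longrightarrow> p \<in> obj_map B v \<Longrightarrow> g' \<cdot> \<theta>B v p = \<theta>P v (app g v p)"
    and a': "a' \<in> Hom C w x" "\<And>v p. v \<in> Obj C \<Longrightarrow> p \<in> obj_map W v \<Longrightarrow> a' \<cdot> \<theta>W v p = \<theta>A v (app a v p)"
    and b': "b' \<in> Hom C w y" "\<And>v p. v \<in> Obj C \<Longrightarrow> p \<in> obj_map W v \<Longrightarrow> b' \<cdot> \<theta>W v p = \<theta>B v (app b v p)"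
  shows "is_pullback C f' g' a' b'"
proof -
  interpret PC: category PC by (rule PC_category)
  have L: "is_functor PC C L" using adj by (simp add: adjunction_def)
  have obj: "A \<in> Obj PC" "B \<in> Obj PC" "P \<in> Obj PC" "W \<in> Obj PC" using f g a by (auto simp: PC_Hom)
  have arr: "f \<in> Arr PC" "Dom PC f = A" "Cod PC f = P" "g \<in> Arr PC" "Dom PC g = B" "Cod PC g = P"
    "a \<in> Arr PC" "Dom PC a = W" "Cod PC a = A" "b \<in> Arr PC" "Dom PC b = W" "Cod PC b = B"
    using f g a b by (auto simp: Hom_iff)
  have LH: "arr_map L \<tau> \<in> Hom C (obj_map L M) (obj_map L N)" if "\<tau> \<in> Hom PC M N" for \<tau> M N
    using functor_hom[OF L, of \<tau>] that by (auto simp: Hom_iff)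
  have La: "arr_map L f \<in> Arr C" "Dom C (arr_map L f) = obj_map L A" "Cod C (arr_map L f) = obj_map L P"
    "arr_map L g \<in> Arr C" "Dom C (arr_map L g) = obj_map L B" "Cod C (arr_map L g) = obj_map L P"
    "Dom C (arr_map L a) = obj_map L W"
    using LH[OF f] LH[OF g] LH[OF a] by (auto simp: Hom_iff)
  let ?p = "\<lambda>j :: nat. if j = 0 then a else if j = 1 then b else f \<cdot>\<^bsub>PC\<^esub> a"
  have "is_limit cospan_cat PC (cospan_ftor PC f g) W ?p"
    using PC.cospan_limit_iff[of f g W ?p] arr pb by simp
  then have "is_limit cospan_cat C (comp_ftor cospan_cat L (cospan_ftor PC f g)) (obj_map L W) (\<lambda>j. arr_map L (?p j))"
    using lex finite_cospan_cat unfolding preserves_finite_limits_def by blast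
  moreover have "comp_ftor cospan_cat L (cospan_ftor PC f g) = cospan_ftor C (arr_map L f) (arr_map L g)"
    by (rule ftor_eqI)
      (use La functor_ident[OF L obj(1)] functor_ident[OF L obj(2)] functor_ident[OF L obj(3)] arr in
        \<open>auto simp: comp_ftor_def cospan_ftor_def cospan_cat_def restrict_def fun_eq_iff\<close>)
  ultimately have "is_pullback C (arr_map L f) (arr_map L g) (arr_map L (?p 0)) (arr_map L (?p 1))"
    using cospan_limit_iff[of "arr_map L f" "arr_map L g" "obj_map L W" "\<lambda>j. arr_map L (?p j)"] La by simp
  then have LP: "is_pullback C (arr_map L f) (arr_map L g) (arr_map L a) (arr_map L b)" by simp
  let ?\<phi> = "\<lambda>M. of_map (obj_map L M) (\<eta> M)"
  have uL: "universal_on (obj_map M) (act M) (obj_map L M) (?\<phi> M)" if "M \<in> Obj PC" for M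
    using adjunction_universal(1)[OF adj that] .
  have Ln: "arr_map L \<tau> \<cdot> ?\<phi> M v p = ?\<phi> N v (app \<tau> v p)"
    if "\<tau> \<in> Hom PC M N" "v \<in> Obj C" "p \<in> obj_map M v" for \<tau> M N v p
  proof -
    have "M \<in> Obj PC" using that by (simp add: PC_Hom)
    then show ?thesis using adjunction_universal(2)[OF adj _ that] by blast
  qed
  \<comment> \<open>Both composites agree on the universal cocone of M, so the comparison
    isomorphisms commute with the sides of the two squares.\<close>
  have square: "t' \<cdot> m = n \<cdot> arr_map L \<tau>"
    if t: "\<tau> \<in> Hom PC M N" and m: "m \<in> Hom C (obj_map L M) c" "\<forall>v\<in>Obj C. \<forall>p\<in>obj_map M v. m \<cdot> ?\<phi> M v p = \<theta> v p"
      and n: "n \<in> Hom C (obj_map L N) d" "\<forall>v\<in>Obj C. \<forall>p\<in>obj_map N v. n \<cdot> ?\<phi> N v p = \<theta>' v p"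
      and t': "t' \<in> Hom C c d" "\<And>v p. v \<in> Obj C \<Longrightarrow> p \<in> obj_map M v \<Longrightarrow> t' \<cdot> \<theta> v p = \<theta>' v (app \<tau> v p)"
    for \<tau> M N m n c d \<theta> \<theta>' t'
  proof -
    have M: "M \<in> Obj PC" "N \<in> Obj PC" using t by (auto simp: PC_Hom)
    have coc: "cocone_on (obj_map M) (act M) (obj_map L M) (?\<phi> M)" using uL[OF M(1)] by (simp add: universal_on_def)
    show ?thesis
    proof (rule universal_on_eqI[OF uL[OF M(1)] comp[OF m(1) t'(1)] comp[OF LH[OF t] n(1)]])
      fix v p assume vp: "v \<in> Obj C" "p \<in> obj_map M v"
      note h = natp_in[OF coc vp]
      show "(t' \<cdot> m) \<cdot> ?\<phi> M v p = (n \<cdot> arr_map L \<tau>) \<cdot> ?\<phi> M v p"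
        using assoc[OF h m(1) t'(1)] assoc[OF h LH[OF t] n(1)] m(2) n(2) t'(2)[OF vp] Ln[OF t vp]
          app_in[OF t vp] vp by simp
    qed
  qed
  obtain \<omega> \<omega>' where w: "\<omega> \<in> Hom C (obj_map L W) w" "\<omega>' \<in> Hom C w (obj_map L W)"
    "\<omega>' \<cdot> \<omega> = Ident C (obj_map L W)" "\<omega> \<cdot> \<omega>' = Ident C w" "\<forall>v\<in>Obj C. \<forall>p\<in>obj_map W v. \<omega> \<cdot> ?\<phi> W v p = \<theta>W v p"
    using universal_on_compare[OF uL[OF obj(4)] uW] .
  obtain \<alpha> \<alpha>' where x: "\<alpha> \<in> Hom C (obj_map L A) x" "\<alpha>' \<in> Hom C x (obj_map L A)"
    "\<alpha>' \<cdot> \<alpha> = Ident C (obj_map L A)" "\<alpha> \<cdot> \<alpha>' = Ident C x" "\<forall>v\<in>Obj C. \<forall>p\<in>obj_map A v. \<alpha> \<cdot> ?\<phi> A v p = \<theta>A v p"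
    using universal_on_compare[OF uL[OF obj(1)] uA] .
  obtain \<beta> \<beta>' where y: "\<beta> \<in> Hom C (obj_map L B) y" "\<beta>' \<in> Hom C y (obj_map L B)"
    "\<beta>' \<cdot> \<beta> = Ident C (obj_map L B)" "\<beta> \<cdot> \<beta>' = Ident C y" "\<forall>v\<in>Obj C. \<forall>p\<in>obj_map B v. \<beta> \<cdot> ?\<phi> B v p = \<theta>B v p"
    using universal_on_compare[OF uL[OF obj(2)] uB] .
  obtain \<gamma> \<gamma>' where z: "\<gamma> \<in> Hom C (obj_map L P) z" "\<gamma>' \<in> Hom C z (obj_map L P)"
    "\<gamma>' \<cdot> \<gamma> = Ident C (obj_map L P)" "\<gamma> \<cdot> \<gamma>' = Ident C z" "\<forall>v\<in>Obj C. \<forall>p\<in>obj_map P v. \<gamma> \<cdot> ?\<phi> P v p = \<theta>P v p"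
    using universal_on_compare[OF uL[OF obj(3)] uP] .
  show ?thesis
  proof (rule is_pullback_transport[OF LP, unfolded La])
    show "f' \<cdot> \<alpha> = \<gamma> \<cdot> arr_map L f" by (rule square[OF f x(1,5) z(1,5) f'])
    show "g' \<cdot> \<beta> = \<gamma> \<cdot> arr_map L g" by (rule square[OF g y(1,5) z(1,5) g'])
    show "a' \<cdot> \<omega> = \<alpha> \<cdot> arr_map L a" by (rule square[OF a w(1,5) x(1,5) a'])
    show "b' \<cdot> \<omega> = \<beta> \<cdot> arr_map L b" by (rule square[OF b w(1,5) y(1,5) b'])
  qed (use w x y z f' g' a' b' in auto)
qed

end


section \<open>Small-exact categories are \<infinity>-pretoposes\<close>

context category
begin

text \<open>Presents the colimit in presheaves of D followed by the Yoneda embedding: each arrow u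
  identifies the generator at its source with the generator at its target restricted along
  \<open>arr_map D u\<close>.\<close>

definition diag_rel :: "('j, 'k) cat \<Rightarrow> ('j, 'k, 'o, 'a) ftor \<Rightarrow> ('j \<times> 'a \<times> 'a \<times> 'j) set" where
  "diag_rel J D = (\<lambda>u. (Dom J u, Ident C (obj_map D (Dom J u)), arr_map D u, Cod J u)) ` Arr J"

lemma diag_pres_data:
  assumes D: "is_functor J C D"
  shows "pres_data (Obj J) (obj_map D) (diag_rel J D)"
proof -
  interpret J: category J using functor_dom[OF D] .
  show ?thesis unfolding pres_data_def diag_rel_def
    using functor_obj[OF D] functor_arr[OF D] by auto
qed

lemma diag_cocone:
  assumes P: "presents F a (Obj J) (obj_map D) (diag_rel J D) e" and D: "is_functor J C D"
    and k: "is_cocone J C D d k"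
  obtains \<theta> where "cocone_on F a d \<theta>"
    "\<forall>j\<in>Obj J. \<forall>l\<in>Arr C. Cod C l = obj_map D j \<longrightarrow> \<theta> (Dom C l) (a l (e j)) = k j \<cdot> l"
proof -
  interpret J: category J using functor_dom[OF D] .
  have kH: "k j \<in> Hom C (obj_map D j) d" if "j \<in> Obj J" for j using k that by (simp add: is_cocone_def)
  have rel: "hom_act u (k i) = hom_act v (k j)" if "(i, u, v, j) \<in> diag_rel J D" for i u v j
  proof -
    obtain w where w: "w \<in> Arr J" "i = Dom J w" "u = Ident C (obj_map D i)" "v = arr_map D w" "j = Cod J w"
      using \<open>(i, u, v, j) \<in> diag_rel J D\<close> by (auto simp: diag_rel_def)
    then show ?thesis using k kH[of i] by (auto simp: is_cocone_def hom_act_def Hom_iff)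
  qed
  obtain \<theta> where "cocone_on F a d \<theta>" "\<And>j. j \<in> Obj J \<Longrightarrow> \<theta> (obj_map D j) (e j) = k j"
    "\<And>j l. j \<in> Obj J \<Longrightarrow> l \<in> Arr C \<Longrightarrow> Cod C l = obj_map D j \<Longrightarrow> \<theta> (Dom C l) (a l (e j)) = hom_act l (k j)"
    using presents_natp[OF P psh_hom kH rel] by blast
  then show thesis using that by (simp add: hom_act_def)
qed

lemma cocone_diag:
  assumes P: "presents F a (Obj J) (obj_map D) (diag_rel J D) e" and D: "is_functor J C D"
    and \<psi>: "cocone_on F a d \<psi>" and d: "d \<in> Obj C"
  shows "is_cocone J C D d (\<lambda>j. \<psi> (obj_map D j) (e j))"
proof -
  interpret J: category J using functor_dom[OF D] .
  note e = presentsD(3)[OF P] and sO = presentsD(4)[OF P] and F = presentsD(2)[OF P]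
  show ?thesis unfolding is_cocone_def
  proof (intro conjI ballI D d)
    show "\<psi> (obj_map D j) (e j) \<in> Hom C (obj_map D j) d" if "j \<in> Obj J" for j
      using natp_in[OF \<psi> sO[OF that] e[OF that]] .
    fix u assume u: "u \<in> Arr J"
    have o: "Dom J u \<in> Obj J" "Cod J u \<in> Obj J" using u by auto
    note Du = functor_arr[OF D u]
    have "(Dom J u, Ident C (obj_map D (Dom J u)), arr_map D u, Cod J u) \<in> diag_rel J D"
      using u by (simp add: diag_rel_def)
    from presents_rel[OF P this] have "e (Dom J u) = a (arr_map D u) (e (Cod J u))"
      using psh_ident[OF F sO[OF o(1)] e[OF o(1)]] by simp
    then show "\<psi> (obj_map D (Cod J u)) (e (Cod J u)) \<cdot> arr_map D u = \<psi> (obj_map D (Dom J u)) (e (Dom J u))"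
      using cocone_on_nat[OF \<psi> Du(1), of "e (Cod J u)"] Du e[OF o(2)] by simp
  qed
qed

text \<open>A cocone on D and a cocone on the elements of F are both families on the generators that
  respect the same relations. So reflecting the colimit of representables yields the colimit in
  C.\<close>

lemma diag_colimit_iff:
  assumes P: "presents F a (Obj J) (obj_map D) (diag_rel J D) e" and D: "is_functor J C D"
    and x: "x \<in> Obj C" and \<theta>: "cocone_on F a x \<theta>"
    and \<theta>i: "\<And>j. j \<in> Obj J \<Longrightarrow> \<theta> (obj_map D j) (e j) = i j"
  shows "is_colimit J C D x i \<longleftrightarrow> universal_on F a x \<theta>"
proof -
  interpret J: category J using functor_dom[OF D] .
  note e = presentsD(3)[OF P] and sO = presentsD(4)[OF P] and F = presentsD(2)[OF P]
  have iff: "(\<forall>j\<in>Obj J. m \<cdot> i j = \<psi> (obj_map D j) (e j)) \<longleftrightarrow> (\<forall>v\<in>Obj C. \<forall>p\<in>F v. m \<cdot> \<theta> v p = \<psi> v p)"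
    if m: "m \<in> Hom C x d" and \<psi>: "cocone_on F a d \<psi>" for m d \<psi>
  proof
    assume *: "\<forall>j\<in>Obj J. m \<cdot> i j = \<psi> (obj_map D j) (e j)"
    show "\<forall>v\<in>Obj C. \<forall>p\<in>F v. m \<cdot> \<theta> v p = \<psi> v p"
    proof (intro ballI)
      fix v p assume vp: "v \<in> Obj C" "p \<in> F v"
      show "m \<cdot> \<theta> v p = \<psi> v p"
        by (rule presents_unique[OF P cocone_on_compose[OF \<theta> m] \<psi> _ vp]) (use * \<theta>i in simp)
    qed
  next
    assume "\<forall>v\<in>Obj C. \<forall>p\<in>F v. m \<cdot> \<theta> v p = \<psi> v p"
    then show "\<forall>j\<in>Obj J. m \<cdot> i j = \<psi> (obj_map D j) (e j)" using \<theta>i sO e by metis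
  qed
  have i_coc: "is_cocone J C D x i"
    using cocone_diag[OF P D \<theta> x] \<theta>i D by (simp add: is_cocone_def)
  show ?thesis
  proof
    assume L: "is_colimit J C D x i"
    show "universal_on F a x \<theta>" unfolding universal_on_def
    proof (intro conjI ballI allI impI x \<theta>)
      fix d \<psi> assume d: "d \<in> Obj C" and \<psi>: "cocone_on F a d \<psi>"
      have "\<exists>!m. m \<in> Hom C x d \<and> (\<forall>j\<in>Obj J. m \<cdot> i j = \<psi> (obj_map D j) (e j))"
        using L cocone_diag[OF P D \<psi> d] unfolding is_colimit_def by blast
      then show "\<exists>!m. m \<in> Hom C x d \<and> (\<forall>v\<in>Obj C. \<forall>p\<in>F v. m \<cdot> \<theta> v p = \<psi> v p)"
        using iff[OF _ \<psi>] by (metis (no_types, lifting))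
    qed
  next
    assume u: "universal_on F a x \<theta>"
    show "is_colimit J C D x i" unfolding is_colimit_def
    proof (intro conjI allI impI i_coc)
      fix d k assume k: "is_cocone J C D d k"
      then have d: "d \<in> Obj C" by (simp add: is_cocone_def)
      obtain \<psi> where \<psi>: "cocone_on F a d \<psi>"
        and \<psi>k: "\<forall>j\<in>Obj J. \<forall>l\<in>Arr C. Cod C l = obj_map D j \<longrightarrow> \<psi> (Dom C l) (a l (e j)) = k j \<cdot> l"
        using diag_cocone[OF P D k] .
      have pk: "\<psi> (obj_map D j) (e j) = k j" if j: "j \<in> Obj J" for j
      proof -
        have "k j \<in> Hom C (obj_map D j) d" using k j by (simp add: is_cocone_def)
        then have "k j \<cdot> Ident C (obj_map D j) = k j" by (rule comp_ident)
        then show ?thesis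
          using \<psi>k[rule_format, OF j, of "Ident C (obj_map D j)"] sO[OF j] psh_ident[OF F sO[OF j] e[OF j]] by simp
      qed
      have "\<exists>!m. m \<in> Hom C x d \<and> (\<forall>v\<in>Obj C. \<forall>p\<in>F v. m \<cdot> \<theta> v p = \<psi> v p)"
        using u d \<psi> by (simp add: universal_on_def)
      then have "\<exists>!m. m \<in> Hom C x d \<and> (\<forall>j\<in>Obj J. m \<cdot> i j = \<psi> (obj_map D j) (e j))"
        using iff[OF _ \<psi>] by (metis (no_types, lifting))
      then show "\<exists>!m. m \<in> Hom C x d \<and> (\<forall>j\<in>Obj J. m \<cdot> i j = k j)" using pk by simp
    qed
  qed
qed

text \<open>Path lifting along \<open>\<alpha>\<close>: as the squares over f are pullbacks, a
  zigzag in D lifts from any point over its start, and the image of the lift in y stays constant.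
  This gives injectivity in the pullback of \<open>small_exact_stable\<close>.\<close>

lemma zigzag_lift:
  assumes z: "zigzag (Obj J) (obj_map D) (diag_rel J D) j k j' k'"
    and D: "is_functor J C D" and D': "is_functor J C D'" and \<alpha>: "nat_trans J C D' D \<alpha>"
    and i: "is_cocone J C D x i" and i': "is_cocone J C D' y i'"
    and pb: "\<And>j. j \<in> Obj J \<Longrightarrow> is_pullback C f (i j) (i' j) (\<alpha> j)"
    and v: "v \<in> Arr C" "Cod C v = obj_map D' j" "\<alpha> j \<cdot> v = k"
  shows "\<exists>v'\<in>Arr C. Cod C v' = obj_map D' j' \<and> \<alpha> j' \<cdot> v' = k' \<and> i' j' \<cdot> v' = i' j \<cdot> v \<and>
    zigzag (Obj J) (obj_map D') (diag_rel J D') j v j' v'"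
proof -
  interpret J: category J using functor_dom[OF D] .
  have ia: "i j \<in> Arr C" "Dom C (i j) = obj_map D j" if "j \<in> Obj J" for j
    using i that by (auto simp: is_cocone_def Hom_iff)
  have i'a: "i' j \<in> Arr C" "Dom C (i' j) = obj_map D' j" if "j \<in> Obj J" for j
    using i' that by (auto simp: is_cocone_def Hom_iff)
  have \<alpha>a: "\<alpha> j \<in> Arr C" "Dom C (\<alpha> j) = obj_map D' j" "Cod C (\<alpha> j) = obj_map D j" if "j \<in> Obj J" for j
    using nat_trans_hom[OF \<alpha> that] by (auto simp: Hom_iff)
  have iu: "i (Cod J u) \<cdot> arr_map D u = i (Dom J u)" and i'u: "i' (Cod J u) \<cdot> arr_map D' u = i' (Dom J u)"
    if "u \<in> Arr J" for u using i i' that by (auto simp: is_cocone_def)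
  have fa: "f \<in> Arr C" "Cod C (i' j) = Dom C f" "f \<cdot> i' j = i j \<cdot> \<alpha> j" if "j \<in> Obj J" for j
    using is_pullbackD[OF pb[OF that]] by auto
  note D'p = diag_pres_data[OF D'] and Dp = diag_pres_data[OF D]
  from z v show ?thesis
  proof induction
    case (refl j k)
    then show ?case by (intro bexI[of _ v]) (auto intro: zigzag.refl)
  next
    \<comment> \<open>Along an arrow of the diagram the lift is pushed forward by
      \<open>D'\<close>.\<close>
    case (fwd j k l u0 h v0 j')
    obtain w where w: "w \<in> Arr J" "l = Dom J w" "u0 = Ident C (obj_map D l)" "v0 = arr_map D w" "j' = Cod J w"
      using fwd.hyps(2) by (auto simp: diag_rel_def)
    have o: "l \<in> Obj J" "j' \<in> Obj J" using w by auto
    note Dw = functor_arr[OF D w(1)] and D'w = functor_arr[OF D' w(1)]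
    obtain v1 where v1: "v1 \<in> Arr C" "Cod C v1 = obj_map D' l" "\<alpha> l \<cdot> v1 = u0 \<cdot> h" "i' l \<cdot> v1 = i' j \<cdot> v"
      "zigzag (Obj J) (obj_map D') (diag_rel J D') j v l v1" using fwd.IH[OF fwd.prems] by blast
    have h: "Cod C h = obj_map D l" using fwd.hyps(4) w(3) functor_obj[OF D o(1)] by simp
    have uh: "u0 \<cdot> h = h" using w(3) h fwd.hyps(3) by simp
    let ?v = "arr_map D' w \<cdot> v1"
    have "\<alpha> j' \<cdot> ?v = (\<alpha> j' \<cdot> arr_map D' w) \<cdot> v1"
      by (rule comp_assoc[symmetric]) (use v1 D'w w \<alpha>a[OF o(2)] in auto)
    also have "\<dots> = (arr_map D w \<cdot> \<alpha> l) \<cdot> v1" using nat_trans_nat[OF \<alpha> w(1)] w by simp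
    also have "\<dots> = arr_map D w \<cdot> (\<alpha> l \<cdot> v1)"
      by (rule comp_assoc) (use v1 Dw w \<alpha>a[OF o(1)] in auto)
    finally have 1: "\<alpha> j' \<cdot> ?v = v0 \<cdot> h" using v1(3) uh w by simp
    have "i' j' \<cdot> ?v = (i' j' \<cdot> arr_map D' w) \<cdot> v1"
      by (rule comp_assoc[symmetric]) (use v1 D'w w i'a[OF o(2)] in auto)
    then have 2: "i' j' \<cdot> ?v = i' j \<cdot> v" using i'u[OF w(1)] v1(4) w by simp
    have r: "(l, Ident C (obj_map D' l), arr_map D' w, j') \<in> diag_rel J D'" using w by (auto simp: diag_rel_def)
    have "zigzag (Obj J) (obj_map D') (diag_rel J D') j v l (Ident C (obj_map D' l) \<cdot> v1)"
      using v1(1,2,5) by simp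
    from zigzag.fwd[OF this r v1(1)] have "zigzag (Obj J) (obj_map D') (diag_rel J D') j v j' ?v"
      using v1(2) functor_obj[OF D' o(1)] by simp
    then show ?case using 1 2 v1 D'w w by (intro bexI[of _ ?v]) auto
  next
    \<comment> \<open>Against an arrow there is nothing to push along: the lift comes from the
      pullback at \<open>j'\<close>, and the pullback at \<open>l\<close> shows that pushing it
      forward returns \<open>v1\<close>.\<close>
    case (bwd j k l v0 h j' u0)
    obtain w where w: "w \<in> Arr J" "j' = Dom J w" "u0 = Ident C (obj_map D j')" "v0 = arr_map D w" "l = Cod J w"
      using bwd.hyps(2) by (auto simp: diag_rel_def)
    have o: "l \<in> Obj J" "j' \<in> Obj J" using w by auto
    note Dw = functor_arr[OF D w(1)] and D'w = functor_arr[OF D' w(1)]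
    obtain v1 where v1: "v1 \<in> Arr C" "Cod C v1 = obj_map D' l" "\<alpha> l \<cdot> v1 = v0 \<cdot> h" "i' l \<cdot> v1 = i' j \<cdot> v"
      "zigzag (Obj J) (obj_map D') (diag_rel J D') j v l v1" using bwd.IH[OF bwd.prems] by blast
    have h: "h \<in> Arr C" "Cod C h = obj_map D j'" using bwd.hyps(3,4) w Dw by simp_all
    have uh: "u0 \<cdot> h = h" using w(3) h by simp
    have "Dom C (\<alpha> l \<cdot> v1) = Dom C v1" by (rule comp_dom) (use v1 \<alpha>a[OF o(1)] in auto)
    moreover have "Dom C (v0 \<cdot> h) = Dom C h" by (rule comp_dom) (use h w Dw in auto)
    ultimately have dv: "Dom C v1 = Dom C h" using v1(3) by simp
    have "f \<cdot> (i' l \<cdot> v1) = (f \<cdot> i' l) \<cdot> v1"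
      by (rule comp_assoc[symmetric]) (use v1 i'a[OF o(1)] fa[OF o(1)] in auto)
    also have "\<dots> = (i l \<cdot> \<alpha> l) \<cdot> v1" using fa(3)[OF o(1)] by simp
    also have "\<dots> = i l \<cdot> (\<alpha> l \<cdot> v1)" by (rule comp_assoc) (use v1 \<alpha>a[OF o(1)] ia[OF o(1)] in auto)
    also have "\<dots> = (i l \<cdot> v0) \<cdot> h" unfolding v1(3)
      by (rule comp_assoc[symmetric]) (use h w Dw ia[OF o(1)] in auto)
    also have "\<dots> = i j' \<cdot> h" using iu[OF w(1)] w by simp
    finally have "\<exists>v'\<in>Arr C. Dom C v' = Dom C (i' l \<cdot> v1) \<and> Cod C v' = Dom C (i' j') \<and> i' j' \<cdot> v' = i' l \<cdot> v1 \<and> \<alpha> j' \<cdot> v' = h"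
      by (intro is_pullback_ex[OF pb[OF o(2)]]) (use v1(1,2) h dv i'a[OF o(1)] ia[OF o(2)] fa(2)[OF o(1)] in auto)
    then obtain v' where v': "v' \<in> Arr C" "Dom C v' = Dom C v1" "Cod C v' = obj_map D' j'" "i' j' \<cdot> v' = i' l \<cdot> v1" "\<alpha> j' \<cdot> v' = h"
      using v1(1,2) i'a[OF o(1)] i'a[OF o(2)] by auto
    have "arr_map D' w \<cdot> v' = v1"
    proof (rule is_pullback_eqI[OF pb[OF o(1)]])
      have "i' l \<cdot> (arr_map D' w \<cdot> v') = (i' l \<cdot> arr_map D' w) \<cdot> v'"
        by (rule comp_assoc[symmetric]) (use v' D'w w i'a[OF o(1)] in auto)
      then show "i' l \<cdot> (arr_map D' w \<cdot> v') = i' l \<cdot> v1" using i'u[OF w(1)] w v'(4) by simp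
      have "\<alpha> l \<cdot> (arr_map D' w \<cdot> v') = (\<alpha> l \<cdot> arr_map D' w) \<cdot> v'"
        by (rule comp_assoc[symmetric]) (use v' D'w w \<alpha>a[OF o(1)] in auto)
      also have "\<dots> = (arr_map D w \<cdot> \<alpha> j') \<cdot> v'" using nat_trans_nat[OF \<alpha> w(1)] w by simp
      also have "\<dots> = arr_map D w \<cdot> (\<alpha> j' \<cdot> v')" by (rule comp_assoc) (use v' Dw w \<alpha>a[OF o(2)] in auto)
      finally show "\<alpha> l \<cdot> (arr_map D' w \<cdot> v') = \<alpha> l \<cdot> v1" using v'(5) v1(3) w by simp
    qed (use v' v1 D'w w i'a[OF o(1)] in auto)
    then have zz: "zigzag (Obj J) (obj_map D') (diag_rel J D') j v l (arr_map D' w \<cdot> v')" using v1(5) by simp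
    have r: "(j', Ident C (obj_map D' j'), arr_map D' w, l) \<in> diag_rel J D'" using w by (auto simp: diag_rel_def)
    from zigzag.bwd[OF zz r v'(1)]
    have "zigzag (Obj J) (obj_map D') (diag_rel J D') j v j' (Ident C (obj_map D' j') \<cdot> v')"
      using v' D'w w by simp
    then have "zigzag (Obj J) (obj_map D') (diag_rel J D') j v j' v'" using v' by simp
    then show ?case using v' v1(4) uh by (intro bexI[of _ v']) auto
  qed
qed

end

section \<open>Stability, disjointness and effectiveness from exactness of the left adjoint\<close>

context universe_category
begin

lemma presented_PC:
  assumes D: "pres_data I s Rel" and sm: "small U I" "small U Rel"
  obtains P e where "P \<in> Obj PC" "presents (obj_map P) (act P) I s Rel e"
  using presented_presheaf_exists[OF D sm(1)] presents_small[OF _ _ sm] unfolding PC_obj by metis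

lemma diag_PC:
  assumes J: "small_cat U J" and D: "is_functor J C D"
  obtains P e where "P \<in> Obj PC" "presents (obj_map P) (act P) (Obj J) (obj_map D) (diag_rel J D) e"
proof (rule presented_PC[OF diag_pres_data[OF D]])
  show "small U (Obj J)" "small U (diag_rel J D)"
    using J by (auto simp: small_cat_def diag_rel_def small_image)
qed (rule that)

lemma act_element:
  assumes "w \<in> Obj C" "s \<in> obj_map (rep x) w"
  shows "app (element_map P x p) w s = act P (dec w x s) p"
  using assms by (simp add: element_map_def app_mk_map)

lemma rep_dec: "w \<in> Obj C \<Longrightarrow> s \<in> obj_map (rep x) w \<Longrightarrow>
    dec w x s \<in> Arr C \<and> Dom C (dec w x s) = w \<and> Cod C (dec w x s) = x"
  using dec_in[of s w x] by (simp add: rep_obj Hom_iff)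

lemma rep_eqI: "w \<in> Obj C \<Longrightarrow> s \<in> obj_map (rep x) w \<Longrightarrow> s' \<in> obj_map (rep x) w \<Longrightarrow>
    dec w x s = dec w x s' \<Longrightarrow> s = s'"
  using enc_dec rep_obj by metis

lemma rep_enc: "w \<in> Obj C \<Longrightarrow> h \<in> Hom C w x \<Longrightarrow> enc w x h \<in> obj_map (rep x) w \<and> dec w x (enc w x h) = h"
  by (simp add: rep_obj enc_in dec_enc)

lemma element_cocone:
  assumes p: "p \<in> obj_map P x"
    and \<theta>: "cocone_on (obj_map P) (act P) c \<theta>" and s: "w \<in> Obj C" "s \<in> obj_map (rep x) w"
  shows "\<theta> x p \<cdot> dec w x s = \<theta> w (app (element_map P x p) w s)"
  using cocone_on_nat[OF \<theta>, of "dec w x s" p] rep_dec[OF s] act_element[OF s] p by simp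

lemma Yoneda_dec:
  assumes f: "f \<in> Hom C x y" and s: "w \<in> Obj C" "s \<in> obj_map (rep x) w"
  shows "dec w y (app (arr_map Y f) w s) = f \<cdot> dec w x s"
  using Yoneda_arr(2)[of f w s] f s by (simp add: of_map_def Hom_iff)

lemma Yoneda_Hom: "f \<in> Hom C x y \<Longrightarrow> arr_map Y f \<in> Hom PC (rep x) (rep y)"
  using Yoneda_arr(1)[of f] by (simp add: Hom_iff)

text \<open>Let P and Q be the colimits of D and \<open>D'\<close> taken in presheaves. Q is the
  pullback of P along \<open>Y f\<close>, and L sends P to x because x is the colimit of D. So
  \<open>L Q\<close> is the pullback of the identity of x along f; hence it is isomorphic to y,
  which is therefore the colimit of \<open>D'\<close>.\<close>

lemma small_exact_stable:
  assumes adj: "adjunction PC C L Y \<eta> \<epsilon>" and lex: "preserves_finite_limits PC C L"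
  shows "pullback_stable_colimits U C"
  unfolding pullback_stable_colimits_def
proof (intro allI impI; elim conjE)
  fix J :: "('u, 'u) cat" and D x i f y D' i' \<alpha>
  assume J: "small_cat U J" and colim: "is_colimit J C D x i" and f: "f \<in> Hom C y x"
    and \<alpha>: "nat_trans J C D' D \<alpha>" and i': "is_cocone J C D' y i'"
    and pb: "\<forall>j\<in>Obj J. is_pullback C f (i j) (i' j) (\<alpha> j)"
  note pb = pb[rule_format]
  have i: "is_cocone J C D x i" using colim by (simp add: is_colimit_def)
  have D: "is_functor J C D" and D': "is_functor J C D'" using nat_trans_cod[OF \<alpha>] nat_trans_dom[OF \<alpha>] .
  interpret J: category J using functor_dom[OF D] .
  interpret PC: category PC by (rule PC_category)
  have xy: "x \<in> Obj C" "y \<in> Obj C" using f by (auto simp: Hom_iff)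
  have fa: "f \<in> Arr C" "Dom C f = y" "Cod C f = x" using f by (auto simp: Hom_iff)
  have ia: "i j \<in> Arr C" "Dom C (i j) = obj_map D j" "Cod C (i j) = x" if "j \<in> Obj J" for j
    using i that by (auto simp: is_cocone_def Hom_iff)
  have i'a: "i' j \<in> Arr C" "Dom C (i' j) = obj_map D' j" "Cod C (i' j) = y" if "j \<in> Obj J" for j
    using i' that by (auto simp: is_cocone_def Hom_iff)
  have \<alpha>a: "\<alpha> j \<in> Arr C" "Dom C (\<alpha> j) = obj_map D' j" "Cod C (\<alpha> j) = obj_map D j" if "j \<in> Obj J" for j
    using nat_trans_hom[OF \<alpha> that] by (auto simp: Hom_iff)
  have sq: "f \<cdot> i' j = i j \<cdot> \<alpha> j" if "j \<in> Obj J" for j using is_pullbackD(9)[OF pb[OF that]] .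
  obtain P e where P: "P \<in> Obj PC" and pP: "presents (obj_map P) (act P) (Obj J) (obj_map D) (diag_rel J D) e"
    using diag_PC[OF J D] .
  obtain Q q where Q: "Q \<in> Obj PC" and pQ: "presents (obj_map Q) (act Q) (Obj J) (obj_map D') (diag_rel J D') q"
    using diag_PC[OF J D'] .
  note FP = PC_psh[OF P] and FQ = PC_psh[OF Q] and e = presentsD(3)[OF pP] and q = presentsD(3)[OF pQ]
  obtain \<theta> where \<theta>: "cocone_on (obj_map P) (act P) x \<theta>"
    and \<theta>l: "\<forall>j\<in>Obj J. \<forall>l\<in>Arr C. Cod C l = obj_map D j \<longrightarrow> \<theta> (Dom C l) (act P l (e j)) = i j \<cdot> l"
    using diag_cocone[OF pP D i] .
  obtain \<theta>' where \<theta>': "cocone_on (obj_map Q) (act Q) y \<theta>'"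
    and \<theta>'l: "\<forall>j\<in>Obj J. \<forall>l\<in>Arr C. Cod C l = obj_map D' j \<longrightarrow> \<theta>' (Dom C l) (act Q l (q j)) = i' j \<cdot> l"
    using diag_cocone[OF pQ D' i'] .
  have gen: "\<theta> (obj_map D j) (e j) = i j" if j: "j \<in> Obj J" for j
    using \<theta>l[rule_format, OF j, of "Ident C (obj_map D j)"] presentsD(4)[OF pP j] psh_ident[OF FP _ e[OF j]] ia[OF j] by simp
  have gen': "\<theta>' (obj_map D' j) (q j) = i' j" if j: "j \<in> Obj J" for j
    using \<theta>'l[rule_format, OF j, of "Ident C (obj_map D' j)"] presentsD(4)[OF pQ j] psh_ident[OF FQ _ q[OF j]] i'a[OF j] by simp
  have uP: "universal_on (obj_map P) (act P) x \<theta>"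
    using diag_colimit_iff[OF pP D xy(1) \<theta> gen] colim by blast
  have ae: "act P (\<alpha> j) (e j) \<in> obj_map P (obj_map D' j)" if "j \<in> Obj J" for j
    using psh_act[OF FP \<alpha>a(1)[OF that], of "e j"] \<alpha>a[OF that] e[OF that] by simp
  \<comment> \<open>The arrows \<open>\<alpha> j\<close> are to induce a map from Q to P; the
    relations of Q are respected because \<open>\<alpha>\<close> is natural.\<close>
  have rel: "act P u (act P (\<alpha> j) (e j)) = act P v (act P (\<alpha> j') (e j'))"
    if r: "(j, u, v, j') \<in> diag_rel J D'" for j u v j'
  proof -
    obtain w where w: "w \<in> Arr J" "j = Dom J w" "u = Ident C (obj_map D' j)" "v = arr_map D' w" "j' = Cod J w"
      using r by (auto simp: diag_rel_def)
    have o: "j \<in> Obj J" "j' \<in> Obj J" using w by auto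
    note Dw = functor_arr[OF D w(1)] and D'w = functor_arr[OF D' w(1)]
    have "(j, Ident C (obj_map D j), arr_map D w, j') \<in> diag_rel J D" using w by (auto simp: diag_rel_def)
    from presents_rel[OF pP this] have ej: "e j = act P (arr_map D w) (e j')"
      using psh_ident[OF FP presentsD(4)[OF pP o(1)] e[OF o(1)]] by simp
    have "act P u (act P (\<alpha> j) (e j)) = act P (\<alpha> j) (e j)"
      using w(3) psh_ident[OF FP presentsD(4)[OF pQ o(1)] ae[OF o(1)]] by simp
    also have "\<dots> = act P (arr_map D w \<cdot> \<alpha> j) (e j')" unfolding ej
      by (rule psh_comp[OF FP, symmetric]) (use w o Dw \<alpha>a[OF o(1)] e[OF o(2)] in auto)
    also have "\<dots> = act P (\<alpha> j' \<cdot> arr_map D' w) (e j')" using nat_trans_nat[OF \<alpha> w(1)] w by simp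
    also have "\<dots> = act P v (act P (\<alpha> j') (e j'))" unfolding w(4)
      by (rule psh_comp[OF FP]) (use w o D'w \<alpha>a[OF o(2)] e[OF o(2)] in auto)
    finally show ?thesis .
  qed
  obtain \<phi> where \<phi>: "natpp Q P \<phi>" and "\<And>j. j \<in> Obj J \<Longrightarrow> \<phi> (obj_map D' j) (q j) = act P (\<alpha> j) (e j)"
    and \<phi>l: "\<And>j l. j \<in> Obj J \<Longrightarrow> l \<in> Arr C \<Longrightarrow> Cod C l = obj_map D' j \<Longrightarrow>
      \<phi> (Dom C l) (act Q l (q j)) = act P l (act P (\<alpha> j) (e j))"
    using presents_natp[OF pQ FP ae rel] by blast
  have \<phi>l': "\<phi> (Dom C l) (act Q l (q j)) = act P (\<alpha> j \<cdot> l) (e j)"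
    if "j \<in> Obj J" "l \<in> Arr C" "Cod C l = obj_map D' j" for j l
    using \<phi>l[OF that] psh_comp[OF FP that(2) \<alpha>a(1)[OF that(1)], of "e j"] \<alpha>a[OF that(1)] e[OF that(1)] that(3) by simp
  let ?a = "mk_map Q P \<phi>" and ?b = "to_map Q y \<theta>'" and ?f = "to_map P x \<theta>" and ?g = "arr_map Y f"
  have a: "?a \<in> Hom PC Q P" by (rule mk_map_Hom[OF Q P \<phi>])
  have b: "?b \<in> Hom PC Q (rep y)" by (rule to_map_Hom[OF Q xy(2) \<theta>'])
  have fH: "?f \<in> Hom PC P (rep x)" by (rule to_map_Hom[OF P xy(1) \<theta>])
  have gH: "?g \<in> Hom PC (rep y) (rep x)" by (rule Yoneda_Hom[OF f])
  have df: "dec v x (app ?f v p) = \<theta> v p" if "v \<in> Obj C" "p \<in> obj_map P v" for v p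
    using of_to_map[OF \<theta> that] by (simp add: of_map_def)
  have db: "dec v y (app ?b v p) = \<theta>' v p" if "v \<in> Obj C" "p \<in> obj_map Q v" for v p
    using of_to_map[OF \<theta>' that] by (simp add: of_map_def)
  have "is_pullback PC ?f ?g ?a ?b"
  proof (rule PC_pullback[OF fH gH a b])
    fix v w assume v: "v \<in> Obj C" and w: "w \<in> obj_map Q v"
    obtain j l where l: "j \<in> Obj J" "l \<in> Arr C" "Dom C l = v" "Cod C l = obj_map D' j" "w = act Q l (q j)"
      using presents_gen[OF pQ v w] .
    note aw = app_in[OF a v w] and bw = app_in[OF b v w]
    show "app ?f v (app ?a v w) = app ?g v (app ?b v w)"
    proof (rule rep_eqI[OF v app_in[OF fH v aw] app_in[OF gH v bw]])
      have "dec v x (app ?f v (app ?a v w)) = \<theta> v (act P (\<alpha> j \<cdot> l) (e j))"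
        using df[OF v aw] \<phi>l'[OF l(1,2,4)] l v w by (simp add: app_mk_map)
      also have "\<dots> = i j \<cdot> (\<alpha> j \<cdot> l)"
        using \<theta>l[rule_format, OF l(1), of "\<alpha> j \<cdot> l"] l \<alpha>a[OF l(1)] by simp
      also have "\<dots> = (i j \<cdot> \<alpha> j) \<cdot> l"
        by (rule comp_assoc[symmetric]) (use l \<alpha>a[OF l(1)] ia[OF l(1)] in auto)
      also have "\<dots> = f \<cdot> (i' j \<cdot> l)" unfolding sq[OF l(1), symmetric]
        by (rule comp_assoc) (use l i'a[OF l(1)] fa in auto)
      also have "\<dots> = f \<cdot> \<theta>' v w" using \<theta>'l[rule_format, OF l(1,2,4)] l(3,5) by simp
      also have "\<dots> = dec v x (app ?g v (app ?b v w))"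
        using Yoneda_dec[OF f v bw] db[OF v w] by simp
      finally show "dec v x (app ?f v (app ?a v w)) = dec v x (app ?g v (app ?b v w))" .
    qed
  next
    fix v p s assume v: "v \<in> Obj C" and p: "p \<in> obj_map P v" and s: "s \<in> obj_map (rep y) v"
      and eq: "app ?f v p = app ?g v s"
    \<comment> \<open>The element of P is a restriction of a generator j, and together with the
      element of \<open>rep y\<close> it factors through the pullback at this j.\<close>
    obtain j k where k: "j \<in> Obj J" "k \<in> Arr C" "Dom C k = v" "Cod C k = obj_map D j" "p = act P k (e j)"
      using presents_gen[OF pP v p] .
    let ?l = "dec v y s"
    note l = rep_dec[OF v s]
    have "f \<cdot> ?l = \<theta> v p" using Yoneda_dec[OF f v s] df[OF v p] eq by simp
    also have "\<dots> = i j \<cdot> k" using \<theta>l[rule_format, OF k(1,2,4)] k(3,5) by simp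
    finally have "\<exists>t\<in>Arr C. Dom C t = Dom C ?l \<and> Cod C t = Dom C (i' j) \<and> i' j \<cdot> t = ?l \<and> \<alpha> j \<cdot> t = k"
      by (intro is_pullback_ex[OF pb[OF k(1)]]) (use l k fa ia[OF k(1)] in auto)
    then obtain t where t: "t \<in> Arr C" "Dom C t = v" "Cod C t = obj_map D' j" "i' j \<cdot> t = ?l" "\<alpha> j \<cdot> t = k"
      using l i'a[OF k(1)] by auto
    let ?w = "act Q t (q j)"
    have w: "?w \<in> obj_map Q v" using psh_act[OF FQ t(1), of "q j"] t q[OF k(1)] by simp
    have "app ?a v ?w = p" using \<phi>l'[OF k(1) t(1,3)] t k v w by (simp add: app_mk_map)
    moreover have "app ?b v ?w = s"
    proof (rule rep_eqI[OF v app_in[OF b v w] s])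
      show "dec v y (app ?b v ?w) = ?l" using db[OF v w] \<theta>'l[rule_format, OF k(1) t(1,3)] t(2,4) by simp
    qed
    ultimately show "\<exists>w\<in>obj_map Q v. app ?a v w = p \<and> app ?b v w = s" using w by blast
  next
    fix v w w' assume v: "v \<in> Obj C" and w: "w \<in> obj_map Q v" "w' \<in> obj_map Q v"
      and eq: "app ?a v w = app ?a v w'" "app ?b v w = app ?b v w'"
    obtain j l where l: "j \<in> Obj J" "l \<in> Arr C" "Dom C l = v" "Cod C l = obj_map D' j" "w = act Q l (q j)"
      using presents_gen[OF pQ v w(1)] .
    obtain j' l' where l': "j' \<in> Obj J" "l' \<in> Arr C" "Dom C l' = v" "Cod C l' = obj_map D' j'" "w' = act Q l' (q j')"
      using presents_gen[OF pQ v w(2)] .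
    have "act P (\<alpha> j \<cdot> l) (e j) = act P (\<alpha> j' \<cdot> l') (e j')"
      using eq(1) \<phi>l'[OF l(1,2,4)] \<phi>l'[OF l'(1,2,4)] l l' v w by (simp add: app_mk_map)
    then have "zigzag (Obj J) (obj_map D) (diag_rel J D) j (\<alpha> j \<cdot> l) j' (\<alpha> j' \<cdot> l')"
      using presents_eq[OF pP l(1) l'(1), of "\<alpha> j \<cdot> l" v "\<alpha> j' \<cdot> l'"] l l' \<alpha>a[OF l(1)] \<alpha>a[OF l'(1)]
      by (simp add: Hom_iff)
    \<comment> \<open>The zigzag between the images in P lifts to one that starts at
      \<open>l\<close>. Its end has the same two projections as \<open>l'\<close>, so the pullback
      at \<open>j'\<close> identifies them.\<close>
    from zigzag_lift[OF this D D' \<alpha> i i' pb l(2,4) HOL.refl] obtain t where t: "t \<in> Arr C" "Cod C t = obj_map D' j'"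
      "\<alpha> j' \<cdot> t = \<alpha> j' \<cdot> l'" "i' j' \<cdot> t = i' j \<cdot> l" "zigzag (Obj J) (obj_map D') (diag_rel J D') j l j' t"
      by blast
    have dt: "Dom C t = v" using zigzag_arr[OF t(5) diag_pres_data[OF D']] l by simp
    have "i' j \<cdot> l = i' j' \<cdot> l'"
      using db[OF v w(1)] db[OF v w(2)] eq(2) \<theta>'l[rule_format, OF l(1,2,4)]
        \<theta>'l[rule_format, OF l'(1,2,4)] l(3,5) l'(3,5) by simp
    then have "t = l'"
      by (intro is_pullback_eqI[OF pb[OF l'(1)], of t l']) (use t l' dt i'a[OF l'(1)] in auto)
    then have "zigzag (Obj J) (obj_map D') (diag_rel J D') j l j' l'" using t(5) by simp
    then show "w = w'" using presents_eq[OF pQ l(1) l'(1), of l v l'] l l' by (simp add: Hom_iff)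
  qed
  note pbPC = this
  let ?z = "obj_map L Q" and ?\<psi> = "of_map (obj_map L Q) (\<eta> Q)"
  have uQ: "universal_on (obj_map Q) (act Q) ?z ?\<psi>" by (rule adjunction_universal(1)[OF adj Q])
  obtain m where m: "m \<in> Hom C ?z x" "\<forall>v\<in>Obj C. \<forall>p\<in>obj_map Q v. m \<cdot> ?\<psi> v p = \<theta> v (app ?a v p)"
    using universal_on_ex[OF uQ xy(1) natp_compose[OF FQ app_natpp[OF a] \<theta>]] by blast
  obtain n where n: "n \<in> Hom C ?z y" "\<forall>v\<in>Obj C. \<forall>p\<in>obj_map Q v. n \<cdot> ?\<psi> v p = \<theta>' v p"
    using universal_on_ex[OF uQ xy(2) \<theta>'] by blast
  have pbC: "is_pullback C (Ident C x) f m n"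
  proof (rule lex_pullback[OF adj lex fH gH a b pbPC uQ uP universal_on_rep[OF xy(2)] universal_on_rep[OF xy(1)]])
    show "Ident C x \<cdot> \<theta> v p = dec v x (app ?f v p)" if "v \<in> Obj C" "p \<in> obj_map P v" for v p
      using df[OF that] ident_comp[OF natp_in[OF \<theta> that]] by simp
    show "f \<cdot> dec v y p = dec v x (app ?g v p)" if "v \<in> Obj C" "p \<in> obj_map (rep y) v" for v p
      using Yoneda_dec[OF f that] by simp
    show "n \<cdot> ?\<psi> v p = dec v y (app ?b v p)" if "v \<in> Obj C" "p \<in> obj_map Q v" for v p
      using n(2) db[OF that] that by simp
  qed (use m n f ident[OF xy(1)] in auto)
  note d = is_pullbackD[OF pbC]
  have ma: "m \<in> Arr C" "Dom C m = ?z" "Cod C m = x" and na: "n \<in> Arr C" "Dom C n = ?z" "Cod C n = y"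
    using m n by (auto simp: Hom_iff)
  have mf: "m = f \<cdot> n" using d(9) ma by simp
  \<comment> \<open>A pullback of an identity is invertible: the pair formed by f and the identity
    of y factors through the inverse \<open>t\<close> of \<open>n\<close>.\<close>
  have "\<exists>t\<in>Arr C. Dom C t = Dom C f \<and> Cod C t = Dom C m \<and> m \<cdot> t = f \<and> n \<cdot> t = Ident C y"
    by (rule is_pullback_ex[OF pbC]) (use fa xy in auto)
  then obtain t where t: "t \<in> Arr C" "Dom C t = y" "Cod C t = ?z" "m \<cdot> t = f" "n \<cdot> t = Ident C y"
    using fa ma by auto
  have z: "?z \<in> Obj C" using uQ by (simp add: universal_on_def)
  have "t \<cdot> n = Ident C ?z"
  proof (rule is_pullback_eqI[OF pbC])
    show "m \<cdot> (t \<cdot> n) = m \<cdot> Ident C ?z"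
      using comp_assoc[of n t m] t ma na mf z by simp
    show "n \<cdot> (t \<cdot> n) = n \<cdot> Ident C ?z"
      using comp_assoc[of n t n] t na z by simp
  qed (use t na ma z in auto)
  then have "universal_on (obj_map Q) (act Q) y \<theta>'"
    by (intro universal_on_iso[OF uQ n(1), of t]) (use t n(2) \<theta>' in \<open>auto simp: Hom_iff\<close>)
  then show "is_colimit J C D' y i'" using diag_colimit_iff[OF pQ D' xy(2) \<theta>' gen'] by blast
qed

text \<open>In presheaves a coproduct is a disjoint union, so its injections have trivial kernel
  pairs and two different ones have the empty presheaf as pullback. L sends these squares to squares
  in C, with an initial object in place of the empty presheaf.\<close>

lemma small_exact_disjoint:
  assumes adj: "adjunction PC C L Y \<eta> \<epsilon>" and lex: "preserves_finite_limits PC C L"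
  shows "disjoint_coproducts U C"
  unfolding disjoint_coproducts_def
proof (intro allI impI; elim conjE)
  fix I :: "'u set" and D x i
  assume I: "small U I" and colim: "is_colimit (discrete_cat I) C D x i"
  let ?J = "discrete_cat I"
  have i: "is_cocone ?J C D x i" using colim by (simp add: is_colimit_def)
  then have D: "is_functor ?J C D" and x: "x \<in> Obj C" by (auto simp: is_cocone_def)
  have J: "small_cat U ?J" using functor_dom[OF D] I by (simp add: small_cat_def discrete_cat_def)
  have oJ: "Obj ?J = I" by (simp add: discrete_cat_def)
  interpret PC: category PC by (rule PC_category)
  let ?s = "obj_map D"
  have ia: "i j \<in> Hom C (?s j) x" if "j \<in> I" for j
    using i that by (auto simp: is_cocone_def discrete_cat_def)
  have sO: "?s j \<in> Obj C" if "j \<in> I" for j using functor_obj[OF D, of j] that by (simp add: oJ)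
  have Did: "arr_map D j = Ident C (?s j)" if "j \<in> I" for j
    using functor_ident[OF D, of j] that by (simp add: discrete_cat_def)
  obtain P e where P: "P \<in> Obj PC" and pP: "presents (obj_map P) (act P) (Obj ?J) ?s (diag_rel ?J D) e"
    using diag_PC[OF J D] .
  note FP = PC_psh[OF P] and e = presentsD(3)[OF pP, unfolded oJ]
  obtain \<theta> where \<theta>: "cocone_on (obj_map P) (act P) x \<theta>"
    and \<theta>l: "\<forall>j\<in>Obj ?J. \<forall>l\<in>Arr C. Cod C l = ?s j \<longrightarrow> \<theta> (Dom C l) (act P l (e j)) = i j \<cdot> l"
    using diag_cocone[OF pP D i] .
  have gen: "\<theta> (?s j) (e j) = i j" if j: "j \<in> I" for j
    using \<theta>l[unfolded oJ, rule_format, OF j, of "Ident C (?s j)"] sO[OF j] psh_ident[OF FP sO[OF j] e[OF j]]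
      comp_ident[OF ia[OF j]] by simp
  have uP: "universal_on (obj_map P) (act P) x \<theta>"
    using diag_colimit_iff[OF pP D x \<theta>, of i] gen colim by (simp add: oJ)
  \<comment> \<open>A discrete diagram has only identity arrows, so every relation and hence every
    zigzag is trivial.\<close>
  have zz: "j = j' \<and> k = k'" if "zigzag (Obj ?J) ?s (diag_rel ?J D) j k j' k'" for j k j' k'
    using that
  proof induction
    case (fwd j k l u h v j')
    then obtain w where "w \<in> I" "l = w" "u = Ident C (?s w)" "v = arr_map D w" "j' = w"
      by (auto simp: diag_rel_def discrete_cat_def)
    then show ?case using fwd Did by simp
  next
    case (bwd j k l v h j' u)
    then obtain w where "w \<in> I" "j' = w" "u = Ident C (?s w)" "v = arr_map D w" "l = w"
      by (auto simp: diag_rel_def discrete_cat_def)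
    then show ?case using bwd Did by simp
  qed simp
  define E where "E j = element_map P (?s j) (e j)" for j
  have E: "E j \<in> Hom PC (rep (?s j)) P" if "j \<in> I" for j
    unfolding E_def by (rule element_map_Hom[OF P sO[OF that] e[OF that]])
  have E_eq: "j = k \<and> dec w (?s j) t = dec w (?s k) t'"
    if jk: "j \<in> I" "k \<in> I" and w: "w \<in> Obj C" and t: "t \<in> obj_map (rep (?s j)) w" "t' \<in> obj_map (rep (?s k)) w"
      and eq: "app (E j) w t = app (E k) w t'" for j k w t t'
  proof -
    have "act P (dec w (?s j) t) (e j) = act P (dec w (?s k) t') (e k)"
      using eq act_element[OF w t(1)] act_element[OF w t(2)]
      by (simp add: E_def)
    then have "zigzag (Obj ?J) ?s (diag_rel ?J D) j (dec w (?s j) t) k (dec w (?s k) t')"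
      using presents_eq[OF pP, of j k "dec w (?s j) t" w "dec w (?s k) t'"] jk rep_dec[OF w t(1)] rep_dec[OF w t(2)]
      by (simp add: oJ Hom_iff)
    then show ?thesis by (rule zz)
  qed
  have iE: "i j \<cdot> dec v (?s j) p = \<theta> v (app (E j) v p)"
    if "j \<in> I" "v \<in> Obj C" "p \<in> obj_map (rep (?s j)) v" for j v p
    using element_cocone[OF e[OF that(1)] \<theta> that(2,3)] gen[OF that(1)] by (simp add: E_def)
  show "(\<forall>j\<in>I. monic C (i j)) \<and>
     (\<forall>j\<in>I. \<forall>k\<in>I. \<forall>p q. j \<noteq> k \<and> is_pullback C (i j) (i k) p q \<longrightarrow> initial_object C (Dom C p))"
  proof (intro conjI ballI allI impI; (elim conjE)?)
    fix j assume j: "j \<in> I"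
    let ?Y = "rep (?s j)" and ?id = "Ident PC (rep (?s j))"
    note R = rep_PC[OF sO[OF j]]
    note id = PC.ident[OF R]
    have pb: "is_pullback PC (E j) (E j) ?id ?id"
    proof (rule PC_pullback[OF E[OF j] E[OF j] id id])
      fix w p q assume w: "w \<in> Obj C" and pq: "p \<in> obj_map ?Y w" "q \<in> obj_map ?Y w"
        and eq: "app (E j) w p = app (E j) w q"
      have "p = q" using E_eq[OF j j w pq eq] rep_eqI[OF w pq] by blast
      then show "\<exists>r\<in>obj_map ?Y w. app ?id w r = p \<and> app ?id w r = q" using pq w by (auto simp: app_Ident)
    qed (simp_all add: app_Ident)
    note u = universal_on_rep[OF sO[OF j]]
    have "is_pullback C (i j) (i j) (Ident C (?s j)) (Ident C (?s j))"
    proof (rule lex_pullback[OF adj lex E[OF j] E[OF j] id id pb u u u uP ia[OF j] iE[OF j] ia[OF j] iE[OF j]])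
      show "Ident C (?s j) \<in> Hom C (?s j) (?s j)" by (rule ident[OF sO[OF j]])
      then show "Ident C (?s j) \<in> Hom C (?s j) (?s j)" .
      show "Ident C (?s j) \<cdot> dec v (?s j) p = dec v (?s j) (app ?id v p)"
        if "v \<in> Obj C" "p \<in> obj_map ?Y v" for v p
        using rep_dec[OF that] that by (simp add: app_Ident)
      then show "Ident C (?s j) \<cdot> dec v (?s j) p = dec v (?s j) (app ?id v p)"
        if "v \<in> Obj C" "p \<in> obj_map ?Y v" for v p using that by blast
    qed
    note pbC = this
    show "monic C (i j)" unfolding monic_def
    proof (intro conjI allI impI; (elim conjE)?)
      show "i j \<in> Arr C" using ia[OF j] by (simp add: Hom_iff)
      fix w f g assume fg: "f \<in> Hom C w (Dom C (i j))" "g \<in> Hom C w (Dom C (i j))" "i j \<cdot> f = i j \<cdot> g"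
      \<comment> \<open>Arrows with the same composite factor through a kernel pair made of
        identities, and so they are equal.\<close>
      have "\<exists>u\<in>Arr C. Dom C u = Dom C f \<and> Cod C u = Dom C (Ident C (?s j)) \<and> Ident C (?s j) \<cdot> u = f \<and> Ident C (?s j) \<cdot> u = g"
        by (rule is_pullback_ex[OF pbC]) (use fg in \<open>auto simp: Hom_iff\<close>)
      then show "f = g" by metis
    qed
  next
    fix j k p q assume jk: "j \<in> I" "k \<in> I" "j \<noteq> k" and pq: "is_pullback C (i j) (i k) p q"
    \<comment> \<open>The empty presheaf, presented by no generators; the universal property makes
      its reflection initial.\<close>
    have "pres_data ({} :: unit set) (\<lambda>_. undefined) {}" by (simp add: pres_data_def)
    from presented_PC[OF this small_finite[OF inacc finite.emptyI] small_finite[OF inacc finite.emptyI]]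
    obtain W w where W: "W \<in> Obj PC" and pW: "presents (obj_map W) (act W) ({} :: unit set) (\<lambda>_. undefined) {} w" .
    have emp: "obj_map W v = {}" if v: "v \<in> Obj C" for v
    proof -
      have "\<not> p \<in> obj_map W v" for p using presents_gen[OF pW v] by blast
      then show ?thesis by blast
    qed
    let ?a = "mk_map W (rep (?s j)) (\<lambda>_ p. p)" and ?b = "mk_map W (rep (?s k)) (\<lambda>_ p. p)"
    have a: "?a \<in> Hom PC W (rep (?s j))" and b: "?b \<in> Hom PC W (rep (?s k))"
      by (auto intro!: mk_map_Hom W rep_PC sO jk simp: natp_def emp)
    have pb: "is_pullback PC (E j) (E k) ?a ?b"
    proof (rule PC_pullback[OF E[OF jk(1)] E[OF jk(2)] a b])
      fix v p q assume "v \<in> Obj C" "p \<in> obj_map (rep (?s j)) v" "q \<in> obj_map (rep (?s k)) v"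
        "app (E j) v p = app (E k) v q"
      then show "\<exists>w\<in>obj_map W v. app ?a v w = p \<and> app ?b v w = q" using E_eq[OF jk(1,2)] jk(3) by blast
    qed (simp_all add: emp)
    let ?z = "obj_map L W" and ?\<psi> = "of_map (obj_map L W) (\<eta> W)"
    have uW: "universal_on (obj_map W) (act W) ?z ?\<psi>" by (rule adjunction_universal(1)[OF adj W])
    have init: "\<exists>!m. m \<in> Hom C ?z d" if d: "d \<in> Obj C" for d
    proof -
      have "cocone_on (obj_map W) (act W) d (\<lambda>_ _. undefined)" by (simp add: natp_def emp)
      then have "\<exists>!m. m \<in> Hom C ?z d \<and> (\<forall>v\<in>Obj C. \<forall>p\<in>obj_map W v. m \<cdot> ?\<psi> v p = undefined)"
        using uW d unfolding universal_on_def by blast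
      then show ?thesis by (simp add: emp)
    qed
    have z: "?z \<in> Obj C" using uW by (simp add: universal_on_def)
    obtain m where m: "m \<in> Hom C ?z (?s j)" using init[OF sO[OF jk(1)]] by blast
    obtain n where n: "n \<in> Hom C ?z (?s k)" using init[OF sO[OF jk(2)]] by blast
    have pbC: "is_pullback C (i j) (i k) m n"
      by (rule lex_pullback[OF adj lex E[OF jk(1)] E[OF jk(2)] a b pb uW universal_on_rep[OF sO[OF jk(1)]]
            universal_on_rep[OF sO[OF jk(2)]] uP ia[OF jk(1)] iE[OF jk(1)] ia[OF jk(2)] iE[OF jk(2)] m _ n])
        (simp_all add: emp)
    note d = is_pullbackD[OF pq]
    have ij: "Dom C (i j) = ?s j" "Dom C (i k) = ?s k" using ia jk by (auto simp: Hom_iff)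
    have mn: "m \<in> Arr C" "Dom C m = ?z" "n \<in> Arr C" "Dom C n = ?z" using m n by (auto simp: Hom_iff)
    let ?p = "Dom C p"
    have pO: "?p \<in> Obj C" using d by simp
    have "\<exists>t\<in>Arr C. Dom C t = Dom C p \<and> Cod C t = Dom C m \<and> m \<cdot> t = p \<and> n \<cdot> t = q"
      by (rule is_pullback_ex[OF pbC]) (use d in auto)
    then obtain t where t: "t \<in> Hom C ?p ?z" "m \<cdot> t = p" "n \<cdot> t = q" using mn by (auto simp: Hom_iff)
    obtain t' where t': "t' \<in> Hom C ?z ?p" using init[OF pO] by blast
    have pH: "p \<in> Hom C ?p (?s j)" and qH: "q \<in> Hom C ?p (?s k)" using d ij by (auto simp: Hom_iff)
    have "p \<cdot> t' = m" using comp[OF t' pH] m init[OF sO[OF jk(1)]] by blast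
    moreover have "q \<cdot> t' = n" using comp[OF t' qH] n init[OF sO[OF jk(2)]] by blast
    ultimately have "p \<cdot> (t' \<cdot> t) = p" "q \<cdot> (t' \<cdot> t) = q"
      using assoc[OF t(1) t' pH] assoc[OF t(1) t' qH] t(2,3) by simp_all
    \<comment> \<open>The vertex of the given pullback is a retract of \<open>?z\<close>, and a
      retract of an initial object is initial.\<close>
    then have t't: "t' \<cdot> t = Ident C ?p"
      by (intro is_pullback_eqI[OF pq, of "t' \<cdot> t" "Ident C ?p"])
        (use comp[OF t(1) t'] d pO comp_ident[OF pH] comp_ident[OF qH] in \<open>auto simp: Hom_iff\<close>)
    show "initial_object C ?p" unfolding initial_object_def
    proof (intro conjI ballI pO)
      fix y assume y: "y \<in> Obj C"
      then obtain h where h: "h \<in> Hom C ?z y" using init by blast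
      show "\<exists>!f. f \<in> Hom C ?p y"
      proof (rule ex1I)
        show "h \<cdot> t \<in> Hom C ?p y" by (rule comp[OF t(1) h])
        fix f assume f: "f \<in> Hom C ?p y"
        have "f \<cdot> t' = h" using comp[OF t' f] h init[OF y] by blast
        then show "f = h \<cdot> t" using assoc[OF t(1) t' f] t't comp_ident[OF f] by simp
      qed
    qed
  qed
qed

text \<open>P is the coequalizer in presheaves of the pair that r and s induce between
  representables. As R is an equivalence relation on elements, zigzags add nothing to it, so the
  kernel pair of the quotient map is \<open>rep R\<close>. L carries this square to one with r and s
  as the kernel pair of an arrow out of X.\<close>

lemma small_exact_effective:
  assumes adj: "adjunction PC C L Y \<eta> \<epsilon>" and lex: "preserves_finite_limits PC C L"
    and fc: "finitely_complete C" and eqv: "equivalence_relation C r s"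
  shows "effective C r s"
proof -
  interpret PC: category PC by (rule PC_category)
  obtain R X where R: "R \<in> Obj C" and X: "X \<in> Obj C" and r: "r \<in> Hom C R X" and s: "s \<in> Hom C R X"
    and jm: "\<forall>w h k. h \<in> Hom C w R \<and> k \<in> Hom C w R \<and> r \<cdot> h = r \<cdot> k \<and> s \<cdot> h = s \<cdot> k \<longrightarrow> h = k"
    and refl: "\<exists>\<rho>\<in>Hom C X R. r \<cdot> \<rho> = Ident C X \<and> s \<cdot> \<rho> = Ident C X"
    and sym: "\<exists>\<sigma>\<in>Hom C R R. r \<cdot> \<sigma> = s \<and> s \<cdot> \<sigma> = r"
    and trans: "\<forall>p q. is_pullback C s r p q \<longrightarrow> (\<exists>\<tau>\<in>Hom C (Dom C p) R. r \<cdot> \<tau> = r \<cdot> p \<and> s \<cdot> \<tau> = s \<cdot> q)"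
    using eqv unfolding equivalence_relation_def by blast
  have ra: "r \<in> Arr C" "Dom C r = R" "Cod C r = X" and sa: "s \<in> Arr C" "Dom C s = R" "Cod C s = X"
    using r s by (auto simp: Hom_iff)
  let ?I = "{()}" and ?s = "\<lambda>_ :: unit. X" and ?Rel = "{((), r, s, ())}"
  have D: "pres_data ?I ?s ?Rel" using X ra sa by (simp add: pres_data_def)
  obtain P e where P: "P \<in> Obj PC" and pP: "presents (obj_map P) (act P) ?I ?s ?Rel e"
    using presented_PC[OF D small_finite[OF inacc] small_finite[OF inacc]] by blast
  note FP = PC_psh[OF P]
  have e: "e () \<in> obj_map P X" using presentsD(3)[OF pP, of "()"] by simp
  obtain p q where pq: "is_pullback C s r p q" using pullback_exists[OF fc sa(1) ra(1)] ra sa by auto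
  note d = is_pullbackD[OF pq]
  obtain \<tau> where \<tau>: "\<tau> \<in> Hom C (Dom C p) R" "r \<cdot> \<tau> = r \<cdot> p" "s \<cdot> \<tau> = s \<cdot> q" using trans pq by blast
  obtain \<sigma> where \<sigma>: "\<sigma> \<in> Hom C R R" "r \<cdot> \<sigma> = s" "s \<cdot> \<sigma> = r" using sym by blast
  obtain \<rho> where \<rho>: "\<rho> \<in> Hom C X R" "r \<cdot> \<rho> = Ident C X" "s \<cdot> \<rho> = Ident C X" using refl by blast
  \<comment> \<open>Transitivity for arbitrary elements, read off from the single map
    \<open>\<tau>\<close> on one pullback.\<close>
  have tr: "\<exists>h''\<in>Hom C w R. r \<cdot> h'' = r \<cdot> h \<and> s \<cdot> h'' = s \<cdot> h'"
    if h: "h \<in> Hom C w R" and h': "h' \<in> Hom C w R" and eq: "s \<cdot> h = r \<cdot> h'" for w h h'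
  proof -
    have "\<exists>t\<in>Arr C. Dom C t = Dom C h \<and> Cod C t = Dom C p \<and> p \<cdot> t = h \<and> q \<cdot> t = h'"
      by (rule is_pullback_ex[OF pq]) (use h h' eq ra sa in \<open>auto simp: Hom_iff\<close>)
    then obtain t where t: "t \<in> Hom C w (Dom C p)" "p \<cdot> t = h" "q \<cdot> t = h'" using h by (auto simp: Hom_iff)
    have pH: "p \<in> Hom C (Dom C p) R" and qH: "q \<in> Hom C (Dom C p) R" using d ra sa by (auto simp: Hom_iff)
    have "r \<cdot> (\<tau> \<cdot> t) = r \<cdot> h" "s \<cdot> (\<tau> \<cdot> t) = s \<cdot> h'"
      using assoc[OF t(1) \<tau>(1) r] assoc[OF t(1) \<tau>(1) s] assoc[OF t(1) pH r] assoc[OF t(1) qH s] \<tau>(2,3) t(2,3)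
      by simp_all
    then show ?thesis using comp[OF t(1) \<tau>(1)] by blast
  qed
  \<comment> \<open>Reflexivity starts a zigzag, transitivity absorbs each forward step, and
    symmetry turns a backward step into a forward one.\<close>
  have zzR: "\<exists>h\<in>Hom C (Dom C k) R. k = r \<cdot> h \<and> k' = s \<cdot> h" if "zigzag ?I ?s ?Rel i k j k'" for i k j k'
    using that
  proof induction
    case (refl i k)
    have k: "k \<in> Hom C (Dom C k) X" using refl by (simp add: Hom_iff)
    have "r \<cdot> (\<rho> \<cdot> k) = k" "s \<cdot> (\<rho> \<cdot> k) = k"
      using assoc[OF k \<rho>(1) r] assoc[OF k \<rho>(1) s] \<rho>(2,3) ident_comp[OF k] by simp_all
    then show ?case using comp[OF k \<rho>(1)] by metis
  next
    case (fwd i k l u h v j)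
    have uv: "u = r" "v = s" using fwd.hyps(2) by auto
    obtain g where g: "g \<in> Hom C (Dom C k) R" "k = r \<cdot> g" "u \<cdot> h = s \<cdot> g" using fwd.IH by blast
    have h: "h \<in> Hom C (Dom C h) R" using fwd.hyps(3,4) uv ra by (simp add: Hom_iff)
    have "Dom C (u \<cdot> h) = Dom C h" by (rule comp_dom) (use fwd.hyps uv ra in auto)
    moreover have "Dom C (s \<cdot> g) = Dom C g" by (rule comp_dom) (use g sa in \<open>auto simp: Hom_iff\<close>)
    ultimately have "h \<in> Hom C (Dom C k) R" using h g by (simp add: Hom_iff)
    then show ?case using tr[OF g(1)] g uv by metis
  next
    case (bwd i k l v h j u)
    have uv: "u = r" "v = s" using bwd.hyps(2) by auto
    obtain g where g: "g \<in> Hom C (Dom C k) R" "k = r \<cdot> g" "v \<cdot> h = s \<cdot> g" using bwd.IH by blast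
    have "Dom C (v \<cdot> h) = Dom C h" by (rule comp_dom) (use bwd.hyps uv sa in auto)
    moreover have "Dom C (s \<cdot> g) = Dom C g" by (rule comp_dom) (use g sa in \<open>auto simp: Hom_iff\<close>)
    ultimately have "Dom C h = Dom C k" using g(1,3) by (simp add: Hom_iff)
    then have h: "h \<in> Hom C (Dom C k) R" using bwd.hyps(3,4) uv sa by (simp add: Hom_iff)
    have "s \<cdot> g = r \<cdot> (\<sigma> \<cdot> h)" "s \<cdot> (\<sigma> \<cdot> h) = r \<cdot> h"
      using assoc[OF h \<sigma>(1) r] assoc[OF h \<sigma>(1) s] \<sigma>(2,3) g(3) uv by simp_all
    then show ?case using tr[OF g(1) comp[OF h \<sigma>(1)]] g uv by metis
  qed
  have rel: "act P (r \<cdot> h) (e ()) = act P (s \<cdot> h) (e ())" if h: "h \<in> Hom C w R" for h w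
  proof -
    have "zigzag ?I ?s ?Rel () (r \<cdot> h) () (s \<cdot> h)" by (rule zigzag_rel(1)[OF D]) (use h ra in \<open>auto simp: Hom_iff\<close>)
    then show ?thesis
      using presents_eq[OF pP, of "()" "()" "r \<cdot> h" w "s \<cdot> h"] comp[OF h r] comp[OF h s] by simp
  qed
  let ?E = "element_map P X (e ())"
  have E: "?E \<in> Hom PC (rep X) P" by (rule element_map_Hom[OF P X e])
  note a = Yoneda_Hom[OF r] and b = Yoneda_Hom[OF s]
  have appE: "app ?E w t = act P (dec w X t) (e ())" if "w \<in> Obj C" "t \<in> obj_map (rep X) w" for w t
    by (rule act_element[OF that])
  have pb: "is_pullback PC ?E ?E (arr_map Y r) (arr_map Y s)"
  proof (rule PC_pullback[OF E E a b])
    fix w t assume w: "w \<in> Obj C" and t: "t \<in> obj_map (rep R) w"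
    have "dec w R t \<in> Hom C w R" using rep_dec[OF w t] by (simp add: Hom_iff)
    then show "app ?E w (app (arr_map Y r) w t) = app ?E w (app (arr_map Y s) w t)"
      using appE[OF w app_in[OF a w t]] appE[OF w app_in[OF b w t]] Yoneda_dec[OF r w t] Yoneda_dec[OF s w t] rel
      by simp
  next
    fix w t t' assume w: "w \<in> Obj C" and t: "t \<in> obj_map (rep X) w" "t' \<in> obj_map (rep X) w"
      and eq: "app ?E w t = app ?E w t'"
    have "act P (dec w X t) (e ()) = act P (dec w X t') (e ())"
      using eq appE[OF w t(1)] appE[OF w t(2)] by simp
    then have "zigzag ?I ?s ?Rel () (dec w X t) () (dec w X t')"
      using presents_eq[OF pP, of "()" "()" "dec w X t" w "dec w X t'"] rep_dec[OF w t(1)] rep_dec[OF w t(2)]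
      by (simp add: Hom_iff)
    from zzR[OF this] obtain h where h: "h \<in> Hom C w R" "dec w X t = r \<cdot> h" "dec w X t' = s \<cdot> h"
      using rep_dec[OF w t(1)] by auto
    let ?t = "enc w R h"
    have tt: "?t \<in> obj_map (rep R) w" "dec w R ?t = h" using rep_enc[OF w h(1)] by auto
    have "app (arr_map Y r) w ?t = t"
      by (rule rep_eqI[OF w app_in[OF a w tt(1)] t(1)]) (use Yoneda_dec[OF r w tt(1)] tt(2) h in simp)
    moreover have "app (arr_map Y s) w ?t = t'"
      by (rule rep_eqI[OF w app_in[OF b w tt(1)] t(2)]) (use Yoneda_dec[OF s w tt(1)] tt(2) h in simp)
    ultimately show "\<exists>u\<in>obj_map (rep R) w. app (arr_map Y r) w u = t \<and> app (arr_map Y s) w u = t'"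
      using tt(1) by blast
  next
    fix w t t' assume w: "w \<in> Obj C" and t: "t \<in> obj_map (rep R) w" "t' \<in> obj_map (rep R) w"
      and eq: "app (arr_map Y r) w t = app (arr_map Y r) w t'" "app (arr_map Y s) w t = app (arr_map Y s) w t'"
    have "r \<cdot> dec w R t = r \<cdot> dec w R t'" "s \<cdot> dec w R t = s \<cdot> dec w R t'"
      using eq Yoneda_dec[OF r w] Yoneda_dec[OF s w] t by metis+
    moreover have "dec w R t \<in> Hom C w R" "dec w R t' \<in> Hom C w R"
      using rep_dec[OF w t(1)] rep_dec[OF w t(2)] by (auto simp: Hom_iff)
    ultimately have "dec w R t = dec w R t'" using jm by blast
    then show "t = t'" by (rule rep_eqI[OF w t])
  qed
  let ?c = "obj_map L P" and ?\<phi> = "of_map (obj_map L P) (\<eta> P)"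
  have uP: "universal_on (obj_map P) (act P) ?c ?\<phi>" by (rule adjunction_universal(1)[OF adj P])
  then have \<phi>: "cocone_on (obj_map P) (act P) ?c ?\<phi>" by (simp add: universal_on_def)
  note uR = universal_on_rep[OF R] and uX = universal_on_rep[OF X]
  let ?m = "?\<phi> X (e ())"
  have m: "?m \<in> Hom C X ?c" using natp_in[OF \<phi> X e] .
  have mE: "?m \<cdot> dec v X p = ?\<phi> v (app ?E v p)" if "v \<in> Obj C" "p \<in> obj_map (rep X) v" for v p
    by (rule element_cocone[OF e \<phi> that])
  have "is_pullback C ?m ?m r s"
    by (rule lex_pullback[OF adj lex E E a b pb uR uX uX uP m mE m mE r Yoneda_dec[OF r, symmetric] s Yoneda_dec[OF s, symmetric]])
  then show ?thesis unfolding effective_def by blast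
qed

end

theorem proposition2p5:
  fixes C :: "('o, 'a) cat"
  assumes "inaccessible TYPE('u)"
    and "category C"
    and "locally_small TYPE('u) C"
    and "finitely_complete C"
    and "small_cocomplete TYPE('u) C"
  shows "small_exact TYPE('u) C \<longleftrightarrow> infinity_pretopos TYPE('u) C"
proof
  interpret universe_category C "TYPE('u)"
    using assms by (simp add: universe_category_def universe_category_axioms_def)
  assume "small_exact TYPE('u) C"
  then obtain L \<eta> \<epsilon> where adj: "adjunction PC C L Y \<eta> \<epsilon>" and lex: "preserves_finite_limits PC C L"
    unfolding small_exact_def by blast
  show "infinity_pretopos TYPE('u) C"
    unfolding infinity_pretopos_def
    using assms small_exact_stable[OF adj lex] small_exact_disjoint[OF adj lex]
      small_exact_effective[OF adj lex] by blast
next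
  assume "infinity_pretopos TYPE('u) C"
  then interpret pretopos C "TYPE('u)"
    using assms by (simp add: pretopos_def pretopos_axioms_def universe_category_def universe_category_axioms_def)
  show "small_exact TYPE('u) C" by (rule small_exact)
qed

end
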